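(* Let $r\geq 1$ and $q\ge1$ be integers, and let $X$ be a finite $r$-dimensional simplicial complex such that one of the following holds: (A) $X$ is a $q$-thick spherical building admitting a strongly transitive action; (B) the universal covering of $X$ is a $q$-thick affine building of dimension $\geq2$ admitting a strongly transitive action, and the labeling of its vertices (by the vertices of its Coxeter diagram) descends to $X$. Let $w$ denote the canonical weight function of $X$, let $T$ denote the Coxeter diagram of the building mentioned in (A) or (B), put $m=m(T)$, and assume $q\geq r^2(m-2)$. Let $R$ be an abelian group and let $\{R_x\}_{x\in X-\{\emptyset\}}$ be subgroups of $R$; set $R_\emptyset=\{0_R\}$ and $n=|X(0)|$. Suppose that: (1) for every subgraph $Y$ of $X$ which is either a cycle of length $\leq\lceil\frac23n\rceil$ or a path of length $\leq2$, the subgroups $\{R_y\}_{y\in Y}$ are linearly disjoint in $R$; and (2) for every distinct $u,v\in X(0)$, the subgroups $R_u$ and $R_v$ are linearly disjoint. For every $x\in X$ put $\mathcal{G}(x)=\sum_{y\subseteq x}R_y$, so that $\mathcal{G}$ becomes a subsheaf of the constant sheaf $R_X$. Then $$\mathrm{cbe}_0(X,w,R_X/\mathcal{G})\geq\frac{2r}{5r+2}-\frac{(4r^3+4r)\sqrt{m-2}}{(5r+2)(\sqrt q-(r-1)\sqrt{m-2})}-\frac{14r+4}{(5r+2)(q+r-1)}.$$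
   Context: Buildings (as in Abramenko--Brown, "Buildings"): a building is a (possibly infinite) simplicial complex $X$ that is the union of a collection $\mathcal{E}$ of subcomplexes, called apartments, each a Coxeter complex, such that any two faces lie in a common apartment and any two apartments containing given faces $x,y$ are isomorphic via an isomorphism fixing $x$ and $y$ pointwise. All apartments are isomorphic to one Coxeter complex, encoded by a Coxeter diagram $T=T(X)$, a finite graph whose edges are labelled by elements of $\{3,4,5,\dots\}\cup\{\infty\}$ (unlabelled edges have label $3$). The vertices of $X$ are labelled by the vertices of $T$, making $X$ a pure $(r+1)$-partite complex with $r=\dim X=|V(T)|-1$. Let $B$ be the real $V(T)\times V(T)$ matrix with $B_{u,u}=1$, $B_{u,v}=-\cos(\pi/k)$ if $\{u,v\}$ is an edge of $T$ labelled $k$, and $B_{u,v}=0$ otherwise. $X$ is spherical if $B$ is positive definite (equivalently, apartments are finite), and affine if $B$ is positive semidefinite of rank $|V(T)|-1$. A building of dimension $r$ is $q$-thick if every $(r-1)$-face is contained in at least $q$ $r$-faces. $X$ admits a strongly transitive action if there is a group $G$ acting on $X$ by type-preserving (label-preserving) simplicial automorphisms that takes apartments to apartments and acts transitively on the pairs $(A,x)$ with $A\in\mathcal{E}$ and $x$ an $r$-face of $A$. Put $m(T)=\max(\{2\}\cup\{k: T\text{ has an edge labelled }k\})$. Simplicial complexes contain the empty face; $X(i)$ is the set of faces of dimension $i$ (cardinality $i+1$). The canonical weight function of a pure $r$-dimensional finite complex $X$ is $w(x)=\binom{r+1}{\dim x+1}^{-1}\frac{|\{y\in X(r):y\supseteq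 x\}|}{|X(r)|}$ for $x\in X$; for $A\subseteq X$, $w(A)=\sum_{a\in A}w(a)$. A subgraph of $X$ is a subcomplex of dimension at most $1$ (it contains $\emptyset$). A cycle of length $\ell\ge 3$ is a subgraph isomorphic to the cycle graph on $\ell$ vertices; a path of length $\ell$ is a subgraph consisting of $\ell$ distinct consecutive edges, their vertices and $\emptyset$ (so a path of length $\le 2$ is a single vertex, an edge with its two vertices, or two distinct edges sharing a vertex together with their three vertices, in each case along with $\emptyset$). A finite family of subgroups $\{R_i\}_{i\in I}$ of $R$ is linearly disjoint if $(r_i)_i\mapsto\sum_i r_i:\bigoplus_{i\in I}R_i\to R$ is injective. Sheaves: a sheaf $\mathcal{F}$ on $X$ assigns an abelian group $\mathcal{F}(x)$ to each $x\in X$ (including $\emptyset$) and homomorphisms $\mathrm{res}_{y\leftarrow x}:\mathcal{F}(x)\to\mathcal{F}(y)$ for $x\subsetneq y$ with $\mathrm{res}_{z\leftarrow y}\circ\mathrm{res}_{y\leftarrow x}=\mathrm{res}_{z\leftarrow x}$. The constant sheaf $R_X$ has $R_X(x)=R$ for all $x$ and identity restriction maps. A subsheaf $\mathcal{G}\subseteq R_X$ is a choice of subgroups $\mathcal{G}(x)\subseteq R$ with $\mathcal{G}(x)\subseteq\mathcal{G}(y)$ for $x\subseteq y$; the quotient sheaf has $(R_X/\mathcal{G})(x)=R/\mathcal{G}(x)$ with the induced restriction maps. Coboundary expansion: fix a linear order on the vertices and let $e^+,e^-$ be the larger and smaller vertex of an edge $e$. Put $C^i=\prod_{x\in X(i)}\mathcal{F}(x)$,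 $(d_{-1}f)(v)=\mathrm{res}_{v\leftarrow\emptyset}f(\emptyset)$, $(d_0f)(e)=\mathrm{res}_{e\leftarrow e^+}f(e^+)-\mathrm{res}_{e\leftarrow e^-}f(e^-)$, $B^0=\mathrm{im}\,d_{-1}$. For $f\in C^i$, $\|f\|_w=w(\{x\in X(i):f(x)\ne0\})$; $\mathrm{dist}_w(f,B^0)=\min_{g\in B^0}\|f-g\|_w$. $\mathrm{cbe}_0(X,w,\mathcal{F})$ is the supremum of all $\varepsilon\in[0,\infty)$ with $\|d_0f\|_w\ge\varepsilon\,\mathrm{dist}_w(f,B^0)$ for all $f\in C^0$. *)

theory Defs
  imports
    "HOL-Analysis.Analysis"
    "HOL-Algebra.Coset"
    "HOL-Algebra.Bij"
    "HOL-Algebra.Generated_Groups"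
    "HOL-Algebra.FiniteProduct"
    "HOL-Library.Extended_Nat"
begin

section \<open>Simplicial complexes\<close>

text \<open>A complex is identified with its set of faces. The empty face always belongs to it, and its
  vertex set is the union of its faces, so there are no vertices outside the complex.\<close>

definition abstract_complex :: "'v set set \<Rightarrow> bool" where
  "abstract_complex X \<longleftrightarrow>
     {} \<in> X \<and> (\<forall>x\<in>X. finite x) \<and> (\<forall>x\<in>X. \<forall>y. y \<subseteq> x \<longrightarrow> y \<in> X)"

text \<open>The dimension is an integer, so that \<open>faces X (-1)\<close> is the set consisting of the empty face.\<close>

definition faces :: "'v set set \<Rightarrow> int \<Rightarrow> 'v set set" where
  "faces X i = {x \<in> X. int (card x) = i + 1}"

definition has_dimension :: "'v set set \<Rightarrow> nat \<Rightarrow> bool" where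
  "has_dimension X r \<longleftrightarrow> (\<forall>x\<in>X. card x \<le> r + 1) \<and> faces X (int r) \<noteq> {}"

definition complex_iso :: "('u \<Rightarrow> 'v) \<Rightarrow> 'u set set \<Rightarrow> 'v set set \<Rightarrow> bool" where
  "complex_iso f X Y \<longleftrightarrow> bij_betw f (\<Union>X) (\<Union>Y) \<and> (\<lambda>x. f ` x) ` X = Y"

definition canonical_weight :: "nat \<Rightarrow> 'v set set \<Rightarrow> 'v set \<Rightarrow> real" where
  "canonical_weight r X x =
     1 / real ((r + 1) choose card x)
       * (real (card {y \<in> faces X (int r). x \<subseteq> y}) / real (card (faces X (int r))))"

definition is_subgraph :: "'v set set \<Rightarrow> 'v set set \<Rightarrow> bool" where
  "is_subgraph X Y \<longleftrightarrow> abstract_complex Y \<and> Y \<subseteq> X \<and> (\<forall>y\<in>Y. card y \<le> 2)"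

definition cycle_graph :: "nat \<Rightarrow> nat set set" where
  "cycle_graph l = {{}} \<union> {{i} |i. i < l} \<union> {{i, (i + 1) mod l} |i. i < l}"

definition is_cycle :: "'v set set \<Rightarrow> 'v set set \<Rightarrow> nat \<Rightarrow> bool" where
  "is_cycle X Y l \<longleftrightarrow>
     is_subgraph X Y \<and> 3 \<le> l \<and> (\<exists>f. complex_iso f (cycle_graph l) Y)"

text \<open>The list \<open>vs\<close> enumerates the vertices met along the path. Only the edges are required to be
  distinct; for \<open>l \<le> 2\<close> this forces the vertices to be distinct as well.\<close>

definition is_path :: "'v set set \<Rightarrow> 'v set set \<Rightarrow> nat \<Rightarrow> bool" where
  "is_path X Y l \<longleftrightarrow>
     is_subgraph X Y \<and>
     (\<exists>vs. length vs = l + 1 \<and>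
        (\<forall>i<l. vs ! i \<noteq> vs ! (i + 1)) \<and>
        inj_on (\<lambda>i. {vs ! i, vs ! (i + 1)}) {..<l} \<and>
        Y = {{}} \<union> {{v} |v. v \<in> set vs} \<union> {{vs ! i, vs ! (i + 1)} |i. i < l})"

section \<open>Coxeter diagrams and Coxeter complexes\<close>

text \<open>The vertex set of a diagram is the whole finite type \<^typ>\<open>'t\<close>.\<close>

record 't diagram =
  edges :: "'t set set"
  label :: "'t set \<Rightarrow> enat"

definition coxeter_diagram :: "'t::finite diagram \<Rightarrow> bool" where
  "coxeter_diagram T \<longleftrightarrow> (\<forall>e\<in>edges T. card e = 2 \<and> 3 \<le> label T e)"

definition max_label :: "'t::finite diagram \<Rightarrow> enat" where
  "max_label T = Max ({2} \<union> label T ` edges T)"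

definition coxeter_entry :: "'t diagram \<Rightarrow> 't \<Rightarrow> 't \<Rightarrow> enat" where
  "coxeter_entry T u v =
     (if u = v then 1 else if {u, v} \<in> edges T then label T {u, v} else 2)"

text \<open>For the label \<open>\<infinity>\<close> one has \<open>\<pi> / \<infinity> = 0\<close>, hence the entry \<open>-1\<close>.\<close>

definition coxeter_form :: "'t::finite diagram \<Rightarrow> real^'t^'t" where
  "coxeter_form T = (\<chi> u v.
     if u = v then 1
     else if {u, v} \<in> edges T then
       - (case label T {u, v} of enat k \<Rightarrow> cos (pi / real k) | \<infinity> \<Rightarrow> 1)
     else 0)"

definition spherical :: "'t::finite diagram \<Rightarrow> bool" where
  "spherical T \<longleftrightarrow> (\<forall>x. x \<noteq> 0 \<longrightarrow> x \<bullet> (coxeter_form T *v x) > 0)"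

definition affine_diagram :: "'t::finite diagram \<Rightarrow> bool" where
  "affine_diagram T \<longleftrightarrow>
     (\<forall>x. x \<bullet> (coxeter_form T *v x) \<ge> 0) \<and> rank (coxeter_form T) = CARD('t) - 1"

text \<open>The Coxeter group is given by its presentation, as the quotient of the free monoid on the
  generators by the congruence generated by \<open>(st)^m(s,t) = 1\<close>; since \<open>m(s,s) = 1\<close>, the generators
  are involutions and the monoid presentation is also a group presentation.\<close>

inductive coxeter_eq :: "'t diagram \<Rightarrow> 't list \<Rightarrow> 't list \<Rightarrow> bool" for T where
  relator: "coxeter_entry T s t = enat k \<Longrightarrow> coxeter_eq T (concat (replicate k [s, t])) []"
| refl: "coxeter_eq T u u"
| sym: "coxeter_eq T u v \<Longrightarrow> coxeter_eq T v u"
| trans: "coxeter_eq T u v \<Longrightarrow> coxeter_eq T v w \<Longrightarrow> coxeter_eq T u w"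
| append: "coxeter_eq T u u' \<Longrightarrow> coxeter_eq T v v' \<Longrightarrow> coxeter_eq T (u @ v) (u' @ v')"

definition coxeter_class :: "'t diagram \<Rightarrow> 't list \<Rightarrow> 't list set" where
  "coxeter_class T u = {v. coxeter_eq T u v}"

definition coxeter_group :: "'t diagram \<Rightarrow> 't list set monoid" where
  "coxeter_group T =
     \<lparr>carrier = range (coxeter_class T),
      mult = (\<lambda>A B. {w. \<exists>u\<in>A. \<exists>v\<in>B. coxeter_eq T (u @ v) w}),
      one = coxeter_class T []\<rparr>"

definition parabolic :: "'t diagram \<Rightarrow> 't set \<Rightarrow> 't list set set" where
  "parabolic T J = generate (coxeter_group T) ((\<lambda>s. coxeter_class T [s]) ` J)"

text \<open>The Coxeter complex is the poset of standard cosets \<open>w W\<^sub>J\<close> ordered by reverse inclusion.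
  As a set of finite sets, its vertices are the maximal proper cosets, tagged by their type \<open>s\<close>,
  and \<open>w W\<^sub>J\<close> becomes the set of the vertices \<open>w W\<^bsub>S - {s}\<^esub>\<close> for \<open>s \<notin> J\<close>; below, \<open>I\<close> is the
  complement of \<open>J\<close>.\<close>

definition coxeter_vertex :: "'t diagram \<Rightarrow> 't list set \<Rightarrow> 't \<Rightarrow> 't \<times> 't list set set" where
  "coxeter_vertex T w s = (s, w <#\<^bsub>coxeter_group T\<^esub> parabolic T (- {s}))"

definition coxeter_complex :: "'t diagram \<Rightarrow> ('t \<times> 't list set set) set set" where
  "coxeter_complex T = {coxeter_vertex T w ` I |w I. w \<in> carrier (coxeter_group T)}"

section \<open>Buildings\<close>

definition building :: "'t::finite diagram \<Rightarrow> 'v set set \<Rightarrow> 'v set set set \<Rightarrow> bool" where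
  "building T X E \<longleftrightarrow>
     coxeter_diagram T \<and> abstract_complex X \<and>
     (\<forall>A\<in>E. abstract_complex A \<and> A \<subseteq> X \<and> (\<exists>f. complex_iso f (coxeter_complex T) A)) \<and>
     \<Union>E = X \<and>
     (\<forall>x\<in>X. \<forall>y\<in>X. \<exists>A\<in>E. x \<in> A \<and> y \<in> A) \<and>
     (\<forall>A\<in>E. \<forall>A'\<in>E. \<forall>x\<in>A \<inter> A'. \<forall>y\<in>A \<inter> A'.
        \<exists>f. complex_iso f A A' \<and> (\<forall>v\<in>x \<union> y. f v = v))"

text \<open>Every building has such a labelling, and it is unique up to automorphisms of the diagram.\<close>

definition building_labelling ::
    "'t::finite diagram \<Rightarrow> 'v set set set \<Rightarrow> ('v \<Rightarrow> 't) \<Rightarrow> bool" where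
  "building_labelling T E \<tau> \<longleftrightarrow>
     (\<forall>A\<in>E. \<exists>f. complex_iso f (coxeter_complex T) A \<and>
        (\<forall>a\<in>\<Union>(coxeter_complex T). \<tau> (f a) = fst a))"

text \<open>A face contained in infinitely many top-dimensional faces satisfies the bound for all \<open>q\<close>,
  although \<^const>\<open>card\<close> is then \<open>0\<close>.\<close>

definition thick :: "nat \<Rightarrow> nat \<Rightarrow> 'v set set \<Rightarrow> bool" where
  "thick q r X \<longleftrightarrow>
     (\<forall>x\<in>faces X (int r - 1).
        infinite {y \<in> faces X (int r). x \<subseteq> y} \<or> q \<le> card {y \<in> faces X (int r). x \<subseteq> y})"

text \<open>The acting group may be replaced by its image in the symmetric group of the vertex set.\<close>

definition strongly_transitive ::
    "nat \<Rightarrow> 'v set set \<Rightarrow> 'v set set set \<Rightarrow> ('v \<Rightarrow> 't) \<Rightarrow> bool" where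
  "strongly_transitive r X E \<tau> \<longleftrightarrow>
     (\<exists>G. subgroup G (BijGroup (\<Union>X)) \<and>
        (\<forall>g\<in>G. complex_iso g X X \<and> (\<forall>v\<in>\<Union>X. \<tau> (g v) = \<tau> v) \<and>
                (\<forall>A\<in>E. (\<lambda>x. g ` x) ` A \<in> E)) \<and>
        (\<forall>A\<in>E. \<forall>A'\<in>E. \<forall>x\<in>faces A (int r). \<forall>x'\<in>faces A' (int r).
           \<exists>g\<in>G. (\<lambda>y. g ` y) ` A = A' \<and> g ` x = x'))"

section \<open>Coverings\<close>

text \<open>Barycentric coordinates with the topology of pointwise convergence. On the realization this
  is the metric topology; for locally finite complexes, in particular for complexes that cover a
  finite complex, it is also the weak topology.\<close>

definition realization :: "'v set set \<Rightarrow> ('v \<Rightarrow> real) set" where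
  "realization X =
     {\<alpha>. (\<forall>v. 0 \<le> \<alpha> v) \<and> {v. \<alpha> v \<noteq> 0} \<in> X \<and> (\<Sum>v | \<alpha> v \<noteq> 0. \<alpha> v) = 1}"

text \<open>The condition at a vertex \<open>v\<close> says that \<open>p\<close> maps the star of \<open>v\<close> isomorphically onto the star
  of \<open>p v\<close>; in particular \<open>p\<close> is injective on every face.\<close>

definition simplicial_covering :: "('u \<Rightarrow> 'v) \<Rightarrow> 'u set set \<Rightarrow> 'v set set \<Rightarrow> bool" where
  "simplicial_covering p Y X \<longleftrightarrow>
     abstract_complex Y \<and> abstract_complex X \<and>
     (\<forall>y\<in>Y. p ` y \<in> X) \<and> p ` \<Union>Y = \<Union>X \<and>
     (\<forall>v\<in>\<Union>Y. bij_betw (\<lambda>y. p ` y) {y \<in> Y. v \<in> y} {x \<in> X. p v \<in> x})"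

definition universal_covering :: "('u \<Rightarrow> 'v) \<Rightarrow> 'u set set \<Rightarrow> 'v set set \<Rightarrow> bool" where
  "universal_covering p Y X \<longleftrightarrow>
     simplicial_covering p Y X \<and> simply_connected (realization Y)"

section \<open>Sheaves\<close>

text \<open>Abelian groups are written multiplicatively. \<open>res F y x\<close> is the restriction from \<open>x\<close> to a
  larger face \<open>y\<close>.\<close>

record ('v, 'a) sheaf =
  stalk :: "'v set \<Rightarrow> 'a monoid"
  res :: "'v set \<Rightarrow> 'v set \<Rightarrow> 'a \<Rightarrow> 'a"

definition sheaf_on :: "'v set set \<Rightarrow> ('v, 'a) sheaf \<Rightarrow> bool" where
  "sheaf_on X F \<longleftrightarrow>
     (\<forall>x\<in>X. comm_group (stalk F x)) \<and>
     (\<forall>x\<in>X. \<forall>y\<in>X. x \<subset> y \<longrightarrow> res F y x \<in> hom (stalk F x) (stalk F y)) \<and>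
     (\<forall>x\<in>X. \<forall>y\<in>X. \<forall>z\<in>X. x \<subset> y \<longrightarrow> y \<subset> z \<longrightarrow>
        (\<forall>a\<in>carrier (stalk F x). res F z y (res F y x a) = res F z x a))"

definition constant_sheaf :: "'a monoid \<Rightarrow> ('v, 'a) sheaf" where
  "constant_sheaf R = \<lparr>stalk = (\<lambda>x. R), res = (\<lambda>y x a. a)\<rparr>"

definition subsheaf_on :: "'v set set \<Rightarrow> ('v set \<Rightarrow> 'a set) \<Rightarrow> ('v, 'a) sheaf \<Rightarrow> bool" where
  "subsheaf_on X G F \<longleftrightarrow>
     (\<forall>x\<in>X. subgroup (G x) (stalk F x)) \<and>
     (\<forall>x\<in>X. \<forall>y\<in>X. x \<subset> y \<longrightarrow> res F y x ` G x \<subseteq> G y)"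

text \<open>The restriction maps of the quotient send the coset of \<open>a\<close> modulo \<open>G x\<close> to the coset of the
  restriction of \<open>a\<close> modulo \<open>G y\<close>, which is the product set below.\<close>

definition quotient_sheaf ::
    "('v, 'a) sheaf \<Rightarrow> ('v set \<Rightarrow> 'a set) \<Rightarrow> ('v, 'a set) sheaf" where
  "quotient_sheaf F G =
     \<lparr>stalk = (\<lambda>x. stalk F x Mod G x),
      res = (\<lambda>y x C. G y <#>\<^bsub>stalk F y\<^esub> (res F y x ` C))\<rparr>"

definition linearly_disjoint :: "'a monoid \<Rightarrow> 'i set \<Rightarrow> ('i \<Rightarrow> 'a set) \<Rightarrow> bool" where
  "linearly_disjoint R I H \<longleftrightarrow> inj_on (\<lambda>f. finprod R f I) (\<Pi>\<^sub>E i\<in>I. H i)"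

definition subgroup_sum :: "'a monoid \<Rightarrow> 'i set \<Rightarrow> ('i \<Rightarrow> 'a set) \<Rightarrow> 'a set" where
  "subgroup_sum R I H = (\<lambda>f. finprod R f I) ` (\<Pi>\<^sub>E i\<in>I. H i)"

lemma subgroup_sum_subgroup:
  assumes R: "comm_group R" and I: "finite I" and H: "\<And>i. i \<in> I \<Longrightarrow> subgroup (H i) R"
  shows "subgroup (subgroup_sum R I H) R"
proof -
  interpret R: comm_group R by (fact R)
  have sub: "f \<in> I \<rightarrow> carrier R" if "f \<in> (\<Pi>\<^sub>E i\<in>I. H i)" for f
    using that H subgroup.subset by fastforce
  have carr: "subgroup_sum R I H \<subseteq> carrier R"
    using sub by (auto simp: subgroup_sum_def)
  have mult: "a \<otimes>\<^bsub>R\<^esub> b \<in> subgroup_sum R I H"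
    if "a \<in> subgroup_sum R I H" "b \<in> subgroup_sum R I H" for a b
  proof -
    from that obtain f g where f: "f \<in> (\<Pi>\<^sub>E i\<in>I. H i)" "a = finprod R f I"
      and g: "g \<in> (\<Pi>\<^sub>E i\<in>I. H i)" "b = finprod R g I"
      by (auto simp: subgroup_sum_def)
    let ?h = "\<lambda>i\<in>I. f i \<otimes>\<^bsub>R\<^esub> g i"
    have h: "?h \<in> (\<Pi>\<^sub>E i\<in>I. H i)"
      using f(1) g(1) by (intro restrict_PiE_iff[THEN iffD2] ballI subgroup.m_closed[OF H]) auto
    have "finprod R ?h I = finprod R (\<lambda>i. f i \<otimes>\<^bsub>R\<^esub> g i) I"
      using sub[OF f(1)] sub[OF g(1)] by (intro R.finprod_cong') auto
    also have "\<dots> = a \<otimes>\<^bsub>R\<^esub> b"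
      unfolding f g by (rule R.finprod_multf[OF sub[OF f(1)] sub[OF g(1)]])
    finally show ?thesis
      unfolding subgroup_sum_def using h by (intro image_eqI[of _ _ ?h]) auto
  qed
  have one: "\<one>\<^bsub>R\<^esub> \<in> subgroup_sum R I H"
  proof -
    have "(\<lambda>i\<in>I. \<one>\<^bsub>R\<^esub>) \<in> (\<Pi>\<^sub>E i\<in>I. H i)"
      by (intro restrict_PiE_iff[THEN iffD2] ballI subgroup.one_closed[OF H])
    moreover have "finprod R (\<lambda>i\<in>I. \<one>\<^bsub>R\<^esub>) I = \<one>\<^bsub>R\<^esub>"
      by (intro R.finprod_one_eqI) auto
    ultimately show ?thesis
      unfolding subgroup_sum_def by (intro image_eqI[of _ _ "\<lambda>i\<in>I. \<one>\<^bsub>R\<^esub>"]) auto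
  qed
  have inv: "inv\<^bsub>R\<^esub> a \<in> subgroup_sum R I H" if "a \<in> subgroup_sum R I H" for a
  proof -
    from that obtain f where f: "f \<in> (\<Pi>\<^sub>E i\<in>I. H i)" "a = finprod R f I"
      by (auto simp: subgroup_sum_def)
    let ?h = "\<lambda>i\<in>I. inv\<^bsub>R\<^esub> f i"
    have h: "?h \<in> (\<Pi>\<^sub>E i\<in>I. H i)"
      using f(1) by (intro restrict_PiE_iff[THEN iffD2] ballI subgroup.m_inv_closed[OF H]) auto
    have "finprod R f I \<otimes>\<^bsub>R\<^esub> finprod R ?h I = finprod R (\<lambda>i. f i \<otimes>\<^bsub>R\<^esub> ?h i) I"
      using sub[OF f(1)] sub[OF h] by (intro R.finprod_multf[symmetric]) auto
    also have "\<dots> = \<one>\<^bsub>R\<^esub>"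
      using sub[OF f(1)] by (intro R.finprod_one_eqI) (auto simp: Pi_iff)
    finally have "inv\<^bsub>R\<^esub> a = finprod R ?h I"
      unfolding f(2) using sub[OF f(1)] sub[OF h]
      by (intro R.inv_equality) (simp_all add: R.m_comm)
    then show ?thesis
      unfolding subgroup_sum_def using h by (intro image_eqI[of _ _ ?h]) auto
  qed
  show ?thesis
    using carr one mult inv by (intro R.subgroupI) auto
qed

lemma subgroup_sum_mono:
  assumes R: "comm_group R" and J: "finite J" "I \<subseteq> J"
    and H: "\<And>i. i \<in> J \<Longrightarrow> subgroup (H i) R"
  shows "subgroup_sum R I H \<subseteq> subgroup_sum R J H"
proof
  interpret R: comm_group R by (fact R)
  fix a assume "a \<in> subgroup_sum R I H"
  then obtain f where f: "f \<in> (\<Pi>\<^sub>E i\<in>I. H i)" "a = finprod R f I"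
    by (auto simp: subgroup_sum_def)
  let ?g = "\<lambda>i\<in>J. if i \<in> I then f i else \<one>\<^bsub>R\<^esub>"
  have g: "?g \<in> (\<Pi>\<^sub>E i\<in>J. H i)"
    using f(1) subgroup.one_closed[OF H] by (intro restrict_PiE_iff[THEN iffD2]) auto
  then have "?g \<in> J \<rightarrow> carrier R"
    using H subgroup.subset by fastforce
  then have "finprod R f I = finprod R ?g J"
    using J by (intro R.finprod_mono_neutral_cong_left) auto
  then show "a \<in> subgroup_sum R J H"
    unfolding subgroup_sum_def f(2) using g by (rule image_eqI)
qed

lemma subsheaf_on_subgroup_sum:
  assumes "comm_group R" "abstract_complex X" "\<And>x. x \<in> X \<Longrightarrow> subgroup (H x) R"
  shows "subsheaf_on X (\<lambda>x. subgroup_sum R (Pow x) H) (constant_sheaf R)"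
proof -
  have *: "finite (Pow x)" "\<And>y. y \<in> Pow x \<Longrightarrow> subgroup (H y) R" if "x \<in> X" for x
    using assms(2,3) that by (auto simp: abstract_complex_def)
  have "subgroup_sum R (Pow x) H \<subseteq> subgroup_sum R (Pow y) H" if "y \<in> X" "x \<subset> y" for x y
  proof (rule subgroup_sum_mono[OF assms(1) *(1)[OF that(1)]])
    show "Pow x \<subseteq> Pow y" using that(2) by blast
    show "subgroup (H z) R" if "z \<in> Pow y" for z by (rule *(2)[OF \<open>y \<in> X\<close> that])
  qed
  moreover have "subgroup (subgroup_sum R (Pow x) H) R" if "x \<in> X" for x
    by (rule subgroup_sum_subgroup[OF assms(1) *(1)[OF that]]) (rule *(2)[OF that])
  ultimately show ?thesis
    by (simp add: subsheaf_on_def constant_sheaf_def)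
qed

lemma quotient_sheaf_res:
  assumes A: "group A" and B: "group B" and h: "h \<in> hom A B"
    and N: "subgroup N A" and M: "subgroup M B" and NM: "h ` N \<subseteq> M" and a: "a \<in> carrier A"
  shows "M <#>\<^bsub>B\<^esub> (h ` (N #>\<^bsub>A\<^esub> a)) = M #>\<^bsub>B\<^esub> h a"
proof -
  interpret B: group B by (fact B)
  interpret M: subgroup M B by (fact M)
  have hN: "h (n \<otimes>\<^bsub>A\<^esub> a) = h n \<otimes>\<^bsub>B\<^esub> h a" if "n \<in> N" for n
    using that a N h by (simp add: hom_mult subgroup.mem_carrier)
  have "h ` (N #>\<^bsub>A\<^esub> a) = (h ` N) #>\<^bsub>B\<^esub> h a"
    using hN by (force simp: r_coset_def)
  moreover have "h a \<in> carrier B" using a h by (auto simp: hom_def)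
  moreover have "M <#>\<^bsub>B\<^esub> (h ` N) = M"
  proof
    show "M <#>\<^bsub>B\<^esub> (h ` N) \<subseteq> M" using NM by (auto simp: set_mult_def)
    have "\<one>\<^bsub>B\<^esub> \<in> h ` N"
      using hom_one[OF h A B] subgroup.one_closed[OF N] by force
    then have "m \<otimes>\<^bsub>B\<^esub> \<one>\<^bsub>B\<^esub> \<in> M <#>\<^bsub>B\<^esub> (h ` N)" if "m \<in> M" for m
      unfolding set_mult_def using that by blast
    then have "m \<in> M <#>\<^bsub>B\<^esub> (h ` N)" if "m \<in> M" for m
      using that M.mem_carrier by (metis B.r_one)
    then show "M \<subseteq> M <#>\<^bsub>B\<^esub> (h ` N)" by blast
  qed
  ultimately show ?thesis
    using NM M.subset by (simp add: B.setmult_rcos_assoc)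
qed

lemma sheaf_on_quotient_sheaf:
  assumes F: "sheaf_on X F" and G: "subsheaf_on X G F"
  shows "sheaf_on X (quotient_sheaf F G)"
proof -
  have cg: "comm_group (stalk F x)" if "x \<in> X" for x using F that by (simp add: sheaf_on_def)
  then have gr: "group (stalk F x)" if "x \<in> X" for x using that comm_group.axioms(2) by blast
  have sg: "subgroup (G x) (stalk F x)" if "x \<in> X" for x using G that by (simp add: subsheaf_on_def)
  have nm: "G x \<lhd> stalk F x" if "x \<in> X" for x
    using comm_group.normal_iff_subgroup[OF cg[OF that]] sg[OF that] by simp
  have hm: "res F y x \<in> hom (stalk F x) (stalk F y)" if "x \<in> X" "y \<in> X" "x \<subset> y" for x y
    using F that by (simp add: sheaf_on_def)
  have key: "res (quotient_sheaf F G) y x (G x #>\<^bsub>stalk F x\<^esub> a) = G y #>\<^bsub>stalk F y\<^esub> res F y x a"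
    if "x \<in> X" "y \<in> X" "x \<subset> y" "a \<in> carrier (stalk F x)" for x y a
    using quotient_sheaf_res[OF gr gr hm sg sg] that G
    by (simp add: quotient_sheaf_def subsheaf_on_def)
  have st: "stalk (quotient_sheaf F G) x = stalk F x Mod G x" for x
    by (simp add: quotient_sheaf_def)
  have cl: "res F y x a \<in> carrier (stalk F y)"
    if "x \<in> X" "y \<in> X" "x \<subset> y" "a \<in> carrier (stalk F x)" for x y a
    using hm[OF that(1-3)] that(4) by (auto simp: hom_def)
  have 1: "comm_group (stalk (quotient_sheaf F G) x)" if x: "x \<in> X" for x
    unfolding st using cg[OF x] sg[OF x] by (rule comm_group.abelian_FactGroup)
  have 2: "res (quotient_sheaf F G) y x \<in> hom (stalk (quotient_sheaf F G) x) (stalk (quotient_sheaf F G) y)"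
    if xy: "x \<in> X" "y \<in> X" "x \<subset> y" for x y
  proof (rule homI)
    fix C assume "C \<in> carrier (stalk (quotient_sheaf F G) x)"
    then show "res (quotient_sheaf F G) y x C \<in> carrier (stalk (quotient_sheaf F G) y)"
      using key[OF xy] cl[OF xy] by (auto simp: st carrier_FactGroup)
  next
    fix C D
    assume "C \<in> carrier (stalk (quotient_sheaf F G) x)" "D \<in> carrier (stalk (quotient_sheaf F G) x)"
    then obtain a b where ab: "a \<in> carrier (stalk F x)" "b \<in> carrier (stalk F x)"
      "C = G x #>\<^bsub>stalk F x\<^esub> a" "D = G x #>\<^bsub>stalk F x\<^esub> b"
      by (auto simp: st carrier_FactGroup)
    have m: "a \<otimes>\<^bsub>stalk F x\<^esub> b \<in> carrier (stalk F x)"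
      using ab gr[OF xy(1)] group.is_monoid monoid.m_closed by fastforce
    show "res (quotient_sheaf F G) y x (C \<otimes>\<^bsub>stalk (quotient_sheaf F G) x\<^esub> D) =
      res (quotient_sheaf F G) y x C \<otimes>\<^bsub>stalk (quotient_sheaf F G) y\<^esub> res (quotient_sheaf F G) y x D"
      using ab m key[OF xy] cl[OF xy] normal.rcos_sum[OF nm[OF xy(1)]]
        normal.rcos_sum[OF nm[OF xy(2)]] hom_mult[OF hm[OF xy]]
      by (simp add: st)
  qed
  have 3: "res (quotient_sheaf F G) z y (res (quotient_sheaf F G) y x C) = res (quotient_sheaf F G) z x C"
    if xyz: "x \<in> X" "y \<in> X" "z \<in> X" "x \<subset> y" "y \<subset> z"
      and C: "C \<in> carrier (stalk (quotient_sheaf F G) x)" for x y z C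
  proof -
    obtain a where a: "a \<in> carrier (stalk F x)" "C = G x #>\<^bsub>stalk F x\<^esub> a"
      using C by (auto simp: st carrier_FactGroup)
    have "res F z y (res F y x a) = res F z x a"
      using F xyz a by (simp add: sheaf_on_def)
    moreover have "x \<subset> z" using xyz by auto
    ultimately show ?thesis
      using a key xyz cl by simp
  qed
  show ?thesis
    unfolding sheaf_on_def using 1 2 3 by blast
qed

section \<open>Coboundary expansion in dimension zero\<close>

definition cochains :: "'v set set \<Rightarrow> ('v, 'a) sheaf \<Rightarrow> int \<Rightarrow> ('v set \<Rightarrow> 'a) set" where
  "cochains X F i = (\<Pi>\<^sub>E x\<in>faces X i. carrier (stalk F x))"

text \<open>The linear order on the vertices is a relation \<open>L\<close>, with \<open>(u, v) \<in> L\<close> meaning \<open>u \<le> v\<close>.\<close>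

definition larger_vertex :: "'v rel \<Rightarrow> 'v set \<Rightarrow> 'v" where
  "larger_vertex L e = (THE v. v \<in> e \<and> (\<forall>u\<in>e. (u, v) \<in> L))"

definition smaller_vertex :: "'v rel \<Rightarrow> 'v set \<Rightarrow> 'v" where
  "smaller_vertex L e = (THE v. v \<in> e \<and> (\<forall>u\<in>e. (v, u) \<in> L))"

definition coboundary_m1 ::
    "'v set set \<Rightarrow> ('v, 'a) sheaf \<Rightarrow> ('v set \<Rightarrow> 'a) \<Rightarrow> 'v set \<Rightarrow> 'a" where
  "coboundary_m1 X F f = (\<lambda>x\<in>faces X 0. res F x {} (f {}))"

definition coboundary_0 ::
    "'v rel \<Rightarrow> 'v set set \<Rightarrow> ('v, 'a) sheaf \<Rightarrow> ('v set \<Rightarrow> 'a) \<Rightarrow> 'v set \<Rightarrow> 'a" where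
  "coboundary_0 L X F f = (\<lambda>e\<in>faces X 1.
     let x = {larger_vertex L e}; y = {smaller_vertex L e}
     in res F e x (f x) \<otimes>\<^bsub>stalk F e\<^esub> inv\<^bsub>stalk F e\<^esub> res F e y (f y))"

definition boundaries_0 :: "'v set set \<Rightarrow> ('v, 'a) sheaf \<Rightarrow> ('v set \<Rightarrow> 'a) set" where
  "boundaries_0 X F = coboundary_m1 X F ` cochains X F (-1)"

definition cochain_norm ::
    "'v set set \<Rightarrow> ('v set \<Rightarrow> real) \<Rightarrow> ('v, 'a) sheaf \<Rightarrow> int \<Rightarrow> ('v set \<Rightarrow> 'a) \<Rightarrow> real" where
  "cochain_norm X w F i f = sum w {x \<in> faces X i. f x \<noteq> \<one>\<^bsub>stalk F x\<^esub>}"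

definition dist_boundaries_0 ::
    "'v set set \<Rightarrow> ('v set \<Rightarrow> real) \<Rightarrow> ('v, 'a) sheaf \<Rightarrow> ('v set \<Rightarrow> 'a) \<Rightarrow> real" where
  "dist_boundaries_0 X w F f =
     Min ((\<lambda>g. cochain_norm X w F 0 (\<lambda>x\<in>faces X 0. f x \<otimes>\<^bsub>stalk F x\<^esub> inv\<^bsub>stalk F x\<^esub> g x))
          ` boundaries_0 X F)"

text \<open>The supremum is taken in \<^typ>\<open>ereal\<close>; it is \<open>\<infinity>\<close> when every 0-cochain is a coboundary.\<close>

definition cbe0 ::
    "'v rel \<Rightarrow> 'v set set \<Rightarrow> ('v set \<Rightarrow> real) \<Rightarrow> ('v, 'a) sheaf \<Rightarrow> ereal" where
  "cbe0 L X w F =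
     Sup {ereal \<epsilon> |\<epsilon>. 0 \<le> \<epsilon> \<and>
            (\<forall>f\<in>cochains X F 0.
               cochain_norm X w F 1 (coboundary_0 L X F f) \<ge> \<epsilon> * dist_boundaries_0 X w F f)}"

end

theory Submission
  imports Defs
begin

text \<open>Lift a cochain of the quotient sheaf to \<open>g\<close> with values in \<open>R\<close>. Its coboundary vanishes at an
  edge \<open>uv\<close> iff \<open>g u - g v\<close> lies in \<open>R\<^sub>u + R\<^sub>v + R\<^bsub>uv\<^esub>\<close>, and it differs from the constant
  \<open>c\<close> exactly outside the cluster of the vertices \<open>v\<close> with \<open>g v - c\<close> in \<open>R\<^sub>v\<close>. Two clusters share at
  most one vertex, and by linear disjointness every short cycle of vanishing edges lies in one
  cluster. A graph on \<open>n\<close> vertices with \<open>n + 1\<close> edges has a cycle of length at most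
  \<open>2 (n + 1) / 3\<close>, so few edges vanish outside the clusters, and the expander mixing lemma bounds
  the number of edges inside the clusters. This gives the expansion \<open>1 - 2 lam - 6 / (r q)\<close>, where
  \<open>lam\<close> is the second eigenvalue of the weighted graph underlying \<open>X\<close>.

  To bound \<open>lam\<close>, note that the links of the faces of codimension two are generalized polygons with
  second eigenvalue at most \<open>2 / sqrt q\<close> (and \<open>0\<close> if the diagram has no edges). Links are connected,
  so the trickling-down theorem gives \<open>lam \<le> 2 / (sqrt q - 2 (r - 1))\<close>. Whenever the claimed bound is
  positive, it is smaller than the resulting expansion. A covering induces isomorphisms of the
  stars of nonempty faces, so only the connectedness of the whole complex has to be transferred
  separately from the universal covering to \<open>X\<close>.\<close>

section \<open>Short cycles and matchings\<close>

text \<open>The cycle hypothesis counts edges, while expansion is about weights. The bridge is an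
  injective choice of an end for every edge of a sparse graph: by thickness and homogeneity an edge
  weighs at most \<open>\<delta> = 2 / (r * q)\<close> times either end, so such a graph weighs at
  most \<open>\<delta>\<close>. Inside a cluster there is no sparsity, and there the mixing
  inequality is charged to the same chosen ends. The loss \<open>3 * \<delta>\<close> comes from a
  case distinction at weight 2/3. If no cluster is that heavy, an additive error
  \<open>\<delta>\<close> is absorbed because the weight outside the heaviest cluster exceeds 1/3. A
  heavier cluster may contain almost everything, and then only an error proportional to the weight
  outside it is affordable; it comes from the edges that leave the heaviest component of the
  cluster. Polygons of every length get the same bound \<open>2 / sqrt q\<close>, so the labels
  reach the final estimate through \<open>sqrt (m - 2) \<ge> 1\<close> and the assumption on
  \<open>q\<close>. If the diagram has an edge, it is positivity of the claimed bound that makes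
  \<open>q\<close> large enough for trickling down.\<close>

definition graph_cycle :: "'v set set \<Rightarrow> 'v list \<Rightarrow> bool" where
  "graph_cycle E vs \<longleftrightarrow> distinct vs \<and> 3 \<le> length vs \<and>
     (\<forall>i<length vs. {vs ! i, vs ! ((i + 1) mod length vs)} \<in> E)"

lemma graph_cycle_mono: "graph_cycle E vs \<Longrightarrow> E \<subseteq> F \<Longrightarrow> graph_cycle F vs"
  by (auto simp: graph_cycle_def)

text \<open>Equal edges at different positions would make each position the cyclic successor of the
  other, which is impossible modulo a length of at least 3.\<close>

lemma graph_cycle_inj_edges:
  assumes "distinct vs" "3 \<le> length vs"
  shows "inj_on (\<lambda>i. {vs ! i, vs ! ((i + 1) mod length vs)}) {..<length vs}"
proof (rule inj_onI)
  let ?l = "length vs"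
  fix i j assume ij: "i \<in> {..<?l}" "j \<in> {..<?l}"
    and eq: "{vs ! i, vs ! ((i + 1) mod ?l)} = {vs ! j, vs ! ((j + 1) mod ?l)}"
  have "0 < ?l" using assms by linarith
  then have lt: "(i + 1) mod ?l < ?l" "(j + 1) mod ?l < ?l" by simp_all
  show "i = j"
  proof (rule ccontr)
    assume "i \<noteq> j"
    then have "vs ! i \<noteq> vs ! j" using ij assms by (auto simp: nth_eq_iff_index_eq)
    with eq have "vs ! i = vs ! ((j + 1) mod ?l)" "vs ! j = vs ! ((i + 1) mod ?l)"
      by (auto simp: doubleton_eq_iff)
    then have 1: "i = (j + 1) mod ?l" "j = (i + 1) mod ?l"
      using ij lt assms by (auto simp: nth_eq_iff_index_eq)
    have 2: "(i + 1) mod ?l = (if i + 1 = ?l then 0 else i + 1)"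
      "(j + 1) mod ?l = (if j + 1 = ?l then 0 else j + 1)"
      using ij by (metis Suc_eq_plus1 Suc_lessI lessThan_iff mod_less mod_self)+
    have "j + 1 = ?l \<and> i = 0 \<or> i = j + 1" "i + 1 = ?l \<and> j = 0 \<or> j = i + 1"
      using 1 2 by metis+
    then show False using assms(2) by linarith
  qed
qed

text \<open>Converts a bound on the number of edges of an element of the cycle space into a bound on
  the length of a cycle inside it.\<close>

lemma graph_cycle_length_le:
  assumes "graph_cycle E vs" "finite E"
  shows "length vs \<le> card E"
proof -
  have "card ((\<lambda>i. {vs ! i, vs ! ((i + 1) mod length vs)}) ` {..<length vs}) \<le> card E"
    using assms by (intro card_mono) (auto simp: graph_cycle_def)
  then show ?thesis
    using card_image[OF graph_cycle_inj_edges[of vs]] assms(1) by (simp add: graph_cycle_def)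
qed

text \<open>The first vertex of a longest path lies on a second edge. By maximality that edge
  returns to the path, at an index of at least 2, and closes an initial segment of it to a
  cycle.\<close>

lemma graph_cycle_exists:
  assumes fin: "finite C" and ne: "C \<noteq> {}" and two: "\<And>e. e \<in> C \<Longrightarrow> card e = 2"
    and deg: "\<And>v. card {e \<in> C. v \<in> e} \<noteq> 1"
  shows "\<exists>vs. graph_cycle C vs"
proof -
  define P where "P p \<longleftrightarrow> distinct p \<and> 2 \<le> length p \<and>
    (\<forall>i. Suc i < length p \<longrightarrow> {p ! i, p ! Suc i} \<in> C)" for p :: "'a list"
  have fU: "finite (\<Union>C)"
    using fin two by (metis card.infinite finite_Union zero_neq_numeral)
  have len: "length p \<le> card (\<Union>C)" if "P p" for p
  proof -
    have "p ! i \<in> \<Union>C" if "i < length p" for i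
    proof (cases i)
      case 0
      have "{p ! 0, p ! Suc 0} \<in> C" using \<open>P p\<close> unfolding P_def by auto
      then show ?thesis using 0 by blast
    next
      case (Suc j)
      have "{p ! j, p ! Suc j} \<in> C" using \<open>P p\<close> Suc that unfolding P_def by auto
      then show ?thesis using Suc by blast
    qed
    then have "set p \<subseteq> \<Union>C" by (auto simp: in_set_conv_nth)
    then have "card (set p) \<le> card (\<Union>C)" by (rule card_mono[OF fU])
    then show ?thesis using that by (simp add: P_def distinct_card)
  qed
  obtain e where "e \<in> C" using ne by auto
  with two obtain a b where ab: "e = {a, b}" "a \<noteq> b" by (metis card_2_iff)
  have "P [a, b]" using ab \<open>e \<in> C\<close> by (auto simp: P_def less_Suc_eq)
  moreover have "\<forall>p. P p \<longrightarrow> length p < card (\<Union>C) + 1" using len by (simp add: le_imp_less_Suc)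
  ultimately have "\<exists>p. P p \<and> (\<forall>p'. P p' \<longrightarrow> length p' \<le> length p)"
    by (rule ex_has_greatest_nat)
  then obtain p where p: "P p" and max: "\<And>p'. P p' \<Longrightarrow> length p' \<le> length p"
    by blast
  have dp: "distinct p" and lp: "2 \<le> length p" and
    ep: "\<And>i. Suc i < length p \<Longrightarrow> {p ! i, p ! Suc i} \<in> C"
    using p by (auto simp: P_def)
  let ?e0 = "{p ! 0, p ! Suc 0}"
  have e0: "?e0 \<in> C" using ep lp by auto
  have "\<exists>e1\<in>C. p ! 0 \<in> e1 \<and> e1 \<noteq> ?e0"
  proof (rule ccontr)
    assume "\<not> ?thesis"
    then have "{e \<in> C. p ! 0 \<in> e} = {?e0}" using e0 by blast
    then show False using deg[of "p ! 0"] by simp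
  qed
  then obtain e1 where e1: "e1 \<in> C" "p ! 0 \<in> e1" "e1 \<noteq> ?e0" by blast
  obtain u where u: "e1 = {p ! 0, u}" "u \<noteq> p ! 0"
    using two[OF e1(1)] e1(2) by (metis card_2_iff doubleton_eq_iff insertE singletonD)
  have "u \<in> set p"
  proof (rule ccontr)
    assume "u \<notin> set p"
    have "{(u # p) ! i, (u # p) ! Suc i} \<in> C" if "Suc i < length (u # p)" for i
      using that ep e1(1) u(1) by (cases i) (auto simp: insert_commute)
    then have "P (u # p)" using dp lp \<open>u \<notin> set p\<close> by (auto simp: P_def)
    then show False using max[of "u # p"] by simp
  qed
  then obtain k where k: "k < length p" "u = p ! k" by (auto simp: in_set_conv_nth)
  have k2: "2 \<le> k"
  proof -
    have "k \<noteq> 0" using k u by metis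
    moreover have "k \<noteq> 1" using k u e1 by (metis One_nat_def)
    ultimately show ?thesis by simp
  qed
  let ?vs = "take (k + 1) p"
  have lvs: "length ?vs = k + 1" using k by simp
  have "{?vs ! i, ?vs ! ((i + 1) mod length ?vs)} \<in> C" if "i < length ?vs" for i
  proof (cases "i = k")
    case True
    then show ?thesis using lvs e1 u k by (simp add: insert_commute)
  next
    case False
    then have "i < k" using that lvs by simp
    then show ?thesis using lvs ep[of i] k by simp
  qed
  then have "graph_cycle C ?vs" using dp k2 lvs by (auto simp: graph_cycle_def)
  then show ?thesis by blast
qed

text \<open>For two distinct nonzero elements of the cycle space over the field with two elements, every
  edge lies in none or in two of them and their sum, so one of the three has at most two thirds of
  the edges.\<close>

lemma short_graph_cycle_exists:
  assumes finV: "finite V" and E: "\<And>e. e \<in> E \<Longrightarrow> e \<subseteq> V \<and> card e = 2"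
    and many: "card V + 1 \<le> card E"
  shows "\<exists>vs. graph_cycle E vs \<and> 3 * length vs \<le> 2 * (card V + 1)"
proof -
  have finE: "finite E" by (rule finite_subset[of _ "Pow V"]) (use E finV in auto)
  \<comment> \<open>Exactly \<open>card V + 1\<close> edges are kept, so that two thirds of them is
    the length to be shown.\<close>
  obtain E' where E': "E' \<subseteq> E" "card E' = card V + 1"
    using many by (meson obtain_subset_with_card_n)
  have finE': "finite E'" using E' finE finite_subset by blast
  obtain e where "e \<in> E'" using E' by (metis card.empty ex_in_conv add_is_0 one_neq_zero)
  then have "e \<subseteq> V" "e \<noteq> {}" using E E' by force+
  then obtain v0 where v0: "v0 \<in> V" by auto
  define deg where "deg A v = card {e \<in> A. v \<in> e}" for A :: "'a set set" and v
  \<comment> \<open>The parity of the degree at \<open>v0\<close> follows from the other parities,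
    so it is left out. The \<open>2 ^ (card V + 1)\<close> edge sets then have at most
    \<open>2 ^ (card V - 1)\<close> parity patterns, and some pattern occurs more than twice.
    Symmetric differences of sets with the same pattern have even degrees.\<close>
  define odds where "odds A = {v \<in> V - {v0}. odd (deg A v)}" for A
  have sub_odds: "odds ` Pow E' \<subseteq> Pow (V - {v0})" by (auto simp: odds_def)
  have cV: "card (V - {v0}) + 1 = card V" using card_Suc_Diff1[OF finV v0] by simp
  obtain S where S: "card {A \<in> Pow E'. odds A = S} \<ge> 3"
  proof (rule ccontr)
    assume "\<not> thesis"
    then have *: "card {A \<in> Pow E'. odds A = S} \<le> 2" for S
      using that[of S] by linarith
    have "card (Pow E') = card (\<Union>S\<in>Pow (V - {v0}). {A \<in> Pow E'. odds A = S})"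
      by (rule arg_cong[of _ _ card]) (use sub_odds in blast)
    also have "\<dots> \<le> (\<Sum>S\<in>Pow (V - {v0}). card {A \<in> Pow E'. odds A = S})"
      by (rule card_UN_le) (use finV in auto)
    also have "\<dots> \<le> (\<Sum>S\<in>Pow (V - {v0}). 2)" by (intro sum_mono *)
    also have "\<dots> = 2 * 2 ^ card (V - {v0})" using finV by (simp add: card_Pow)
    also have "\<dots> = 2 ^ card V" using cV by (metis power_Suc Suc_eq_plus1)
    also have "\<dots> < card (Pow E')" using finE' E' by (simp add: card_Pow)
    finally show False by simp
  qed
  then obtain F where F: "F \<subseteq> {A \<in> Pow E'. odds A = S}" "card F = 3"
    by (meson obtain_subset_with_card_n)
  obtain A0 A1 A2 where "F = {A0, A1, A2}" and ne: "A0 \<noteq> A1" "A0 \<noteq> A2" "A1 \<noteq> A2"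
    using F(2) unfolding card_3_iff by blast
  with F(1) have A: "A0 \<subseteq> E'" "A1 \<subseteq> E'" "A2 \<subseteq> E'" "odds A0 = S" "odds A1 = S" "odds A2 = S"
    by blast+
  have cycle: "\<exists>vs. graph_cycle E vs \<and> length vs \<le> card ((A - B) \<union> (B - A))"
    if AB: "A \<subseteq> E'" "B \<subseteq> E'" "odds A = odds B" "A \<noteq> B" for A B
  proof -
    let ?D = "(A - B) \<union> (B - A)"
    have D: "?D \<subseteq> E'" "finite ?D" using AB finE' by (auto intro: finite_subset)
    have degD: "deg ?D v + 2 * card {e \<in> A \<inter> B. v \<in> e} = deg A v + deg B v" for v
    proof -
      have fin: "finite {e \<in> A - B. v \<in> e}" "finite {e \<in> B - A. v \<in> e}" "finite {e \<in> A \<inter> B. v \<in> e}"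
        using AB finE' by (auto intro: finite_subset)
      have eq: "{e \<in> ?D. v \<in> e} = {e \<in> A - B. v \<in> e} \<union> {e \<in> B - A. v \<in> e}"
        "{e \<in> A. v \<in> e} = {e \<in> A - B. v \<in> e} \<union> {e \<in> A \<inter> B. v \<in> e}"
        "{e \<in> B. v \<in> e} = {e \<in> B - A. v \<in> e} \<union> {e \<in> A \<inter> B. v \<in> e}"
        by blast+
      have "deg ?D v = card {e \<in> A - B. v \<in> e} + card {e \<in> B - A. v \<in> e}"
        unfolding deg_def eq(1) using fin by (intro card_Un_disjoint) blast+
      moreover have "deg A v = card {e \<in> A - B. v \<in> e} + card {e \<in> A \<inter> B. v \<in> e}"
        unfolding deg_def eq(2) using fin by (intro card_Un_disjoint) blast+
      moreover have "deg B v = card {e \<in> B - A. v \<in> e} + card {e \<in> A \<inter> B. v \<in> e}"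
        unfolding deg_def eq(3) using fin by (intro card_Un_disjoint) blast+
      ultimately show ?thesis by linarith
    qed
    have even1: "even (deg ?D v)" if "v \<in> V - {v0}" for v
    proof -
      have "odd (deg A v) \<longleftrightarrow> odd (deg B v)" using AB(3) that by (auto simp: odds_def)
      then show ?thesis using degD[of v] by presburger
    qed
    \<comment> \<open>The degrees add up to twice the number of edges; this settles the parity at
      \<open>v0\<close>.\<close>
    have "(\<Sum>v\<in>V. deg ?D v) = (\<Sum>e\<in>?D. card {v \<in> V. v \<in> e})"
    proof -
      have "(\<Sum>v\<in>V. deg ?D v) = (\<Sum>v\<in>V. \<Sum>e\<in>{e \<in> ?D. v \<in> e}. 1)" by (simp add: deg_def)
      also have "\<dots> = (\<Sum>e\<in>?D. \<Sum>v\<in>{v \<in> V. v \<in> e}. 1)" by (rule sum.swap_restrict[OF finV D(2)])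
      finally show ?thesis by simp
    qed
    also have "\<dots> = (\<Sum>e\<in>?D. 2)"
    proof (rule sum.cong)
      fix e assume "e \<in> ?D"
      then have "e \<subseteq> V" "card e = 2" using D E E' by auto
      moreover from this have "{v \<in> V. v \<in> e} = e" by auto
      ultimately show "card {v \<in> V. v \<in> e} = 2" by simp
    qed simp
    finally have "even (\<Sum>v\<in>V. deg ?D v)" by simp
    moreover have "(\<Sum>v\<in>V. deg ?D v) = deg ?D v0 + (\<Sum>v\<in>V - {v0}. deg ?D v)"
      using v0 finV by (simp add: sum.remove)
    moreover have "even (\<Sum>v\<in>V - {v0}. deg ?D v)" using even1 by (intro dvd_sum) auto
    ultimately have even0: "even (deg ?D v0)" by (metis even_add)
    have deg1: "deg ?D v \<noteq> 1" for v
    proof (cases "v \<in> V")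
      case True
      then have "even (deg ?D v)" using even0 even1[of v] by (cases "v = v0") auto
      then show ?thesis by auto
    next
      case False
      then have "{e \<in> ?D. v \<in> e} = {}" using D E E' by blast
      then show ?thesis unfolding deg_def by (simp only: card.empty)
    qed
    have "\<exists>vs. graph_cycle ?D vs"
    proof (rule graph_cycle_exists)
      show "?D \<noteq> {}" using AB(4) by blast
      show "card e = 2" if "e \<in> ?D" for e using that D(1) E E'(1) by blast
      show "card {e \<in> ?D. v \<in> e} \<noteq> 1" for v using deg1[of v] unfolding deg_def .
    qed (rule D(2))
    then obtain vs where "graph_cycle ?D vs" by blast
    moreover have "graph_cycle E vs" by (rule graph_cycle_mono[OF calculation]) (use D(1) E'(1) in blast)
    ultimately show ?thesis using graph_cycle_length_le[of ?D vs] D(2) by blast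
  qed
  let ?D = "\<lambda>A B. (A - B) \<union> (B - A)"
  have fin: "finite A0" "finite A1" "finite A2"
    using A(1-3)[THEN finite_subset, OF finE'] by blast+
  have "card (?D A0 A1) + card (?D A0 A2) + card (?D A1 A2) \<le> 2 * card E'"
  proof -
    let ?P = "?D A0 A1" and ?Q = "?D A0 A2"
    have "?D A1 A2 = (?P - ?Q) \<union> (?Q - ?P)" by auto
    then have "card (?D A1 A2) = card (?P - ?Q) + card (?Q - ?P)"
      using fin by (simp, subst card_Un_disjoint) auto
    moreover have "card ?P = card (?P - ?Q) + card (?P \<inter> ?Q)"
      using fin by (subst card_Un_disjoint[symmetric]) (auto intro!: arg_cong[of _ _ card])
    moreover have "card ?Q = card (?Q - ?P) + card (?P \<inter> ?Q)"
      using fin by (subst card_Un_disjoint[symmetric]) (auto intro!: arg_cong[of _ _ card])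
    moreover have "card (?P \<union> ?Q) = card ((?P - ?Q) \<union> (?Q - ?P)) + card (?P \<inter> ?Q)"
      using fin by (subst card_Un_disjoint[symmetric]) (auto intro!: arg_cong[of _ _ card])
    moreover have "card ((?P - ?Q) \<union> (?Q - ?P)) = card (?P - ?Q) + card (?Q - ?P)"
      using fin by (subst card_Un_disjoint) auto
    moreover have "card (?P \<union> ?Q) \<le> card E'" using A finE' by (intro card_mono) auto
    ultimately show ?thesis by linarith
  qed
  then consider "3 * card (?D A0 A1) \<le> 2 * card E'" | "3 * card (?D A0 A2) \<le> 2 * card E'"
    | "3 * card (?D A1 A2) \<le> 2 * card E'" by linarith
  then obtain A B where AB: "A \<subseteq> E'" "B \<subseteq> E'" "odds A = odds B" "A \<noteq> B" "3 * card (?D A B) \<le> 2 * card E'"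
    using A ne by cases metis+
  then obtain vs where "graph_cycle E vs" "length vs \<le> card (?D A B)" using cycle[of A B] by blast
  then show ?thesis using AB(5) E'(2) by (intro exI[of _ vs]) auto
qed

text \<open>Hall's theorem by the induction of Halmos and Vaughan. If some nonempty proper subset is
  tight, it and its complement are matched separately, the complement without the elements available
  to the tight set. Otherwise all proper subsets have one element to spare, and any choice for one
  index preserves the condition.\<close>

lemma marriage:
  assumes "finite I" and "\<And>i. i \<in> I \<Longrightarrow> finite (S i)"
    and "\<And>J. J \<subseteq> I \<Longrightarrow> card J \<le> card (\<Union>(S ` J))"
  shows "\<exists>\<phi>. inj_on \<phi> I \<and> (\<forall>i\<in>I. \<phi> i \<in> S i)"
  using assms
proof (induction "card I" arbitrary: I S rule: less_induct)
  case less
  show ?case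
  proof (cases "\<exists>J. J \<noteq> {} \<and> J \<subset> I \<and> card (\<Union>(S ` J)) \<le> card J")
    case True
    then obtain J where J: "J \<noteq> {}" "J \<subset> I" "card (\<Union>(S ` J)) \<le> card J" by blast
    have "finite J" using J less.prems(1) finite_subset by blast
    moreover have "finite (\<Union>(S ` J))" using calculation J less.prems(2) by blast
    ultimately have finJ: "finite J" "finite (\<Union>(S ` J))" .
    have "card J < card I" using J less.prems by (simp add: psubset_card_mono)
    then have "\<exists>\<phi>. inj_on \<phi> J \<and> (\<forall>i\<in>J. \<phi> i \<in> S i)"
    proof (rule less.hyps)
      show "card K \<le> card (\<Union>(S ` K))" if "K \<subseteq> J" for K
        using that J by (intro less.prems) blast
      show "finite (S i)" if "i \<in> J" for i using that J less.prems(2) by blast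
    qed (rule finJ)
    then obtain \<phi> where \<phi>: "inj_on \<phi> J" "\<forall>i\<in>J. \<phi> i \<in> S i" by blast
    let ?S = "\<lambda>i. S i - \<Union>(S ` J)"
    have "card (I - J) < card I" using J less.prems by (intro psubset_card_mono) auto
    then have "\<exists>\<psi>. inj_on \<psi> (I - J) \<and> (\<forall>i\<in>I - J. \<psi> i \<in> ?S i)"
    proof (rule less.hyps)
      fix K assume K: "K \<subseteq> I - J"
      have "finite K" using K less.prems(1) finite_subset by blast
      moreover have "finite (\<Union>(S ` K))" using calculation K less.prems(2) by blast
      ultimately have finK: "finite K" "finite (\<Union>(S ` K))" .
      have "card (J \<union> K) \<le> card (\<Union>(S ` (J \<union> K)))" using K J by (intro less.prems) auto
      also have "\<Union>(S ` (J \<union> K)) = \<Union>(S ` J) \<union> \<Union>(?S ` K)" by auto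
      also have "card \<dots> = card (\<Union>(S ` J)) + card (\<Union>(?S ` K))"
      proof (rule card_Un_disjoint)
        show "finite (\<Union>(?S ` K))" by (rule finite_subset[OF _ finK(2)]) blast
      qed (use finJ in blast)+
      also have "card (J \<union> K) = card J + card K"
        by (rule card_Un_disjoint[OF finJ(1) finK(1)]) (use K in blast)
      finally show "card K \<le> card (\<Union>(?S ` K))" using J(3) by linarith
    qed (simp_all add: less.prems(1,2))
    then obtain \<psi> where \<psi>: "inj_on \<psi> (I - J)" "\<forall>i\<in>I - J. \<psi> i \<in> ?S i" by blast
    let ?\<chi> = "\<lambda>i. if i \<in> J then \<phi> i else \<psi> i"
    have cross: "\<psi> j \<noteq> \<phi> i" if "j \<in> I - J" "i \<in> J" for i j
    proof -
      have "\<psi> j \<notin> S i" using bspec[OF \<psi>(2) that(1)] that(2) by simp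
      then show ?thesis using bspec[OF \<phi>(2) that(2)] by metis
    qed
    have "inj_on ?\<chi> I"
    proof (rule inj_onI)
      fix i j assume ij: "i \<in> I" "j \<in> I" "?\<chi> i = ?\<chi> j"
      show "i = j"
        by (cases "i \<in> J"; cases "j \<in> J")
          (use ij cross[of i j] cross[of j i] inj_onD[OF \<phi>(1)] inj_onD[OF \<psi>(1)] in simp_all)
    qed
    moreover have "\<forall>i\<in>I. ?\<chi> i \<in> S i" using \<phi> \<psi> by auto
    ultimately show ?thesis by blast
  next
    case False
    show ?thesis
    proof (cases "I = {}")
      case True
      then show ?thesis by simp
    next
      case ne: False
      then obtain i where i: "i \<in> I" by auto
      have "card {i} \<le> card (\<Union>(S ` {i}))" using i by (intro less.prems) auto
      then have "S i \<noteq> {}" by auto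
      then obtain x where x: "x \<in> S i" by auto
      let ?S = "\<lambda>j. S j - {x}"
      have "card (I - {i}) < card I" using i less.prems by (intro psubset_card_mono) auto
      then have "\<exists>\<psi>. inj_on \<psi> (I - {i}) \<and> (\<forall>j\<in>I - {i}. \<psi> j \<in> ?S j)"
      proof (rule less.hyps)
        fix K assume K: "K \<subseteq> I - {i}"
        show "card K \<le> card (\<Union>(?S ` K))"
        proof (cases "K = {}")
          case False
          have "K \<subset> I" using K i by auto
          then have "card K < card (\<Union>(S ` K))"
            using \<open>\<not> (\<exists>J. J \<noteq> {} \<and> J \<subset> I \<and> card (\<Union>(S ` J)) \<le> card J)\<close> False by (meson not_le)
          moreover have "\<Union>(?S ` K) = \<Union>(S ` K) - {x}" by auto
          moreover have "finite (\<Union>(S ` K))"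
            using K less.prems(1,2) finite_subset[of K I] by blast
          ultimately show ?thesis by (auto simp: card_Diff_singleton_if)
        qed simp
      qed (simp_all add: less.prems(1,2))
      then obtain \<psi> where \<psi>: "inj_on \<psi> (I - {i})" "\<forall>j\<in>I - {i}. \<psi> j \<in> ?S j" by blast
      have "inj_on (\<psi>(i := x)) I"
      proof (rule inj_onI)
        fix j k assume jk: "j \<in> I" "k \<in> I" "(\<psi>(i := x)) j = (\<psi>(i := x)) k"
        have "\<psi> j \<noteq> x" if "j \<in> I - {i}" for j using bspec[OF \<psi>(2) that] by simp
        then show "j = k"
          using jk inj_onD[OF \<psi>(1), of j k] by (cases "j = i"; cases "k = i") force+
      qed
      moreover have "(\<psi>(i := x)) j \<in> S j" if "j \<in> I" for j
        using that bspec[OF \<psi>(2), of j] x by (cases "j = i") auto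
      ultimately show ?thesis by blast
    qed
  qed
qed

section \<open>Expansion away from clusters\<close>

lemma graph_cycle_neighbours:
  assumes "graph_cycle E vs" "i < length vs"
  obtains j k where "j < length vs" "k < length vs" "j \<noteq> k" "{vs ! i, vs ! j} \<in> E" "{vs ! i, vs ! k} \<in> E"
proof -
  let ?l = "length vs"
  have l: "3 \<le> ?l" and edge: "\<And>i. i < ?l \<Longrightarrow> {vs ! i, vs ! ((i + 1) mod ?l)} \<in> E"
    using assms(1) by (simp_all add: graph_cycle_def)
  define j where "j = (i + 1) mod ?l"
  define k where "k = (if i = 0 then ?l - 1 else i - 1)"
  have k: "k < ?l" "(k + 1) mod ?l = i" using assms(2) l by (auto simp: k_def)
  have j: "j < ?l" unfolding j_def using l by (intro mod_less_divisor) linarith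
  have "j = (if i + 1 = ?l then 0 else i + 1)"
  proof (cases "i + 1 = ?l")
    case True
    then show ?thesis by (simp add: j_def)
  next
    case False
    then have "i + 1 < ?l" using assms(2) by simp
    then show ?thesis by (simp add: j_def)
  qed
  then have "j \<noteq> k" using l assms(2) by (auto simp: k_def split: if_splits)
  moreover have "{vs ! i, vs ! k} \<in> E" using edge[OF k(1)] unfolding k(2) by (simp only: insert_commute)
  ultimately show ?thesis using that[of j k] j k(1) edge[OF assms(2)] by (simp add: j_def)
qed

text \<open>The relation uses only edges between vertices of the cycle, so a flat cycle with all its
  vertices in a cluster stays in one component of that cluster.\<close>

lemma graph_cycle_connected:
  assumes "graph_cycle E vs" "i < length vs"
  shows "(vs ! 0, vs ! i) \<in> {(u, v). u \<in> set vs \<and> v \<in> set vs \<and> {u, v} \<in> E}\<^sup>*"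
  using assms(2)
proof (induction i)
  case (Suc i)
  have "{vs ! i, vs ! Suc i} \<in> E"
    using assms(1) Suc.prems unfolding graph_cycle_def by (metis Suc_eq_plus1 Suc_lessD mod_less)
  then have "(vs ! i, vs ! Suc i) \<in> {(u, v). u \<in> set vs \<and> v \<in> set vs \<and> {u, v} \<in> E}"
    using Suc.prems by simp
  then show ?case by (rule rtrancl.rtrancl_into_rtrancl[OF Suc.IH[OF Suc_lessD[OF Suc.prems]]])
qed (rule rtrancl.rtrancl_refl)

lemma graph_cycle_set_subset:
  assumes "graph_cycle E vs"
  shows "set vs \<subseteq> \<Union>E"
proof
  fix v assume "v \<in> set vs"
  then obtain i where "i < length vs" "v = vs ! i" by (metis in_set_conv_nth)
  then show "v \<in> \<Union>E" using assms unfolding graph_cycle_def by blast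
qed

text \<open>A breadth-first tree: every vertex other than the root \<open>a\<close> chooses a
  neighbour closer to \<open>a\<close>. It has no cycle, since at a vertex of the cycle farthest
  from \<open>a\<close> both neighbours along the cycle would have to be the chosen one.\<close>

lemma spanning_tree_exists:
  fixes F :: "'v set set"
  defines "R \<equiv> {(u, v). {u, v} \<in> F}"
  assumes fin: "finite (R\<^sup>* `` {a})"
  shows "\<exists>T\<subseteq>F. (\<forall>e\<in>T. e \<subseteq> R\<^sup>* `` {a}) \<and> card T + 1 = card (R\<^sup>* `` {a}) \<and> (\<forall>vs. \<not> graph_cycle T vs)"
proof -
  let ?K = "R\<^sup>* `` {a}"
  define d where "d u = (LEAST n. (a, u) \<in> R ^^ n)" for u
  have d: "(a, u) \<in> R ^^ d u" if "u \<in> ?K" for u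
  proof -
    have "(a, u) \<in> R\<^sup>*" using that by simp
    then have "\<exists>n. (a, u) \<in> R ^^ n" by (rule rtrancl_imp_relpow)
    then show ?thesis unfolding d_def by (rule LeastI_ex)
  qed
  have d_le: "d u \<le> n" if "(a, u) \<in> R ^^ n" for u n
    unfolding d_def by (rule Least_le) (rule that)
  have "\<exists>p. p \<in> ?K \<and> {p, u} \<in> F \<and> d p < d u" if u: "u \<in> ?K - {a}" for u
  proof -
    have du: "(a, u) \<in> R ^^ d u" using d[of u] u by blast
    have "d u \<noteq> 0"
    proof
      assume "d u = 0"
      with du have "u = a" by simp
      then show False using u by simp
    qed
    then obtain m where m: "d u = Suc m" by (cases "d u") simp_all
    obtain p where p: "(a, p) \<in> R ^^ m" "(p, u) \<in> R" using du unfolding m by (rule relpow_Suc_E)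
    have "p \<in> ?K" using relpow_imp_rtrancl[OF p(1)] by simp
    moreover have "{p, u} \<in> F" using p(2) unfolding R_def by simp
    moreover have "d p < d u" using d_le[OF p(1)] m by simp
    ultimately show ?thesis by blast
  qed
  then obtain par where par: "\<And>u. u \<in> ?K - {a} \<Longrightarrow> par u \<in> ?K" "\<And>u. u \<in> ?K - {a} \<Longrightarrow> {par u, u} \<in> F"
    "\<And>u. u \<in> ?K - {a} \<Longrightarrow> d (par u) < d u" by metis
  define T where "T = (\<lambda>u. {par u, u}) ` (?K - {a})"
  have inj: "inj_on (\<lambda>u. {par u, u}) (?K - {a})"
  proof (rule inj_onI, rule ccontr)
    fix u u' assume u: "u \<in> ?K - {a}" "u' \<in> ?K - {a}" "{par u, u} = {par u', u'}" "u \<noteq> u'"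
    then have "par u = u'" "par u' = u" by (metis doubleton_eq_iff)+
    then show False using par(3)[OF u(1)] par(3)[OF u(2)] by simp
  qed
  have "card T = card (?K - {a})" unfolding T_def by (rule card_image[OF inj])
  moreover have "card (?K - {a}) + 1 = card ?K" using card_Suc_Diff1[OF fin, of a] by simp
  ultimately have "card T + 1 = card ?K" by simp
  moreover have "T \<subseteq> F" "\<forall>e\<in>T. e \<subseteq> ?K" unfolding T_def using par(1,2) by blast+
  moreover have "\<not> graph_cycle T vs" for vs
  proof
    assume c: "graph_cycle T vs"
    obtain i where i: "i < length vs" and mx: "\<And>j. j < length vs \<Longrightarrow> d (vs ! j) \<le> d (vs ! i)"
      proof -
      have "\<exists>i. i < length vs \<and> (\<forall>j. j < length vs \<longrightarrow> d (vs ! j) \<le> d (vs ! i))"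
      proof (rule ex_has_greatest_nat)
        show "0 < length vs" using c unfolding graph_cycle_def by linarith
        show "\<forall>j<length vs. d (vs ! j) < Suc (Max ((\<lambda>j. d (vs ! j)) ` {..<length vs}))"
          by (simp add: less_Suc_eq_le)
      qed
      then show ?thesis using that by blast
    qed
    have nb: "vs ! j = par (vs ! i)" if j: "j < length vs" "{vs ! i, vs ! j} \<in> T" for j
    proof -
      obtain u where u: "u \<in> ?K - {a}" "{vs ! i, vs ! j} = {par u, u}" using j(2) by (auto simp: T_def)
      show ?thesis
      proof (cases "u = vs ! i")
        case True
        then show ?thesis using u(2) par(3)[OF u(1)] by (metis doubleton_eq_iff)
      next
        case False
        then have "vs ! i = par u" "u = vs ! j" using u(2) by (metis doubleton_eq_iff)+
        then show ?thesis using par(3)[OF u(1)] mx[OF j(1)] by simp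
      qed
    qed
    obtain j k where "j < length vs" "k < length vs" "j \<noteq> k" "{vs ! i, vs ! j} \<in> T" "{vs ! i, vs ! k} \<in> T"
      using graph_cycle_neighbours[OF c i] by blast
    moreover have "vs ! j = vs ! k" using nb calculation by metis
    moreover have "distinct vs" using c by (simp add: graph_cycle_def)
    ultimately show False by (simp add: nth_eq_iff_index_eq)
  qed
  ultimately show ?thesis by blast
qed

text \<open>What the combinatorial estimate needs to know about the complex. \<open>degree\<close>
  makes \<open>wv\<close> the stationary distribution of the random walk with edge weights
  \<open>we\<close>. \<open>mixing\<close> is the one-sided expander mixing inequality for a single
  set, and \<open>light\<close> is what thickness contributes.\<close>

locale weighted_graph =
  fixes V :: "'v set" and E :: "'v set set" and wv :: "'v \<Rightarrow> real" and we :: "'v set \<Rightarrow> real"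
    and lam \<delta> :: real
  assumes finite_V: "finite V" and edge: "e \<in> E \<Longrightarrow> e \<subseteq> V \<and> card e = 2"
    and wv_nonneg: "0 \<le> wv v" and we_nonneg: "0 \<le> we e"
    and sum_wv: "sum wv V = 1" and sum_we: "sum we E = 1"
    and degree: "v \<in> V \<Longrightarrow> (\<Sum>e | e \<in> E \<and> v \<in> e. we e) = 2 * wv v"
    and light: "e \<in> E \<Longrightarrow> v \<in> e \<Longrightarrow> we e \<le> \<delta> * wv v"
    and mixing: "S \<subseteq> V \<Longrightarrow> (\<Sum>e | e \<in> E \<and> e \<subseteq> S. we e) \<le> (sum wv S)\<^sup>2 + lam * sum wv S * (1 - sum wv S)"
    and lam: "0 \<le> lam" "lam \<le> 1" and \<delta>_nonneg: "0 \<le> \<delta>"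
begin

section \<open>Edges inside a vertex set and components of the induced graph\<close>

lemma finite_E: "finite E"
  by (rule finite_subset[of _ "Pow V"]) (use edge finite_V in auto)

definition inner :: "'v set \<Rightarrow> 'v set set" where
  "inner S = {e \<in> E. e \<subseteq> S}"

definition adj :: "'v set \<Rightarrow> 'v rel" where
  "adj S = {(u, v). {u, v} \<in> inner S}"

definition component :: "'v set \<Rightarrow> 'v \<Rightarrow> 'v set" where
  "component S a = (adj S)\<^sup>* `` {a}"

lemma wv_le_1: "S \<subseteq> V \<Longrightarrow> sum wv S \<le> 1"
  using sum_mono2[OF finite_V, of S wv] wv_nonneg sum_wv by simp

lemma wv_sum_nonneg: "0 \<le> sum wv S"
  by (intro sum_nonneg wv_nonneg)

lemma inner_weight: "S \<subseteq> V \<Longrightarrow> sum we (inner S) \<le> sum wv S * (sum wv S + lam * (1 - sum wv S))"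
  using mixing[of S] by (simp add: inner_def power2_eq_square algebra_simps)

text \<open>Since \<open>lam \<le> 1\<close>, the factor of \<open>sum wv S\<close> in the mixing
  bound increases with the weight of \<open>S\<close>. Bounding it by its value at \<beta> leaves an
  estimate that is linear in the weight and can be added up over many pieces.\<close>

lemma sum_wv_le_inner_bound:
  assumes "sum wv S \<le> \<beta>" "S \<subseteq> V"
  shows "sum we (inner S) \<le> sum wv S * (\<beta> + lam * (1 - \<beta>))"
proof -
  have "(1 - lam) * sum wv S \<le> (1 - lam) * \<beta>" using assms lam by (intro mult_left_mono) auto
  then have "sum wv S + lam * (1 - sum wv S) \<le> \<beta> + lam * (1 - \<beta>)" by (simp add: algebra_simps)
  then have "sum wv S * (sum wv S + lam * (1 - sum wv S)) \<le> sum wv S * (\<beta> + lam * (1 - \<beta>))"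
    by (intro mult_left_mono wv_sum_nonneg)
  then show ?thesis using inner_weight[OF assms(2)] by linarith
qed

lemma component_subset: "a \<in> S \<Longrightarrow> component S a \<subseteq> S"
proof
  fix x assume "a \<in> S" "x \<in> component S a"
  then have "(a, x) \<in> (adj S)\<^sup>*" by (simp add: component_def)
  then show "x \<in> S" by (induction) (use \<open>a \<in> S\<close> in \<open>auto simp: adj_def inner_def\<close>)
qed

lemma component_self: "a \<in> component S a"
  by (simp add: component_def)

lemma sym_adj: "sym (adj S)"
  by (auto simp: sym_def adj_def insert_commute)

lemma component_eq: "x \<in> component S a \<Longrightarrow> component S x = component S a"
  unfolding component_def using sym_rtrancl[OF sym_adj[of S]]
  by (auto dest: symD intro: rtrancl_trans)

lemma component_closed: "x \<in> component S a \<Longrightarrow> {x, y} \<in> inner S \<Longrightarrow> y \<in> component S a"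
  using rtrancl.rtrancl_into_rtrancl[of a x "adj S" y] by (simp add: component_def adj_def)

lemma component_tree:
  assumes "a \<in> S" "S \<subseteq> V"
  shows "\<exists>T\<subseteq>inner (component S a). card T + 1 = card (component S a) \<and> (\<forall>vs. \<not> graph_cycle T vs)"
proof -
  have fin: "finite (component S a)"
    by (rule finite_subset[OF subset_trans[OF component_subset[OF assms(1)] assms(2)] finite_V])
  have "\<exists>T\<subseteq>inner S. (\<forall>e\<in>T. e \<subseteq> component S a) \<and> card T + 1 = card (component S a) \<and>
      (\<forall>vs. \<not> graph_cycle T vs)"
    unfolding component_def adj_def
  proof (rule spanning_tree_exists)
    show "finite ({(u, v). {u, v} \<in> inner S}\<^sup>* `` {a})"
      using fin unfolding component_def adj_def .
  qed
  then obtain T where T: "T \<subseteq> inner S" "\<forall>e\<in>T. e \<subseteq> component S a" "card T + 1 = card (component S a)"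
    "\<forall>vs. \<not> graph_cycle T vs" by blast
  have "T \<subseteq> inner (component S a)" using T(1,2) by (auto simp: inner_def)
  then show ?thesis using T(3,4) by blast
qed

text \<open>Spanning trees of the pieces together with the edges outside all pieces form a graph in which
  a vertex set spans at most as many edges as it has vertices, because otherwise it would contain a
  short cycle. By Hall's theorem its edges have distinct representatives among their ends.\<close>

lemma forest_bound:
  assumes fin: "finite K" and KV: "\<And>K'. K' \<in> K \<Longrightarrow> K' \<subseteq> V"
    and tree: "\<And>K'. K' \<in> K \<Longrightarrow> \<exists>T\<subseteq>inner K'. card T + 1 = card K' \<and> (\<forall>vs. \<not> graph_cycle T vs)"
    and meet: "\<And>K1 K2 u v. K1 \<in> K \<Longrightarrow> K2 \<in> K \<Longrightarrow> K1 \<noteq> K2 \<Longrightarrow> u \<in> K1 \<inter> K2 \<Longrightarrow> v \<in> K1 \<inter> K2 \<Longrightarrow> u = v"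
    and F: "F \<subseteq> E" "\<And>K'. K' \<in> K \<Longrightarrow> inner K' \<subseteq> F"
    and short: "\<And>vs. graph_cycle F vs \<Longrightarrow> 3 * length vs \<le> 2 * (card V + 1) \<Longrightarrow> \<exists>K'\<in>K. set vs \<subseteq> K'"
    and bound: "\<And>K'. K' \<in> K \<Longrightarrow> sum wv K' \<le> \<alpha>" and \<alpha>: "0 \<le> \<alpha>" "\<alpha> \<le> 1"
  shows "sum we F \<le> \<alpha> + lam * (1 - \<alpha>) + \<delta>"
proof -
  obtain T where T: "\<And>K'. K' \<in> K \<Longrightarrow> T K' \<subseteq> inner K'" "\<And>K'. K' \<in> K \<Longrightarrow> card (T K') + 1 = card K'"
    "\<And>K' vs. K' \<in> K \<Longrightarrow> \<not> graph_cycle (T K') vs"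
    using tree by metis
  have same: "K1 = K2" if K: "K1 \<in> K" "K2 \<in> K" "e \<in> inner K1" "e \<in> inner K2" for K1 K2 e
  proof (rule ccontr)
    assume "K1 \<noteq> K2"
    obtain u v where uv: "e = {u, v}" "u \<noteq> v"
      using edge[of e] K(3) unfolding inner_def card_2_iff by blast
    have "u \<in> K1 \<inter> K2" "v \<in> K1 \<inter> K2" using K(3,4) uv(1) unfolding inner_def by blast+
    then show False using meet[OF K(1,2) \<open>K1 \<noteq> K2\<close>] uv(2) by blast
  qed
  define F0 where "F0 = F - (\<Union>K'\<in>K. inner K')"
  define D where "D = (\<Union>K'\<in>K. T K') \<union> F0"
  have DF: "D \<subseteq> F" unfolding D_def F0_def using T(1) F(2) by blast
  have finF: "finite F" by (rule finite_subset[OF F(1) finite_E])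
  have finD: "finite D" by (rule finite_subset[OF DF finF])
  have hall: "card J \<le> card (\<Union>((\<lambda>e. e) ` J))" if J: "J \<subseteq> D" for J
  proof (rule ccontr)
    assume "\<not> ?thesis"
    then have many: "card (\<Union>J) + 1 \<le> card J" by simp
    have JE: "J \<subseteq> E" using J DF F(1) by blast
    then have JV: "\<Union>J \<subseteq> V" using edge by blast
    then have finJ: "finite (\<Union>J)" by (rule finite_subset[OF _ finite_V])
    have "\<exists>vs. graph_cycle J vs \<and> 3 * length vs \<le> 2 * (card (\<Union>J) + 1)"
    proof (rule short_graph_cycle_exists[OF finJ _ many])
      show "e \<subseteq> \<Union>J \<and> card e = 2" if "e \<in> J" for e using that JE edge by blast
    qed
    then obtain vs where vs: "graph_cycle J vs" "3 * length vs \<le> 2 * (card (\<Union>J) + 1)" by blast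
    have "graph_cycle F vs" using graph_cycle_mono[OF vs(1)] J DF by blast
    moreover have "3 * length vs \<le> 2 * (card V + 1)"
      using vs(2) card_mono[OF finite_V JV] by arith
    ultimately obtain K1 where K1: "K1 \<in> K" "set vs \<subseteq> K1" using short by blast
    \<comment> \<open>All edges of the cycle lie inside the piece \<open>K1\<close>. Edges of
      \<open>J\<close> inside a piece are tree edges, and distinct pieces share no edge, so this
      would be a cycle in the tree of \<open>K1\<close>.\<close>
    have "{vs ! i, vs ! ((i + 1) mod length vs)} \<in> T K1" if i: "i < length vs" for i
    proof -
      let ?e = "{vs ! i, vs ! ((i + 1) mod length vs)}"
      have eJ: "?e \<in> J" using vs(1) i by (simp add: graph_cycle_def)
      have "(i + 1) mod length vs < length vs" using i by (intro mod_less_divisor) linarith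
      then have "?e \<subseteq> K1" using subsetD[OF K1(2) nth_mem] i by simp
      then have eK: "?e \<in> inner K1" using eJ JE unfolding inner_def by blast
      then have "?e \<notin> F0" unfolding F0_def using K1(1) by blast
      then obtain K2 where K2: "K2 \<in> K" "?e \<in> T K2" using eJ J unfolding D_def by blast
      then have "?e \<in> inner K2" using T(1) by blast
      then show ?thesis using same[OF K2(1) K1(1) _ eK] K2(2) by simp
    qed
    then have "graph_cycle (T K1) vs" using vs(1) by (simp add: graph_cycle_def)
    then show False using T(3)[OF K1(1)] by blast
  qed
  have "\<exists>\<phi>. inj_on \<phi> D \<and> (\<forall>e\<in>D. \<phi> e \<in> e)"
  proof (rule marriage[OF finD _ hall])
    show "finite e" if "e \<in> D" for e
    proof (rule finite_subset[OF _ finite_V])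
      show "e \<subseteq> V" using that DF F(1) edge[of e] by blast
    qed
  qed
  then obtain \<phi> where \<phi>: "inj_on \<phi> D" "\<And>e. e \<in> D \<Longrightarrow> \<phi> e \<in> e" by blast
  let ?c = "\<alpha> + lam * (1 - \<alpha>) + \<delta>"
  have c: "\<delta> \<le> ?c" using \<alpha> lam by (simp add: mult_nonneg_nonneg)
  have piece: "sum we (inner K1) \<le> ?c * (\<Sum>e\<in>T K1. wv (\<phi> e))" if K1: "K1 \<in> K" for K1
  proof -
    have TD: "T K1 \<subseteq> D" using K1 unfolding D_def by blast
    have injT: "inj_on \<phi> (T K1)" by (rule inj_on_subset[OF \<phi>(1) TD])
    \<comment> \<open>The representatives of the tree edges are all vertices of the piece except
      one, \<rho>. The edges avoiding \<rho> are bounded by mixing, and an edge at \<rho> is charged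
      to its other end, so the weight of all edges of the piece is paid for by the
      representatives.\<close>
    define B where "B = \<phi> ` T K1"
    have BK: "B \<subseteq> K1" unfolding B_def using \<phi>(2) TD T(1)[OF K1] unfolding inner_def by blast
    have finK1: "finite K1" by (rule finite_subset[OF KV[OF K1] finite_V])
    have "card B + 1 = card K1" unfolding B_def using card_image[OF injT] T(2)[OF K1] by simp
    then have "card (K1 - B) = 1" using card_Diff_subset[OF finite_subset[OF BK finK1] BK] by simp
    then obtain \<rho> where "K1 - B = {\<rho>}" by (auto simp: card_1_singleton_iff)
    then have \<rho>: "K1 = insert \<rho> B" "\<rho> \<notin> B" using BK by blast+
    have finB: "finite B" using finite_subset[OF BK finK1] .
    define B' where "B' = {v \<in> B. {v, \<rho>} \<in> E}"
    have "inner K1 \<subseteq> inner B \<union> (\<lambda>v. {v, \<rho>}) ` B'"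
    proof
      fix e assume e: "e \<in> inner K1"
      then obtain u v where uv: "e = {u, v}" "u \<noteq> v"
        using edge[of e] unfolding inner_def card_2_iff by blast
      have eE: "e \<in> E" "u \<in> insert \<rho> B" "v \<in> insert \<rho> B" using e uv \<rho>(1) unfolding inner_def by blast+
      consider "u \<in> B" "v \<in> B" | "u = \<rho>" "v \<in> B" | "v = \<rho>" "u \<in> B" using eE uv by blast
      then show "e \<in> inner B \<union> (\<lambda>v. {v, \<rho>}) ` B'"
      proof cases
        case 1
        then show ?thesis using eE uv unfolding inner_def by blast
      next
        case 2
        then have "e = {v, \<rho>}" using uv by blast
        then show ?thesis using eE(1) 2 unfolding B'_def by blast
      next
        case 3
        then show ?thesis using eE(1) uv(1) unfolding B'_def by blast
      qed
    qed
    then have "sum we (inner K1) \<le> sum we (inner B \<union> (\<lambda>v. {v, \<rho>}) ` B')"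
      by (intro sum_mono2) (use finB we_nonneg finite_E in \<open>auto simp: inner_def B'_def\<close>)
    also have "\<dots> \<le> sum we (inner B) + sum we ((\<lambda>v. {v, \<rho>}) ` B')"
      using sum.union_inter[of "inner B" "(\<lambda>v. {v, \<rho>}) ` B'" we] finB finite_E
        sum_nonneg[of "inner B \<inter> (\<lambda>v. {v, \<rho>}) ` B'" we] we_nonneg
      by (simp add: inner_def B'_def)
    also have "sum we (inner B) \<le> sum wv B * (\<alpha> + lam * (1 - \<alpha>))"
    proof (rule sum_wv_le_inner_bound)
      show "sum wv B \<le> \<alpha>"
        using sum_mono2[OF finK1 BK, of wv] wv_nonneg bound[OF K1] by fastforce
      show "B \<subseteq> V" using BK KV[OF K1] by blast
    qed
    also have "sum we ((\<lambda>v. {v, \<rho>}) ` B') \<le> (\<Sum>v\<in>B'. \<delta> * wv v)"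
    proof -
      have "inj_on (\<lambda>v. {v, \<rho>}) B'"
        by (rule inj_onI) (metis doubleton_eq_iff)
      then have "sum we ((\<lambda>v. {v, \<rho>}) ` B') = (\<Sum>v\<in>B'. we {v, \<rho>})" by (simp add: sum.reindex)
      also have "\<dots> \<le> (\<Sum>v\<in>B'. \<delta> * wv v)" by (intro sum_mono light) (auto simp: B'_def)
      finally show ?thesis .
    qed
    also have "(\<Sum>v\<in>B'. \<delta> * wv v) \<le> (\<Sum>v\<in>B. \<delta> * wv v)"
      by (intro sum_mono2 finB) (use wv_nonneg \<delta>_nonneg in \<open>auto simp: B'_def\<close>)
    finally have "sum we (inner K1) \<le> ?c * sum wv B"
      by (simp add: sum_distrib_left[symmetric] algebra_simps)
    moreover have "sum wv B = (\<Sum>e\<in>T K1. wv (\<phi> e))" unfolding B_def by (simp add: sum.reindex[OF injT])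
    ultimately show ?thesis by simp
  qed
  have rest: "sum we F0 \<le> ?c * (\<Sum>e\<in>F0. wv (\<phi> e))"
  proof -
    have "we e \<le> ?c * wv (\<phi> e)" if "e \<in> F0" for e
    proof -
      have "e \<in> D" using that unfolding D_def by blast
      then have "we e \<le> \<delta> * wv (\<phi> e)" using light[of e "\<phi> e"] \<phi>(2) DF F(1) by blast
      also have "\<dots> \<le> ?c * wv (\<phi> e)" by (intro mult_right_mono c wv_nonneg)
      finally show ?thesis .
    qed
    then show ?thesis by (simp add: sum_distrib_left sum_mono)
  qed
  have finT: "finite (T K')" if "K' \<in> K" for K'
  proof (rule finite_subset[OF _ finD])
    show "T K' \<subseteq> D" using that unfolding D_def by blast
  qed
  have finF0: "finite F0" unfolding F0_def using finF by blast
  have "F \<subseteq> (\<Union>K'\<in>K. inner K') \<union> F0" unfolding F0_def by blast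
  then have "sum we F \<le> sum we ((\<Union>K'\<in>K. inner K') \<union> F0)"
    by (intro sum_mono2) (use fin finF0 finite_E we_nonneg in \<open>auto simp: inner_def\<close>)
  also have "\<dots> = sum we (\<Union>K'\<in>K. inner K') + sum we F0"
    by (intro sum.union_disjoint) (use fin finF0 finite_E in \<open>auto simp: inner_def F0_def\<close>)
  also have "sum we (\<Union>K'\<in>K. inner K') = (\<Sum>K'\<in>K. sum we (inner K'))"
  proof (rule sum.UNION_disjoint[OF fin])
    show "\<forall>K'\<in>K. finite (inner K')" using finite_E unfolding inner_def by simp
    show "\<forall>K1\<in>K. \<forall>K2\<in>K. K1 \<noteq> K2 \<longrightarrow> inner K1 \<inter> inner K2 = {}" using same by blast
  qed
  also have "\<dots> + sum we F0 \<le> (\<Sum>K'\<in>K. ?c * (\<Sum>e\<in>T K'. wv (\<phi> e))) + ?c * (\<Sum>e\<in>F0. wv (\<phi> e))"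
    by (intro add_mono sum_mono piece rest)
  also have "\<dots> = ?c * ((\<Sum>K'\<in>K. \<Sum>e\<in>T K'. wv (\<phi> e)) + (\<Sum>e\<in>F0. wv (\<phi> e)))"
    by (simp only: sum_distrib_left distrib_left)
  also have "(\<Sum>K'\<in>K. \<Sum>e\<in>T K'. wv (\<phi> e)) = (\<Sum>e\<in>(\<Union>K'\<in>K. T K'). wv (\<phi> e))"
  proof (rule sum.UNION_disjoint[symmetric, OF fin])
    show "\<forall>K'\<in>K. finite (T K')" using finT by blast
    show "\<forall>K1\<in>K. \<forall>K2\<in>K. K1 \<noteq> K2 \<longrightarrow> T K1 \<inter> T K2 = {}" using same T(1) by blast
  qed
  also have "\<dots> + (\<Sum>e\<in>F0. wv (\<phi> e)) = (\<Sum>e\<in>D. wv (\<phi> e))"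
    unfolding D_def
  proof (rule sum.union_disjoint[symmetric])
    show "finite (\<Union>K'\<in>K. T K')" using fin finT by blast
    show "(\<Union>K'\<in>K. T K') \<inter> F0 = {}" unfolding F0_def using T(1) by blast
  qed (rule finF0)
  also have "\<dots> = sum wv (\<phi> ` D)" using \<phi>(1) by (simp add: sum.reindex)
  \<comment> \<open>Different edges have different representatives, so no vertex is charged twice
    and the total charge is at most the total weight 1.\<close>
  also have "?c * sum wv (\<phi> ` D) \<le> ?c * 1"
  proof (rule mult_left_mono)
    have "\<phi> ` D \<subseteq> V" using \<phi>(2) DF F(1) edge by blast
    then show "sum wv (\<phi> ` D) \<le> 1" by (rule wv_le_1)
    show "0 \<le> ?c" using c \<delta>_nonneg by linarith
  qed
  finally show ?thesis by simp
qed

end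

section \<open>The case of a heavy cluster, and the expansion estimate\<close>

lemma sum_UN_le:
  fixes f :: "'a \<Rightarrow> real"
  assumes "finite I" "\<And>i. i \<in> I \<Longrightarrow> finite (A i)" "\<And>x. 0 \<le> f x"
  shows "sum f (\<Union>i\<in>I. A i) \<le> (\<Sum>i\<in>I. sum f (A i))"
  using assms(1,2)
proof (induction rule: finite_induct)
  case (insert i I)
  have "sum f (A i \<union> (\<Union>i\<in>I. A i)) + sum f (A i \<inter> (\<Union>i\<in>I. A i)) = sum f (A i) + sum f (\<Union>i\<in>I. A i)"
    using insert.prems insert.hyps(1) by (intro sum.union_inter) simp_all
  moreover have "0 \<le> sum f (A i \<inter> (\<Union>i\<in>I. A i))" by (intro sum_nonneg assms(3))
  moreover have "sum f (\<Union>i\<in>I. A i) \<le> (\<Sum>i\<in>I. sum f (A i))" using insert.prems by (intro insert.IH) simp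
  ultimately show ?case using insert.hyps by simp
qed simp

context weighted_graph
begin

text \<open>A vertex outside \<open>A\<close> is joined by at most two edges of \<open>F\<close> to the heaviest component of
  \<open>A\<close>: a third edge would produce a short cycle leaving \<open>A\<close>.\<close>

lemma large_cluster_bound:
  assumes F: "F \<subseteq> E" and A: "A \<subseteq> V" "inner A \<subseteq> F" "2 / 3 \<le> sum wv A"
    and short: "\<And>vs u v. graph_cycle F vs \<Longrightarrow> 3 * length vs \<le> 2 * (card V + 1) \<Longrightarrow>
       u \<in> set vs \<inter> A \<Longrightarrow> v \<in> set vs \<inter> A \<Longrightarrow> u \<noteq> v \<Longrightarrow> set vs \<subseteq> A"
  shows "(1 - 2 * lam - 2 * \<delta>) * (1 - sum wv A) \<le> sum we (E - F)"
proof -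
  let ?\<alpha> = "sum wv A"
  have finA: "finite A" by (rule finite_subset[OF A(1) finite_V])
  have \<alpha>1: "?\<alpha> \<le> 1" by (rule wv_le_1[OF A(1)])
  have "A \<noteq> {}" using A(3) by auto
  then have "Max ((\<lambda>a. sum wv (component A a)) ` A) \<in> (\<lambda>a. sum wv (component A a)) ` A"
    using finA by (intro Max_in) simp_all
  then obtain a where a: "a \<in> A" "Max ((\<lambda>a. sum wv (component A a)) ` A) = sum wv (component A a)" by blast
  have a_max: "sum wv (component A b) \<le> sum wv (component A a)" if "b \<in> A" for b
    unfolding a(2)[symmetric] using that finA by (intro Max_ge) simp_all
  define B where "B = component A a"
  let ?\<beta> = "sum wv B"
  have BA: "B \<subseteq> A" unfolding B_def by (rule component_subset[OF a(1)])
  have BV: "B \<subseteq> V" using BA A(1) by (rule subset_trans)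
  have finB: "finite B" by (rule finite_subset[OF BV finite_V])
  have \<beta>1: "?\<beta> \<le> ?\<alpha>" using sum_mono2[OF finA BA, of wv] wv_nonneg by simp
  let ?C = "component A ` A"
  have C_sub: "K \<subseteq> A" if "K \<in> ?C" for K using that component_subset by auto
  have C_disj: "K = K'" if K: "K \<in> ?C" "K' \<in> ?C" "x \<in> K" "x \<in> K'" for K K' x
  proof -
    obtain a b where "K = component A a" "K' = component A b" using K(1,2) by blast
    then show ?thesis using component_eq[of x A a] component_eq[of x A b] K(3,4) by simp
  qed
  have finC: "finite K" if "K \<in> ?C" for K by (rule finite_subset[OF C_sub[OF that] finA])
  have UC: "\<Union>?C = A"
  proof (intro equalityI subsetI)
    fix x assume "x \<in> A"
    then show "x \<in> \<Union>?C" using component_self[of x A] by (intro UnionI[of "component A x"]) simp_all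
  qed (use C_sub in blast)
  have "sum we (inner A) \<le> (\<Sum>K\<in>?C. sum we (inner K))"
  proof -
    have "e \<in> (\<Union>K\<in>?C. inner K)" if e: "e \<in> inner A" for e
    proof -
      obtain u v where uv: "e = {u, v}" using e edge[of e] unfolding inner_def card_2_iff by blast
      have "u \<in> A" using e uv unfolding inner_def by blast
      moreover have "v \<in> component A u" using component_closed[OF component_self, of u v A] e uv by simp
      then have "e \<in> inner (component A u)" using e uv component_self[of u A] unfolding inner_def by simp
      ultimately show ?thesis by blast
    qed
    then have "sum we (inner A) \<le> sum we (\<Union>K\<in>?C. inner K)"
      by (intro sum_mono2) (use finA finite_E we_nonneg in \<open>auto simp: inner_def\<close>)
    also have "\<dots> = (\<Sum>K\<in>?C. sum we (inner K))"
    proof (rule sum.UNION_disjoint)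
      show "\<forall>K1\<in>?C. \<forall>K2\<in>?C. K1 \<noteq> K2 \<longrightarrow> inner K1 \<inter> inner K2 = {}"
      proof (intro ballI impI)
        fix K1 K2 assume K: "K1 \<in> ?C" "K2 \<in> ?C" "K1 \<noteq> K2"
        have "e \<notin> inner K2" if e: "e \<in> inner K1" for e
        proof
          assume e2: "e \<in> inner K2"
          obtain u v where uv: "e = {u, v}" using e edge[of e] unfolding inner_def card_2_iff by blast
          then have "u \<in> K1" "u \<in> K2" using e e2 unfolding inner_def by blast+
          then show False using C_disj[OF K(1,2)] K(3) by blast
        qed
        then show "inner K1 \<inter> inner K2 = {}" by blast
      qed
    qed (use finA finite_E in \<open>auto simp: inner_def\<close>)
    finally show ?thesis .
  qed
  also have "\<dots> \<le> (\<Sum>K\<in>?C. sum wv K * (?\<beta> + lam * (1 - ?\<beta>)))"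
  proof (rule sum_mono)
    fix K assume K: "K \<in> ?C"
    show "sum we (inner K) \<le> sum wv K * (?\<beta> + lam * (1 - ?\<beta>))"
    proof (rule sum_wv_le_inner_bound)
      show "sum wv K \<le> ?\<beta>" using K a_max unfolding B_def by blast
      show "K \<subseteq> V" using C_sub[OF K] A(1) by blast
    qed
  qed
  also have "\<dots> = (\<Sum>K\<in>?C. sum wv K) * (?\<beta> + lam * (1 - ?\<beta>))" by (simp add: sum_distrib_right)
  also have "(\<Sum>K\<in>?C. sum wv K) = sum wv (\<Union>?C)"
  proof (rule sum.Union_disjoint[unfolded comp_def, symmetric])
    show "\<forall>K\<in>?C. finite K" using finC by blast
    show "\<forall>K1\<in>?C. \<forall>K2\<in>?C. K1 \<noteq> K2 \<longrightarrow> K1 \<inter> K2 = {}" using C_disj by blast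
  qed
  also have "\<dots> = ?\<alpha>" unfolding UC ..
  finally have upper: "sum we (inner A) \<le> ?\<alpha> * (?\<beta> + lam * (1 - ?\<beta>))" .
  \<comment> \<open>An edge not inside \<open>A\<close> has an end outside \<open>A\<close>, and the
    degrees there add up to \<open>2 * (1 - sum wv A)\<close>.\<close>
  have lower: "2 * ?\<alpha> - 1 \<le> sum we (inner A)"
  proof -
    have "E - inner A \<subseteq> (\<Union>v\<in>V - A. {e. e \<in> E \<and> v \<in> e})"
      using edge unfolding inner_def by blast
    then have "sum we (E - inner A) \<le> sum we (\<Union>v\<in>V - A. {e. e \<in> E \<and> v \<in> e})"
      by (intro sum_mono2) (use finite_V finite_E we_nonneg in auto)
    also have "\<dots> \<le> (\<Sum>v\<in>V - A. sum we {e. e \<in> E \<and> v \<in> e})"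
      by (rule sum_UN_le) (use finite_V finite_E we_nonneg in auto)
    also have "\<dots> = (\<Sum>v\<in>V - A. 2 * wv v)" by (intro sum.cong HOL.refl degree) simp
    also have "\<dots> = 2 * (1 - ?\<alpha>)"
      using sum_diff[OF finite_V A(1), of wv] sum_wv by (simp add: sum_distrib_left[symmetric])
    finally have "sum we (E - inner A) \<le> 2 - 2 * ?\<alpha>" by simp
    moreover have "sum we (E - inner A) = 1 - sum we (inner A)"
      using sum_diff[OF finite_E, of "inner A" we] sum_we unfolding inner_def by simp
    ultimately show ?thesis by linarith
  qed
  \<comment> \<open>Here 2/3 has its origin: with \<alpha> the weight of \<open>A\<close>, the
    inequality \<open>2 * \<alpha> - 1 \<ge> \<alpha> / 2\<close> holds exactly for
    \<open>\<alpha> \<ge> 2 / 3\<close>.\<close>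
  have half: "1 / 2 \<le> ?\<beta> + lam * (1 - ?\<beta>)"
  proof -
    have "?\<alpha> * (1 / 2) \<le> ?\<alpha> * (?\<beta> + lam * (1 - ?\<beta>))" using upper lower A(3) by linarith
    then show ?thesis using A(3) by (simp add: mult_le_cancel_left)
  qed
  define X where "X = {e \<in> E. e \<inter> B \<noteq> {} \<and> \<not> e \<subseteq> B}"
  \<comment> \<open>The degrees of the vertices of \<open>B\<close> count an edge inside
    \<open>B\<close> twice and an edge leaving \<open>B\<close> once.\<close>
  have cross: "sum we X = 2 * ?\<beta> - 2 * sum we (inner B)"
  proof -
    have "2 * ?\<beta> = (\<Sum>v\<in>B. \<Sum>e | e \<in> E \<and> v \<in> e. we e)"
      unfolding sum_distrib_left by (intro sum.cong HOL.refl degree[symmetric]) (use BV in blast)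
    also have "\<dots> = (\<Sum>e\<in>E. \<Sum>v | v \<in> B \<and> v \<in> e. we e)"
      using sum.swap_restrict[OF finB finite_E, of "\<lambda>v e. we e" "\<lambda>v e. v \<in> e"] by simp
    also have "\<dots> = (\<Sum>e\<in>E. of_nat (card (B \<inter> e)) * we e)"
      by (intro sum.cong HOL.refl) (simp add: Int_def)
    also have "\<dots> = (\<Sum>e\<in>E. (if e \<in> X then we e else 0) + 2 * (if e \<in> inner B then we e else 0))"
    proof (intro sum.cong HOL.refl)
      fix e assume e: "e \<in> E"
      then obtain u v where uv: "e = {u, v}" "u \<noteq> v" using edge[of e] unfolding card_2_iff by blast
      show "of_nat (card (B \<inter> e)) * we e = (if e \<in> X then we e else 0) + 2 * (if e \<in> inner B then we e else 0)"
        using e uv(2) unfolding uv(1) X_def inner_def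
        by (cases "u \<in> B"; cases "v \<in> B") (simp_all add: Int_insert_right)
    qed
    also have "\<dots> = sum we X + 2 * sum we (inner B)"
      unfolding sum.distrib sum_distrib_left[symmetric]
      using finite_E by (simp add: sum.If_cases X_def inner_def Int_def conj_commute)
    finally show ?thesis by simp
  qed
  have few: "card {b \<in> B. {b, v} \<in> F} \<le> 2" if v: "v \<in> V - A" for v
  proof (rule ccontr)
    assume "\<not> ?thesis"
    then have "3 \<le> card {b \<in> B. {b, v} \<in> F}" by simp
    then obtain N where N: "N \<subseteq> {b \<in> B. {b, v} \<in> F}" "card N = 3" by (meson obtain_subset_with_card_n)
    obtain T where T: "T \<subseteq> inner B" "card T + 1 = card B" "\<forall>vs. \<not> graph_cycle T vs"
      using component_tree[OF a(1) A(1)] unfolding B_def by blast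
    \<comment> \<open>A spanning tree of \<open>B\<close> and three edges to \<open>v\<close> are
      \<open>card B + 2\<close> edges on \<open>card B + 1\<close> vertices, just enough for a short
      cycle.\<close>
    let ?J = "T \<union> (\<lambda>b. {b, v}) ` N"
    have vB: "v \<notin> B" using v BA by blast
    have finN: "finite N" using N(2) card.infinite by fastforce
    have finT: "finite T" by (rule finite_subset[OF T(1)]) (simp add: inner_def finite_E)
    have "card ?J = card T + card ((\<lambda>b. {b, v}) ` N)"
    proof (rule card_Un_disjoint[OF finT])
      show "T \<inter> (\<lambda>b. {b, v}) ` N = {}" using T(1) vB unfolding inner_def by blast
    qed (simp add: finN)
    also have "card ((\<lambda>b. {b, v}) ` N) = 3"
      using N(2) by (subst card_image) (auto simp: inj_on_def doubleton_eq_iff)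
    finally have "card (insert v B) + 1 \<le> card ?J" using T(2) vB finB by simp
    moreover have JE: "?J \<subseteq> E" using T(1) N(1) F unfolding inner_def by blast
    moreover have "\<Union>?J \<subseteq> insert v B" using T(1) N(1) unfolding inner_def by blast
    ultimately have "\<exists>vs. graph_cycle ?J vs \<and> 3 * length vs \<le> 2 * (card (insert v B) + 1)"
      by (intro short_graph_cycle_exists) (use edge finB in auto)
    then obtain vs where vs: "graph_cycle ?J vs" "3 * length vs \<le> 2 * (card (insert v B) + 1)" by blast
    have JF: "?J \<subseteq> F" using T(1) N(1) A(2) BA unfolding inner_def by blast
    have vsJ: "set vs \<subseteq> insert v B"
      using graph_cycle_set_subset[OF vs(1)] \<open>\<Union>?J \<subseteq> insert v B\<close> by (rule subset_trans)
    \<comment> \<open>At least two vertices of the cycle lie in \<open>B\<close>, hence in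
      \<open>A\<close>, so \<open>short\<close> puts the whole cycle into \<open>A\<close>. It then
      avoids \<open>v\<close> and would be a cycle of the tree.\<close>
    have "card (set vs - {v}) \<ge> 2"
    proof -
      have "card (set vs) \<ge> 3" using vs(1) by (simp add: graph_cycle_def distinct_card)
      then show ?thesis using card_Diff_singleton_if[of "set vs" v] by (simp split: if_splits)
    qed
    then obtain P where P: "P \<subseteq> set vs - {v}" "card P = 2" by (meson obtain_subset_with_card_n)
    then obtain x y where xy: "x \<in> set vs - {v}" "y \<in> set vs - {v}" "x \<noteq> y" unfolding card_2_iff by blast
    have "set vs \<subseteq> A"
    proof (rule short)
      show "graph_cycle F vs" by (rule graph_cycle_mono[OF vs(1) JF])
      have "card (insert v B) \<le> card V" by (rule card_mono[OF finite_V]) (use v BV in blast)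
      then show "3 * length vs \<le> 2 * (card V + 1)" using vs(2) by arith
      show "x \<in> set vs \<inter> A" "y \<in> set vs \<inter> A" using xy vsJ BA by blast+
    qed (rule xy(3))
    then have "v \<notin> set vs" using v by blast
    have "graph_cycle T vs"
      unfolding graph_cycle_def
    proof (intro conjI allI impI)
      fix i assume i: "i < length vs"
      let ?e = "{vs ! i, vs ! ((i + 1) mod length vs)}"
      have "(i + 1) mod length vs < length vs" using i by (intro mod_less_divisor) linarith
      then have "?e \<subseteq> set vs" using i by simp
      then have "v \<notin> ?e" using \<open>v \<notin> set vs\<close> by blast
      moreover have "?e \<in> ?J" using vs(1) i unfolding graph_cycle_def by blast
      ultimately show "?e \<in> T" by blast
    qed (use vs(1) in \<open>simp_all add: graph_cycle_def\<close>)
    then show False using T(3) by blast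
  qed
  have crossF: "sum we (X \<inter> F) \<le> 2 * \<delta> * (1 - ?\<alpha>)"
  proof -
    have "X \<inter> F \<subseteq> (\<Union>v\<in>V - A. (\<lambda>b. {b, v}) ` {b \<in> B. {b, v} \<in> F})"
    proof
      fix e assume e: "e \<in> X \<inter> F"
      then have "e \<in> E" "e \<inter> B \<noteq> {}" "\<not> e \<subseteq> B" unfolding X_def by blast+
      then obtain b v where bv: "e = {b, v}" "b \<in> B" "v \<notin> B"
        using edge[of e] unfolding card_2_iff by blast
      \<comment> \<open>An edge from \<open>B\<close> to another vertex of \<open>A\<close> would
        stay inside the component \<open>B\<close>.\<close>
      have "v \<notin> A"
      proof
        assume "v \<in> A"
        then have "{b, v} \<in> inner A" using bv \<open>e \<in> E\<close> BA unfolding inner_def by blast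
        then have "v \<in> B" using component_closed[of b A a v] bv(2) unfolding B_def by blast
        then show False using bv(3) by blast
      qed
      moreover have "v \<in> V" using edge[OF \<open>e \<in> E\<close>] bv by blast
      ultimately show "e \<in> (\<Union>v\<in>V - A. (\<lambda>b. {b, v}) ` {b \<in> B. {b, v} \<in> F})"
        using e bv by blast
    qed
    then have "sum we (X \<inter> F) \<le> sum we (\<Union>v\<in>V - A. (\<lambda>b. {b, v}) ` {b \<in> B. {b, v} \<in> F})"
      by (intro sum_mono2) (use finite_V finB we_nonneg in auto)
    also have "\<dots> \<le> (\<Sum>v\<in>V - A. sum we ((\<lambda>b. {b, v}) ` {b \<in> B. {b, v} \<in> F}))"
      by (rule sum_UN_le) (use finite_V finB we_nonneg in auto)
    also have "\<dots> \<le> (\<Sum>v\<in>V - A. 2 * \<delta> * wv v)"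
    proof (rule sum_mono)
      fix v assume v: "v \<in> V - A"
      let ?N = "{b \<in> B. {b, v} \<in> F}"
      have "sum we ((\<lambda>b. {b, v}) ` ?N) \<le> of_nat (card ((\<lambda>b. {b, v}) ` ?N)) * (\<delta> * wv v)"
        by (rule sum_bounded_above) (use F light in blast)
      also have "\<dots> \<le> 2 * (\<delta> * wv v)"
      proof (rule mult_right_mono)
        have "card ((\<lambda>b. {b, v}) ` ?N) \<le> 2"
          using card_image_le[of ?N "\<lambda>b. {b, v}"] few[OF v] finB by simp
        then show "of_nat (card ((\<lambda>b. {b, v}) ` ?N)) \<le> (2 :: real)" by simp
      qed (simp add: \<delta>_nonneg wv_nonneg)
      finally show "sum we ((\<lambda>b. {b, v}) ` ?N) \<le> 2 * \<delta> * wv v" by simp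
    qed
    also have "\<dots> = 2 * \<delta> * (1 - ?\<alpha>)"
      using sum_diff[OF finite_V A(1), of wv] sum_wv by (simp add: sum_distrib_left[symmetric])
    finally show ?thesis .
  qed
  have "sum we X \<le> sum we (E - F) + sum we (X \<inter> F)"
  proof -
    have "sum we X = sum we (X - F) + sum we (X \<inter> F)"
      using sum.Int_Diff[of X we F] finite_E unfolding X_def by simp
    moreover have "sum we (X - F) \<le> sum we (E - F)"
      by (intro sum_mono2) (use finite_E we_nonneg in \<open>auto simp: X_def\<close>)
    ultimately show ?thesis by linarith
  qed
  then have "2 * ?\<beta> - 2 * sum we (inner B) - 2 * \<delta> * (1 - ?\<alpha>) \<le> sum we (E - F)"
    using crossF cross by linarith
  moreover have "sum we (inner B) \<le> ?\<beta> * (?\<beta> + lam * (1 - ?\<beta>))" by (rule inner_weight[OF BV])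
  moreover have "2 * ?\<beta> - 2 * (?\<beta> * (?\<beta> + lam * (1 - ?\<beta>))) = (2 * (?\<beta> * (1 - lam))) * (1 - ?\<beta>)"
    by (simp add: algebra_simps)
  \<comment> \<open>\<open>half\<close> rearranges to
    \<open>1 - 2 * lam \<le> 2 * (?\<beta> * (1 - lam))\<close>.\<close>
  moreover have "(1 - 2 * lam) * (1 - ?\<beta>) \<le> (2 * (?\<beta> * (1 - lam))) * (1 - ?\<beta>)"
    using half \<beta>1 \<alpha>1 by (intro mult_right_mono) (simp_all add: algebra_simps)
  ultimately have *: "(1 - 2 * lam) * (1 - ?\<beta>) - 2 * \<delta> * (1 - ?\<alpha>) \<le> sum we (E - F)" by linarith
  \<comment> \<open>Replacing \<beta> by the larger \<alpha> weakens the estimate only if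
    \<open>1 - 2 * lam\<close> is nonnegative. Otherwise the left side of the claim is
    nonpositive.\<close>
  show ?thesis
  proof (cases "2 * lam \<le> 1")
    case True
    then have "(1 - 2 * lam) * (1 - ?\<alpha>) \<le> (1 - 2 * lam) * (1 - ?\<beta>)"
      using \<beta>1 by (intro mult_left_mono) auto
    then show ?thesis using * by (simp add: algebra_simps)
  next
    case False
    then have "(1 - 2 * lam - 2 * \<delta>) * (1 - ?\<alpha>) \<le> 0"
      using \<alpha>1 \<delta>_nonneg by (intro mult_nonpos_nonneg) auto
    also have "0 \<le> sum we (E - F)" by (intro sum_nonneg we_nonneg)
    finally show ?thesis .
  qed
qed

theorem cluster_expansion:
  assumes F: "F \<subseteq> E" and fin: "finite \<A>"
    and \<A>: "\<And>A. A \<in> \<A> \<Longrightarrow> A \<subseteq> V" "\<And>A. A \<in> \<A> \<Longrightarrow> inner A \<subseteq> F"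
    and meet: "\<And>A B u v. A \<in> \<A> \<Longrightarrow> B \<in> \<A> \<Longrightarrow> A \<noteq> B \<Longrightarrow> u \<in> A \<inter> B \<Longrightarrow> v \<in> A \<inter> B \<Longrightarrow> u = v"
    and short: "\<And>vs. graph_cycle F vs \<Longrightarrow> 3 * length vs \<le> 2 * (card V + 1) \<Longrightarrow> \<exists>A\<in>\<A>. set vs \<subseteq> A"
    and M: "M \<in> \<A>" "\<And>A. A \<in> \<A> \<Longrightarrow> sum wv A \<le> sum wv M"
  shows "(1 - 2 * lam - 3 * \<delta>) * (1 - sum wv M) \<le> sum we (E - F)"
proof -
  let ?\<alpha> = "sum wv M"
  have \<alpha>: "0 \<le> ?\<alpha>" "?\<alpha> \<le> 1" using wv_sum_nonneg wv_le_1[OF \<A>(1)[OF M(1)]] by simp_all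
  show ?thesis
  proof (cases "2 / 3 \<le> ?\<alpha>")
    case True
    have "(1 - 2 * lam - 2 * \<delta>) * (1 - ?\<alpha>) \<le> sum we (E - F)"
    proof (rule large_cluster_bound[OF F \<A>(1)[OF M(1)] \<A>(2)[OF M(1)] True])
      fix vs u v
      assume vs: "graph_cycle F vs" "3 * length vs \<le> 2 * (card V + 1)"
        and uv: "u \<in> set vs \<inter> M" "v \<in> set vs \<inter> M" "u \<noteq> v"
      obtain A where A: "A \<in> \<A>" "set vs \<subseteq> A" using short[OF vs] by blast
      have "A = M" using meet[OF A(1) M(1), of u v] A(2) uv by blast
      then show "set vs \<subseteq> M" using A(2) by simp
    qed
    moreover have "\<delta> * (1 - ?\<alpha>) \<ge> 0" using \<alpha> \<delta>_nonneg by simp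
    ultimately show ?thesis by (simp add: algebra_simps)
  next
    case False
    \<comment> \<open>Pieces must be connected to have spanning trees, so each cluster is replaced
      by its components. Short flat cycles are connected and still lie in one piece.\<close>
    let ?K = "\<Union>A\<in>\<A>. component A ` A"
    have "sum we F \<le> ?\<alpha> + lam * (1 - ?\<alpha>) + \<delta>"
    proof (rule forest_bound[where K = ?K])
      have "finite A" if "A \<in> \<A>" for A by (rule finite_subset[OF \<A>(1)[OF that] finite_V])
      then show "finite ?K" using fin by simp
      show "K \<subseteq> V" if K: "K \<in> ?K" for K
      proof -
        obtain A a where Aa: "A \<in> \<A>" "a \<in> A" "K = component A a" using K by blast
        show ?thesis using component_subset[OF Aa(2)] \<A>(1)[OF Aa(1)] Aa(3) by simp
      qed
      show "\<exists>T\<subseteq>inner K. card T + 1 = card K \<and> (\<forall>vs. \<not> graph_cycle T vs)" if K: "K \<in> ?K" for K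
      proof -
        obtain A a where Aa: "A \<in> \<A>" "a \<in> A" "K = component A a" using K by blast
        show ?thesis unfolding Aa(3) by (rule component_tree[OF Aa(2) \<A>(1)[OF Aa(1)]])
      qed
      show "inner K \<subseteq> F" if K: "K \<in> ?K" for K
      proof -
        obtain A a where Aa: "A \<in> \<A>" "a \<in> A" "K = component A a" using K by blast
        have "K \<subseteq> A" using component_subset[OF Aa(2)] Aa(3) by simp
        then have "inner K \<subseteq> inner A" unfolding inner_def by blast
        then show ?thesis using \<A>(2)[OF Aa(1)] by blast
      qed
      show "sum wv K \<le> ?\<alpha>" if K: "K \<in> ?K" for K
      proof -
        obtain A a where Aa: "A \<in> \<A>" "a \<in> A" "K = component A a" using K by blast
        have "sum wv K \<le> sum wv A"
          using component_subset[OF Aa(2)] Aa(3) finite_subset[OF \<A>(1)[OF Aa(1)] finite_V] wv_nonneg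
          by (intro sum_mono2) auto
        then show ?thesis using M(2)[OF Aa(1)] by linarith
      qed
      show "u = v" if K: "K1 \<in> ?K" "K2 \<in> ?K" "K1 \<noteq> K2" "u \<in> K1 \<inter> K2" "v \<in> K1 \<inter> K2" for K1 K2 u v
      proof -
        obtain A a where A: "A \<in> \<A>" "a \<in> A" "K1 = component A a" using K(1) by blast
        obtain B b where B: "B \<in> \<A>" "b \<in> B" "K2 = component B b" using K(2) by blast
        have sub: "K1 \<subseteq> A" "K2 \<subseteq> B" using component_subset A B by blast+
        have "A \<noteq> B"
        proof
          assume "A = B"
          then have "K1 = K2" using component_eq[of u A a] component_eq[of u B b] K(4) A(3) B(3) by simp
          then show False using K(3) by simp
        qed
        then show ?thesis using meet[OF A(1) B(1)] sub K(4,5) by blast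
      qed
      show "\<exists>K\<in>?K. set vs \<subseteq> K" if vs: "graph_cycle F vs" "3 * length vs \<le> 2 * (card V + 1)" for vs
      proof -
        obtain A where A: "A \<in> \<A>" "set vs \<subseteq> A" using short[OF vs] by blast
        have l: "0 < length vs" using vs(1) unfolding graph_cycle_def by linarith
        have "set vs \<subseteq> component A (vs ! 0)"
        proof
          fix x assume "x \<in> set vs"
          then obtain i where i: "i < length vs" "x = vs ! i" by (metis in_set_conv_nth)
          have "{(u, v). u \<in> set vs \<and> v \<in> set vs \<and> {u, v} \<in> F} \<subseteq> adj A"
            using A(2) F unfolding adj_def inner_def by auto
          then show "x \<in> component A (vs ! 0)"
            using subsetD[OF rtrancl_mono graph_cycle_connected[OF vs(1) i(1)]] i(2)
            unfolding component_def by simp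
        qed
        moreover have "vs ! 0 \<in> A" using A(2) l by (meson nth_mem subsetD)
        ultimately show ?thesis using A(1) by blast
      qed
    qed (use F \<alpha> in auto)
    moreover have "sum we (E - F) = 1 - sum we F" using sum_diff[OF finite_E F, of we] sum_we by simp
    ultimately have "(1 - lam) * (1 - ?\<alpha>) - \<delta> \<le> sum we (E - F)" by (simp add: algebra_simps)
    \<comment> \<open>In this case \<open>1 - ?\<alpha>\<close> exceeds 1/3; this is the origin of
      the constant 3.\<close>
    moreover have "\<delta> \<le> 3 * \<delta> * (1 - ?\<alpha>)"
    proof -
      have "\<delta> * 1 \<le> \<delta> * (3 * (1 - ?\<alpha>))" using False \<delta>_nonneg by (intro mult_left_mono) auto
      then show ?thesis by (simp add: algebra_simps)
    qed
    moreover have "0 \<le> lam * (1 - ?\<alpha>)" using lam \<alpha> by simp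
    ultimately show ?thesis by (simp add: algebra_simps)
  qed
qed

end

section \<open>Gaps in links and trickling down\<close>

text \<open>A nonpositive quadratic polynomial that vanishes at 0 has derivative 0 there. It is
  evaluated at a small multiple of \<open>a\<close>, chosen so that the quadratic term cannot
  outweigh the linear one.\<close>

lemma linear_coefficient_zero:
  fixes a b :: real
  assumes "\<And>t. 2 * t * a + t\<^sup>2 * b \<le> 0"
  shows "a = 0"
proof (rule ccontr)
  assume "a \<noteq> 0"
  \<comment> \<open>This makes \<open>s * \<bar>b\<bar>\<close> less than 1, whence
    \<open>2 + s * b\<close> is positive.\<close>
  define s where "s = 1 / (\<bar>b\<bar> + 1)"
  have s: "0 < s" "s * (\<bar>b\<bar> + 1) = 1" unfolding s_def by simp_all
  have "s * b \<le> s * \<bar>b\<bar>" using s(1) by (intro mult_left_mono) auto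
  then have sb: "- 1 \<le> s * b"
  proof -
    have "s * (- \<bar>b\<bar>) \<le> s * b" using s(1) by (intro mult_left_mono) auto
    then show ?thesis using s by (simp add: algebra_simps)
  qed
  have "2 * (s * a) * a + (s * a)\<^sup>2 * b \<le> 0" by (rule assms)
  then have "s * a\<^sup>2 * (2 + s * b) \<le> 0" by (simp add: power2_eq_square algebra_simps)
  moreover have "0 < s * a\<^sup>2 * (2 + s * b)" using s(1) sb \<open>a \<noteq> 0\<close> by (intro mult_pos_pos) auto
  ultimately show False by linarith
qed

text \<open>The form \<open>B\<close> attains its maximum \<theta> on the unit sphere of the
  functions of mean 0, and \<open>f0\<close> shows \<open>l < \<theta>\<close>. Vanishing of the
  first variation at a maximiser \<open>f\<close> in every direction of mean 0 is the eigenvalue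
  equation in weak form.\<close>

lemma top_eigenfunction:
  fixes B :: "('v \<Rightarrow> real) \<Rightarrow> ('v \<Rightarrow> real) \<Rightarrow> real" and c :: "'v \<Rightarrow> real"
  assumes finU: "finite U" and c: "\<And>v. v \<in> U \<Longrightarrow> 0 < c v"
    and cont: "continuous_on UNIV (\<lambda>f. B f f)"
    and expand: "\<And>f g t. B (\<lambda>v. f v + t * g v) (\<lambda>v. f v + t * g v) = B f f + 2 * t * B f g + t\<^sup>2 * B g g"
    and zero: "\<And>g. B (\<lambda>_. 0) g = 0"
    and supp: "\<And>f g. (\<And>v. v \<in> U \<Longrightarrow> f v = g v) \<Longrightarrow> B f f = B g g"
    and f0: "(\<Sum>v\<in>U. c v * f0 v) = 0" "l * (\<Sum>v\<in>U. c v * (f0 v)\<^sup>2) < B f0 f0"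
  shows "\<exists>\<theta> f. l < \<theta> \<and> (\<Sum>v\<in>U. c v * f v) = 0 \<and> (\<Sum>v\<in>U. c v * (f v)\<^sup>2) = 1 \<and>
    (\<forall>g. (\<Sum>v\<in>U. c v * g v) = 0 \<longrightarrow> B f g = \<theta> * (\<Sum>v\<in>U. c v * f v * g v))"
proof -
  define m where "m f = (\<Sum>v\<in>U. c v * f v)" for f
  define N where "N f = (\<Sum>v\<in>U. c v * (f v)\<^sup>2)" for f
  have cnn: "0 \<le> c v * (f v)\<^sup>2" if "v \<in> U" for f v
    by (intro mult_nonneg_nonneg less_imp_le[OF c[OF that]] zero_le_power2)
  have N_nonneg: "0 \<le> N f" for f
    unfolding N_def by (rule sum_nonneg) (rule cnn)
  have scale: "B (\<lambda>v. t * f v) (\<lambda>v. t * f v) = t\<^sup>2 * B f f" for t f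
    using expand[of "\<lambda>_. 0" t f] zero by simp
  have N_zero: "B f f = 0" if Nf: "N f = 0" for f
  proof -
    have "\<forall>v\<in>U. c v * (f v)\<^sup>2 = 0"
      using Nf unfolding N_def by (subst (asm) sum_nonneg_eq_0_iff[OF finU cnn])
    then have "f v = 0" if "v \<in> U" for v using c[OF that] that by force
    then have "B f f = B (\<lambda>_. 0) (\<lambda>_. 0)" by (intro supp) simp
    then show ?thesis using zero by simp
  qed
  define S where "S = {f. (\<forall>v. v \<notin> U \<longrightarrow> f v = 0) \<and> m f = 0 \<and> N f = 1}"
  \<comment> \<open>On the unit sphere each coordinate satisfies
    \<open>c v * (f v)\<^sup>2 \<le> 1\<close>, so the sphere is a closed subset of this box, which
    is compact in the product topology. Coordinates outside \<open>U\<close> are fixed at 0 for the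
    same purpose.\<close>
  define K where "K v = (if v \<in> U then {- (1 / sqrt (c v)) .. 1 / sqrt (c v)} else {0 :: real})" for v
  have cm: "continuous_on UNIV m" unfolding m_def by (intro continuous_intros continuous_on_product_coordinates)
  have cN: "continuous_on UNIV N" unfolding N_def by (intro continuous_intros continuous_on_product_coordinates)
  have "compact (PiE UNIV K)"
  proof -
    have "compactin (product_topology (\<lambda>_. euclidean) UNIV) (PiE UNIV K)"
      unfolding compactin_PiE by (auto simp: K_def)
    then show ?thesis by (simp add: euclidean_product_topology)
  qed
  moreover have "closed {f. m f = 0}" by (intro closed_Collect_eq cm continuous_on_const)
  moreover have "closed {f. N f = 1}" by (intro closed_Collect_eq cN continuous_on_const)
  ultimately have "compact (PiE UNIV K \<inter> ({f. m f = 0} \<inter> {f. N f = 1}))"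
    by (intro compact_Int_closed closed_Int)
  moreover have "S = PiE UNIV K \<inter> ({f. m f = 0} \<inter> {f. N f = 1})"
  proof (intro equalityI subsetI)
    fix f assume f: "f \<in> S"
    have "f v \<in> K v" for v
    proof (cases "v \<in> U")
      case True
      have "c v * (f v)\<^sup>2 \<le> N f"
        unfolding N_def by (rule member_le_sum[OF True]) (use cnn finU in auto)
      then have "(f v)\<^sup>2 \<le> 1 / c v" using f c[OF True] by (simp add: S_def field_simps)
      then have "\<bar>f v\<bar> \<le> 1 / sqrt (c v)"
        using real_sqrt_le_mono[of "(f v)\<^sup>2" "1 / c v"] by (simp add: real_sqrt_divide)
      then show ?thesis using True by (auto simp: K_def)
    next
      case False
      then show ?thesis using f by (simp add: S_def K_def)
    qed
    then show "f \<in> PiE UNIV K \<inter> ({f. m f = 0} \<inter> {f. N f = 1})"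
      using f by (simp add: S_def PiE_UNIV_domain Pi_iff)
  next
    fix f assume f: "f \<in> PiE UNIV K \<inter> ({f. m f = 0} \<inter> {f. N f = 1})"
    have "f v = 0" if "v \<notin> U" for v
    proof -
      have "f v \<in> K v" using f by (simp add: PiE_UNIV_domain Pi_iff)
      then show ?thesis using that by (simp add: K_def)
    qed
    then show "f \<in> S" using f by (simp add: S_def)
  qed
  ultimately have compS: "compact S" by simp
  have normalize: "\<exists>h\<in>S. B h h = B f f / N f" if "m f = 0" "0 < N f" for f
  proof -
    define t where "t = 1 / sqrt (N f)"
    have t: "t\<^sup>2 = 1 / N f" unfolding t_def using that(2) by (simp add: power_divide)
    define h where "h v = (if v \<in> U then t * f v else 0)" for v
    have "m h = t * m f" unfolding m_def h_def sum_distrib_left by (intro sum.cong) auto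
    moreover have "N h = t\<^sup>2 * N f" unfolding N_def h_def sum_distrib_left
      by (intro sum.cong) (auto simp: power_mult_distrib)
    ultimately have "h \<in> S" using that t by (simp add: S_def) (simp add: h_def)
    moreover have "B h h = t\<^sup>2 * B f f" unfolding scale[symmetric] by (rule supp) (simp add: h_def)
    ultimately show ?thesis using t by (intro bexI[of _ h]) simp_all
  qed
  have f0': "l * N f0 < B f0 f0" using f0(2) unfolding N_def .
  have N0: "0 < N f0"
  proof (rule ccontr)
    assume "\<not> 0 < N f0"
    then have "N f0 = 0" using N_nonneg[of f0] by simp
    then show False using f0' N_zero[of f0] by simp
  qed
  obtain h0 where h0: "h0 \<in> S" "B h0 h0 = B f0 f0 / N f0" using normalize[of f0] f0(1) N0 unfolding m_def by blast
  obtain f where f: "f \<in> S" "\<And>h. h \<in> S \<Longrightarrow> B h h \<le> B f f"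
    using continuous_attains_sup[OF compS, of "\<lambda>f. B f f"] h0(1) continuous_on_subset[OF cont] by blast
  define \<theta> where "\<theta> = B f f"
  have "l < B f0 f0 / N f0" using f0' N0 by (simp add: field_simps)
  then have l: "l < \<theta>" using f(2)[OF h0(1)] h0(2) unfolding \<theta>_def by linarith
  have upper: "B h h \<le> \<theta> * N h" if h: "m h = 0" for h
  proof (cases "N h = 0")
    case True
    then show ?thesis using N_zero by simp
  next
    case False
    then have "0 < N h" using N_nonneg[of h] by linarith
    then obtain h' where "h' \<in> S" "B h' h' = B h h / N h" using normalize[OF h] by blast
    then have "B h h / N h \<le> \<theta>" using f(2) unfolding \<theta>_def by metis
    then show ?thesis using \<open>0 < N h\<close> by (simp add: field_simps)
  qed
  have "B f g = \<theta> * (\<Sum>v\<in>U. c v * f v * g v)" if g: "m g = 0" for g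
  proof -
    let ?i = "\<Sum>v\<in>U. c v * f v * g v"
    have "2 * t * (B f g - \<theta> * ?i) + t\<^sup>2 * (B g g - \<theta> * N g) \<le> 0" for t
    proof -
      let ?h = "\<lambda>v. f v + t * g v"
      have "m ?h = m f + t * m g"
        unfolding m_def by (simp add: algebra_simps sum.distrib sum_distrib_left)
      then have "B ?h ?h \<le> \<theta> * N ?h" using f(1) g by (intro upper) (simp add: S_def)
      moreover have "N ?h = N f + 2 * t * ?i + t\<^sup>2 * N g"
        unfolding N_def by (simp add: power2_eq_square algebra_simps sum.distrib sum_distrib_left)
      moreover have "N f = 1" using f(1) by (simp add: S_def)
      ultimately show ?thesis using expand[of f t g] unfolding \<theta>_def by (simp add: algebra_simps)
    qed
    then have "B f g - \<theta> * ?i = 0" by (rule linear_coefficient_zero)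
    then show ?thesis by simp
  qed
  then show ?thesis using l f(1) unfolding S_def m_def N_def by blast
qed

section \<open>Weighted links, their adjacency forms, and connectedness\<close>

definition star :: "'v set set \<Rightarrow> 'v set \<Rightarrow> 'v set set" where
  "star \<C> x = {C \<in> \<C>. x \<subseteq> C}"

definition link_vertices :: "'v set set \<Rightarrow> 'v set \<Rightarrow> 'v set" where
  "link_vertices \<C> x = \<Union>(star \<C> x) - x"

text \<open>The integral over the link, without normalisation. Summing over chambers gives a vertex
  of the link the number of chambers through it as its weight, so no division occurs and links of
  different faces can be compared directly.\<close>

definition mass :: "'v set set \<Rightarrow> 'v set \<Rightarrow> ('v \<Rightarrow> real) \<Rightarrow> real" where
  "mass \<C> x f = (\<Sum>C\<in>star \<C> x. \<Sum>v\<in>C - x. f v)"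

text \<open>Product of the sums minus sum of the products: in each chamber this is the sum of
  \<open>f u * g v\<close> over ordered pairs of distinct vertices of the link, that is, the
  adjacency form with edges weighted by their numbers of chambers.\<close>

definition link_form :: "'v set set \<Rightarrow> 'v set \<Rightarrow> ('v \<Rightarrow> real) \<Rightarrow> ('v \<Rightarrow> real) \<Rightarrow> real" where
  "link_form \<C> x f g = (\<Sum>C\<in>star \<C> x. (\<Sum>v\<in>C - x. f v) * (\<Sum>v\<in>C - x. g v) - (\<Sum>v\<in>C - x. f v * g v))"

text \<open>For a face \<open>x\<close> with \<open>D\<close>-dimensional link this says that the second largest eigenvalue of
  the random walk on the weighted graph underlying the link is at most \<open>lam\<close>.\<close>

definition gap :: "'v set set \<Rightarrow> nat \<Rightarrow> 'v set \<Rightarrow> real \<Rightarrow> bool" where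
  "gap \<C> D x lam \<longleftrightarrow> (\<forall>f. link_form \<C> x f f \<le> lam * D * mass \<C> x (\<lambda>v. (f v)\<^sup>2) +
     (1 - lam) * D * (mass \<C> x f)\<^sup>2 / ((D + 1) * card (star \<C> x)))"

text \<open>Connectedness through locally constant functions. This is how it excludes the eigenvalue
  1, and it is transported along a covering by composing functions with the covering map.\<close>

definition link_connected :: "'v set set \<Rightarrow> 'v set \<Rightarrow> bool" where
  "link_connected \<C> x \<longleftrightarrow> (\<forall>f :: 'v \<Rightarrow> real.
     (\<forall>C\<in>star \<C> x. \<forall>u\<in>C - x. \<forall>v\<in>C - x. f u = f v) \<longrightarrow>
     (\<forall>u\<in>link_vertices \<C> x. \<forall>v\<in>link_vertices \<C> x. f u = f v))"

text \<open>Summed over chambers, this turns the distance of an eigenvalue from 1 into a sum of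
  squares.\<close>

lemma sum_square_deviation:
  fixes f :: "'a \<Rightarrow> real"
  assumes "finite A"
  shows "(\<Sum>u\<in>A. \<Sum>v\<in>A. (f u - f v)\<^sup>2) = 2 * (card A * (\<Sum>u\<in>A. (f u)\<^sup>2) - (\<Sum>u\<in>A. f u)\<^sup>2)"
proof -
  have "(\<Sum>u\<in>A. \<Sum>v\<in>A. (f u - f v)\<^sup>2) =
      (\<Sum>u\<in>A. \<Sum>v\<in>A. (f u)\<^sup>2) + (\<Sum>u\<in>A. \<Sum>v\<in>A. (f v)\<^sup>2) - 2 * (\<Sum>u\<in>A. \<Sum>v\<in>A. f u * f v)"
    by (simp add: power2_diff sum.distrib sum_subtractf sum_distrib_left mult.assoc)
  moreover have "(\<Sum>u\<in>A. \<Sum>v\<in>A. (f u)\<^sup>2) = card A * (\<Sum>u\<in>A. (f u)\<^sup>2)"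
    by (simp add: sum_distrib_left)
  moreover have "(\<Sum>u\<in>A. \<Sum>v\<in>A. (f v)\<^sup>2) = card A * (\<Sum>u\<in>A. (f u)\<^sup>2)" by simp
  moreover have "(\<Sum>u\<in>A. \<Sum>v\<in>A. f u * f v) = (\<Sum>u\<in>A. f u)\<^sup>2"
    by (simp add: power2_eq_square sum_product)
  ultimately show ?thesis by simp
qed

locale link =
  fixes \<C> :: "'v set set" and x :: "'v set" and D :: nat
  assumes finite_star: "finite (star \<C> x)" and star_ne: "star \<C> x \<noteq> {}"
    and chamber: "C \<in> star \<C> x \<Longrightarrow> finite C \<and> card (C - x) = D + 1"
begin

abbreviation "U \<equiv> link_vertices \<C> x"
abbreviation "c v \<equiv> real (card (star \<C> (insert v x)))"

lemma finite_U: "finite U"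
  using finite_star chamber by (auto simp: link_vertices_def)

lemma star_insert: "star \<C> (insert v x) = {C \<in> star \<C> x. v \<in> C}"
  by (auto simp: star_def)

lemma c_pos: "v \<in> U \<Longrightarrow> 0 < c v"
  using finite_star by (auto simp: link_vertices_def star_insert card_gt_0_iff)

text \<open>Double counting of a link vertex and a chamber through it. Every comparison of the link
  of \<open>x\<close> with the links of the faces \<open>insert v x\<close> rests on it.\<close>

lemma sum_link: "(\<Sum>v\<in>U. \<Sum>C\<in>star \<C> (insert v x). h v C) = (\<Sum>C\<in>star \<C> x. \<Sum>v\<in>C - x. h v C)"
proof -
  have "(\<Sum>v\<in>U. \<Sum>C\<in>star \<C> (insert v x). h v C) = (\<Sum>C\<in>star \<C> x. \<Sum>v | v \<in> U \<and> v \<in> C. h v C)"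
    unfolding star_insert by (rule sum.swap_restrict[OF finite_U finite_star])
  also have "\<dots> = (\<Sum>C\<in>star \<C> x. \<Sum>v\<in>C - x. h v C)"
    by (intro sum.cong HOL.refl) (auto simp: link_vertices_def)
  finally show ?thesis .
qed

lemma mass_alt: "mass \<C> x f = (\<Sum>v\<in>U. c v * f v)"
  using sum_link[of "\<lambda>v C. f v"] by (simp add: mass_def)

lemma mass_const: "mass \<C> x (\<lambda>_. a) = real ((D + 1) * card (star \<C> x)) * (a :: real)"
  unfolding mass_def using chamber by (simp add: algebra_simps)

lemma sum_others: "C \<in> star \<C> x \<Longrightarrow> v \<in> C - x \<Longrightarrow> (\<Sum>u\<in>C - insert v x. f u) = (\<Sum>u\<in>C - x. f u) - (f v :: real)"
proof -
  assume C: "C \<in> star \<C> x" "v \<in> C - x"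
  have "C - insert v x = (C - x) - {v}" by blast
  then show ?thesis using C chamber[OF C(1)] by (simp add: sum_diff1)
qed

lemma mass_insert: "v \<in> U \<Longrightarrow> mass \<C> (insert v x) f = (\<Sum>C\<in>star \<C> (insert v x). (\<Sum>u\<in>C - x. f u) - f v)"
  unfolding mass_def by (intro sum.cong HOL.refl sum_others) (auto simp: star_insert link_vertices_def)

text \<open>A pair of distinct vertices of a chamber is a vertex \<open>v\<close> together with a
  vertex of the link of \<open>insert v x\<close>. Thus \<open>mass \<C> (insert v x)\<close> acts
  as the adjacency operator, evaluated at \<open>v\<close>.\<close>

lemma link_form_alt: "link_form \<C> x f g = (\<Sum>v\<in>U. f v * mass \<C> (insert v x) g)"
proof -
  have "(\<Sum>v\<in>U. f v * mass \<C> (insert v x) g) =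
      (\<Sum>v\<in>U. \<Sum>C\<in>star \<C> (insert v x). f v * ((\<Sum>u\<in>C - x. g u) - g v))"
    by (intro sum.cong HOL.refl) (simp add: mass_insert sum_distrib_left)
  also have "\<dots> = (\<Sum>C\<in>star \<C> x. \<Sum>v\<in>C - x. f v * ((\<Sum>u\<in>C - x. g u) - g v))"
    by (rule sum_link)
  also have "\<dots> = link_form \<C> x f g"
    unfolding link_form_def
    by (intro sum.cong HOL.refl) (simp only: right_diff_distrib sum_subtractf sum_distrib_right[symmetric])
  finally show ?thesis by simp
qed

lemma link_form_commute: "link_form \<C> x f g = link_form \<C> x g f"
  by (simp add: link_form_def mult.commute)

lemma link_form_add: "link_form \<C> x f (\<lambda>v. g v + h v) = link_form \<C> x f g + link_form \<C> x f h"
  unfolding link_form_def by (simp add: algebra_simps sum.distrib sum_subtractf)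

lemma link_form_scale: "link_form \<C> x f (\<lambda>v. t * g v) = t * link_form \<C> x f g"
  unfolding link_form_def by (simp add: algebra_simps sum_distrib_left sum_subtractf)

text \<open>Constants are eigenfunctions: a link vertex has \<open>D\<close> companions in each of
  its chambers.\<close>

lemma link_form_const: "link_form \<C> x f (\<lambda>_. a) = (a :: real) * D * mass \<C> x f"
proof -
  have "link_form \<C> x f (\<lambda>_. a) = (\<Sum>C\<in>star \<C> x. a * D * (\<Sum>v\<in>C - x. f v))"
    unfolding link_form_def
    by (intro sum.cong HOL.refl) (use chamber in \<open>simp add: algebra_simps sum_distrib_left\<close>)
  then show ?thesis by (simp add: mass_def sum_distrib_left)
qed

lemma mass_add: "mass \<C> x (\<lambda>v. g v + h v) = mass \<C> x g + mass \<C> x h"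
  by (simp add: mass_def sum.distrib)

lemma mass_scale: "mass \<C> x (\<lambda>v. t * g v) = t * mass \<C> x g"
  by (simp add: mass_def sum_distrib_left)

text \<open>Split \<open>f\<close> into its mean and a part of mean 0. By
  \<open>link_form_const\<close> the two are orthogonal for the form as well, and the last term in
  \<open>gap\<close> is made so that constants give equality.\<close>

lemma gapI:
  fixes lam :: real
  assumes "\<And>f. mass \<C> x f = 0 \<Longrightarrow> link_form \<C> x f f \<le> lam * D * mass \<C> x (\<lambda>v. (f v)\<^sup>2)"
  shows "gap \<C> D x lam"
  unfolding gap_def
proof
  fix f
  define n where "n = real ((D + 1) * card (star \<C> x))"
  have "0 < card (star \<C> x)" using finite_star star_ne by (simp add: card_gt_0_iff)
  then have n: "0 < n" unfolding n_def of_nat_0_less_iff by simp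
  have mass_const_n: "mass \<C> x (\<lambda>_. a) = n * a" for a unfolding n_def by (rule mass_const)
  define a where "a = mass \<C> x f / n"
  have na: "n * a = mass \<C> x f" using n by (simp add: a_def)
  define g where "g v = f v + - a" for v
  have f: "f = (\<lambda>v. g v + a)" by (simp add: g_def)
  have mg: "mass \<C> x g = 0" unfolding g_def mass_add mass_const_n using na by simp
  have form: "link_form \<C> x f f = link_form \<C> x g g + a\<^sup>2 * D * n"
    unfolding f link_form_add link_form_const link_form_commute[of "\<lambda>v. g v + a"] mass_add mass_const_n
    using mg by (simp add: power2_eq_square algebra_simps)
  have "(\<lambda>v. (f v)\<^sup>2) = (\<lambda>v. ((g v)\<^sup>2 + (2 * a) * g v) + a\<^sup>2)"
    unfolding f by (simp add: power2_eq_square algebra_simps)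
  then have energy: "mass \<C> x (\<lambda>v. (f v)\<^sup>2) = mass \<C> x (\<lambda>v. (g v)\<^sup>2) + n * a\<^sup>2"
    by (simp add: mass_add mass_scale mass_const_n mg)
  have mean: "(1 - lam) * D * (mass \<C> x f)\<^sup>2 / n = (1 - lam) * D * (n * a\<^sup>2)"
    using n unfolding na[symmetric] by (simp add: power2_eq_square)
  have "link_form \<C> x g g \<le> lam * D * mass \<C> x (\<lambda>v. (g v)\<^sup>2)" by (rule assms[OF mg])
  then show "link_form \<C> x f f \<le> lam * D * mass \<C> x (\<lambda>v. (f v)\<^sup>2) +
     (1 - lam) * D * (mass \<C> x f)\<^sup>2 / ((D + 1) * card (star \<C> x))"
    unfolding n_def[symmetric] mean form energy by (simp add: algebra_simps)
qed

text \<open>The form of the gap used in proofs by contradiction: if it fails, there is a normalised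
  function of mean 0 that satisfies the eigenvalue equation at every vertex. Dividing by
  \<open>D\<close> makes \<theta> an eigenvalue of the random walk.\<close>

lemma gap_or_eigenfunction:
  fixes lam :: real
  assumes D: "1 \<le> D"
  shows "gap \<C> D x lam \<or> (\<exists>\<theta> f. lam < \<theta> \<and> mass \<C> x f = 0 \<and> mass \<C> x (\<lambda>v. (f v)\<^sup>2) = 1 \<and>
    (\<forall>v\<in>U. mass \<C> (insert v x) f = \<theta> * D * c v * f v))"
proof (rule disjCI)
  assume no: "\<not> (\<exists>\<theta> f. lam < \<theta> \<and> mass \<C> x f = 0 \<and> mass \<C> x (\<lambda>v. (f v)\<^sup>2) = 1 \<and>
    (\<forall>v\<in>U. mass \<C> (insert v x) f = \<theta> * D * c v * f v))"
  show "gap \<C> D x lam"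
  proof (rule gapI, rule ccontr)
    fix f0
    assume f0: "mass \<C> x f0 = 0" "\<not> link_form \<C> x f0 f0 \<le> lam * D * mass \<C> x (\<lambda>v. (f0 v)\<^sup>2)"
    have "\<exists>\<theta> f. lam * D < \<theta> \<and> (\<Sum>v\<in>U. c v * f v) = 0 \<and> (\<Sum>v\<in>U. c v * (f v)\<^sup>2) = 1 \<and>
      (\<forall>g. (\<Sum>v\<in>U. c v * g v) = 0 \<longrightarrow> link_form \<C> x f g = \<theta> * (\<Sum>v\<in>U. c v * f v * g v))"
    proof (rule top_eigenfunction[where B = "link_form \<C> x" and ?f0.0 = f0, OF finite_U c_pos])
      show "continuous_on UNIV (\<lambda>f. link_form \<C> x f f)"
        unfolding link_form_def by (intro continuous_intros continuous_on_product_coordinates)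
      show "link_form \<C> x (\<lambda>v. f v + t * g v) (\<lambda>v. f v + t * g v) =
          link_form \<C> x f f + 2 * t * link_form \<C> x f g + t\<^sup>2 * link_form \<C> x g g" for f g t
        unfolding link_form_add link_form_scale link_form_commute[of "\<lambda>v. f v + t * g v"]
        using link_form_commute[of f g] by (simp add: power2_eq_square algebra_simps)
      show "link_form \<C> x (\<lambda>_. 0) g = 0" for g by (simp add: link_form_def)
      show "link_form \<C> x f f = link_form \<C> x g g" if fg: "\<And>v. v \<in> U \<Longrightarrow> f v = g v" for f g
        unfolding link_form_def
      proof (intro sum.cong HOL.refl)
        fix C assume "C \<in> star \<C> x"
        then have "f v = g v" if "v \<in> C - x" for v using that by (intro fg) (auto simp: link_vertices_def)
        then have "sum f (C - x) = sum g (C - x)" "(\<Sum>v\<in>C - x. f v * f v) = (\<Sum>v\<in>C - x. g v * g v)"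
          by (intro sum.cong[OF HOL.refl]; simp)+
        then show "sum f (C - x) * sum f (C - x) - (\<Sum>v\<in>C - x. f v * f v) =
          sum g (C - x) * sum g (C - x) - (\<Sum>v\<in>C - x. g v * g v)" by simp
      qed
    qed (use f0 in \<open>simp_all add: mass_alt\<close>)
    then obtain \<theta> f where \<theta>: "lam * D < \<theta>" and f: "mass \<C> x f = 0" "mass \<C> x (\<lambda>v. (f v)\<^sup>2) = 1"
      and eig: "\<And>g. mass \<C> x g = 0 \<Longrightarrow> link_form \<C> x f g = \<theta> * (\<Sum>v\<in>U. c v * f v * g v)"
      by (auto simp: mass_alt)
    have "mass \<C> (insert v x) f = \<theta> * c v * f v" if v: "v \<in> U" for v
    proof -
      \<comment> \<open>The weak equation may only be tested against functions of mean 0, so the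
        indicator of \<open>v\<close> is corrected by the constant \<kappa>. The correction
        contributes nothing on either side because \<open>f\<close> has mean 0.\<close>
      let ?e = "\<lambda>u. if u = v then 1 else 0 :: real"
      define n where "n = real ((D + 1) * card (star \<C> x))"
      have "0 < card (star \<C> x)" using finite_star star_ne by (simp add: card_gt_0_iff)
      then have n: "0 < n" unfolding n_def of_nat_0_less_iff by simp
      define \<kappa> where "\<kappa> = - c v / n"
      have delta: "(\<Sum>u\<in>U. g u * ?e u) = g v" for g :: "'v \<Rightarrow> real"
      proof -
        have "(\<Sum>u\<in>U. g u * ?e u) = (\<Sum>u\<in>U. if u = v then g u else 0)" by (intro sum.cong HOL.refl) simp
        then show ?thesis using v finite_U by simp
      qed
      have me: "mass \<C> x ?e = c v" unfolding mass_alt by (rule delta)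
      have "mass \<C> x (\<lambda>u. ?e u + \<kappa>) = 0"
        unfolding mass_add mass_const me n_def[symmetric] using n by (simp add: \<kappa>_def)
      then have "link_form \<C> x f (\<lambda>u. ?e u + \<kappa>) = \<theta> * (\<Sum>u\<in>U. c u * f u * (?e u + \<kappa>))"
        by (rule eig)
      moreover have "link_form \<C> x f (\<lambda>u. ?e u + \<kappa>) = link_form \<C> x f ?e"
        unfolding link_form_add link_form_const f(1) by simp
      moreover have "link_form \<C> x f ?e = mass \<C> (insert v x) f"
      proof -
        have "link_form \<C> x f ?e = (\<Sum>u\<in>U. ?e u * mass \<C> (insert u x) f)"
          using link_form_commute[of f ?e] link_form_alt[of ?e f] by simp
        also have "\<dots> = (\<Sum>u\<in>U. mass \<C> (insert u x) f * ?e u)" by (intro sum.cong HOL.refl mult.commute)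
        finally show ?thesis unfolding delta .
      qed
      moreover have "(\<Sum>u\<in>U. c u * f u * (?e u + \<kappa>)) = (\<Sum>u\<in>U. c u * f u * ?e u) + \<kappa> * (\<Sum>u\<in>U. c u * f u)"
        unfolding sum_distrib_left sum.distrib[symmetric] by (intro sum.cong HOL.refl) (simp add: algebra_simps)
      moreover have "(\<Sum>u\<in>U. c u * f u * ?e u) = c v * f v" by (rule delta)
      moreover have "(\<Sum>u\<in>U. c u * f u) = 0" using f(1) by (simp add: mass_alt)
      ultimately show ?thesis by simp
    qed
    moreover have D_eq: "\<theta> / D * D = \<theta>" using D by simp
    ultimately have "\<forall>v\<in>U. mass \<C> (insert v x) f = \<theta> / D * D * c v * f v" unfolding D_eq by blast
    moreover have "lam < \<theta> / D" using D \<theta> by (simp add: pos_less_divide_eq)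
    ultimately show False using no f by blast
  qed
qed

text \<open>Oppenheim's argument: apply the gaps of the vertex links to an eigenfunction
  \<open>f\<close> of the whole link and add up. By the eigenvalue equation the mean of
  \<open>f\<close> over the link of \<open>v\<close> is \<open>\<theta> * f v\<close>, so the result
  is \<open>\<theta> \<le> \<mu> + (1 - \<mu>) * \<theta>\<^sup>2\<close>, that is,
  \<open>(1 - \<theta>) * (\<theta> * (1 - \<mu>) - \<mu>) \<le> 0\<close>. Connectedness excludes
  \<open>\<theta> = 1\<close> and leaves \<open>\<theta> \<le> \<mu> / (1 - \<mu>)\<close>.\<close>

lemma trickling_down:
  assumes D: "2 \<le> D" and local_gap: "\<And>v. v \<in> U \<Longrightarrow> gap \<C> (D - 1) (insert v x) \<mu>"
    and conn: "link_connected \<C> x" and \<mu>: "0 \<le> \<mu>" "\<mu> < 1"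
  shows "gap \<C> D x (\<mu> / (1 - \<mu>))"
proof (rule ccontr)
  assume "\<not> ?thesis"
  then obtain \<theta> f where \<theta>: "\<mu> / (1 - \<mu>) < \<theta>" and f: "mass \<C> x f = 0" "mass \<C> x (\<lambda>v. (f v)\<^sup>2) = 1"
    and eig: "\<And>v. v \<in> U \<Longrightarrow> mass \<C> (insert v x) f = \<theta> * D * c v * f v"
    using gap_or_eigenfunction[of "\<mu> / (1 - \<mu>)"] D by auto
  have energy: "(\<Sum>v\<in>U. c v * (f v)\<^sup>2) = 1" using f(2) by (simp add: mass_alt)
  have form: "link_form \<C> x f f = \<theta> * D"
  proof -
    have "link_form \<C> x f f = (\<Sum>v\<in>U. \<theta> * D * (c v * (f v)\<^sup>2))"
      unfolding link_form_alt by (intro sum.cong HOL.refl) (simp add: eig power2_eq_square algebra_simps)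
    also have "\<dots> = \<theta> * D" unfolding sum_distrib_left[symmetric] energy by simp
    finally show ?thesis .
  qed
  \<comment> \<open>A pair of distinct vertices among the \<open>D + 1\<close> link vertices of a
    chamber is seen from the \<open>D - 1\<close> others.\<close>
  have "(\<Sum>v\<in>U. link_form \<C> (insert v x) f f) = (D - 1) * link_form \<C> x f f"
  proof -
    have "(\<Sum>v\<in>U. link_form \<C> (insert v x) f f) =
        (\<Sum>v\<in>U. \<Sum>C\<in>star \<C> (insert v x). ((\<Sum>u\<in>C - x. f u) - f v)\<^sup>2 - ((\<Sum>u\<in>C - x. (f u)\<^sup>2) - (f v)\<^sup>2))"
      unfolding link_form_def
    proof (intro sum.cong HOL.refl)
      fix v C assume "v \<in> U" "C \<in> star \<C> (insert v x)"
      then have C: "C \<in> star \<C> x" "v \<in> C - x" by (auto simp: star_insert link_vertices_def)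
      show "sum f (C - insert v x) * sum f (C - insert v x) - (\<Sum>v\<in>C - insert v x. f v * f v) =
        (sum f (C - x) - f v)\<^sup>2 - ((\<Sum>u\<in>C - x. (f u)\<^sup>2) - (f v)\<^sup>2)"
        unfolding sum_others[OF C] by (simp add: power2_eq_square)
    qed
    also have "\<dots> = (\<Sum>C\<in>star \<C> x. \<Sum>v\<in>C - x. ((\<Sum>u\<in>C - x. f u) - f v)\<^sup>2 - ((\<Sum>u\<in>C - x. (f u)\<^sup>2) - (f v)\<^sup>2))"
      by (rule sum_link)
    also have "\<dots> = (\<Sum>C\<in>star \<C> x. (D - 1) * ((\<Sum>v\<in>C - x. f v) * (\<Sum>v\<in>C - x. f v) - (\<Sum>v\<in>C - x. f v * f v)))"
    proof (intro sum.cong HOL.refl)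
      fix C assume C: "C \<in> star \<C> x"
      let ?s = "\<Sum>u\<in>C - x. f u" and ?q = "\<Sum>u\<in>C - x. (f u)\<^sup>2"
      have "(\<Sum>v\<in>C - x. (?s - f v)\<^sup>2 - (?q - (f v)\<^sup>2)) = (\<Sum>v\<in>C - x. ?s\<^sup>2 - ?q - 2 * ?s * f v + 2 * (f v)\<^sup>2)"
        by (intro sum.cong HOL.refl) (simp add: power2_eq_square algebra_simps)
      also have "\<dots> = (D + 1) * (?s\<^sup>2 - ?q) - 2 * ?s * ?s + 2 * ?q"
        using chamber[OF C] by (simp add: sum.distrib sum_subtractf sum_distrib_left[symmetric])
      also have "\<dots> = (D - 1) * (?s * ?s - (\<Sum>v\<in>C - x. f v * f v))"
        using D by (simp add: power2_eq_square algebra_simps of_nat_diff)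
      finally show "(\<Sum>v\<in>C - x. (?s - f v)\<^sup>2 - (?q - (f v)\<^sup>2)) = (D - 1) * (?s * ?s - (\<Sum>v\<in>C - x. f v * f v))" .
    qed
    finally show ?thesis by (simp add: link_form_def sum_distrib_left)
  qed
  moreover have "(\<Sum>v\<in>U. link_form \<C> (insert v x) f f) \<le>
      (\<Sum>v\<in>U. \<mu> * (D - 1) * mass \<C> (insert v x) (\<lambda>v. (f v)\<^sup>2) + (1 - \<mu>) * (D - 1) * D * \<theta>\<^sup>2 * (c v * (f v)\<^sup>2))"
  proof (rule sum_mono)
    fix v assume v: "v \<in> U"
    have D1: "D - 1 + 1 = D" using D by simp
    have "link_form \<C> (insert v x) f f \<le> \<mu> * (D - 1) * mass \<C> (insert v x) (\<lambda>v. (f v)\<^sup>2) +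
        (1 - \<mu>) * (D - 1) * (mass \<C> (insert v x) f)\<^sup>2 / (D * card (star \<C> (insert v x)))"
      using local_gap[OF v] unfolding gap_def D1 by blast
    also have "(mass \<C> (insert v x) f)\<^sup>2 = (D * c v) * (D * \<theta>\<^sup>2 * (c v * (f v)\<^sup>2))"
      unfolding eig[OF v] by (simp add: power2_eq_square algebra_simps)
    also have "(1 - \<mu>) * (D - 1) * ((D * c v) * (D * \<theta>\<^sup>2 * (c v * (f v)\<^sup>2))) / (D * card (star \<C> (insert v x))) =
        (1 - \<mu>) * (D - 1) * D * \<theta>\<^sup>2 * (c v * (f v)\<^sup>2)"
      using D c_pos[OF v] by simp
    finally show "link_form \<C> (insert v x) f f \<le> \<mu> * (D - 1) * mass \<C> (insert v x) (\<lambda>v. (f v)\<^sup>2) +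
        (1 - \<mu>) * (D - 1) * D * \<theta>\<^sup>2 * (c v * (f v)\<^sup>2)" .
  qed
  moreover have "\<dots> = \<mu> * (D - 1) * D + (1 - \<mu>) * (D - 1) * D * \<theta>\<^sup>2"
  proof -
    have "(\<Sum>v\<in>U. mass \<C> (insert v x) (\<lambda>v. (f v)\<^sup>2)) = D"
    proof -
      have "(\<Sum>v\<in>U. mass \<C> (insert v x) (\<lambda>v. (f v)\<^sup>2)) = link_form \<C> x (\<lambda>_. 1) (\<lambda>v. (f v)\<^sup>2)"
        by (simp add: link_form_alt)
      also have "\<dots> = D" unfolding link_form_commute[of "\<lambda>_. 1"] link_form_const f(2) by simp
      finally show ?thesis .
    qed
    then show ?thesis unfolding sum.distrib sum_distrib_left[symmetric] energy by simp
  qed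
  ultimately have "real (D - 1) * D * \<theta> \<le> real (D - 1) * D * (\<mu> + (1 - \<mu>) * \<theta>\<^sup>2)"
    unfolding form by (simp add: algebra_simps)
  moreover have "0 < real (D - 1) * D" using D by simp
  ultimately have ineq: "\<theta> \<le> \<mu> + (1 - \<mu>) * \<theta>\<^sup>2" by (simp only: mult_le_cancel_left_pos)
  \<comment> \<open>The right side is a Dirichlet energy. It vanishes for
    \<open>\<theta> = 1\<close>; then \<open>f\<close> is constant on chambers, hence constant by
    \<open>conn\<close>, against mean 0 and norm 1.\<close>
  have dev: "D - link_form \<C> x f f = (\<Sum>C\<in>star \<C> x. (\<Sum>u\<in>C - x. \<Sum>v\<in>C - x. (f u - f v)\<^sup>2) / 2)"
  proof -
    have "D - link_form \<C> x f f = D * mass \<C> x (\<lambda>v. (f v)\<^sup>2) - link_form \<C> x f f" using f(2) by simp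
    also have "\<dots> = (\<Sum>C\<in>star \<C> x. D * (\<Sum>v\<in>C - x. (f v)\<^sup>2) -
        ((\<Sum>v\<in>C - x. f v) * (\<Sum>v\<in>C - x. f v) - (\<Sum>v\<in>C - x. f v * f v)))"
      by (simp only: mass_def link_form_def sum_subtractf sum_distrib_left[symmetric])
    also have "\<dots> = (\<Sum>C\<in>star \<C> x. (\<Sum>u\<in>C - x. \<Sum>v\<in>C - x. (f u - f v)\<^sup>2) / 2)"
    proof (intro sum.cong HOL.refl)
      fix C assume C: "C \<in> star \<C> x"
      show "D * (\<Sum>v\<in>C - x. (f v)\<^sup>2) - ((\<Sum>v\<in>C - x. f v) * (\<Sum>v\<in>C - x. f v) - (\<Sum>v\<in>C - x. f v * f v)) =
        (\<Sum>u\<in>C - x. \<Sum>v\<in>C - x. (f u - f v)\<^sup>2) / 2"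
        using chamber[OF C] sum_square_deviation[of "C - x" f]
        by (simp add: power2_eq_square algebra_simps)
    qed
    finally show ?thesis .
  qed
  have nonneg: "0 \<le> (\<Sum>u\<in>C - x. \<Sum>v\<in>C - x. (f u - f v)\<^sup>2) / 2" for C
    by (intro divide_nonneg_nonneg sum_nonneg) auto
  have "\<theta> \<noteq> 1"
  proof
    assume "\<theta> = 1"
    then have "(\<Sum>C\<in>star \<C> x. (\<Sum>u\<in>C - x. \<Sum>v\<in>C - x. (f u - f v)\<^sup>2) / 2) = 0" using dev form by simp
    then have z: "(\<Sum>u\<in>C - x. \<Sum>v\<in>C - x. (f u - f v)\<^sup>2) = 0" if "C \<in> star \<C> x" for C
      using sum_nonneg_eq_0_iff[OF finite_star nonneg] that by simp
    have "f u = f v" if C: "C \<in> star \<C> x" and uv: "u \<in> C - x" "v \<in> C - x" for C u v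
    proof -
      have fin: "finite (C - x)" using chamber[OF C] by simp
      have "(\<Sum>v\<in>C - x. (f u - f v)\<^sup>2) = 0"
        using z[OF C] uv(1) fin by (subst (asm) sum_nonneg_eq_0_iff) (auto intro: sum_nonneg)
      then have "(f u - f v)\<^sup>2 = 0" using uv(2) fin by (subst (asm) sum_nonneg_eq_0_iff) auto
      then show ?thesis by simp
    qed
    then have const: "f u = f v" if "u \<in> U" "v \<in> U" for u v
      using conn that unfolding link_connected_def by blast
    have "f v = 0" if v: "v \<in> U" for v
    proof -
      have "(\<Sum>u\<in>U. c u * f u) = (\<Sum>u\<in>U. c u) * f v"
        unfolding sum_distrib_right by (intro sum.cong HOL.refl) (metis const v)
      moreover have "(\<Sum>u\<in>U. c u) > 0" using c_pos v finite_U by (intro sum_pos) auto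
      ultimately show ?thesis using f(1) by (simp add: mass_alt)
    qed
    then have "(\<Sum>v\<in>U. c v * (f v)\<^sup>2) = 0" by simp
    then show False using energy by simp
  qed
  moreover have "\<theta> \<le> 1"
  proof -
    have "0 \<le> D - \<theta> * D" using dev form sum_nonneg[of "star \<C> x", OF nonneg] by simp
    then have "\<theta> * D \<le> 1 * D" by simp
    then show ?thesis using D by (simp add: mult_le_cancel_right)
  qed
  ultimately have "\<theta> < 1" by simp
  have "(1 - \<theta>) * (\<theta> * (1 - \<mu>) - \<mu>) \<le> 0" using ineq by (simp add: power2_eq_square algebra_simps)
  moreover have "0 < (1 - \<theta>) * (\<theta> * (1 - \<mu>) - \<mu>)"
    using \<open>\<theta> < 1\<close> \<theta> \<mu> by (intro mult_pos_pos) (simp_all add: field_simps)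
  ultimately show False by linarith
qed

end

text \<open>The map from \<mu> to \<open>\<mu> / (1 - \<mu>)\<close> subtracts 1 from the reciprocal
  of a positive \<mu>. Starting from links of dimension 1, this gives the closed form; the condition
  on \<open>r\<close> keeps all intermediate bounds below 1.\<close>

theorem iterated_trickling_down:
  assumes fin: "finite \<C>" and chamber: "\<And>C. C \<in> \<C> \<Longrightarrow> finite C \<and> card C = r + 1"
    and base: "\<And>x. star \<C> x \<noteq> {} \<Longrightarrow> card x + 1 = r \<Longrightarrow> gap \<C> 1 x \<mu>"
    and conn: "\<And>x. star \<C> x \<noteq> {} \<Longrightarrow> card x + 2 \<le> r \<Longrightarrow> link_connected \<C> x"
    and \<mu>: "0 \<le> \<mu>" "(real r - 1) * \<mu> < 1"
  shows "1 \<le> D \<Longrightarrow> star \<C> x \<noteq> {} \<Longrightarrow> card x + D = r \<Longrightarrow> gap \<C> D x (\<mu> / (1 - (real D - 1) * \<mu>))"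
proof (induction D arbitrary: x rule: nat_induct_at_least)
  case base
  then show ?case using assms(3)[of x] by simp
next
  case (Suc D)
  interpret link \<C> x "Suc D"
  proof
    show "finite (star \<C> x)" using fin by (simp add: star_def)
    show "finite C \<and> card (C - x) = Suc D + 1" if "C \<in> star \<C> x" for C
    proof -
      have C: "finite C" "card C = r + 1" "x \<subseteq> C" using chamber that by (auto simp: star_def)
      then show ?thesis using Suc.prems(2) card_Diff_subset[of x C] finite_subset[of x C] by simp
    qed
  qed (rule Suc.prems)
  let ?\<nu> = "\<mu> / (1 - (real D - 1) * \<mu>)"
  have "real D * \<mu> \<le> (real r - 1) * \<mu>"
    using Suc.prems(2) \<mu>(1) by (intro mult_right_mono) auto
  then have D\<mu>: "real D * \<mu> < 1" using \<mu>(2) by linarith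
  then have pos: "0 < 1 - (real D - 1) * \<mu>" using \<mu>(1) by (simp add: algebra_simps)
  have "gap \<C> (Suc D) x (?\<nu> / (1 - ?\<nu>))"
  proof (rule trickling_down)
    show "2 \<le> Suc D" using Suc.hyps by simp
    show "gap \<C> (Suc D - 1) (insert v x) ?\<nu>" if v: "v \<in> link_vertices \<C> x" for v
    proof -
      have "star \<C> (insert v x) \<noteq> {}" using v by (auto simp: link_vertices_def star_insert)
      moreover have "card (insert v x) + D = r"
      proof -
        obtain C where "C \<in> star \<C> x" using star_ne by blast
        then have "finite x" using chamber finite_subset by (auto simp: star_def)
        then show ?thesis using v Suc.prems(2) by (simp add: link_vertices_def)
      qed
      ultimately show ?thesis using Suc.IH by simp
    qed
    show "link_connected \<C> x" using Suc.prems Suc.hyps by (intro conn) auto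
    show "0 \<le> ?\<nu>" using \<mu>(1) pos by simp
    show "?\<nu> < 1" using D\<mu> pos by (simp add: field_simps)
  qed
  moreover have "?\<nu> / (1 - ?\<nu>) = \<mu> / (1 - (real (Suc D) - 1) * \<mu>)"
  proof -
    define a b where "a = 1 - (real D - 1) * \<mu>" and "b = 1 - real D * \<mu>"
    have ab: "0 < a" "0 < b" "a = b + \<mu>" using pos D\<mu> by (simp_all add: a_def b_def algebra_simps)
    have "1 - \<mu> / a = b / a" using ab by (simp add: diff_divide_eq_iff)
    then have "\<mu> / a / (1 - \<mu> / a) = \<mu> / b" using ab(1) by simp
    then show ?thesis unfolding a_def b_def by simp
  qed
  ultimately show ?case by (simp only:)
qed

section \<open>Rank two links\<close>

locale rank_two_link = link \<C> x 1 for \<C> :: "'v set set" and x +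
  fixes \<tau> :: "'v \<Rightarrow> 't" and s t :: 't and a b :: nat
  assumes types: "s \<noteq> t" "C \<in> star \<C> x \<Longrightarrow> \<exists>u v. C - x = {u, v} \<and> \<tau> u = s \<and> \<tau> v = t"
    and degree_s: "v \<in> link_vertices \<C> x \<Longrightarrow> \<tau> v = s \<Longrightarrow> card (star \<C> (insert v x)) = a"
    and degree_t: "v \<in> link_vertices \<C> x \<Longrightarrow> \<tau> v = t \<Longrightarrow> card (star \<C> (insert v x)) = b"
begin

definition nbrs :: "'v \<Rightarrow> 'v set" where
  "nbrs v = {z \<in> U. z \<noteq> v \<and> (\<exists>C\<in>star \<C> x. v \<in> C \<and> z \<in> C)}"

lemma nbrs_sym: "v \<in> U \<Longrightarrow> z \<in> nbrs v \<Longrightarrow> v \<in> nbrs z"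
  by (auto simp: nbrs_def)

lemma nbrs_subset: "nbrs v \<subseteq> U"
  by (auto simp: nbrs_def)

lemma finite_nbrs: "finite (nbrs v)"
  by (rule finite_subset[OF nbrs_subset finite_U])

lemma type_cases: "v \<in> U \<Longrightarrow> \<tau> v = s \<or> \<tau> v = t"
  using types(2) by (force simp: link_vertices_def)

lemma type_nbrs: "v \<in> U \<Longrightarrow> z \<in> nbrs v \<Longrightarrow> \<tau> z = s \<longleftrightarrow> \<tau> v = t"
proof -
  assume v: "v \<in> U" and z: "z \<in> nbrs v"
  then obtain C where C: "C \<in> star \<C> x" "v \<in> C - x" "z \<in> C - x" "z \<noteq> v"
    by (auto simp: nbrs_def link_vertices_def)
  obtain u w where uw: "C - x = {u, w}" and "\<tau> u = s" "\<tau> w = t" using types(2)[OF C(1)] by blast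
  have "v = u \<and> z = w \<or> v = w \<and> z = u" using C(2-4) unfolding uw by blast
  then show ?thesis using \<open>\<tau> u = s\<close> \<open>\<tau> w = t\<close> types(1) by auto
qed

text \<open>In a link of dimension 1 the chambers are the edges of a graph, so chambers through
  \<open>v\<close> correspond to neighbours of \<open>v\<close> and local masses become sums over
  neighbours.\<close>

lemma star_nbrs:
  assumes v: "v \<in> U"
  shows "star \<C> (insert v x) = (\<lambda>z. insert z (insert v x)) ` nbrs v"
    and "inj_on (\<lambda>z. insert z (insert v x)) (nbrs v)"
    and "\<And>z. z \<in> nbrs v \<Longrightarrow> insert z (insert v x) - insert v x = {z}"
proof -
  have vx: "v \<notin> x" using v by (simp add: link_vertices_def)
  show eq: "insert z (insert v x) - insert v x = {z}" if "z \<in> nbrs v" for z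
  proof -
    have "z \<notin> insert v x" using that by (simp add: nbrs_def link_vertices_def)
    then show ?thesis by blast
  qed
  show "inj_on (\<lambda>z. insert z (insert v x)) (nbrs v)"
  proof (rule inj_onI)
    fix z w assume z: "z \<in> nbrs v" and w: "w \<in> nbrs v" and h: "insert z (insert v x) = insert w (insert v x)"
    have "{w} = {z}" using eq[OF z] unfolding h eq[OF w] .
    then show "z = w" by simp
  qed
  have two: "C = insert z (insert v x)" if C: "C \<in> star \<C> x" "v \<in> C" "z \<in> C" "z \<notin> x" "z \<noteq> v" for C z
  proof -
    have "{v, z} \<subseteq> C - x" using C vx by blast
    moreover have "card (C - x) = 2" "finite (C - x)" using chamber[OF C(1)] by simp_all
    moreover have "card {v, z} = 2" using C(5) by simp
    ultimately have "{v, z} = C - x" by (metis card_subset_eq)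
    moreover have "x \<subseteq> C" using C(1) by (simp add: star_def)
    ultimately show ?thesis by blast
  qed
  show "star \<C> (insert v x) = (\<lambda>z. insert z (insert v x)) ` nbrs v"
  proof (intro equalityI subsetI)
    fix C assume "C \<in> star \<C> (insert v x)"
    then have C: "C \<in> star \<C> x" "v \<in> C" by (auto simp: star_insert)
    have "card (C - x) = 2" using chamber[OF C(1)] by simp
    then obtain y z where "C - x = {y, z}" "y \<noteq> z" unfolding card_2_iff by blast
    then obtain z where z: "z \<in> C - x" "z \<noteq> v" by blast
    have "C = insert z (insert v x)" using two[OF C] z by blast
    moreover have "z \<in> nbrs v" using z C unfolding nbrs_def link_vertices_def by blast
    ultimately show "C \<in> (\<lambda>z. insert z (insert v x)) ` nbrs v" by blast
  next
    fix C assume "C \<in> (\<lambda>z. insert z (insert v x)) ` nbrs v"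
    then obtain z where z: "z \<in> nbrs v" "C = insert z (insert v x)" by blast
    then obtain C' where C': "C' \<in> star \<C> x" "v \<in> C'" "z \<in> C'" "z \<notin> x" "z \<noteq> v"
      unfolding nbrs_def link_vertices_def by blast
    then have "C = C'" using two z(2) by simp
    then show "C \<in> star \<C> (insert v x)" using C' by (simp add: star_insert)
  qed
qed

lemma mass_nbrs: "v \<in> U \<Longrightarrow> mass \<C> (insert v x) f = (\<Sum>z\<in>nbrs v. f z)"
  unfolding mass_def star_nbrs(1) sum.reindex[OF star_nbrs(2)]
  by (simp add: star_nbrs(3))

lemma card_nbrs: "v \<in> U \<Longrightarrow> card (nbrs v) = card (star \<C> (insert v x))"
  unfolding star_nbrs(1) by (simp add: card_image[OF star_nbrs(2)])

lemma sum_sides: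
  fixes f :: "'v \<Rightarrow> real"
  assumes "{p, p'} = {s, t}"
  shows "(\<Sum>v | v \<in> U \<and> \<tau> v = p. \<Sum>z\<in>nbrs v. f z) = (\<Sum>z | z \<in> U \<and> \<tau> z = p'. card (nbrs z) * f z)"
proof -
  let ?P = "{v. v \<in> U \<and> \<tau> v = p}" and ?Q = "{v. v \<in> U \<and> \<tau> v = p'}"
  have side: "\<tau> z = p' \<longleftrightarrow> \<tau> v = p" if "v \<in> U" "z \<in> nbrs v" for v z
  proof -
    have "z \<in> U" using that nbrs_subset by blast
    then show ?thesis
      using type_nbrs[OF that] type_cases[OF that(1)] type_cases[of z] assms types(1)
      by (auto simp: doubleton_eq_iff)
  qed
  have "(\<Sum>v\<in>?P. \<Sum>z\<in>nbrs v. f z) = (\<Sum>v\<in>?P. \<Sum>z | z \<in> ?Q \<and> z \<in> nbrs v. f z)"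
  proof (intro sum.cong HOL.refl)
    fix v assume "v \<in> ?P"
    then show "nbrs v = {z. z \<in> ?Q \<and> z \<in> nbrs v}" using side nbrs_subset by blast
  qed
  also have "\<dots> = (\<Sum>z\<in>?Q. \<Sum>v | v \<in> ?P \<and> z \<in> nbrs v. f z)"
    by (rule sum.swap_restrict) (simp_all add: finite_U)
  also have "\<dots> = (\<Sum>z\<in>?Q. card (nbrs z) * f z)"
  proof (intro sum.cong HOL.refl)
    fix z assume z: "z \<in> ?Q"
    have "{v. v \<in> ?P \<and> z \<in> nbrs v} = nbrs z"
      using z side nbrs_sym nbrs_subset by blast
    then show "(\<Sum>v | v \<in> ?P \<and> z \<in> nbrs v. f z) = card (nbrs z) * f z" by simp
  qed
  finally show ?thesis .
qed

text \<open>Weighted by degrees, the sums over the two sides add up to the mass 0, while summing the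
  eigenvalue equation over one side gives \<theta> times its sum as the sum of the other. For
  positive \<theta> both vanish, and the degree is constant on each side.\<close>

lemma eigenfunction_sides:
  fixes f :: "'v \<Rightarrow> real" and \<theta> :: real
  assumes \<theta>: "0 < \<theta>" and m: "mass \<C> x f = 0"
    and eig: "\<And>v. v \<in> U \<Longrightarrow> (\<Sum>z\<in>nbrs v. f z) = \<theta> * card (nbrs v) * f v"
    and p: "p \<in> {s, t}"
  shows "(\<Sum>v | v \<in> U \<and> \<tau> v = p. f v) = 0"
proof -
  let ?X = "\<lambda>p. \<Sum>v | v \<in> U \<and> \<tau> v = p. card (nbrs v) * f v"
  have step: "\<theta> * ?X p = ?X p'" if "{p, p'} = {s, t}" for p p'
  proof -
    have "\<theta> * ?X p = (\<Sum>v | v \<in> U \<and> \<tau> v = p. \<Sum>z\<in>nbrs v. f z)"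
      unfolding sum_distrib_left by (intro sum.cong HOL.refl) (simp add: eig)
    then show ?thesis using sum_sides[OF that, of f] by simp
  qed
  have "mass \<C> x f = ?X s + ?X t"
  proof -
    have "mass \<C> x f = (\<Sum>v\<in>U. card (nbrs v) * f v)"
      unfolding mass_alt by (intro sum.cong HOL.refl) (simp add: card_nbrs)
    also have "\<dots> = (\<Sum>v\<in>{v. v \<in> U \<and> \<tau> v = s} \<union> {v. v \<in> U \<and> \<tau> v = t}. card (nbrs v) * f v)"
      by (rule sum.cong) (use type_cases in auto)
    also have "\<dots> = ?X s + ?X t"
      by (rule sum.union_disjoint) (use finite_U types(1) in auto)
    finally show ?thesis .
  qed
  then have zero: "?X s + ?X t = 0" using m by simp
  have "\<theta> * ?X s = ?X t" by (rule step) simp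
  then have "(\<theta> + 1) * ?X s = 0" using zero by (simp add: algebra_simps)
  then have "?X s = 0" using \<theta> by simp
  with zero p have Xp: "?X p = 0" by auto
  have deg: "card (nbrs v) = (if p = s then a else b)" if "v \<in> U" "\<tau> v = p" for v
    using that degree_s degree_t card_nbrs types(1) p by auto
  have "?X p = (if p = s then a else b) * (\<Sum>v | v \<in> U \<and> \<tau> v = p. f v)"
    unfolding sum_distrib_left by (intro sum.cong HOL.refl) (use deg in auto)
  moreover have "(if p = s then a else b) \<noteq> 0 \<or> {v. v \<in> U \<and> \<tau> v = p} = {}"
  proof (rule ccontr)
    assume "\<not> ?thesis"
    then obtain v where v: "v \<in> U" "\<tau> v = p" "(if p = s then a else b) = 0" by auto
    then have "card (nbrs v) = 0" using deg by simp
    then show False using c_pos[OF v(1)] card_nbrs[OF v(1)] by simp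
  qed
  ultimately show ?thesis using Xp by (metis (mono_tags, lifting) mult_eq_0_iff of_nat_eq_0_iff sum.empty)
qed

lemma eigen_nbrs:
  fixes f :: "'v \<Rightarrow> real" and \<theta> :: real
  assumes "\<forall>v\<in>U. mass \<C> (insert v x) f = \<theta> * (1 :: nat) * c v * f v" "v \<in> U"
  shows "(\<Sum>z\<in>nbrs v. f z) = \<theta> * card (nbrs v) * f v"
  using bspec[OF assms] mass_nbrs[OF assms(2), of f] card_nbrs[OF assms(2)] by simp

text \<open>The neighbours of a vertex are one full side, over which an eigenfunction with positive
  eigenvalue sums to 0; by the eigenvalue equation it vanishes everywhere.\<close>

lemma complete_gap:
  assumes complete: "\<And>u v. u \<in> U \<Longrightarrow> v \<in> U \<Longrightarrow> \<tau> u \<noteq> \<tau> v \<Longrightarrow> v \<in> nbrs u"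
  shows "gap \<C> 1 x 0"
proof (rule ccontr)
  assume "\<not> ?thesis"
  then obtain \<theta> :: real and f where \<theta>: "0 < \<theta>" and f: "mass \<C> x f = 0" "mass \<C> x (\<lambda>v. (f v)\<^sup>2) = 1"
    and e: "\<forall>v\<in>U. mass \<C> (insert v x) f = \<theta> * (1 :: nat) * c v * f v"
    using gap_or_eigenfunction[of 0] by auto
  have "f v = 0" if v: "v \<in> U" for v
  proof -
    define p where "p = (if \<tau> v = s then t else s)"
    have "nbrs v = {z. z \<in> U \<and> \<tau> z = p}"
    proof (intro equalityI subsetI)
      fix z assume z: "z \<in> nbrs v"
      then have "z \<in> U" using nbrs_subset by blast
      then show "z \<in> {z. z \<in> U \<and> \<tau> z = p}"
        using type_nbrs[OF v z] type_cases[OF v] type_cases[of z] types(1) by (auto simp: p_def)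
    next
      fix z assume "z \<in> {z. z \<in> U \<and> \<tau> z = p}"
      then show "z \<in> nbrs v" using complete[OF v, of z] types(1) by (auto simp: p_def split: if_splits)
    qed
    moreover have "(\<Sum>z | z \<in> U \<and> \<tau> z = p. f z) = 0"
      by (rule eigenfunction_sides[OF \<theta> f(1) eigen_nbrs[OF e]]) (simp_all add: p_def)
    ultimately have "\<theta> * c v * f v = 0" using eigen_nbrs[OF e v] card_nbrs[OF v] by simp
    then show ?thesis using \<theta> c_pos[OF v] by simp
  qed
  then show False using f(2) by (simp add: mass_alt)
qed

text \<open>The sums of an eigenfunction over the vertices at distance \<open>j\<close>, \<open>j - 2\<close>, \<dots> from a fixed
  vertex satisfy a three-term recursion. An eigenvalue above \<open>2 / sqrt q\<close> would keep them positive,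
  but the last one is the sum over all vertices of one type, which vanishes.\<close>

lemma polygon_gap:
  fixes q :: real and d :: "'v \<Rightarrow> 'v \<Rightarrow> nat" and k :: "'v \<Rightarrow> nat"
  assumes q: "0 < q" "q \<le> a" "q \<le> b"
    and d0: "\<And>v y. v \<in> U \<Longrightarrow> y \<in> U \<Longrightarrow> d v y = 0 \<longleftrightarrow> y = v"
    and dk: "\<And>v y. v \<in> U \<Longrightarrow> y \<in> U \<Longrightarrow> d v y \<le> k v" and k: "\<And>v. v \<in> U \<Longrightarrow> 1 \<le> k v"
    and step: "\<And>v y z. v \<in> U \<Longrightarrow> y \<in> U \<Longrightarrow> z \<in> nbrs y \<Longrightarrow> d v z = d v y + 1 \<or> d v y = d v z + 1"
    and even: "\<And>v y. v \<in> U \<Longrightarrow> y \<in> U \<Longrightarrow> even (d v y) \<longleftrightarrow> \<tau> y = \<tau> v"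
    and closer: "\<And>v y. v \<in> U \<Longrightarrow> y \<in> U \<Longrightarrow> 0 < d v y \<Longrightarrow> d v y < k v \<Longrightarrow> card {z \<in> nbrs y. d v z < d v y} = 1"
  shows "gap \<C> 1 x (2 / sqrt q)"
proof (rule ccontr)
  assume "\<not> ?thesis"
  then obtain \<theta> :: real and f where \<theta>: "2 / sqrt q < \<theta>" and f: "mass \<C> x f = 0" "mass \<C> x (\<lambda>v. (f v)\<^sup>2) = 1"
    and e: "\<forall>v\<in>U. mass \<C> (insert v x) f = \<theta> * (1 :: nat) * c v * f v"
    using gap_or_eigenfunction[of "2 / sqrt q"] by auto
  have "0 < 2 / sqrt q" using q(1) by simp
  then have \<theta>0: "0 < \<theta>" using \<theta> by linarith
  have \<theta>q: "4 \<le> \<theta>\<^sup>2 * q"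
  proof -
    have "2 \<le> \<theta> * sqrt q" using \<theta> q(1) by (simp add: field_simps)
    then have "2\<^sup>2 \<le> (\<theta> * sqrt q)\<^sup>2" by (rule power_mono) simp
    then show ?thesis using q(1) by (simp add: power_mult_distrib)
  qed
  have "\<exists>v\<in>U. f v \<noteq> 0"
  proof (rule ccontr)
    assume "\<not> ?thesis"
    then have "mass \<C> x (\<lambda>v. (f v)\<^sup>2) = 0" by (simp add: mass_alt)
    then show False using f(2) by simp
  qed
  then obtain v0 where v0: "v0 \<in> U" "f v0 \<noteq> 0" by blast
  \<comment> \<open>Normalised to be 1 at \<open>v0\<close>, from where all distances are
    measured.\<close>
  define g where "g v = f v / f v0" for v
  have eig: "(\<Sum>z\<in>nbrs v. g z) = \<theta> * card (nbrs v) * g v" if "v \<in> U" for v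
    using eigen_nbrs[OF e that] by (simp add: g_def sum_divide_distrib[symmetric])
  have sides: "(\<Sum>v | v \<in> U \<and> \<tau> v = p. g v) = 0" if "p \<in> {s, t}" for p
    using eigenfunction_sides[OF \<theta>0 f(1) eigen_nbrs[OF e] that] by (simp add: g_def sum_divide_distrib[symmetric])
  define h where "h = d v0"
  define n where "n = k v0"
  define p1 where "p1 = (if \<tau> v0 = s then t else s)"
  have pU: "\<tau> y = (if even (h y) then \<tau> v0 else p1)" if "y \<in> U" for y
    using even[OF v0(1) that] type_cases[OF that] type_cases[OF v0(1)] by (auto simp: h_def p1_def)
  define D where "D j = (if even j \<longleftrightarrow> \<tau> v0 = s then a else b)" for j :: nat
  have D: "card (nbrs y) = D (h y)" if "y \<in> U" for y
    using pU[OF that] type_cases[OF v0(1)] card_nbrs[OF that] degree_s[OF that] degree_t[OF that] types(1)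
    by (auto simp: D_def p1_def split: if_splits)
  have DD: "D (Suc (Suc j)) = D j" for j by (simp add: D_def)
  have Dq: "q \<le> D j" for j using q by (simp add: D_def)
  define S where "S j = (\<Sum>y | y \<in> U \<and> h y = j. g y)" for j
  \<comment> \<open>Sum the eigenvalue equation over the sphere of radius \<open>j\<close>. A vertex
    of the next sphere is met once, through its only closer neighbour; here \<open>Suc j < n\<close>
    is essential. A vertex of the previous sphere is met from all its neighbours but the closer one,
    and the centre, which has no closer neighbour, from all of them.\<close>
  have S_step: "\<theta> * D j * S j = S (Suc j) + (if j = 0 then 0 else (real (D (j - 1)) - (if j = 1 then 0 else 1)) * S (j - 1))"
    if j: "Suc j < n" for j
  proof -
    let ?L = "\<lambda>i. {y. y \<in> U \<and> h y = i}"
    have "\<theta> * D j * S j = (\<Sum>y\<in>?L j. \<Sum>z\<in>nbrs y. g z)"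
      unfolding S_def sum_distrib_left by (intro sum.cong HOL.refl) (use eig D in auto)
    also have "\<dots> = (\<Sum>y\<in>?L j. \<Sum>z | z \<in> U \<and> z \<in> nbrs y. g z)"
      by (intro sum.cong HOL.refl) (use nbrs_subset in auto)
    also have "\<dots> = (\<Sum>z\<in>U. \<Sum>y | y \<in> ?L j \<and> z \<in> nbrs y. g z)"
      by (rule sum.swap_restrict) (simp_all add: finite_U)
    also have "\<dots> = (\<Sum>z\<in>U. card {y \<in> nbrs z. h y = j} * g z)"
    proof (intro sum.cong HOL.refl)
      fix z assume z: "z \<in> U"
      have "{y. y \<in> ?L j \<and> z \<in> nbrs y} = {y \<in> nbrs z. h y = j}"
        using nbrs_sym nbrs_subset z by blast
      then show "(\<Sum>y | y \<in> ?L j \<and> z \<in> nbrs y. g z) = card {y \<in> nbrs z. h y = j} * g z" by simp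
    qed
    also have "\<dots> = (\<Sum>z\<in>U. (if h z = Suc j then g z else 0) +
      (if h z = j - 1 \<and> j \<noteq> 0 then (real (D (j - 1)) - (if j = 1 then 0 else 1)) * g z else 0))"
    proof (intro sum.cong HOL.refl)
      fix z assume z: "z \<in> U"
      have st: "h y = h z + 1 \<or> h z = h y + 1" if "y \<in> nbrs z" for y
        using step[OF v0(1) z that] by (simp add: h_def)
      consider "h z = Suc j" | "j \<noteq> 0" "h z = j - 1" | "h z \<noteq> Suc j" "j = 0 \<or> h z \<noteq> j - 1"
        by metis
      then show "card {y \<in> nbrs z. h y = j} * g z = (if h z = Suc j then g z else 0) +
        (if h z = j - 1 \<and> j \<noteq> 0 then (real (D (j - 1)) - (if j = 1 then 0 else 1)) * g z else 0)"
      proof cases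
        case 1
        have "{y \<in> nbrs z. h y = j} = {y \<in> nbrs z. d v0 y < d v0 z}"
          using st 1 unfolding h_def by fastforce
        then have "card {y \<in> nbrs z. h y = j} = 1"
          using closer[OF v0(1) z] 1 j by (simp add: h_def n_def)
        moreover have "h z \<noteq> j - 1" using 1 by arith
        ultimately show ?thesis using 1 by simp
      next
        case 2
        have "nbrs z = {y \<in> nbrs z. h y = j} \<union> {y \<in> nbrs z. d v0 y < d v0 z}"
          using st 2 unfolding h_def by fastforce
        moreover have "{y \<in> nbrs z. h y = j} \<inter> {y \<in> nbrs z. d v0 y < d v0 z} = {}"
          using 2 by (auto simp: h_def)
        ultimately have "card (nbrs z) = card {y \<in> nbrs z. h y = j} + card {y \<in> nbrs z. d v0 y < d v0 z}"
          using finite_nbrs[of z] by (metis (no_types, lifting) card_Un_disjoint finite_Un)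
        moreover have "card {y \<in> nbrs z. d v0 y < d v0 z} = (if j = 1 then 0 else 1)"
        proof (cases "j = 1")
          case True
          then have "d v0 z = 0" using 2 by (simp add: h_def)
          then show ?thesis using True by simp
        next
          case False
          then show ?thesis using closer[OF v0(1) z] 2 j by (simp add: h_def n_def)
        qed
        moreover have "card (nbrs z) = D (j - 1)" using D[OF z] 2 by simp
        ultimately have "real (card {y \<in> nbrs z. h y = j}) = real (D (j - 1)) - (if j = 1 then 0 else 1)"
          by (auto split: if_splits)
        then show ?thesis using 2 by simp
      next
        case 3
        have "{y \<in> nbrs z. h y = j} = {}" using st 3 by fastforce
        then have "card {y \<in> nbrs z. h y = j} = 0" by (simp only: card.empty)
        moreover have "\<not> (h z = j - 1 \<and> j \<noteq> 0)" using 3(2) by blast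
        ultimately show ?thesis using 3(1) by (simp only: if_False)
      qed
    qed
    also have "\<dots> = S (Suc j) + (if j = 0 then 0 else (real (D (j - 1)) - (if j = 1 then 0 else 1)) * S (j - 1))"
      unfolding sum.distrib S_def sum_distrib_left
      by (cases "j = 0") (simp_all add: sum.inter_filter[OF finite_U, symmetric] finite_U)
    finally show ?thesis .
  qed
  \<comment> \<open>\<open>W j\<close> adds up the spheres of radius \<open>j - 1\<close>,
    \<open>j - 3\<close>, and so on. In the recursion for these sums the exceptional coefficient at
    the centre disappears, and \<open>W n\<close> exhausts one side because no distance exceeds
    \<open>n\<close>.\<close>
  define W where "W j = (\<Sum>y | y \<in> U \<and> h y < j \<and> (odd (h y) \<longleftrightarrow> even j). g y)" for j
  have W0: "W 0 = 0" by (simp add: W_def)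
  have L0: "{y. y \<in> U \<and> h y = 0} = {v0}" using d0[OF v0(1)] v0(1) by (auto simp: h_def)
  have W1: "W (Suc 0) = 1"
  proof -
    have "{y. y \<in> U \<and> h y < Suc 0 \<and> (odd (h y) \<longleftrightarrow> even (Suc 0))} = {v0}"
      unfolding L0[symmetric] by auto
    then show ?thesis unfolding W_def using v0(2) by (simp add: g_def)
  qed
  have S0: "S 0 = 1"
    unfolding S_def L0 using v0(2) by (simp add: g_def)
  have W_Suc: "W (Suc (Suc j)) = S (Suc j) + W j" for j
  proof -
    have "{y. y \<in> U \<and> h y < Suc (Suc j) \<and> (odd (h y) \<longleftrightarrow> even (Suc (Suc j)))} =
        {y. y \<in> U \<and> h y = Suc j} \<union> {y. y \<in> U \<and> h y < j \<and> (odd (h y) \<longleftrightarrow> even j)}"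
      by (auto simp: less_Suc_eq)
    then show ?thesis unfolding W_def S_def
      by (simp only:) (rule sum.union_disjoint; use finite_U in auto)
  qed
  have W_rec: "W (Suc (Suc j)) = \<theta> * D j * W (Suc j) - (real (D (Suc j)) - 1) * W j" if "Suc j < n" for j
    using that
  proof (induction j rule: less_induct)
    case (less j)
    consider "j = 0" | "j = 1" | i where "j = Suc (Suc i)" by (metis One_nat_def old.nat.exhaust)
    then show ?case
    proof cases
      case 1
      then show ?thesis using S_step[OF less.prems] W_Suc[of 0] W0 W1 S0 by simp
    next
      case 2
      have "W (Suc (Suc 0)) = S (Suc 0)" using W_Suc[of 0] W0 by simp
      moreover have "\<theta> * D 1 * S 1 = S (Suc 1) + D 0 * S 0" using S_step[OF less.prems] 2 by simp
      ultimately show ?thesis using 2 W_Suc[of 1] W1 S0 DD[of 0] by (simp add: algebra_simps)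
    next
      case 3
      have "W (Suc (Suc i)) = \<theta> * D i * W (Suc i) - (real (D (Suc i)) - 1) * W i"
        using less.IH[of i] less.prems 3 by simp
      moreover have "\<theta> * D j * S j = S (Suc j) + (real (D (Suc i)) - 1) * S (Suc i)"
        using S_step[OF less.prems] 3 by simp
      ultimately show ?thesis
        using 3 W_Suc[of j] W_Suc[of "Suc i"] W_Suc[of i] DD[of i] DD[of "Suc i"] by (simp add: algebra_simps)
    qed
  qed
  \<comment> \<open>Half of the positive term of the recursion survives as a lower bound. That the
    subtracted term takes at most the other half needs
    \<open>4 \<le> \<theta>\<^sup>2 * D (Suc j)\<close>, and this is what
    \<open>2 / sqrt q < \<theta>\<close> provides.\<close>
  have pos: "0 < W (Suc j) \<and> (Suc j < n \<longrightarrow> \<theta> / 2 * D j * W (Suc j) \<le> W (Suc (Suc j)))" if "j < n" for j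
    using that
  proof (induction j)
    case 0
    show ?case
    proof (intro conjI impI)
      show "0 < W (Suc 0)" using W1 by simp
      assume "Suc 0 < n"
      then have "W (Suc (Suc 0)) = \<theta> * D 0" using W_rec[of 0] W0 W1 by simp
      then show "\<theta> / 2 * D 0 * W (Suc 0) \<le> W (Suc (Suc 0))" using \<theta>0 W1 by simp
    qed
  next
    case (Suc j)
    then have IH: "0 < W (Suc j)" "\<theta> / 2 * D j * W (Suc j) \<le> W (Suc (Suc j))" by simp_all
    have Dpos: "0 < real (D i)" for i using Dq[of i] q(1) by linarith
    have W2: "0 < W (Suc (Suc j))"
    proof -
      have "0 < \<theta> / 2 * D j * W (Suc j)" using \<theta>0 Dpos IH(1) by simp
      then show ?thesis using IH(2) by linarith
    qed
    have "\<theta> / 2 * D (Suc j) * W (Suc (Suc j)) \<le> W (Suc (Suc (Suc j)))" if "Suc (Suc j) < n"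
    proof -
      have "W (Suc (Suc (Suc j))) = \<theta> * D (Suc j) * W (Suc (Suc j)) - (real (D j) - 1) * W (Suc j)"
        using W_rec[OF that] DD[of j] by simp
      moreover have "(real (D j) - 1) * W (Suc j) \<le> D j * W (Suc j)" using IH(1) by (intro mult_right_mono) auto
      moreover have "D j * W (Suc j) \<le> 2 / \<theta> * W (Suc (Suc j))" using IH(2) \<theta>0 by (simp add: field_simps)
      moreover have "2 / \<theta> * W (Suc (Suc j)) \<le> \<theta> / 2 * D (Suc j) * W (Suc (Suc j))"
      proof (rule mult_right_mono)
        have "4 \<le> \<theta>\<^sup>2 * D (Suc j)"
          using \<theta>q mult_left_mono[OF Dq[of "Suc j"], of "\<theta>\<^sup>2"] by simp
        then show "2 / \<theta> \<le> \<theta> / 2 * D (Suc j)" using \<theta>0 by (simp add: field_simps power2_eq_square)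
      qed (use W2 in simp)
      moreover have "\<theta> * D (Suc j) * W (Suc (Suc j)) = 2 * (\<theta> / 2 * D (Suc j) * W (Suc (Suc j)))" by simp
      ultimately show ?thesis by linarith
    qed
    then show ?case using W2 by simp
  qed
  have n: "1 \<le> n" using k[OF v0(1)] by (simp add: n_def)
  then have "0 < W n" using pos[of "n - 1"] by simp
  moreover have "W n = 0"
  proof -
    define p where "p = (if odd n then \<tau> v0 else p1)"
    have "{y. y \<in> U \<and> h y < n \<and> (odd (h y) \<longleftrightarrow> even n)} = {y. y \<in> U \<and> \<tau> y = p}"
    proof (intro equalityI subsetI)
      fix y assume y: "y \<in> {y. y \<in> U \<and> h y < n \<and> (odd (h y) \<longleftrightarrow> even n)}"
      then show "y \<in> {y. y \<in> U \<and> \<tau> y = p}" using pU[of y] by (auto simp: p_def)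
    next
      fix y assume y: "y \<in> {y. y \<in> U \<and> \<tau> y = p}"
      have "p1 \<noteq> \<tau> v0" using types(1) by (auto simp: p1_def)
      then have "odd (h y) \<longleftrightarrow> even n" using y pU[of y] by (auto simp: p_def split: if_splits)
      moreover have "h y \<le> n" using dk[OF v0(1)] y by (simp add: h_def n_def)
      ultimately show "y \<in> {y. y \<in> U \<and> h y < n \<and> (odd (h y) \<longleftrightarrow> even n)}"
        using y by (auto simp: le_less)
    qed
    then show ?thesis using sides[of p] type_cases[OF v0(1)] by (auto simp: W_def p_def p1_def)
  qed
  ultimately show False by simp
qed

end

section \<open>Polygons\<close>

definition edge_rel :: "'v set set \<Rightarrow> 'v rel" where
  "edge_rel E = {(u, v). {u, v} \<in> E}"

definition graph_iso :: "('v \<Rightarrow> 'v) \<Rightarrow> 'v set set \<Rightarrow> 'v set set \<Rightarrow> bool" where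
  "graph_iso f P Q \<longleftrightarrow> bij_betw f (\<Union>P) (\<Union>Q) \<and> (\<lambda>e. f ` e) ` P = Q"

lemma graph_iso_edge: "graph_iso f P Q \<Longrightarrow> {u, v} \<in> P \<Longrightarrow> {f u, f v} \<in> Q"
  using imageI[of "{u, v}" P "\<lambda>e. f ` e"] by (simp add: graph_iso_def)

lemma graph_iso_comp:
  assumes "graph_iso f P Q" "graph_iso g Q R"
  shows "graph_iso (g \<circ> f) P R"
proof -
  have "(\<lambda>e. (g \<circ> f) ` e) ` P = (\<lambda>e. g ` e) ` (\<lambda>e. f ` e) ` P" by (simp add: image_image image_comp)
  then show ?thesis using assms bij_betw_trans[of f "\<Union>P" "\<Union>Q" g "\<Union>R"] by (simp add: graph_iso_def)
qed

lemma relpow_map: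
  assumes "\<And>u v. (u, v) \<in> R \<Longrightarrow> (f u, f v) \<in> S" "(a, b) \<in> R ^^ n"
  shows "(f a, f b) \<in> S ^^ n"
  using assms(2)
proof (induction n arbitrary: b)
  case (Suc n)
  then obtain c where "(a, c) \<in> R ^^ n" "(c, b) \<in> R" by auto
  then show ?case using Suc.IH assms(1) by auto
qed simp

text \<open>The building axioms in rank two, in terms of graphs. Finite, connected and with all
  degrees 2, the members of \<open>\<P>\<close> are single closed polygons; connectedness says that
  no proper nonempty set of edges is closed under sharing a vertex.\<close>

locale polygon_system =
  fixes E :: "'v set set" and \<P> :: "'v set set set" and col :: "'v \<Rightarrow> bool"
  assumes finite_E: "finite E"
    and two: "e \<in> E \<Longrightarrow> card e = 2"
    and bipartite: "{u, v} \<in> E \<Longrightarrow> col u \<noteq> col v"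
    and sub: "P \<in> \<P> \<Longrightarrow> P \<subseteq> E"
    and common: "e \<in> E \<Longrightarrow> e' \<in> E \<Longrightarrow> \<exists>P\<in>\<P>. e \<in> P \<and> e' \<in> P"
    and iso_edge: "P \<in> \<P> \<Longrightarrow> Q \<in> \<P> \<Longrightarrow> e \<in> P \<Longrightarrow> e \<in> Q \<Longrightarrow> y \<in> \<Union>P \<Longrightarrow> y \<in> \<Union>Q \<Longrightarrow>
      \<exists>f. graph_iso f P Q \<and> (\<forall>v\<in>e. f v = v) \<and> f y = y"
    and iso_vertex: "P \<in> \<P> \<Longrightarrow> Q \<in> \<P> \<Longrightarrow> y \<in> \<Union>P \<Longrightarrow> y \<in> \<Union>Q \<Longrightarrow> \<exists>f. graph_iso f P Q \<and> f y = y"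
    and degree: "P \<in> \<P> \<Longrightarrow> v \<in> \<Union>P \<Longrightarrow> card {e \<in> P. v \<in> e} = 2"
    and connected: "P \<in> \<P> \<Longrightarrow> Q \<subseteq> P \<Longrightarrow> Q \<noteq> {} \<Longrightarrow>
      (\<And>e e'. e \<in> Q \<Longrightarrow> e' \<in> P \<Longrightarrow> e \<inter> e' \<noteq> {} \<Longrightarrow> e' \<in> Q) \<Longrightarrow> Q = P"
begin

lemma edge_distinct: "{u, v} \<in> E \<Longrightarrow> u \<noteq> v"
  using two[of "{u, v}"] by auto

lemma edge_cases: "e \<in> E \<Longrightarrow> v \<in> e \<Longrightarrow> \<exists>u. e = {v, u} \<and> u \<noteq> v"
  using two[of e] unfolding card_2_iff by blast

lemma other_edge:
  assumes "P \<in> \<P>" "{v, u} \<in> P" "{v, w} \<in> P" "u \<noteq> w" "e \<in> P" "v \<in> e"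
  shows "e = {v, u} \<or> e = {v, w}"
proof -
  have "v \<in> \<Union>P" using assms(2) by blast
  then have c: "card {e \<in> P. v \<in> e} = 2" by (rule degree[OF assms(1)])
  moreover have "{{v, u}, {v, w}} \<subseteq> {e \<in> P. v \<in> e}" using assms(2,3) by blast
  moreover have "card {{v, u}, {v, w}} = 2" using assms(4) by (simp add: doubleton_eq_iff)
  moreover have "finite {e \<in> P. v \<in> e}" by (rule card_ge_0_finite) (simp only: c)
  ultimately have "{{v, u}, {v, w}} = {e \<in> P. v \<in> e}" by (intro card_subset_eq) simp_all
  then show ?thesis using assms(5,6) by blast
qed

text \<open>Agreement spreads along the polygon: if the maps agree on an edge, then at each of its
  ends both send the next edge to the one remaining edge of the target.\<close>

lemma rigid:
  assumes PA: "P \<in> \<P>" "A \<in> \<P>" and f: "graph_iso f P A" and g: "graph_iso g P A"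
    and e: "e \<in> P" "\<And>v. v \<in> e \<Longrightarrow> f v = g v" and y: "y \<in> \<Union>P"
  shows "f y = g y"
proof -
  define Q where "Q = {e \<in> P. \<forall>v\<in>e. f v = g v}"
  have "Q = P"
  proof (rule connected[OF PA(1)])
    show "Q \<noteq> {}" "Q \<subseteq> P" using e unfolding Q_def by blast+
    fix e1 e2 assume e1: "e1 \<in> Q" and e2: "e2 \<in> P" and "e1 \<inter> e2 \<noteq> {}"
    then obtain v where v: "v \<in> e1" "v \<in> e2" by blast
    have e1P: "e1 \<in> P" using e1 by (simp add: Q_def)
    obtain u where u: "e1 = {v, u}" "u \<noteq> v" using edge_cases[of e1 v] e1P sub[OF PA(1)] v by blast
    obtain w where w: "e2 = {v, w}" "w \<noteq> v" using edge_cases[of e2 v] e2 sub[OF PA(1)] v by blast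
    have same: "f v = g v" "f u = g u" using e1 u by (simp_all add: Q_def)
    show "e2 \<in> Q"
    proof (cases "u = w")
      case True
      then show ?thesis using e1 u w by simp
    next
      case False
      have uw: "u \<in> \<Union>P" "w \<in> \<Union>P" using e1P e2 u w by blast+
      have "f u \<noteq> f w" "g u \<noteq> g w"
        using f g uw False unfolding graph_iso_def bij_betw_def by (metis inj_onD)+
      have fe: "{f v, f u} \<in> A" "{f v, f w} \<in> A" using graph_iso_edge[OF f] e1P e2 u w by blast+
      have ge: "{g v, g w} \<in> A" using graph_iso_edge[OF g] e2 w by blast
      have "{g v, g w} = {f v, f u} \<or> {g v, g w} = {f v, f w}"
        by (rule other_edge[OF PA(2) fe \<open>f u \<noteq> f w\<close> ge]) (simp add: same)
      then have "g w = f w"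
        using same \<open>g u \<noteq> g w\<close> by (metis doubleton_eq_iff)
      then show ?thesis using e2 w same by (simp add: Q_def)
    qed
  qed
  then show ?thesis using y unfolding Q_def by blast
qed

text \<open>The retraction onto \<open>A\<close> centred at \<open>e\<close>: every edge shares a
  polygon with \<open>e\<close>, and the isomorphisms of these polygons to \<open>A\<close> that fix
  \<open>e\<close> are glued together by rigidity. They are injective, so an edge leaving
  \<open>e\<close> is not folded back onto \<open>e\<close>.\<close>

lemma retraction:
  assumes A: "A \<in> \<P>" and e: "e \<in> A"
  shows "\<exists>\<rho>. (\<forall>y z. {y, z} \<in> E \<longrightarrow> {\<rho> y, \<rho> z} \<in> A) \<and> (\<forall>y\<in>\<Union>A. \<rho> y = y) \<and>
    (\<forall>p z. p \<in> e \<longrightarrow> {p, z} \<in> E \<longrightarrow> z \<notin> e \<longrightarrow> \<rho> z \<notin> e)"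
proof -
  have eE: "e \<in> E" using sub[OF A] e by blast
  define good where "good P f \<longleftrightarrow> P \<in> \<P> \<and> e \<in> P \<and> graph_iso f P A \<and> (\<forall>v\<in>e. f v = v)" for P f
  have unique: "f y = g y" if P: "good P f" "y \<in> \<Union>P" and Q: "good Q g" "y \<in> \<Union>Q" for P f Q g y
  proof -
    obtain h where h: "graph_iso h P Q" "\<forall>v\<in>e. h v = v" "h y = y"
      using iso_edge[of P Q e y] P Q unfolding good_def by blast
    have "(g \<circ> h) y = f y"
    proof (rule rigid[of P A "g \<circ> h" f e])
      show "graph_iso (g \<circ> h) P A" using graph_iso_comp[OF h(1)] Q(1) unfolding good_def by blast
      show "(g \<circ> h) v = f v" if "v \<in> e" for v using that h(2) P(1) Q(1) unfolding good_def by simp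
    qed (use P A in \<open>simp_all add: good_def\<close>)
    then show ?thesis using h(3) by simp
  qed
  \<comment> \<open>By \<open>unique\<close> the value does not depend on the polygon chosen through
    \<open>y\<close>.\<close>
  define \<rho> where "\<rho> y = (SOME z. \<exists>P f. good P f \<and> y \<in> \<Union>P \<and> z = f y)" for y
  have \<rho>: "\<rho> y = f y" if P: "good P f" "y \<in> \<Union>P" for P f y
  proof -
    have "\<exists>P f. good P f \<and> y \<in> \<Union>P \<and> \<rho> y = f y"
      unfolding \<rho>_def by (rule someI_ex) (use P in blast)
    then obtain Q g where "good Q g" "y \<in> \<Union>Q" "\<rho> y = g y" by blast
    then show ?thesis using unique[OF P, of Q g] by simp
  qed
  have good_edge: "\<exists>P f. good P f \<and> e' \<in> P" if e': "e' \<in> E" for e'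
  proof -
    obtain P where P: "P \<in> \<P>" "e \<in> P" "e' \<in> P" using common[OF eE e'] by blast
    obtain p where p: "p \<in> e" using two[OF eE] by fastforce
    then have "\<exists>f. graph_iso f P A \<and> (\<forall>v\<in>e. f v = v) \<and> f p = p"
      using iso_edge[OF P(1) A P(2) e] P(2) e by blast
    then show ?thesis using P unfolding good_def by blast
  qed
  show ?thesis
  proof (intro exI[of _ \<rho>] conjI allI impI ballI)
    fix y z assume "{y, z} \<in> E"
    then obtain P f where P: "good P f" "{y, z} \<in> P" using good_edge by blast
    have "\<rho> y = f y" "\<rho> z = f z" using \<rho>[OF P(1)] P(2) by blast+
    then show "{\<rho> y, \<rho> z} \<in> A" using graph_iso_edge[of f P A y z] P unfolding good_def by simp
  next
    fix y assume y: "y \<in> \<Union>A"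
    have "good A id" using A e unfolding good_def graph_iso_def by simp
    then show "\<rho> y = y" using \<rho> y by fastforce
  next
    fix p z assume p: "p \<in> e" and pz: "{p, z} \<in> E" and z: "z \<notin> e"
    obtain P f where P: "good P f" "{p, z} \<in> P" using good_edge[OF pz] by blast
    have zP: "z \<in> \<Union>P" using P(2) by blast
    have inj: "inj_on f (\<Union>P)" and fe: "\<forall>v\<in>e. f v = v" "e \<subseteq> \<Union>P"
      using P(1) unfolding good_def graph_iso_def bij_betw_def by blast+
    show "\<rho> z \<notin> e"
    proof
      assume "\<rho> z \<in> e"
      then have "f z \<in> e" using \<rho>[OF P(1) zP] by simp
      then have "f (f z) = f z" "f z \<in> \<Union>P" using fe by blast+
      then have "f z = z" using inj_onD[OF inj] zP by blast
      then show False using \<open>f z \<in> e\<close> z by simp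
    qed
  qed
qed

section \<open>Distances in a polygon system\<close>

abbreviation "U \<equiv> \<Union>E"

definition dist :: "'v \<Rightarrow> 'v \<Rightarrow> nat" where
  "dist u v = (LEAST n. (u, v) \<in> edge_rel E ^^ n)"

lemma dist_le: "(u, v) \<in> edge_rel E ^^ n \<Longrightarrow> dist u v \<le> n"
  unfolding dist_def by (rule Least_le)

lemma edge_rel_mono: "P \<subseteq> Q \<Longrightarrow> (u, v) \<in> edge_rel P ^^ n \<Longrightarrow> (u, v) \<in> edge_rel Q ^^ n"
  using relpow_map[of "edge_rel P" "\<lambda>u. u" "edge_rel Q" u v n] by (auto simp: edge_rel_def)

lemma reachable:
  assumes u: "u \<in> U" and v: "v \<in> U"
  shows "\<exists>n. (u, v) \<in> edge_rel E ^^ n"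
proof -
  obtain e e' where e: "e \<in> E" "u \<in> e" and e': "e' \<in> E" "v \<in> e'" using u v by blast
  obtain P where P: "P \<in> \<P>" "e \<in> P" "e' \<in> P" using common[OF e(1) e'(1)] by blast
  define Q where "Q = {f \<in> P. \<forall>w\<in>f. (u, w) \<in> (edge_rel E)\<^sup>*}"
  have reach: "(u, w) \<in> (edge_rel E)\<^sup>*" if f: "f \<in> E" "w \<in> f" "x \<in> f" "(u, x) \<in> (edge_rel E)\<^sup>*" for f w x
  proof (cases "w = x")
    case False
    obtain y where "f = {x, y}" using edge_cases[OF f(1,3)] by blast
    then have "f = {x, w}" using f(2) False by blast
    then have "(x, w) \<in> edge_rel E" using f(1) by (simp add: edge_rel_def)
    then show ?thesis using f(4) by (rule rtrancl.rtrancl_into_rtrancl[rotated])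
  qed (use f in simp)
  have "Q = P"
  proof (rule connected[OF P(1)])
    show "Q \<subseteq> P" unfolding Q_def by blast
    have "e \<in> Q" unfolding Q_def using P(2) reach[OF e(1) _ e(2)] by blast
    then show "Q \<noteq> {}" by blast
    fix f f' assume f: "f \<in> Q" "f' \<in> P" "f \<inter> f' \<noteq> {}"
    then obtain x where x: "x \<in> f" "x \<in> f'" by blast
    have "(u, x) \<in> (edge_rel E)\<^sup>*" using f(1) x(1) unfolding Q_def by blast
    moreover have "f' \<in> E" using f(2) sub[OF P(1)] by blast
    ultimately show "f' \<in> Q" unfolding Q_def using f(2) reach x(2) by blast
  qed
  then have "(u, v) \<in> (edge_rel E)\<^sup>*" using P(3) e'(2) unfolding Q_def by blast
  then show ?thesis by (rule rtrancl_imp_relpow)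
qed

lemma dist_path: "u \<in> U \<Longrightarrow> v \<in> U \<Longrightarrow> (u, v) \<in> edge_rel E ^^ dist u v"
  unfolding dist_def by (rule LeastI_ex) (rule reachable)

lemma dist_edge_le: "v \<in> U \<Longrightarrow> {y, z} \<in> E \<Longrightarrow> dist v z \<le> dist v y + 1"
proof -
  assume v: "v \<in> U" and yz: "{y, z} \<in> E"
  have "(v, y) \<in> edge_rel E ^^ dist v y" by (rule dist_path[OF v]) (use yz in blast)
  then have "(v, z) \<in> edge_rel E ^^ Suc (dist v y)" using yz by (auto simp: edge_rel_def)
  then show ?thesis using dist_le by fastforce
qed

lemma col_path: "(u, v) \<in> edge_rel E ^^ n \<Longrightarrow> even n \<longleftrightarrow> col u = col v"
proof (induction n arbitrary: v)
  case (Suc n)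
  then obtain w where w: "(u, w) \<in> edge_rel E ^^ n" "(w, v) \<in> edge_rel E" by auto
  have "col w \<noteq> col v" using bipartite[of w v] w(2) by (simp add: edge_rel_def)
  moreover have "even n \<longleftrightarrow> col u = col w" by (rule Suc.IH[OF w(1)])
  ultimately show ?case by auto
qed simp

lemma even_dist: "u \<in> U \<Longrightarrow> v \<in> U \<Longrightarrow> even (dist u v) \<longleftrightarrow> col u = col v"
  by (rule col_path) (rule dist_path)

lemma dist_step:
  assumes "v \<in> U" "{y, z} \<in> E"
  shows "dist v z = dist v y + 1 \<or> dist v y = dist v z + 1"
proof -
  have yz: "y \<in> U" "z \<in> U" using assms(2) by blast+
  have "dist v z \<noteq> dist v y"
    using even_dist[OF assms(1) yz(1)] even_dist[OF assms(1) yz(2)] bipartite[OF assms(2)] by auto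
  moreover have "dist v y \<le> dist v z + 1"
    using dist_edge_le[OF assms(1), of z y] assms(2) by (simp add: insert_commute)
  ultimately show ?thesis using dist_edge_le[OF assms] by arith
qed

lemma dist_zero: "v \<in> U \<Longrightarrow> y \<in> U \<Longrightarrow> dist v y = 0 \<longleftrightarrow> y = v"
proof -
  assume v: "v \<in> U" and y: "y \<in> U"
  have "y = v" if "dist v y = 0" using dist_path[OF v y] that by simp
  moreover have "dist v v \<le> 0" by (rule dist_le) simp
  ultimately show ?thesis by auto
qed

lemma geodesic:
  assumes f: "f 0 = v" "f n = y" "\<And>i. i < n \<Longrightarrow> (f i, f (Suc i)) \<in> edge_rel E"
    and n: "dist v y = n" and i: "i \<le> n" and v: "v \<in> U"
  shows "dist v (f i) = i"
proof -
  have path: "(f a, f (a + k)) \<in> edge_rel E ^^ k" if "a + k \<le> n" for a k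
    using that
  proof (induction k)
    case (Suc k)
    then have "(f a, f (a + k)) \<in> edge_rel E ^^ k" "(f (a + k), f (Suc (a + k))) \<in> edge_rel E"
      using f(3)[of "a + k"] by simp_all
    then show ?case by auto
  qed simp
  have up: "dist v (f i) \<le> i" using path[of 0 i] i f(1) by (intro dist_le) simp
  have "f i \<in> U"
  proof (cases "i = 0")
    case True
    then show ?thesis using f(1) v by simp
  next
    case False
    then have "(f (i - 1), f i) \<in> edge_rel E" using f(3)[of "i - 1"] i by simp
    then show ?thesis by (auto simp: edge_rel_def)
  qed
  then have "(v, f i) \<in> edge_rel E ^^ dist v (f i)" by (rule dist_path[OF v])
  moreover have "(f i, y) \<in> edge_rel E ^^ (n - i)" using path[of i "n - i"] i f(2) by simp
  ultimately have "(v, y) \<in> edge_rel E ^^ (dist v (f i) + (n - i))" by (auto simp: relpow_add)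
  then have "n \<le> dist v (f i) + (n - i)" using dist_le n by blast
  then show ?thesis using up i by arith
qed

text \<open>Two shortest paths in \<open>A\<close> from \<open>v\<close> to \<open>y\<close> that
  arrive through different neighbours also leave \<open>v\<close> through different neighbours.
  Their union is then closed under adjacency in \<open>A\<close>, so it is all of \<open>A\<close>,
  and no vertex of \<open>A\<close> is farther from \<open>v\<close> than \<open>y\<close>.\<close>

lemma two_geodesics:
  assumes A: "A \<in> \<P>" and v: "v \<in> U" and y: "dist v y = Suc j"
    and z: "{y, z1} \<in> A" "{y, z2} \<in> A" "z1 \<noteq> z2"
    and paths: "(v, z1) \<in> edge_rel A ^^ j" "(v, z2) \<in> edge_rel A ^^ j"
    and w: "w \<in> \<Union>A"
  shows "\<exists>i\<le>Suc j. (v, w) \<in> edge_rel A ^^ i"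
proof -
  have ex: "\<exists>f. f 0 = v \<and> f j = z \<and> f (Suc j) = y \<and> (\<forall>i<Suc j. {f i, f (Suc i)} \<in> A)"
    if vz: "(v, z) \<in> edge_rel A ^^ j" and yz: "{y, z} \<in> A" for z
  proof -
    obtain f where f: "f 0 = v" "f j = z" "\<forall>i<j. (f i, f (Suc i)) \<in> edge_rel A"
      using vz unfolding relpow_fun_conv by blast
    let ?f = "f(Suc j := y)"
    have "{?f i, ?f (Suc i)} \<in> A" if "i < Suc j" for i
    proof (cases "i = j")
      case True
      then show ?thesis using f(2) yz by (simp add: insert_commute)
    next
      case False
      then have "i < j" using that by simp
      then have "(f i, f (Suc i)) \<in> edge_rel A" using f(3) by blast
      then show ?thesis using \<open>i < j\<close> by (simp add: edge_rel_def)
    qed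
    then show ?thesis using f(1,2) by (intro exI[of _ ?f]) simp
  qed
  obtain f where f: "f 0 = v" "f j = z1" "f (Suc j) = y" "\<And>i. i < Suc j \<Longrightarrow> {f i, f (Suc i)} \<in> A"
    using ex[OF paths(1) z(1)] by blast
  obtain g where g: "g 0 = v" "g j = z2" "g (Suc j) = y" "\<And>i. i < Suc j \<Longrightarrow> {g i, g (Suc i)} \<in> A"
    using ex[OF paths(2) z(2)] by blast
  have AE: "A \<subseteq> E" by (rule sub[OF A])
  have df: "dist v (f i) = i" if "i \<le> Suc j" for i
    by (rule geodesic[OF f(1,3) _ y that v]) (use f(4) AE in \<open>auto simp: edge_rel_def\<close>)
  have dg: "dist v (g i) = i" if "i \<le> Suc j" for i
    by (rule geodesic[OF g(1,3) _ y that v]) (use g(4) AE in \<open>auto simp: edge_rel_def\<close>)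
  \<comment> \<open>With a common first step, degree 2 and the absence of backtracking would force
    all later steps to coincide, including the arrival at \<open>z1\<close> and
    \<open>z2\<close>.\<close>
  have start: "f 1 \<noteq> g 1" if "0 < j"
  proof
    assume fg: "f 1 = g 1"
    have "f i = g i \<and> f (Suc i) = g (Suc i)" if "Suc i \<le> j" for i
      using that
    proof (induction i)
      case 0
      then show ?case using fg f(1) g(1) by simp
    next
      case (Suc i)
      then have eq: "f i = g i" "f (Suc i) = g (Suc i)" by simp_all
      have i2: "Suc (Suc i) < Suc j" "i < Suc j" "Suc i < Suc j" using Suc.prems by simp_all
      have "{f (Suc i), f i} \<in> A" using f(4)[OF i2(2)] by (simp add: insert_commute)
      moreover have "{f (Suc i), f (Suc (Suc i))} \<in> A" using f(4)[OF i2(3)] .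
      moreover have "f i \<noteq> f (Suc (Suc i))" using df[of i] df[of "Suc (Suc i)"] i2 by force
      moreover have "{g (Suc i), g (Suc (Suc i))} \<in> A" using g(4)[OF i2(3)] .
      ultimately have "{g (Suc i), g (Suc (Suc i))} = {f (Suc i), f i} \<or>
          {g (Suc i), g (Suc (Suc i))} = {f (Suc i), f (Suc (Suc i))}"
        using other_edge[OF A] eq(2) by blast
      moreover have "g (Suc (Suc i)) \<noteq> g i" using dg[of i] dg[of "Suc (Suc i)"] i2 by force
      ultimately have "g (Suc (Suc i)) = f (Suc (Suc i))" using eq by (metis doubleton_eq_iff)
      then show ?case using eq by simp
    qed
    from this[of "j - 1"] that have "f j = g j" by simp
    then show False using f(2) g(2) z(3) by simp
  qed
  have j: "0 < j"
  proof (rule ccontr)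
    assume "\<not> 0 < j"
    then have "z1 = z2" using f(1,2) g(1,2) by simp
    then show False using z(3) by simp
  qed
  have ends: "{v, f 1} \<in> A" "{v, g 1} \<in> A" using f(4)[of 0] g(4)[of 0] f(1) g(1) by simp_all
  define Q where "Q = (\<lambda>i. {f i, f (Suc i)}) ` {..j} \<union> (\<lambda>i. {g i, g (Suc i)}) ` {..j}"
  have inner: "e \<in> (\<lambda>i. {h i, h (Suc i)}) ` {..j}"
    if h: "\<And>i. i < Suc j \<Longrightarrow> {h i, h (Suc i)} \<in> A" "\<And>i. i \<le> Suc j \<Longrightarrow> dist v (h i) = i"
      and i: "Suc i \<le> j" and e: "e \<in> A" "h (Suc i) \<in> e" for h i e
  proof -
    have "{h (Suc i), h i} \<in> A" using h(1)[of i] i by (simp add: insert_commute)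
    moreover have "{h (Suc i), h (Suc (Suc i))} \<in> A" using h(1)[of "Suc i"] i by simp
    moreover have "h i \<noteq> h (Suc (Suc i))" using h(2)[of i] h(2)[of "Suc (Suc i)"] i by force
    ultimately have "e = {h (Suc i), h i} \<or> e = {h (Suc i), h (Suc (Suc i))}"
      using other_edge[OF A] e by blast
    then show ?thesis
    proof
      assume "e = {h (Suc i), h i}"
      then show ?thesis using i by (intro image_eqI[of _ _ i]) auto
    next
      assume "e = {h (Suc i), h (Suc (Suc i))}"
      then show ?thesis using i by (intro image_eqI[of _ _ "Suc i"]) auto
    qed
  qed
  have closed: "e \<in> Q" if e: "e \<in> A" "x \<in> e" "x = f i \<or> x = g i" "i \<le> Suc j" for e x i
  proof -
    consider "i = 0" | "i = Suc j" | k where "i = Suc k" "Suc k \<le> j"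
      using e(4) by (metis le_SucE not0_implies_Suc)
    then show ?thesis
    proof cases
      case 1
      then have "v \<in> e" using e f(1) g(1) by auto
      then have "e = {v, f 1} \<or> e = {v, g 1}" using other_edge[OF A ends start[OF j] e(1)] by blast
      then show ?thesis
      proof
        assume "e = {v, f 1}"
        then show ?thesis unfolding Q_def using f(1) by (intro UnI1 image_eqI[of _ _ 0]) auto
      next
        assume "e = {v, g 1}"
        then show ?thesis unfolding Q_def using g(1) by (intro UnI2 image_eqI[of _ _ 0]) auto
      qed
    next
      case 2
      then have "y \<in> e" using e f(3) g(3) by auto
      then have "e = {y, z1} \<or> e = {y, z2}" using other_edge[OF A z e(1)] by blast
      then show ?thesis
      proof
        assume "e = {y, z1}"
        then show ?thesis unfolding Q_def using f(2,3) by (intro UnI1 image_eqI[of _ _ j]) auto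
      next
        assume "e = {y, z2}"
        then show ?thesis unfolding Q_def using g(2,3) by (intro UnI2 image_eqI[of _ _ j]) auto
      qed
    next
      case 3
      from e(3) show ?thesis
      proof
        assume "x = f i"
        then show ?thesis using inner[of f k e] f(4) df 3 e(1,2) unfolding Q_def by blast
      next
        assume "x = g i"
        then show ?thesis using inner[of g k e] g(4) dg 3 e(1,2) unfolding Q_def by blast
      qed
    qed
  qed
  have "Q = A"
  proof (rule connected[OF A])
    show "Q \<subseteq> A" unfolding Q_def using f(4) g(4) by (auto simp: less_Suc_eq_le)
    show "Q \<noteq> {}" unfolding Q_def by blast
    fix e e' assume e: "e \<in> Q" "e' \<in> A" "e \<inter> e' \<noteq> {}"
    then obtain x where x: "x \<in> e" "x \<in> e'" by blast
    from e(1) x(1) obtain i where "i \<le> Suc j" "x = f i \<or> x = g i"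
      unfolding Q_def by (auto intro: le_SucI)
    then show "e' \<in> Q" using closed[OF e(2) x(2)] by blast
  qed
  then obtain e where e: "e \<in> Q" "w \<in> e" using w by blast
  then obtain i where i: "i \<le> Suc j" "w = f i \<or> w = g i"
    unfolding Q_def by (auto intro: le_SucI)
  have "(h 0, h i) \<in> edge_rel A ^^ i" if "\<And>i. i < Suc j \<Longrightarrow> {h i, h (Suc i)} \<in> A" for h
    using i(1)
  proof (induction i)
    case (Suc i)
    have "(h i, h (Suc i)) \<in> edge_rel A" using that[of i] Suc.prems by (simp add: edge_rel_def)
    then show ?case using Suc by auto
  qed simp
  from this[of f] this[of g] f(1,4) g(1,4) i show ?thesis by auto
qed

text \<open>Take a polygon \<open>A\<close> through \<open>v\<close> and the edge from
  \<open>y\<close> to \<open>z1\<close>, and retract onto it, centred at that edge. Shortest paths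
  to \<open>z1\<close> and \<open>z2\<close> go to paths of the same length in \<open>A\<close>, and
  the image of \<open>z2\<close> is neither \<open>y\<close> nor \<open>z1\<close>. So
  \<open>two_geodesics\<close> applies: \<open>y\<close> is as far from \<open>v\<close> as any
  vertex of \<open>A\<close>.\<close>

lemma unique_closer:
  assumes v: "v \<in> U" and y: "y \<in> U" and z: "{y, z1} \<in> E" "{y, z2} \<in> E" "z1 \<noteq> z2"
    and closer: "dist v z1 < dist v y" "dist v z2 < dist v y" and w: "w \<in> U"
  shows "dist v w \<le> dist v y"
proof -
  obtain j where j: "dist v y = Suc j" using closer(1) by (metis less_nat_zero_code not0_implies_Suc)
  have dz: "dist v z1 = j" "dist v z2 = j" using dist_step[OF v z(1)] dist_step[OF v z(2)] closer j by auto
  have zU: "z1 \<in> U" "z2 \<in> U" using z by blast+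
  obtain ev where ev: "ev \<in> E" "v \<in> ev" using v by blast
  obtain A where A: "A \<in> \<P>" "ev \<in> A" "{y, z1} \<in> A" using common[OF ev(1) z(1)] by blast
  obtain \<rho> where \<rho>: "\<And>a b. {a, b} \<in> E \<Longrightarrow> {\<rho> a, \<rho> b} \<in> A" "\<And>a. a \<in> \<Union>A \<Longrightarrow> \<rho> a = a"
    "\<And>a b. a \<in> {y, z1} \<Longrightarrow> {a, b} \<in> E \<Longrightarrow> b \<notin> {y, z1} \<Longrightarrow> \<rho> b \<notin> {y, z1}"
    using retraction[OF A(1,3)] by metis
  have fix_pts: "\<rho> v = v" "\<rho> y = y" "\<rho> z1 = z1" using \<rho>(2) A(2,3) ev(2) by blast+
  have map: "(\<rho> a, \<rho> b) \<in> edge_rel A ^^ n" if "(a, b) \<in> edge_rel E ^^ n" for a b n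
    by (rule relpow_map[OF _ that]) (use \<rho>(1) in \<open>auto simp: edge_rel_def\<close>)
  have "z2 \<noteq> y" using edge_distinct[OF z(2)] by blast
  then have "z2 \<notin> {y, z1}" using z(3) by simp
  then have "\<rho> z2 \<notin> {y, z1}" using \<rho>(3)[OF insertI1 z(2)] by blast
  moreover have "{y, \<rho> z2} \<in> A" using \<rho>(1)[OF z(2)] fix_pts(2) by simp
  moreover have "(v, z1) \<in> edge_rel A ^^ j" using map[OF dist_path[OF v zU(1)]] fix_pts dz by simp
  moreover have "(v, \<rho> z2) \<in> edge_rel A ^^ j" using map[OF dist_path[OF v zU(2)]] fix_pts dz by simp
  ultimately have near: "\<exists>i\<le>Suc j. (v, w) \<in> edge_rel A ^^ i" if "w \<in> \<Union>A" for w
    using two_geodesics[OF A(1) v j A(3) _ _ _ _ that] by blast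
  \<comment> \<open>A vertex outside \<open>A\<close> shares a polygon with \<open>v\<close>, and an
    isomorphism from \<open>A\<close> that fixes \<open>v\<close> carries the bound over.\<close>
  obtain ew where ew: "ew \<in> E" "w \<in> ew" using w by blast
  obtain P where P: "P \<in> \<P>" "ev \<in> P" "ew \<in> P" using common[OF ev(1) ew(1)] by blast
  obtain h where h: "graph_iso h A P" "h v = v" using iso_vertex[OF A(1) P(1), of v] A(2) P(2) ev(2) by blast
  obtain w' where w': "w' \<in> \<Union>A" "h w' = w"
    using h(1) P(3) ew(2) unfolding graph_iso_def bij_betw_def by (metis UnionI imageE)
  obtain i where i: "i \<le> Suc j" "(v, w') \<in> edge_rel A ^^ i" using near[OF w'(1)] by blast
  have "(h v, h w') \<in> edge_rel P ^^ i"
    by (rule relpow_map[OF _ i(2)]) (use graph_iso_edge[OF h(1)] in \<open>auto simp: edge_rel_def\<close>)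
  then have "(v, w) \<in> edge_rel E ^^ i" using edge_rel_mono[OF sub[OF P(1)]] h(2) w'(2) by simp
  then show ?thesis using dist_le i(1) j by fastforce
qed

definition ecc :: "'v \<Rightarrow> nat" where
  "ecc v = Max (dist v ` U)"

lemma finite_U: "finite U"
  using finite_E two by (metis card.infinite finite_Union zero_neq_numeral)

lemma dist_le_ecc: "y \<in> U \<Longrightarrow> dist v y \<le> ecc v"
  unfolding ecc_def using finite_U by (intro Max_ge) simp_all

lemma ecc_pos: "v \<in> U \<Longrightarrow> 1 \<le> ecc v"
proof -
  assume v: "v \<in> U"
  then obtain e where e: "e \<in> E" "v \<in> e" by blast
  then obtain u where u: "e = {v, u}" "u \<noteq> v" using edge_cases by blast
  then have "u \<in> U" using e by blast
  then show ?thesis using dist_le_ecc[of u v] dist_zero[OF v, of u] u(2) by simp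
qed

text \<open>The last step of a shortest path gives one closer neighbour; a second one would put
  \<open>y\<close> at the largest distance from \<open>v\<close>.\<close>

lemma card_closer:
  assumes v: "v \<in> U" and y: "y \<in> U" and d: "0 < dist v y" "dist v y < ecc v"
  shows "card {z. {y, z} \<in> E \<and> dist v z < dist v y} = 1"
proof -
  obtain j where j: "dist v y = Suc j" using d(1) by (metis less_nat_zero_code not0_implies_Suc)
  have "(v, y) \<in> edge_rel E ^^ Suc j" using dist_path[OF v y] j by simp
  then obtain z where z: "(v, z) \<in> edge_rel E ^^ j" "(z, y) \<in> edge_rel E" by auto
  have zy: "{y, z} \<in> E" using z(2) by (simp add: edge_rel_def insert_commute)
  have dz: "dist v z < dist v y" using dist_le[OF z(1)] j by simp
  have "z' = z" if z': "{y, z'} \<in> E" "dist v z' < dist v y" for z'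
  proof (rule ccontr)
    assume "z' \<noteq> z"
    then have "dist v w \<le> dist v y" if "w \<in> U" for w
      using unique_closer[OF v y z'(1) zy _ z'(2) dz that] by blast
    then have "ecc v \<le> dist v y" unfolding ecc_def using finite_U y by (subst Max_le_iff) auto
    then show False using d(2) by simp
  qed
  then have "{z. {y, z} \<in> E \<and> dist v z < dist v y} = {z}" using zy dz by blast
  then show ?thesis by simp
qed

end

section \<open>Words in Coxeter groups\<close>

lemma card_less_Suc:
  "card {i. i < Suc n \<and> P i} = (if P 0 then 1 else 0) + card {i. i < n \<and> P (Suc i)}"
proof -
  have "{i. i < Suc n \<and> P i} = (if P 0 then {0} else {}) \<union> Suc ` {i. i < n \<and> P (Suc i)}"
  proof (intro equalityI subsetI)
    fix i assume "i \<in> {i. i < Suc n \<and> P i}"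
    then show "i \<in> (if P 0 then {0} else {}) \<union> Suc ` {i. i < n \<and> P (Suc i)}"
      by (cases i) auto
  qed (auto split: if_splits)
  then have "card {i. i < Suc n \<and> P i} =
      card (if P 0 then {0 :: nat} else {}) + card (Suc ` {i. i < n \<and> P (Suc i)})"
    by (simp only:) (rule card_Un_disjoint; auto)
  moreover have "card (Suc ` {i. i < n \<and> P (Suc i)}) = card {i. i < n \<and> P (Suc i)}"
    by (rule card_image) simp
  ultimately show ?thesis by simp
qed

lemma even_card_periodic:
  fixes P :: "nat \<Rightarrow> bool"
  assumes "\<And>i. P (i + k) = P i"
  shows "even (card {i. i < 2 * k \<and> P i})"
proof -
  have "{i. i < 2 * k \<and> P i} = {i. i < k \<and> P i} \<union> (\<lambda>i. i + k) ` {i. i < k \<and> P i}"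
  proof (intro equalityI subsetI)
    fix i assume i: "i \<in> {i. i < 2 * k \<and> P i}"
    show "i \<in> {i. i < k \<and> P i} \<union> (\<lambda>i. i + k) ` {i. i < k \<and> P i}"
    proof (cases "i < k")
      case False
      then have "i = (i - k) + k" "i - k < k" using i by auto
      then show ?thesis using i assms[of "i - k"] by (intro UnI2 image_eqI[of _ _ "i - k"]) auto
    qed (use i in simp)
  qed (auto simp: assms)
  then have "card {i. i < 2 * k \<and> P i} = card {i. i < k \<and> P i} + card ((\<lambda>i. i + k) ` {i. i < k \<and> P i})"
    by (simp only:) (rule card_Un_disjoint; auto)
  moreover have "card ((\<lambda>i. i + k) ` {i. i < k \<and> P i}) = card {i. i < k \<and> P i}"
    by (rule card_image) simp
  ultimately show ?thesis by simp
qed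

fun alternating :: "'a \<Rightarrow> 'a \<Rightarrow> nat \<Rightarrow> 'a list" where
  "alternating s t 0 = []"
| "alternating s t (Suc n) = s # alternating t s n"

lemma concat_replicate_alternating: "concat (replicate k [s, t]) = alternating s t (2 * k)"
  by (induction k) simp_all

lemma alternating_Suc_even: "alternating t s (Suc (Suc (2 * i))) = alternating t s (Suc (2 * i)) @ [s]"
  by (induction i) simp_all

lemma alternating_add_even: "alternating s t (2 * k + n) = alternating s t (2 * k) @ alternating s t n"
  by (induction k) simp_all

context
  fixes T :: "'t diagram"
begin

section \<open>The congruence on words and the exchange condition\<close>

abbreviation ceq :: "'t list \<Rightarrow> 't list \<Rightarrow> bool" (infix "\<doteq>" 50) where
  "u \<doteq> v \<equiv> coxeter_eq T u v"

lemma ceq_refl [simp]: "u \<doteq> u"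
  by (rule coxeter_eq.refl)

lemma ceq_sym: "u \<doteq> v \<Longrightarrow> v \<doteq> u"
  by (rule coxeter_eq.sym)

lemma ceq_trans [trans]: "u \<doteq> v \<Longrightarrow> v \<doteq> w \<Longrightarrow> u \<doteq> w"
  by (rule coxeter_eq.trans)

lemma ceq_append: "u \<doteq> u' \<Longrightarrow> v \<doteq> v' \<Longrightarrow> u @ v \<doteq> u' @ v'"
  by (rule coxeter_eq.append)

lemma ceq_left: "v \<doteq> v' \<Longrightarrow> u @ v \<doteq> u @ v'"
  by (rule ceq_append) simp_all

lemma ceq_right: "u \<doteq> u' \<Longrightarrow> u @ v \<doteq> u' @ v"
  by (rule ceq_append) simp_all

lemma ceq_square: "[s, s] \<doteq> []"
proof -
  have "coxeter_entry T s s = enat 1" by (simp add: coxeter_entry_def one_enat_def)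
  from coxeter_eq.relator[OF this] show ?thesis by simp
qed

lemma ceq_Cons_Cons: "s # s # u \<doteq> u"
  using ceq_right[OF ceq_square, of s u] by simp

lemma ceq_rev_append: "rev u @ u \<doteq> []"
proof (induction u)
  case (Cons s u)
  have "rev (s # u) @ s # u = rev u @ (s # s # u)" by simp
  also have "\<dots> \<doteq> rev u @ u" by (rule ceq_left[OF ceq_Cons_Cons])
  also note Cons.IH
  finally show ?case .
qed simp

lemma ceq_append_rev: "u @ rev u \<doteq> []"
  using ceq_rev_append[of "rev u"] by simp

lemma ceq_cancel_left: "rev u @ u @ v \<doteq> v"
  using ceq_right[OF ceq_rev_append, of u v] by simp

lemma ceq_cancel_left': "u @ rev u @ v \<doteq> v"
  using ceq_cancel_left[of "rev u" v] by simp

lemma ceq_rev: "u \<doteq> v \<Longrightarrow> rev u \<doteq> rev v"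
proof -
  assume uv: "u \<doteq> v"
  have "rev u = rev u @ []" by simp
  also have "\<dots> \<doteq> rev u @ v @ rev v" by (rule ceq_left[OF ceq_sym[OF ceq_append_rev]])
  also have "\<dots> \<doteq> rev u @ u @ rev v" by (rule ceq_left[OF ceq_right[OF ceq_sym[OF uv]]])
  also have "\<dots> \<doteq> rev v" by (rule ceq_cancel_left)
  finally show ?thesis .
qed

lemma ceq_move: "u @ v \<doteq> w \<longleftrightarrow> v \<doteq> rev u @ w"
proof
  assume h: "u @ v \<doteq> w"
  have "v \<doteq> rev u @ u @ v" by (rule ceq_sym[OF ceq_cancel_left])
  also have "\<dots> \<doteq> rev u @ w" by (rule ceq_left[OF h])
  finally show "v \<doteq> rev u @ w" .
next
  assume h: "v \<doteq> rev u @ w"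
  have "u @ v \<doteq> u @ rev u @ w" by (rule ceq_left[OF h])
  also have "\<dots> \<doteq> w" by (rule ceq_cancel_left')
  finally show "u @ v \<doteq> w" .
qed

lemma ceq_even_length: "u \<doteq> v \<Longrightarrow> even (length u) \<longleftrightarrow> even (length v)"
  by (induction rule: coxeter_eq.induct) (auto simp: concat_replicate_alternating[symmetric] length_concat sum_list_replicate)

text \<open>For the word \<open>s\<^sub>1\<dots>s\<^sub>n\<close> this is the parity of the number of \<open>i\<close> such that the reflection
  \<open>s\<^sub>1\<dots>s\<^sub>i\<dots>s\<^sub>1\<close> equals \<open>x\<close>.\<close>

fun parity :: "'t list \<Rightarrow> 't list \<Rightarrow> bool" where
  "parity [] x = False"
| "parity (s # u) x = (([s] \<doteq> x) \<noteq> parity u ([s] @ x @ [s]))"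

lemma ceq_cong_right: "x \<doteq> y \<Longrightarrow> u \<doteq> x \<longleftrightarrow> u \<doteq> y"
  by (blast intro: ceq_sym ceq_trans)

lemma parity_cong: "x \<doteq> y \<Longrightarrow> parity u x = parity u y"
proof (induction u arbitrary: x y)
  case (Cons s u)
  have "[s] @ x @ [s] \<doteq> [s] @ y @ [s]" by (intro ceq_append Cons.prems ceq_refl)
  then have "parity u ([s] @ x @ [s]) = parity u ([s] @ y @ [s])" by (rule Cons.IH)
  then show ?case using ceq_cong_right[OF Cons.prems, of "[s]"] by simp
qed simp

lemma parity_append: "parity (u @ v) x = (parity u x \<noteq> parity v (rev u @ x @ u))"
  by (induction u arbitrary: x) auto

lemma ceq_conj: "z \<doteq> [s] @ x @ [s] \<longleftrightarrow> [s] @ z @ [s] \<doteq> x"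
proof
  assume h: "z \<doteq> [s] @ x @ [s]"
  have "[s] @ z @ [s] \<doteq> [s] @ ([s] @ x @ [s]) @ [s]" by (intro ceq_append h ceq_refl)
  also have "\<dots> = [s, s] @ x @ [s, s]" by simp
  also have "\<dots> \<doteq> [] @ x @ []" by (intro ceq_append ceq_square ceq_refl)
  finally show "[s] @ z @ [s] \<doteq> x" by simp
next
  assume h: "[s] @ z @ [s] \<doteq> x"
  have "z = [] @ z @ []" by simp
  also have "\<dots> \<doteq> [s, s] @ z @ [s, s]" by (intro ceq_append ceq_sym[OF ceq_square] ceq_refl)
  also have "\<dots> = [s] @ ([s] @ z @ [s]) @ [s]" by simp
  also have "\<dots> \<doteq> [s] @ x @ [s]" by (intro ceq_append h ceq_refl)
  finally show "z \<doteq> [s] @ x @ [s]" .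
qed

text \<open>The reflections belonging to an alternating word are the alternating words of odd length
  with the same first letter.\<close>

lemma parity_alternating:
  "parity (alternating s t n) x \<longleftrightarrow> odd (card {i. i < n \<and> alternating s t (Suc (2 * i)) \<doteq> x})"
proof (induction n arbitrary: s t x)
  case (Suc n)
  have shift: "alternating t s (Suc (2 * i)) \<doteq> [s] @ x @ [s] \<longleftrightarrow> alternating s t (Suc (2 * Suc i)) \<doteq> x" for i
  proof -
    have "[s] @ alternating t s (Suc (2 * i)) @ [s] = alternating s t (Suc (2 * Suc i))"
      using alternating_Suc_even[of t s i] by simp
    then show ?thesis using ceq_conj[of "alternating t s (Suc (2 * i))" s x] by simp
  qed
  have "parity (alternating s t (Suc n)) x = (([s] \<doteq> x) \<noteq> parity (alternating t s n) ([s] @ x @ [s]))"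
    by simp
  also have "parity (alternating t s n) ([s] @ x @ [s]) \<longleftrightarrow>
      odd (card {i. i < n \<and> alternating s t (Suc (2 * Suc i)) \<doteq> x})"
    unfolding Suc.IH shift ..
  also have "(([s] \<doteq> x) \<noteq> odd (card {i. i < n \<and> alternating s t (Suc (2 * Suc i)) \<doteq> x})) \<longleftrightarrow>
      odd (card {i. i < Suc n \<and> alternating s t (Suc (2 * i)) \<doteq> x})"
    unfolding card_less_Suc[of n "\<lambda>i. alternating s t (Suc (2 * i)) \<doteq> x"] by simp
  finally show ?case .
qed simp

text \<open>The \<open>2 * k\<close> reflections of the relator repeat with period \<open>k\<close>,
  so each of them occurs an even number of times.\<close>

lemma parity_relator:
  assumes "coxeter_entry T s t = enat k"
  shows "\<not> parity (concat (replicate k [s, t])) x"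
proof -
  have one: "alternating s t (2 * k) \<doteq> []"
    using coxeter_eq.relator[OF assms] by (simp add: concat_replicate_alternating)
  have "alternating s t (Suc (2 * (i + k))) \<doteq> x \<longleftrightarrow> alternating s t (Suc (2 * i)) \<doteq> x" for i
  proof -
    have "alternating s t (Suc (2 * (i + k))) = alternating s t (2 * k) @ alternating s t (Suc (2 * i))"
      using alternating_add_even[of s t k "Suc (2 * i)"] by (simp add: algebra_simps)
    also have "\<dots> \<doteq> [] @ alternating s t (Suc (2 * i))" by (rule ceq_right[OF one])
    finally have "alternating s t (Suc (2 * (i + k))) \<doteq> alternating s t (Suc (2 * i))" by simp
    then show ?thesis by (blast intro: ceq_sym ceq_trans)
  qed
  then have "even (card {i. i < 2 * k \<and> alternating s t (Suc (2 * i)) \<doteq> x})" by (rule even_card_periodic)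
  then show ?thesis by (simp only: concat_replicate_alternating parity_alternating) simp
qed

text \<open>By \<open>parity_append\<close> the parity is a cocycle, and it vanishes on relators, so
  it depends only on the group element. Exchange and deletion follow from it.\<close>

lemma parity_ceq: "u \<doteq> v \<Longrightarrow> parity u x = parity v x"
proof (induction arbitrary: x rule: coxeter_eq.induct)
  case (relator s t k)
  then show ?case using parity_relator by simp
next
  case (append u u' v v')
  have "rev u @ x @ u \<doteq> rev u' @ x @ u'"
    by (intro ceq_append ceq_rev append.hyps ceq_refl)
  then have "parity v (rev u @ x @ u) = parity v (rev u' @ x @ u')" by (rule parity_cong)
  then show ?case unfolding parity_append using append.IH by simp
qed simp_all

text \<open>The strong exchange condition. An odd number of occurrences is at least one, and
  multiplying by the reflection of an occurrence deletes the corresponding letter.\<close>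

lemma deletion: "parity w x \<Longrightarrow> \<exists>w'. x @ w \<doteq> w' \<and> length w' < length w \<and> set w' \<subseteq> set w"
proof (induction w arbitrary: x)
  case (Cons a u)
  show ?case
  proof (cases "[a] \<doteq> x")
    case True
    have "x @ a # u \<doteq> [a] @ a # u" by (rule ceq_right[OF ceq_sym[OF True]])
    also have "\<dots> = a # a # u" by simp
    also have "\<dots> \<doteq> u" by (rule ceq_Cons_Cons)
    finally show ?thesis by (intro exI[of _ u]) auto
  next
    case False
    then have "parity u ([a] @ x @ [a])" using Cons.prems by simp
    then obtain u' where u': "([a] @ x @ [a]) @ u \<doteq> u'" "length u' < length u" "set u' \<subseteq> set u"
      using Cons.IH by blast
    have "x @ a # u \<doteq> [a, a] @ x @ a # u" using ceq_sym[OF ceq_Cons_Cons] by simp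
    also have "\<dots> = [a] @ (([a] @ x @ [a]) @ u)" by simp
    also have "\<dots> \<doteq> [a] @ u'" by (rule ceq_left[OF u'(1)])
    finally show ?thesis using u'(2,3) by (intro exI[of _ "a # u'"]) auto
  qed
qed simp

definition reduced :: "'t list \<Rightarrow> bool" where
  "reduced u \<longleftrightarrow> (\<forall>v. u \<doteq> v \<longrightarrow> length u \<le> length v)"

text \<open>If the reflection \<open>b\<close> had even parity, it would have odd parity in
  \<open>z\<close>, and deletion would give a shorter word for \<open>b # z\<close>. Minimality is
  required only among words in the letters of \<open>z\<close>, so that words that are shortest
  within a parabolic subgroup qualify.\<close>

lemma parity_head:
  assumes "\<And>v. b # z \<doteq> v \<Longrightarrow> set v \<subseteq> set z \<Longrightarrow> length (b # z) \<le> length v"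
  shows "parity (b # z) [b]"
proof (rule ccontr)
  assume "\<not> ?thesis"
  then have "parity z ([b] @ [b] @ [b])" by simp
  moreover have "[b] @ [b] @ [b] \<doteq> [b]" using ceq_Cons_Cons[of b "[b]"] by simp
  ultimately have "parity z [b]" using parity_cong by blast
  then obtain z' where "[b] @ z \<doteq> z'" "length z' < length z" "set z' \<subseteq> set z" using deletion by blast
  then show False using assms[of z'] by simp
qed

lemma reduced_exists: "\<exists>u. w \<doteq> u \<and> reduced u"
proof -
  obtain u where u: "w \<doteq> u" "\<And>v. w \<doteq> v \<Longrightarrow> length u \<le> length v"
    using ex_has_least_nat[of "\<lambda>u. w \<doteq> u" w length] ceq_refl by blast
  then show ?thesis unfolding reduced_def using ceq_trans by blast
qed

text \<open>A shortest word over \<open>J\<close> for \<open>s\<close> has odd parity at its first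
  letter \<open>b\<close>. Parity is an invariant of the element, and the word \<open>[s]\<close>
  has odd parity only at \<open>s\<close> itself.\<close>

lemma generator_in_parabolic:
  assumes "[s] \<doteq> z" "set z \<subseteq> J"
  shows "\<exists>b\<in>J. [s] \<doteq> [b]"
proof -
  obtain z where z: "[s] \<doteq> z \<and> set z \<subseteq> J" and min: "\<And>v. [s] \<doteq> v \<and> set v \<subseteq> J \<Longrightarrow> length z \<le> length v"
    using ex_has_least_nat[of "\<lambda>z. [s] \<doteq> z \<and> set z \<subseteq> J" z length] assms by blast
  have "z \<noteq> []" using ceq_even_length[of "[s]" z] z by auto
  then obtain b z' where b: "z = b # z'" by (cases z) auto
  have "parity (b # z') [b]"
  proof (rule parity_head)
    fix v assume v: "b # z' \<doteq> v" "set v \<subseteq> set z'"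
    have "[s] \<doteq> v" using ceq_trans[of "[s]" z v] z v(1) b by simp
    moreover have "set v \<subseteq> J" using v(2) z b by auto
    ultimately show "length (b # z') \<le> length v" using min b by blast
  qed
  then have "parity [s] [b]" using parity_ceq[of "[s]" z "[b]"] z b by simp
  then have "[s] \<doteq> [b]" by simp
  moreover have "b \<in> J" using z b by simp
  ultimately show ?thesis by blast
qed

text \<open>The first letter \<open>s\<close> of a reduced word has odd parity at \<open>s\<close>,
  and so has \<open>w\<close>. Deleting a letter of \<open>w\<close> then writes both
  \<open>s\<close> and the remaining word over \<open>J\<close>.\<close>

lemma reduced_letters:
  assumes "reduced u" "u \<doteq> w" "set w \<subseteq> J"
  shows "\<forall>a\<in>set u. \<exists>b\<in>J. [a] \<doteq> [b]"
  using assms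
proof (induction u arbitrary: w)
  case (Cons s u)
  have "parity (s # u) [s]"
    by (rule parity_head) (use Cons.prems(1) in \<open>simp add: reduced_def\<close>)
  then have "parity w [s]" using parity_ceq[OF Cons.prems(2), of "[s]"] by blast
  then obtain w' where w': "[s] @ w \<doteq> w'" "set w' \<subseteq> set w" using deletion by blast
  have "u \<doteq> [s] @ s # u" using ceq_sym[OF ceq_Cons_Cons] by simp
  also have "\<dots> \<doteq> [s] @ w" by (rule ceq_left[OF Cons.prems(2)])
  also note w'(1)
  finally have "u \<doteq> w'" .
  moreover have "reduced u"
    unfolding reduced_def
  proof (intro allI impI)
    fix v assume "u \<doteq> v"
    then have "s # u \<doteq> s # v" using ceq_left[of u v "[s]"] by simp
    then show "length u \<le> length v" using Cons.prems(1) unfolding reduced_def by fastforce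
  qed
  ultimately have "\<forall>a\<in>set u. \<exists>b\<in>J. [a] \<doteq> [b]" using Cons.IH w'(2) Cons.prems(3) by blast
  moreover have "\<exists>b\<in>J. [s] \<doteq> [b]"
  proof (rule generator_in_parabolic)
    have "[s] \<doteq> [s] @ w @ rev w" using ceq_left[OF ceq_sym[OF ceq_append_rev], of "[s]"] by simp
    also have "\<dots> \<doteq> w' @ rev w" using ceq_right[OF w'(1)] by simp
    finally show "[s] \<doteq> w' @ rev w" .
    show "set (w' @ rev w) \<subseteq> J" using w'(2) Cons.prems(3) by auto
  qed
  ultimately show ?case by simp
qed simp

text \<open>For Coxeter diagrams this always holds, by the canonical linear representation. Here it
  is read off from thickness, or from counting letters if there are no edges.\<close>

definition nonredundant :: bool where
  "nonredundant \<longleftrightarrow> (\<forall>a b. [a] \<doteq> [b] \<longrightarrow> a = b)"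

text \<open>Maximal parabolic subgroups intersect in the parabolic subgroup of the common
  generators: a reduced word for \<open>w\<close> avoids every letter \<open>j\<close> in
  \<open>I\<close>.\<close>

lemma parabolic_Inter:
  assumes nonredundant and "\<And>j. j \<in> I \<Longrightarrow> \<exists>z. set z \<subseteq> - {j} \<and> w \<doteq> z"
  shows "\<exists>z. set z \<subseteq> - I \<and> w \<doteq> z"
proof -
  obtain u where u: "w \<doteq> u" "reduced u" using reduced_exists by blast
  have "a \<noteq> j" if a: "a \<in> set u" and j: "j \<in> I" for a j
  proof -
    obtain z where z: "set z \<subseteq> - {j}" "w \<doteq> z" using assms(2)[OF j] by blast
    have "u \<doteq> z" using ceq_trans[OF ceq_sym[OF u(1)] z(2)] .
    then obtain b where "b \<in> - {j}" "[a] \<doteq> [b]" using reduced_letters[OF u(2) _ z(1)] a by blast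
    then show ?thesis using assms(1) unfolding nonredundant_def by blast
  qed
  then show ?thesis using u(1) by (intro exI[of _ u]) auto
qed

text \<open>Without edges each relator contains every letter an even number of times, so the
  parities of the letter counts are invariants.\<close>

lemma nonredundant_edgeless:
  assumes "edges T = {}"
  shows nonredundant
proof -
  have count: "even (count_list u a) \<longleftrightarrow> even (count_list v a)" if "u \<doteq> v" for u v a
    using that
  proof (induction rule: coxeter_eq.induct)
    case (relator s t k)
    then have "s = t \<or> k = 2"
      using assms by (auto simp: coxeter_entry_def numeral_eq_enat split: if_splits)
    moreover have "count_list (concat (replicate k xs)) a = k * count_list xs a" for xs :: "'t list"
      by (induction k) (simp_all add: count_list_append)
    ultimately show ?case by auto
  qed (auto simp: count_list_append)
  have "a = b" if "[a] \<doteq> [b]" for a b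
    by (rule ccontr) (use count[OF that, of a] in simp)
  then show ?thesis unfolding nonredundant_def by blast
qed

section \<open>Cosets and vertices of the Coxeter complex in terms of words\<close>

lemma ceq_class: "coxeter_class T u = coxeter_class T v \<longleftrightarrow> u \<doteq> v"
  unfolding coxeter_class_def by (auto intro: ceq_sym ceq_trans)

lemma class_mult: "coxeter_class T u \<otimes>\<^bsub>coxeter_group T\<^esub> coxeter_class T v = coxeter_class T (u @ v)"
proof -
  have "{w. \<exists>u'\<in>coxeter_class T u. \<exists>v'\<in>coxeter_class T v. u' @ v' \<doteq> w} = coxeter_class T (u @ v)"
    unfolding coxeter_class_def
  proof (intro equalityI subsetI)
    fix w assume "w \<in> {w. \<exists>u'\<in>{u'. u \<doteq> u'}. \<exists>v'\<in>{v'. v \<doteq> v'}. u' @ v' \<doteq> w}"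
    then obtain u' v' where "u \<doteq> u'" "v \<doteq> v'" "u' @ v' \<doteq> w" by blast
    then show "w \<in> {w. u @ v \<doteq> w}" using ceq_trans[OF ceq_append] by blast
  qed (use ceq_refl in blast)
  then show ?thesis by (simp add: coxeter_group_def)
qed

lemma class_carrier: "carrier (coxeter_group T) = range (coxeter_class T)"
  by (simp add: coxeter_group_def)

lemma class_one: "\<one>\<^bsub>coxeter_group T\<^esub> = coxeter_class T []"
  by (simp add: coxeter_group_def)

lemma group_coxeter_group: "group (coxeter_group T)"
proof (rule groupI)
  fix x assume "x \<in> carrier (coxeter_group T)"
  then obtain u where u: "x = coxeter_class T u" by (auto simp: class_carrier)
  have "coxeter_class T (rev u) \<otimes>\<^bsub>coxeter_group T\<^esub> x = \<one>\<^bsub>coxeter_group T\<^esub>"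
    unfolding u class_mult class_one ceq_class by (rule ceq_rev_append)
  then show "\<exists>y\<in>carrier (coxeter_group T). y \<otimes>\<^bsub>coxeter_group T\<^esub> x = \<one>\<^bsub>coxeter_group T\<^esub>"
    by (auto simp: class_carrier)
qed (auto simp: class_carrier class_one class_mult)

lemma class_inv: "inv\<^bsub>coxeter_group T\<^esub> (coxeter_class T u) = coxeter_class T (rev u)"
proof (rule group.inv_equality[OF group_coxeter_group])
  show "coxeter_class T (rev u) \<otimes>\<^bsub>coxeter_group T\<^esub> coxeter_class T u = \<one>\<^bsub>coxeter_group T\<^esub>"
    unfolding class_mult class_one ceq_class by (rule ceq_rev_append)
qed (simp_all add: class_carrier)

lemma parabolic_words: "parabolic T J = {coxeter_class T u |u. set u \<subseteq> J}"
proof (intro equalityI subsetI)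
  fix x assume "x \<in> parabolic T J"
  then show "x \<in> {coxeter_class T u |u. set u \<subseteq> J}"
    unfolding parabolic_def
  proof (induction rule: generate.induct)
    case one
    then show ?case unfolding class_one by (intro CollectI exI[of _ "[]"]) simp
  next
    case (incl h)
    then obtain s where "s \<in> J" "h = coxeter_class T [s]" by blast
    then show ?case by (intro CollectI exI[of _ "[s]"]) simp
  next
    case (inv h)
    then obtain s where "s \<in> J" "h = coxeter_class T [s]" by blast
    then show ?case by (intro CollectI exI[of _ "[s]"]) (simp add: class_inv)
  next
    case (eng h1 h2)
    then obtain u v where "set u \<subseteq> J" "h1 = coxeter_class T u" "set v \<subseteq> J" "h2 = coxeter_class T v" by blast
    then show ?case by (intro CollectI exI[of _ "u @ v"]) (simp add: class_mult)
  qed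
next
  fix x assume "x \<in> {coxeter_class T u |u. set u \<subseteq> J}"
  then obtain u where u: "x = coxeter_class T u" "set u \<subseteq> J" by blast
  have "coxeter_class T u \<in> parabolic T J" using u(2)
  proof (induction u)
    case Nil
    show ?case unfolding parabolic_def class_one[symmetric] by (rule generate.one)
  next
    case (Cons s u)
    have "coxeter_class T (s # u) = coxeter_class T [s] \<otimes>\<^bsub>coxeter_group T\<^esub> coxeter_class T u"
      by (simp add: class_mult)
    moreover have "coxeter_class T [s] \<in> parabolic T J"
      unfolding parabolic_def by (rule generate.incl) (use Cons.prems in simp)
    ultimately show ?case using Cons.IH Cons.prems unfolding parabolic_def by (simp add: generate.eng)
  qed
  then show "x \<in> parabolic T J" using u(1) by simp
qed

definition vert :: "'t list \<Rightarrow> 't \<Rightarrow> 't \<times> 't list set set" where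
  "vert u s = coxeter_vertex T (coxeter_class T u) s"

lemma coset_words:
  "coxeter_class T u <#\<^bsub>coxeter_group T\<^esub> parabolic T J = {coxeter_class T (u @ z) |z. set z \<subseteq> J}"
proof -
  have "coxeter_class T u <#\<^bsub>coxeter_group T\<^esub> parabolic T J =
      {coxeter_class T u \<otimes>\<^bsub>coxeter_group T\<^esub> coxeter_class T z |z. set z \<subseteq> J}"
    unfolding l_coset_def parabolic_words by blast
  then show ?thesis by (simp only: class_mult)
qed

lemma vert_eq: "vert u s = vert v t \<longleftrightarrow> s = t \<and> (\<exists>z. set z \<subseteq> - {s} \<and> v \<doteq> u @ z)"
proof -
  have cosets: "{coxeter_class T (u @ z) |z. set z \<subseteq> J} = {coxeter_class T (v @ z) |z. set z \<subseteq> J} \<longleftrightarrow>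
      (\<exists>z. set z \<subseteq> J \<and> v \<doteq> u @ z)" (is "?A = ?B \<longleftrightarrow> ?R") for J
  proof
    assume "?A = ?B"
    moreover have "coxeter_class T (v @ []) \<in> ?B" by (intro CollectI exI[of _ "[]"]) simp
    ultimately have "coxeter_class T v \<in> ?A" by simp
    then show ?R unfolding ceq_class[symmetric] by blast
  next
    assume ?R
    then obtain z where z: "set z \<subseteq> J" "v \<doteq> u @ z" by blast
    have "\<exists>y'. coxeter_class T (v @ y) = coxeter_class T (u @ y') \<and> set y' \<subseteq> J" if "set y \<subseteq> J" for y
      using ceq_right[OF z(2), of y] that z(1) unfolding ceq_class by (intro exI[of _ "z @ y"]) simp
    moreover have "\<exists>y'. coxeter_class T (u @ y) = coxeter_class T (v @ y') \<and> set y' \<subseteq> J" if "set y \<subseteq> J" for y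
    proof -
      have "u @ y \<doteq> u @ z @ rev z @ y" by (rule ceq_left[OF ceq_sym[OF ceq_cancel_left']])
      also have "\<dots> \<doteq> v @ rev z @ y" using ceq_right[OF ceq_sym[OF z(2)], of "rev z @ y"] by simp
      finally show ?thesis using that z(1) unfolding ceq_class by (intro exI[of _ "rev z @ y"]) simp
    qed
    ultimately show "?A = ?B" by blast
  qed
  show ?thesis
    unfolding vert_def coxeter_vertex_def coset_words prod.inject
  proof (rule conj_cong)
    assume "s = t"
    then show "({coxeter_class T (u @ z) |z. set z \<subseteq> - {s}} = {coxeter_class T (v @ z) |z. set z \<subseteq> - {t}}) =
        (\<exists>z. set z \<subseteq> - {s} \<and> v \<doteq> u @ z)"
      using cosets[of "- {s}"] by simp
  qed simp
qed

lemma fst_vert [simp]: "fst (vert u s) = s"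
  by (simp add: vert_def coxeter_vertex_def)

lemma coxeter_complex_vert: "coxeter_complex T = {vert u ` I |u I. True}"
  unfolding coxeter_complex_def class_carrier vert_def by auto

text \<open>Each shared vertex gives its own word for the quotient of \<open>v\<close> by
  \<open>u\<close>, avoiding one letter; \<open>parabolic_Inter\<close> combines them into one word
  that avoids all of \<open>I\<close>.\<close>

lemma chamber_coset:
  assumes nonredundant
  shows "(\<forall>s\<in>I. vert v s = vert u s) \<longleftrightarrow> (\<exists>z. set z \<subseteq> - I \<and> v \<doteq> u @ z)"
proof
  assume h: "\<forall>s\<in>I. vert v s = vert u s"
  have "\<exists>z. set z \<subseteq> - I \<and> rev u @ v \<doteq> z"
  proof (rule parabolic_Inter[OF assms])
    fix s assume "s \<in> I"
    then have "vert u s = vert v s" using h by simp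
    then obtain z where z: "set z \<subseteq> - {s}" "v \<doteq> u @ z" unfolding vert_eq by blast
    have "rev u @ v \<doteq> rev u @ u @ z" by (rule ceq_left[OF z(2)])
    also have "\<dots> \<doteq> z" by (rule ceq_cancel_left)
    finally show "\<exists>z. set z \<subseteq> - {s} \<and> rev u @ v \<doteq> z" using z(1) by blast
  qed
  then obtain z where z: "set z \<subseteq> - I" "rev u @ v \<doteq> z" by blast
  then show "\<exists>z. set z \<subseteq> - I \<and> v \<doteq> u @ z" using ceq_move[of "rev u" v z] by auto
next
  assume "\<exists>z. set z \<subseteq> - I \<and> v \<doteq> u @ z"
  then obtain z where z: "set z \<subseteq> - I" "v \<doteq> u @ z" by blast
  show "\<forall>s\<in>I. vert v s = vert u s"
  proof
    fix s assume "s \<in> I"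
    then have "set z \<subseteq> - {s}" using z(1) by blast
    then have "vert u s = vert v s" unfolding vert_eq using z(2) by blast
    then show "vert v s = vert u s" by simp
  qed
qed

text \<open>Otherwise \<open>s\<close> would be a product of the other generators, hence equal to
  one of them. So crossing a wall really changes the vertex.\<close>

lemma chamber_adjacent_ne:
  assumes nonredundant
  shows "vert (u @ [s]) s \<noteq> vert u s"
proof
  assume "vert (u @ [s]) s = vert u s"
  then obtain z where z: "set z \<subseteq> - {s}" "u \<doteq> (u @ [s]) @ z" unfolding vert_eq by blast
  have "[] \<doteq> rev u @ u" by (rule ceq_sym[OF ceq_rev_append])
  also have "\<dots> \<doteq> rev u @ (u @ [s] @ z)" using ceq_left[OF z(2), of "rev u"] by simp
  also have "\<dots> \<doteq> [s] @ z" by (rule ceq_cancel_left)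
  finally have "[s] @ z \<doteq> []" by (rule ceq_sym)
  then have "z \<doteq> [s]" unfolding ceq_move by simp
  then have "[s] \<doteq> z" by (rule ceq_sym)
  then obtain b where "b \<in> - {s}" "[s] \<doteq> [b]" using generator_in_parabolic[OF _ z(1)] by blast
  then show False using assms unfolding nonredundant_def by blast
qed

text \<open>In every word \<open>a\<close> can be replaced by \<open>b\<close>, so the parabolic
  subgroup without \<open>a\<close> is the whole group and there is only one vertex of type
  \<open>a\<close>.\<close>

lemma redundant_vert:
  assumes "[a] \<doteq> [b]" "a \<noteq> b"
  shows "vert v a = vert u a"
proof -
  have "\<exists>z. set z \<subseteq> - {a} \<and> w \<doteq> z" for w
  proof (induction w)
    case (Cons c w)
    then obtain z where z: "set z \<subseteq> - {a}" "w \<doteq> z" by blast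
    have "c # w \<doteq> [c] @ z" using ceq_left[OF z(2), of "[c]"] by simp
    also have "\<dots> \<doteq> [if c = a then b else c] @ z" using ceq_right[OF assms(1), of z] by simp
    finally show ?case using z(1) assms(2) by (intro exI[of _ "[if c = a then b else c] @ z"]) auto
  qed (use ceq_refl in \<open>auto intro!: exI[of _ "[]"]\<close>)
  then obtain z where z: "set z \<subseteq> - {a}" "rev u @ v \<doteq> z" by blast
  then have "v \<doteq> u @ z" using ceq_move[of "rev u" v z] by simp
  then have "vert u a = vert v a" unfolding vert_eq using z(1) by blast
  then show ?thesis by simp
qed

lemma singleton_word: "set z \<subseteq> {s} \<Longrightarrow> z \<doteq> [] \<or> z \<doteq> [s]"
proof (induction z)
  case (Cons a z)
  then have a: "a = s" and z: "z \<doteq> [] \<or> z \<doteq> [s]" by auto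
  from z show ?case
  proof
    assume "z \<doteq> []"
    then show ?thesis using ceq_left[of z "[]" "[s]"] a by simp
  next
    assume "z \<doteq> [s]"
    then have "s # z \<doteq> [s, s]" using ceq_left[of z "[s]" "[s]"] by simp
    then show ?thesis using ceq_trans[OF _ ceq_square] a by blast
  qed
qed simp

text \<open>The same \<open>x\<close> and \<open>y\<close> serve in both orders, so a chamber can be
  reached either by changing one vertex first or by changing the other first.\<close>

lemma commuting_word:
  assumes comm: "coxeter_entry T s t = 2" and z: "set z \<subseteq> {s, t}"
  shows "\<exists>x y. set x \<subseteq> {s} \<and> set y \<subseteq> {t} \<and> z \<doteq> x @ y \<and> z \<doteq> y @ x"
proof -
  have "coxeter_entry T s t = enat 2" using comm by (simp add: numeral_eq_enat)
  from coxeter_eq.relator[OF this] have "[s, t, s, t] \<doteq> []" by (simp add: numeral_2_eq_2)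
  then have st: "[s, t] \<doteq> [t, s]" using ceq_move[of "[s, t]" "[s, t]" "[]"] by simp
  have slide: "[s] @ y \<doteq> y @ [s]" if "set y \<subseteq> {t}" for y using that
  proof (induction y)
    case (Cons a y)
    then have a: "a = t" by simp
    have "[s] @ a # y = [s, t] @ y" using a by simp
    also have "\<dots> \<doteq> [t, s] @ y" by (rule ceq_right[OF st])
    also have "\<dots> = [t] @ [s] @ y" by simp
    also have "\<dots> \<doteq> [t] @ y @ [s]" using Cons by (intro ceq_left) simp
    finally show ?case using a by simp
  qed simp
  have slide': "[t] @ y \<doteq> y @ [t]" if "set y \<subseteq> {s}" for y using that
  proof (induction y)
    case (Cons a y)
    then have a: "a = s" by simp
    have "[t] @ a # y = [t, s] @ y" using a by simp
    also have "\<dots> \<doteq> [s, t] @ y" by (rule ceq_right[OF ceq_sym[OF st]])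
    also have "\<dots> = [s] @ [t] @ y" by simp
    also have "\<dots> \<doteq> [s] @ y @ [t]" using Cons by (intro ceq_left) simp
    finally show ?case using a by simp
  qed simp
  show ?thesis using z
  proof (induction z)
    case (Cons a z)
    then obtain x y where xy: "set x \<subseteq> {s}" "set y \<subseteq> {t}" "z \<doteq> x @ y" "z \<doteq> y @ x" by auto
    from Cons.prems consider "a = s" | "a = t" by auto
    then show ?case
    proof cases
      case 1
      have "a # z \<doteq> (s # x) @ y" using ceq_left[OF xy(3), of "[s]"] 1 by simp
      moreover have "a # z \<doteq> y @ s # x"
      proof -
        have "a # z \<doteq> [s] @ y @ x" using ceq_left[OF xy(4), of "[s]"] 1 by simp
        also have "\<dots> \<doteq> (y @ [s]) @ x" using ceq_right[OF slide[OF xy(2)], of x] by simp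
        finally show ?thesis by simp
      qed
      ultimately show ?thesis using xy(1,2) by (intro exI[of _ "s # x"] exI[of _ y]) simp
    next
      case 2
      have "a # z \<doteq> (t # y) @ x" using ceq_left[OF xy(4), of "[t]"] 2 by simp
      moreover have "a # z \<doteq> x @ t # y"
      proof -
        have "a # z \<doteq> [t] @ x @ y" using ceq_left[OF xy(3), of "[t]"] 2 by simp
        also have "\<dots> \<doteq> (x @ [t]) @ y" using ceq_right[OF slide'[OF xy(1)], of y] by simp
        finally show ?thesis by simp
      qed
      ultimately show ?thesis using xy(1,2) by (intro exI[of _ x] exI[of _ "t # y"]) simp
    qed
  qed (auto intro!: exI[of _ "[]"])
qed

end

section \<open>Links in buildings\<close>

locale typed_building =
  fixes T :: "'t::finite diagram" and X :: "'v set set" and \<E> :: "'v set set set" and \<tau> :: "'v \<Rightarrow> 't"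
  assumes building: "building T X \<E>" and labelling: "building_labelling T \<E> \<tau>"
begin

section \<open>Chambers, and apartments in coordinates\<close>

definition chambers :: "'v set set" where
  "chambers = {C \<in> X. card C = CARD('t)}"

lemma complex_X: "abstract_complex X"
  using building by (simp add: building_def)

lemma face_subset: "x \<in> X \<Longrightarrow> y \<subseteq> x \<Longrightarrow> y \<in> X"
  using complex_X by (auto simp: abstract_complex_def)

lemma face_finite: "x \<in> X \<Longrightarrow> finite x"
  using complex_X by (auto simp: abstract_complex_def)

lemma apartment_complex: "A \<in> \<E> \<Longrightarrow> abstract_complex A \<and> A \<subseteq> X"
  using building by (simp add: building_def)

lemma apartment_subset: "A \<in> \<E> \<Longrightarrow> A \<subseteq> X"
  using apartment_complex by blast

lemma apartment_face: "A \<in> \<E> \<Longrightarrow> x \<in> A \<Longrightarrow> y \<subseteq> x \<Longrightarrow> y \<in> A"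
  using apartment_complex[of A] unfolding abstract_complex_def by blast

lemma common_apartment: "x \<in> X \<Longrightarrow> y \<in> X \<Longrightarrow> \<exists>A\<in>\<E>. x \<in> A \<and> y \<in> A"
proof -
  have "\<forall>x\<in>X. \<forall>y\<in>X. \<exists>A\<in>\<E>. x \<in> A \<and> y \<in> A"
    using building unfolding building_def by (elim conjE)
  then show "x \<in> X \<Longrightarrow> y \<in> X \<Longrightarrow> \<exists>A\<in>\<E>. x \<in> A \<and> y \<in> A" by blast
qed

lemma apartment_iso:
  "A \<in> \<E> \<Longrightarrow> A' \<in> \<E> \<Longrightarrow> x \<in> A \<inter> A' \<Longrightarrow> y \<in> A \<inter> A' \<Longrightarrow>
    \<exists>f. complex_iso f A A' \<and> (\<forall>v\<in>x \<union> y. f v = v)"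
proof -
  have *: "\<forall>A\<in>\<E>. \<forall>A'\<in>\<E>. \<forall>x\<in>A \<inter> A'. \<forall>y\<in>A \<inter> A'. \<exists>f. complex_iso f A A' \<and> (\<forall>v\<in>x \<union> y. f v = v)"
    using building unfolding building_def by (elim conjE)
  assume "A \<in> \<E>" "A' \<in> \<E>" "x \<in> A \<inter> A'" "y \<in> A \<inter> A'"
  then show ?thesis by (rule *[rule_format])
qed

text \<open>A chart of an apartment: \<open>a w s\<close> is the vertex of type \<open>s\<close> of
  the chamber named by the word \<open>w\<close>. Incidence in the apartment thereby becomes a
  question about words.\<close>

definition coordinates :: "'v set set \<Rightarrow> ('t list \<Rightarrow> 't \<Rightarrow> 'v) \<Rightarrow> bool" where
  "coordinates A a \<longleftrightarrow> A = {a w ` I |w I. True} \<and>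
     (\<forall>w s v t. a w s = a v t \<longleftrightarrow> vert T w s = vert T v t) \<and> (\<forall>w s. \<tau> (a w s) = s)"

lemma coordinatesD:
  assumes "coordinates A a"
  shows "A = {a w ` I |w I. True}" "\<And>w s v t. a w s = a v t \<longleftrightarrow> vert T w s = vert T v t"
    "\<And>w s. \<tau> (a w s) = s"
  using assms unfolding coordinates_def by (elim conjE; blast)+

lemma apartment_coordinates:
  assumes "A \<in> \<E>"
  shows "\<exists>a. coordinates A a"
proof -
  obtain f where f: "complex_iso f (coxeter_complex T) A" "\<forall>b\<in>\<Union>(coxeter_complex T). \<tau> (f b) = fst b"
    using bspec[OF labelling[unfolded building_labelling_def] assms] by (elim exE conjE)
  define a where "a w s = f (vert T w s)" for w s
  have in_complex: "vert T w s \<in> \<Union>(coxeter_complex T)" for w s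
    unfolding coxeter_complex_vert by blast
  have img: "a w ` I = f ` (vert T w ` I)" for w I by (simp add: a_def image_image)
  have "A = (\<lambda>x. f ` x) ` coxeter_complex T" using f(1) by (simp add: complex_iso_def)
  then have "A = {a w ` I |w I. True}" unfolding coxeter_complex_vert img by blast
  moreover have "a w s = a v t \<longleftrightarrow> vert T w s = vert T v t" for w s v t
  proof -
    have "inj_on f (\<Union>(coxeter_complex T))" using f(1) by (simp add: complex_iso_def bij_betw_def)
    then show ?thesis unfolding a_def using in_complex by (metis inj_onD)
  qed
  moreover have "\<tau> (a w s) = s" for w s unfolding a_def using f(2) in_complex fst_vert by metis
  ultimately show ?thesis unfolding coordinates_def by blast
qed

lemma face_type_inj: "x \<in> X \<Longrightarrow> inj_on \<tau> x"
proof -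
  assume x: "x \<in> X"
  then obtain A where A: "A \<in> \<E>" "x \<in> A" using common_apartment[OF x x] by blast
  obtain a where "coordinates A a" using apartment_coordinates[OF A(1)] by blast
  note a = coordinatesD[OF this]
  obtain w I where "x = a w ` I" using A(2) a(1) by blast
  then show ?thesis using a(3) by (auto simp: inj_on_def)
qed

lemma chamber_types: "C \<in> chambers \<Longrightarrow> \<tau> ` C = UNIV"
proof -
  assume C: "C \<in> chambers"
  then have "card (\<tau> ` C) = CARD('t)" using card_image[OF face_type_inj] by (simp add: chambers_def)
  then show ?thesis by (intro card_subset_eq) simp_all
qed

lemma chamber_in_apartment:
  assumes a: "A = {a w ` I |w I. True}" "\<And>w s. \<tau> (a w s) = s" and C: "C \<in> A" "C \<in> chambers"
  shows "\<exists>w. C = a w ` UNIV"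
proof -
  obtain w I where wI: "C = a w ` I" using a(1) C(1) by blast
  have "\<tau> ` C = I" unfolding wI image_image a(2) by simp
  then show ?thesis using chamber_types[OF C(2)] wI by blast
qed

lemma card_coordinates:
  assumes "\<And>w s. \<tau> (a w s) = s"
  shows "card (a w ` I) = card I"
proof (rule card_image)
  show "inj_on (a w) I" by (rule inj_onI) (metis assms)
qed

lemma coordinates_chamber:
  assumes a: "A = {a w ` I |w I. True}" "\<And>w s. \<tau> (a w s) = s" and A: "A \<in> \<E>"
  shows "a w ` UNIV \<in> A" "a w ` UNIV \<in> chambers"
proof -
  show "a w ` UNIV \<in> A" using a(1) by blast
  then show "a w ` UNIV \<in> chambers"
    using apartment_subset[OF A] card_coordinates[OF a(2)] by (auto simp: chambers_def)
qed

lemma face_in_chamber: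
  assumes x: "x \<in> X"
  shows "star chambers x \<noteq> {}"
proof -
  obtain A where A: "A \<in> \<E>" "x \<in> A" using common_apartment[OF x x] by blast
  obtain a where "coordinates A a" using apartment_coordinates[OF A(1)] by blast
  note a = coordinatesD[OF this]
  obtain w I where "x = a w ` I" using A(2) a(1) by blast
  then have "x \<subseteq> a w ` UNIV" by blast
  then show ?thesis using coordinates_chamber(2)[OF a(1,3) A(1), of w] by (auto simp: star_def)
qed

lemma star_face: "star chambers x \<noteq> {} \<Longrightarrow> x \<in> X"
  using face_subset by (auto simp: star_def chambers_def)

lemma dimension:
  assumes "has_dimension X d"
  shows "CARD('t) = d + 1"
proof (rule antisym)
  have "{} \<in> X" using complex_X by (simp add: abstract_complex_def)
  then obtain C where "C \<in> X" "card C = CARD('t)" using face_in_chamber by (auto simp: star_def chambers_def)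
  then show "CARD('t) \<le> d + 1" using assms by (auto simp: has_dimension_def)
  obtain x where x: "x \<in> X" "card x = d + 1" using assms by (auto simp: has_dimension_def faces_def)
  obtain C where C: "C \<in> chambers" "x \<subseteq> C" using face_in_chamber[OF x(1)] by (auto simp: star_def)
  then have "card x \<le> card C" using face_finite by (intro card_mono) (auto simp: chambers_def)
  then show "d + 1 \<le> CARD('t)" using x(2) C(1) by (simp add: chambers_def)
qed

definition thick_chambers :: "nat \<Rightarrow> bool" where
  "thick_chambers q \<longleftrightarrow> (\<forall>x\<in>X. card x + 1 = CARD('t) \<longrightarrow>
     infinite (star chambers x) \<or> q \<le> card (star chambers x))"

lemma thick_chambersI:
  assumes "has_dimension X d" "thick q d X"
  shows "thick_chambers q"
proof -
  have "chambers = faces X (int d)" unfolding chambers_def faces_def dimension[OF assms(1)] by auto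
  then have "star chambers x = {y \<in> faces X (int d). x \<subseteq> y}" for x by (simp add: star_def)
  then show ?thesis
    using assms(2) unfolding thick_chambers_def thick_def faces_def dimension[OF assms(1)] by auto
qed

lemma chamber_eqI:
  assumes C: "C \<in> chambers" and x: "x \<subseteq> C" "card x + 1 = CARD('t)"
  shows "\<exists>v. C = insert v x \<and> v \<notin> x \<and> \<tau> ` x = - {\<tau> v}"
proof -
  have fin: "finite C" using C face_finite by (simp add: chambers_def)
  then have "card (C - x) = 1"
    using x C card_Diff_subset[of x C] finite_subset[OF x(1)] by (simp add: chambers_def)
  then obtain v where v: "C - x = {v}" by (auto simp: card_1_singleton_iff)
  then have Cv: "C = insert v x" "v \<notin> x" using x(1) by blast+
  have inj: "inj_on \<tau> C" using C face_type_inj by (simp add: chambers_def)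
  have "\<tau> v \<notin> \<tau> ` x" using inj Cv by (auto simp: inj_on_def)
  moreover have "insert (\<tau> v) (\<tau> ` x) = UNIV" using chamber_types[OF C] Cv(1) by simp
  ultimately have "\<tau> ` x = - {\<tau> v}" by blast
  then show ?thesis using Cv by blast
qed

text \<open>If the generators \<open>b\<close> and \<open>c\<close> coincided, every apartment would
  have only one vertex of type \<open>b\<close>. Two chambers through a panel without a vertex of
  type \<open>b\<close> lie in a common apartment and would be equal.\<close>

lemma nonredundant_thick:
  assumes "thick_chambers q" "2 \<le> q"
  shows "nonredundant T"
  unfolding nonredundant_def
proof (intro allI impI, rule ccontr)
  fix b c assume bc: "coxeter_eq T [b] [c]" "b \<noteq> c"
  have "{} \<in> X" using complex_X by (simp add: abstract_complex_def)
  then obtain C where C: "C \<in> chambers" using face_in_chamber by (auto simp: star_def)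
  then obtain v where v: "v \<in> C" "\<tau> v = b" using chamber_types[OF C] by (metis UNIV_I imageE)
  define x where "x = C - {v}"
  have CX: "C \<in> X" "finite C" "card C = CARD('t)" using C face_finite by (auto simp: chambers_def)
  have xX: "x \<in> X" "x \<subseteq> C" using face_subset[OF CX(1)] by (auto simp: x_def)
  have cx: "card x + 1 = CARD('t)" using CX v(1) unfolding x_def by (metis Suc_eq_plus1 card_Suc_Diff1)
  have "infinite (star chambers x) \<or> 2 \<le> card (star chambers x)"
    using assms xX(1) cx unfolding thick_chambers_def by force
  then have "\<exists>P. P \<subseteq> star chambers x \<and> card P = 2"
    by (metis infinite_arbitrarily_large obtain_subset_with_card_n)
  then obtain P where P: "P \<subseteq> star chambers x" "card P = 2" by blast
  then obtain C1 C2 where C12: "P = {C1, C2}" "C1 \<noteq> C2" unfolding card_2_iff by blast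
  then have C1: "C1 \<in> chambers" "x \<subseteq> C1" and C2: "C2 \<in> chambers" "x \<subseteq> C2"
    using P(1) by (auto simp: star_def)
  obtain A where A: "A \<in> \<E>" "C1 \<in> A" "C2 \<in> A"
    using common_apartment[of C1 C2] C1 C2 by (auto simp: chambers_def)
  obtain a where "coordinates A a" using apartment_coordinates[OF A(1)] by blast
  note a = coordinatesD[OF this]
  obtain w1 w2 where w: "C1 = a w1 ` UNIV" "C2 = a w2 ` UNIV"
    using chamber_in_apartment[OF a(1,3)] A C1(1) C2(1) by metis
  have tx: "\<tau> ` x = - {b}"
  proof -
    obtain v' where v': "C = insert v' x" "v' \<notin> x" "\<tau> ` x = - {\<tau> v'}" using chamber_eqI[OF C xX(2) cx] by blast
    then have "v' = v" using v(1) by (auto simp: x_def)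
    then show ?thesis using v' v by simp
  qed
  have "a w1 s = a w2 s" for s
  proof (cases "s = b")
    case True
    then show ?thesis unfolding a(2) using redundant_vert[OF bc] by simp
  next
    case False
    then obtain y where y: "y \<in> x" "\<tau> y = s" using tx by (metis ComplI imageE singletonD)
    obtain t1 t2 where "y = a w1 t1" "y = a w2 t2" using y(1) C1(2) C2(2) w by blast
    then show ?thesis using y(2) a(3) by metis
  qed
  then have "C1 = C2" unfolding w by simp
  then show False using C12(2) by simp
qed

lemma star_link:
  assumes x: "x \<in> X" and fin: "finite (star chambers x)" and D: "card x + D + 1 = CARD('t)"
  shows "link chambers x D"
proof
  show "star chambers x \<noteq> {}" by (rule face_in_chamber[OF x])
  show "finite C \<and> card (C - x) = D + 1" if "C \<in> star chambers x" for C
  proof -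
    have C: "C \<in> X" "card C = CARD('t)" "x \<subseteq> C" using that by (auto simp: star_def chambers_def)
    then show ?thesis using D card_Diff_subset[OF face_finite[OF x] C(3)] face_finite by simp
  qed
qed (rule fin)

text \<open>In an apartment the chambers around a face with types \<open>I\<close> form a coset of
  the parabolic subgroup of the complementary types.\<close>

lemma coordinates_star:
  assumes nr: "nonredundant T" and A: "A \<in> \<E>"
    and a: "A = {a w ` I |w I. True}" "\<And>w s v t. a w s = a v t \<longleftrightarrow> vert T w s = vert T v t"
    "\<And>w s. \<tau> (a w s) = s"
  shows "C \<in> A \<and> C \<in> star chambers (a u ` I) \<longleftrightarrow> (\<exists>z. set z \<subseteq> - I \<and> C = a (u @ z) ` UNIV)"
proof -
  have sub: "a u ` I \<subseteq> a v ` UNIV \<longleftrightarrow> (\<exists>z. set z \<subseteq> - I \<and> coxeter_eq T v (u @ z))" for v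
  proof -
    have "a u ` I \<subseteq> a v ` UNIV \<longleftrightarrow> (\<forall>s\<in>I. a v s = a u s)"
    proof
      assume h: "a u ` I \<subseteq> a v ` UNIV"
      show "\<forall>s\<in>I. a v s = a u s"
      proof
        fix s assume "s \<in> I"
        then obtain t where t: "a u s = a v t" using h by blast
        then have "s = t" using a(3) by metis
        then show "a v s = a u s" using t by simp
      qed
    next
      assume "\<forall>s\<in>I. a v s = a u s"
      then show "a u ` I \<subseteq> a v ` UNIV" by (metis image_subsetI rangeI)
    qed
    then show ?thesis unfolding a(2) using chamber_coset[OF nr] by simp
  qed
  have cong: "a v = a w" if "coxeter_eq T v w" for v w
  proof
    fix s
    have "vert T w s = vert T v s" unfolding vert_eq using that by (intro conjI exI[of _ "[]"]) simp_all
    then show "a v s = a w s" unfolding a(2) by simp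
  qed
  show ?thesis
  proof
    assume C: "C \<in> A \<and> C \<in> star chambers (a u ` I)"
    then have "C \<in> A" "C \<in> chambers" by (simp_all add: star_def)
    then obtain v where v: "C = a v ` UNIV" using chamber_in_apartment[OF a(1,3)] by blast
    have "a u ` I \<subseteq> a v ` UNIV" using C v by (simp add: star_def)
    then obtain z where z: "set z \<subseteq> - I" "coxeter_eq T v (u @ z)" unfolding sub by blast
    have "C = a (u @ z) ` UNIV" using cong[OF z(2)] v by simp
    then show "\<exists>z. set z \<subseteq> - I \<and> C = a (u @ z) ` UNIV" using z(1) by blast
  next
    assume "\<exists>z. set z \<subseteq> - I \<and> C = a (u @ z) ` UNIV"
    then obtain z where z: "set z \<subseteq> - I" "C = a (u @ z) ` UNIV" by blast
    have "a u ` I \<subseteq> C" unfolding z(2) sub using z(1) ceq_refl by blast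
    then show "C \<in> A \<and> C \<in> star chambers (a u ` I)"
      using coordinates_chamber[OF a(1,3) A] unfolding z(2) by (simp add: star_def)
  qed
qed

lemma coordinates_snoc:
  assumes "\<And>w s v t. a w s = a v t \<longleftrightarrow> vert T w s = vert T v t" "s \<noteq> c"
  shows "a (u @ [c]) s = a u s"
proof -
  have "vert T u s = vert T (u @ [c]) s"
    unfolding vert_eq using assms(2) by (intro conjI exI[of _ "[c]"]) simp_all
  then show ?thesis unfolding assms(1) by simp
qed

text \<open>Two chambers around \<open>x\<close> lie in an apartment, where a word in the types
  missing from \<open>x\<close> joins them by a gallery around \<open>x\<close>. Consecutive
  chambers share a vertex of the link, as at least two types are missing.\<close>

lemma connected_link:
  assumes nr: "nonredundant T" and x: "card x + 2 \<le> CARD('t)"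
  shows "link_connected chambers x"
  unfolding link_connected_def
proof (intro allI impI ballI)
  fix f :: "'v \<Rightarrow> real" and y z
  assume f: "\<forall>C\<in>star chambers x. \<forall>u\<in>C - x. \<forall>v\<in>C - x. f u = f v"
    and y: "y \<in> link_vertices chambers x" and z: "z \<in> link_vertices chambers x"
  obtain C where C: "C \<in> star chambers x" "y \<in> C - x" using y by (auto simp: link_vertices_def)
  obtain C' where C': "C' \<in> star chambers x" "z \<in> C' - x" using z by (auto simp: link_vertices_def)
  obtain A where A: "A \<in> \<E>" "C \<in> A" "C' \<in> A"
    using common_apartment[of C C'] C(1) C'(1) by (auto simp: star_def chambers_def)
  obtain a where "coordinates A a" using apartment_coordinates[OF A(1)] by blast
  note a = coordinatesD[OF this]
  obtain u where u: "C = a u ` UNIV" using chamber_in_apartment[OF a(1,3) A(2)] C(1) unfolding star_def by blast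
  have xC: "x \<subseteq> C" using C(1) by (simp add: star_def)
  define I where "I = \<tau> ` x"
  have xI: "x = a u ` I"
  proof -
    have "v = a u (\<tau> v)" if "v \<in> x" for v using that xC u a(3) by auto
    then show ?thesis unfolding I_def by (auto simp: image_image)
  qed
  have cI: "card I = card x" unfolding xI using card_coordinates[where a = a, OF a(3), of u I] by simp
  have notx: "a v s \<notin> x" if "s \<in> - I" for v s
    using that a(3) unfolding I_def by (metis ComplD imageI)
  have star_w: "a (u @ w) ` UNIV \<in> star chambers x" if "set w \<subseteq> - I" for w
  proof -
    have "\<exists>z. set z \<subseteq> - I \<and> a (u @ w) ` UNIV = a (u @ z) ` UNIV" using that by blast
    then have "a (u @ w) ` UNIV \<in> A \<and> a (u @ w) ` UNIV \<in> star chambers (a u ` I)"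
      by (rule iffD2[OF coordinates_star[OF nr A(1) a]])
    then show ?thesis unfolding xI[symmetric] by (rule conjunct2)
  qed
  have const: "f (a (u @ w) s) = f (a (u @ w) s')" if "set w \<subseteq> - I" "s \<in> - I" "s' \<in> - I" for w s s'
  proof -
    have 1: "a (u @ w) s \<in> a (u @ w) ` UNIV - x" and 2: "a (u @ w) s' \<in> a (u @ w) ` UNIV - x"
      using notx[OF that(2)] notx[OF that(3)] by simp_all
    show ?thesis by (rule f[rule_format, OF star_w[OF that(1)] 1 2])
  qed
  obtain s0 where s0: "y = a u s0" using C(2) u by blast
  have s0I: "s0 \<in> - I" using C(2) s0 xI by auto
  have all: "set w \<subseteq> - I \<Longrightarrow> s \<in> - I \<Longrightarrow> f (a (u @ w) s) = f y" for w s
  proof (induction w arbitrary: s rule: rev_induct)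
    case Nil
    then show ?case using const[of "[]" s s0] s0 s0I by simp
  next
    case (snoc c w)
    \<comment> \<open>A missing type other than \<open>c\<close> is needed: its vertex is common to
      both sides of the wall crossed by \<open>c\<close>.\<close>
    have "- I \<noteq> {c}"
    proof
      assume "- I = {c}"
      then have "card (- I) = 1" by simp
      then have "CARD('t) - card I = 1" using card_Diff_subset[of I "UNIV :: 't set"] by (simp add: Compl_eq_Diff_UNIV)
      then show False using x cI by arith
    qed
    then obtain s' where s': "s' \<in> - I" "s' \<noteq> c" using s0I by blast
    have "f (a (u @ w @ [c]) s) = f (a (u @ w @ [c]) s')" using const[of "w @ [c]" s s'] snoc.prems s'(1) by simp
    also have "a (u @ w @ [c]) s' = a (u @ w) s'" using coordinates_snoc[OF a(2) s'(2), of "u @ w"] by simp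
    also have "f \<dots> = f y" using snoc.IH snoc.prems s'(1) by simp
    finally show ?case .
  qed
  obtain w where w: "set w \<subseteq> - I" "C' = a (u @ w) ` UNIV"
  proof -
    have "C' \<in> A \<and> C' \<in> star chambers (a u ` I)" using A(3) C'(1) xI by simp
    then have "\<exists>z. set z \<subseteq> - I \<and> C' = a (u @ z) ` UNIV"
      by (rule iffD1[OF coordinates_star[OF nr A(1) a]])
    then show ?thesis using that by blast
  qed
  obtain s where s: "z = a (u @ w) s" using C'(2) w(2) by blast
  have "s \<in> - I"
  proof
    assume "s \<in> I"
    then have "\<tau> z \<in> \<tau> ` x" using s a(3) I_def by simp
    then obtain v where v: "v \<in> x" "\<tau> v = \<tau> z" by auto
    have "x \<subseteq> C'" "C' \<in> X" using C'(1) by (auto simp: star_def chambers_def)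
    then have "v = z" using inj_onD[OF face_type_inj[of C'] v(2)] v(1) C'(2) by blast
    then show False using v(1) C'(2) by simp
  qed
  then show "f y = f z" using all[OF w(1)] s by simp
qed

text \<open>An automorphism taking a chamber through \<open>x\<close> to a chamber through
  \<open>x'\<close> preserves types, so it takes \<open>x\<close> to the unique face of that chamber
  with the types of \<open>x'\<close>.\<close>

lemma type_invariance:
  assumes st: "strongly_transitive d X \<E> \<tau>" and d: "CARD('t) = d + 1"
    and x: "x \<in> X" "x' \<in> X" "\<tau> ` x = \<tau> ` x'"
  shows "card (star chambers x) = card (star chambers x')"
proof -
  obtain G where G: "\<forall>g\<in>G. complex_iso g X X \<and> (\<forall>v\<in>\<Union>X. \<tau> (g v) = \<tau> v) \<and> (\<forall>A\<in>\<E>. (\<lambda>x. g ` x) ` A \<in> \<E>)"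
    and transitive: "\<forall>A\<in>\<E>. \<forall>A'\<in>\<E>. \<forall>y\<in>faces A (int d). \<forall>y'\<in>faces A' (int d).
      \<exists>g\<in>G. (\<lambda>y. g ` y) ` A = A' \<and> g ` y = y'"
    using st unfolding strongly_transitive_def by (elim exE conjE)
  obtain C C' where C: "C \<in> chambers" "x \<subseteq> C" and C': "C' \<in> chambers" "x' \<subseteq> C'"
    using face_in_chamber[OF x(1)] face_in_chamber[OF x(2)] by (auto simp: star_def)
  obtain A A' where A: "A \<in> \<E>" "C \<in> A" and A': "A' \<in> \<E>" "C' \<in> A'"
    using common_apartment[of C C] common_apartment[of C' C'] C C' by (auto simp: chambers_def)
  have CA: "C \<in> faces A (int d)" "C' \<in> faces A' (int d)"
    using A A' C C' d by (auto simp: faces_def chambers_def)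
  obtain g where g: "g \<in> G" "g ` C = C'"
    using transitive[rule_format, OF A(1) A'(1) CA] by (elim bexE conjE)
  note G_g = bspec[OF G g(1)]
  have iso: "bij_betw g (\<Union>X) (\<Union>X)" "(\<lambda>x. g ` x) ` X = X"
    using conjunct1[OF G_g] unfolding complex_iso_def by simp_all
  have \<tau>g: "\<tau> (g v) = \<tau> v" if "v \<in> \<Union>X" for v
    by (rule bspec[OF conjunct1[OF conjunct2[OF G_g]] that])
  have inj: "inj_on g (\<Union>X)" using iso(1) by (simp add: bij_betw_def)
  have CX: "C \<subseteq> \<Union>X" "C' \<in> X" using C C' by (auto simp: chambers_def)
  have gx: "g ` x = x'"
  proof -
    have sub: "g ` x \<subseteq> C'" using g(2) C(2) by blast
    have "\<tau> ` g ` x = \<tau> ` x"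
      unfolding image_image
    proof (rule image_cong[OF HOL.refl])
      fix v assume "v \<in> x"
      then have "v \<in> \<Union>X" using C(2) CX(1) by blast
      then show "\<tau> (g v) = \<tau> v" by (rule \<tau>g)
    qed
    then have "\<tau> ` (g ` x) = \<tau> ` x'" using x(3) by simp
    then show ?thesis using inj_on_image_eq_iff[OF face_type_inj[OF CX(2)] sub C'(2)] by simp
  qed
  have "bij_betw (\<lambda>D. g ` D) (star chambers x) (star chambers x')"
    unfolding bij_betw_def
  proof
    have sub: "star chambers x \<subseteq> Pow (\<Union>X)" by (auto simp: star_def chambers_def)
    show "inj_on ((`) g) (star chambers x)"
      by (rule inj_on_subset[OF inj_on_image_Pow[OF inj] sub])
    have card_g: "card (g ` D) = card D" if "D \<in> X" for D
      by (rule card_image) (use inj_on_subset[OF inj, of D] that in blast)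
    show "(`) g ` star chambers x = star chambers x'"
    proof (intro equalityI subsetI)
      fix D assume "D \<in> (`) g ` star chambers x"
      then obtain D0 where D0: "D0 \<in> X" "card D0 = CARD('t)" "x \<subseteq> D0" "D = g ` D0"
        by (auto simp: star_def chambers_def)
      have "D \<in> X" using iso(2) D0 by blast
      then show "D \<in> star chambers x'" using D0 card_g[OF D0(1)] gx by (auto simp: star_def chambers_def)
    next
      fix D assume "D \<in> star chambers x'"
      then have D: "D \<in> X" "card D = CARD('t)" "x' \<subseteq> D" by (auto simp: star_def chambers_def)
      then obtain D0 where D0: "D0 \<in> X" "D = g ` D0" using iso(2) by (metis imageE)
      have "g ` x \<subseteq> g ` D0" using D(3) D0(2) gx by simp
      moreover have "x \<subseteq> \<Union>X" "D0 \<subseteq> \<Union>X" using x(1) D0(1) by blast+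
      ultimately have "x \<subseteq> D0" using inj_on_image_subset_iff[OF inj] by simp
      then have "D0 \<in> star chambers x" using D0 D(2) card_g[OF D0(1)] by (simp add: star_def chambers_def)
      then show "D \<in> (`) g ` star chambers x" using D0(2) by blast
    qed
  qed
  then show ?thesis by (rule bij_betw_same_card)
qed

end

section \<open>Links of faces of codimension two\<close>

context typed_building
begin

lemma rank_two_link_face:
  assumes x: "x \<in> X" "card x + 2 = CARD('t)" and fin: "finite (star chambers x)"
    and inv: "\<And>y y'. y \<in> X \<Longrightarrow> y' \<in> X \<Longrightarrow> \<tau> ` y = \<tau> ` y' \<Longrightarrow> card (star chambers y) = card (star chambers y')"
    and st: "- \<tau> ` x = {s, t}" "s \<noteq> t"
  shows "\<exists>a b. rank_two_link chambers x \<tau> s t a b"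
proof -
  interpret link chambers x 1 by (rule star_link[OF x(1) fin]) (use x(2) in simp)
  have pair: "\<exists>u v. C - x = {u, v} \<and> \<tau> u = s \<and> \<tau> v = t" if C: "C \<in> star chambers x" for C
  proof -
    have C': "C \<in> X" "C \<in> chambers" "x \<subseteq> C" using C by (auto simp: star_def chambers_def)
    have inj: "inj_on \<tau> C" by (rule face_type_inj[OF C'(1)])
    have "\<tau> ` (C - x) = \<tau> ` C - \<tau> ` x"
      by (rule inj_on_image_set_diff[OF inj]) (use C'(3) in auto)
    then have img: "\<tau> ` (C - x) = {s, t}" using chamber_types[OF C'(2)] st(1) by (simp add: Compl_eq_Diff_UNIV)
    have "s \<in> \<tau> ` (C - x)" "t \<in> \<tau> ` (C - x)" unfolding img by simp_all
    then obtain u v where uv: "u \<in> C - x" "\<tau> u = s" "v \<in> C - x" "\<tau> v = t" by (elim imageE) simp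
    have "C - x = {u, v}"
    proof (intro equalityI subsetI)
      fix w assume w: "w \<in> C - x"
      have "\<tau> w \<in> {s, t}" using imageI[OF w, of \<tau>] unfolding img .
      then show "w \<in> {u, v}" using inj_onD[OF inj, of w u] inj_onD[OF inj, of w v] w uv by auto
    qed (use uv in auto)
    then show ?thesis using uv by blast
  qed
  have vert_face: "insert v x \<in> X" if v: "v \<in> U" for v
  proof -
    obtain C where "C \<in> star chambers x" "v \<in> C" using v by (auto simp: link_vertices_def)
    then show ?thesis using face_subset[of C "insert v x"] by (auto simp: star_def chambers_def)
  qed
  have same: "card (star chambers (insert v x)) = card (star chambers (insert w x))"
    if "v \<in> U" "w \<in> U" "\<tau> v = \<tau> w" for v w
    by (rule inv[OF vert_face[OF that(1)] vert_face[OF that(2)]]) (simp add: that(3))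
  obtain C where C: "C \<in> star chambers x" using star_ne by auto
  then obtain u v where uv': "C - x = {u, v}" "\<tau> u = s" "\<tau> v = t" using pair by blast
  then have "u \<in> C - x" "v \<in> C - x" by simp_all
  then have uv: "u \<in> U" "\<tau> u = s" "v \<in> U" "\<tau> v = t"
    using C uv'(2,3) unfolding link_vertices_def by auto
  have "rank_two_link chambers x \<tau> s t (card (star chambers (insert u x))) (card (star chambers (insert v x)))"
  proof
    show "s \<noteq> t" by (rule st(2))
    show "\<exists>u v. C - x = {u, v} \<and> \<tau> u = s \<and> \<tau> v = t" if "C \<in> star chambers x" for C by (rule pair[OF that])
    show "card (star chambers (insert w x)) = card (star chambers (insert u x))" if "w \<in> U" "\<tau> w = s" for w
      by (rule same) (use that uv in simp_all)
    show "card (star chambers (insert w x)) = card (star chambers (insert v x))" if "w \<in> U" "\<tau> w = t" for w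
      by (rule same) (use that uv in simp_all)
  qed
  then show ?thesis by blast
qed

lemma face_coordinates:
  assumes nr: "nonredundant T" and A: "A \<in> \<E>" and a: "coordinates A a"
    and C: "C \<in> star chambers x" "C \<in> A"
  obtains u where "C = a u ` UNIV" "x = a u ` (\<tau> ` x)"
    "\<And>D. D \<in> A \<Longrightarrow> D \<in> star chambers x \<Longrightarrow> \<exists>z. set z \<subseteq> - \<tau> ` x \<and> D = a (u @ z) ` UNIV"
    "\<And>z. set z \<subseteq> - \<tau> ` x \<Longrightarrow> a (u @ z) ` UNIV \<in> A \<and> a (u @ z) ` UNIV \<in> star chambers x"
proof -
  note a = coordinatesD[OF a]
  have C': "C \<in> chambers" "x \<subseteq> C" using C(1) by (simp_all add: star_def)
  obtain u where u: "C = a u ` UNIV" using chamber_in_apartment[OF a(1,3) C(2) C'(1)] by blast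
  have xI: "x = a u ` (\<tau> ` x)"
  proof -
    have "v = a u (\<tau> v)" if "v \<in> x" for v
    proof -
      have "v \<in> a u ` UNIV" using that C'(2) u by blast
      then show ?thesis using a(3) by auto
    qed
    then show ?thesis by (auto simp: image_image)
  qed
  have iff: "D \<in> A \<and> D \<in> star chambers x \<longleftrightarrow> (\<exists>z. set z \<subseteq> - \<tau> ` x \<and> D = a (u @ z) ` UNIV)" for D
    using coordinates_star[OF nr A a, of D u "\<tau> ` x"] xI by simp
  show ?thesis
    by (rule that[OF u xI]) (use iff in blast)+
qed

lemma word_vertex:
  assumes "\<And>w s v t. a w s = a v t \<longleftrightarrow> vert T w s = vert T v t" "set z \<subseteq> - {s}" "coxeter_eq T v (u @ z)"
  shows "a v s = a u s"
proof -
  have "vert T u s = vert T v s" unfolding vert_eq using assms(2,3) by blast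
  then show ?thesis unfolding assms(1) by simp
qed

text \<open>The two missing generators commute, and the link is complete bipartite.\<close>

lemma gap_edgeless:
  assumes T: "edges T = {}" and x: "x \<in> X" "card x + 2 = CARD('t)" and fin: "finite (star chambers x)"
    and inv: "\<And>y y'. y \<in> X \<Longrightarrow> y' \<in> X \<Longrightarrow> \<tau> ` y = \<tau> ` y' \<Longrightarrow> card (star chambers y) = card (star chambers y')"
  shows "gap chambers 1 x 0"
proof -
  have nr: "nonredundant T" by (rule nonredundant_edgeless[OF T])
  have "card (- \<tau> ` x) = 2"
    using card_Diff_subset[of "\<tau> ` x" UNIV] face_finite[OF x(1)] card_image[OF face_type_inj[OF x(1)]] x(2)
    by (simp add: Compl_eq_Diff_UNIV)
  then obtain s t where st: "- \<tau> ` x = {s, t}" "s \<noteq> t" unfolding card_2_iff by blast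
  obtain p q where "rank_two_link chambers x \<tau> s t p q" using rank_two_link_face[OF x fin inv st] by blast
  then interpret rank_two_link chambers x \<tau> s t p q .
  have comm: "coxeter_entry T s t = 2" using T st(2) by (simp add: coxeter_entry_def)
  show ?thesis
  proof (rule complete_gap)
    fix u v assume u: "u \<in> U" and v: "v \<in> U" and uv: "\<tau> u \<noteq> \<tau> v"
    obtain C where C: "C \<in> star chambers x" "u \<in> C" "u \<notin> x" using u by (auto simp: link_vertices_def)
    obtain C' where C': "C' \<in> star chambers x" "v \<in> C'" "v \<notin> x" using v by (auto simp: link_vertices_def)
    obtain A where A: "A \<in> \<E>" "C \<in> A" "C' \<in> A"
      using common_apartment[of C C'] C(1) C'(1) by (auto simp: star_def chambers_def)
    obtain a where ca: "coordinates A a" using apartment_coordinates[OF A(1)] by blast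
    note a = coordinatesD[OF ca]
    obtain w where w: "C = a w ` UNIV"
      "\<And>D. D \<in> A \<Longrightarrow> D \<in> star chambers x \<Longrightarrow> \<exists>z. set z \<subseteq> - \<tau> ` x \<and> D = a (w @ z) ` UNIV"
      "\<And>z. set z \<subseteq> - \<tau> ` x \<Longrightarrow> a (w @ z) ` UNIV \<in> A \<and> a (w @ z) ` UNIV \<in> star chambers x"
      using face_coordinates[OF nr A(1) ca C(1) A(2)] by metis
    obtain z where z: "set z \<subseteq> {s, t}" "C' = a (w @ z) ` UNIV" using w(2)[OF A(3) C'(1)] st(1) by blast
    obtain y1 y2 where y: "set y1 \<subseteq> {s}" "set y2 \<subseteq> {t}" "coxeter_eq T z (y1 @ y2)" "coxeter_eq T z (y2 @ y1)"
      using commuting_word[OF comm z(1)] by blast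
    have u': "u = a w (\<tau> u)" using C(2) w(1) a(3) by auto
    have v': "v = a (w @ z) (\<tau> v)" using C'(2) z(2) a(3) by auto
    \<comment> \<open>Split \<open>z\<close> into a power of each generator, in either order. Moving
      from \<open>C\<close> only by the generator that keeps \<open>u\<close> leads to a chamber
      that contains \<open>u\<close> and already has the vertex \<open>v\<close> of
      \<open>C'\<close>.\<close>
    have "\<exists>y. set y \<subseteq> {s, t} \<and> a (w @ y) (\<tau> u) = u \<and> a (w @ y) (\<tau> v) = v"
    proof (cases "\<tau> u = s")
      case True
      then have vt: "\<tau> v = t" using type_cases[OF v] uv by auto
      have "a (w @ y2) s = a w s" by (rule word_vertex[OF a(2), of y2]) (use y(2) st(2) in auto)
      moreover have "a (w @ z) t = a (w @ y2) t"
        by (rule word_vertex[OF a(2), of y1]) (use y(1) st(2) ceq_left[OF y(4), of w] in auto)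
      ultimately show ?thesis using True vt u' v' y(2) by (intro exI[of _ y2]) auto
    next
      case False
      then have ut: "\<tau> u = t" "\<tau> v = s" using type_cases[OF u] type_cases[OF v] uv by auto
      have "a (w @ y1) t = a w t" by (rule word_vertex[OF a(2), of y1]) (use y(1) st(2) in auto)
      moreover have "a (w @ z) s = a (w @ y1) s"
        by (rule word_vertex[OF a(2), of y2]) (use y(2) st(2) ceq_left[OF y(3), of w] in auto)
      ultimately show ?thesis using ut u' v' y(1) by (intro exI[of _ y1]) auto
    qed
    then obtain y where y: "set y \<subseteq> {s, t}" "a (w @ y) (\<tau> u) = u" "a (w @ y) (\<tau> v) = v" by blast
    then have D: "a (w @ y) ` UNIV \<in> star chambers x" using w(3)[of y] st(1) by simp
    have "u \<in> a (w @ y) ` UNIV" by (rule image_eqI[where x = "\<tau> u"]) (simp_all add: y(2))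
    moreover have "v \<in> a (w @ y) ` UNIV" by (rule image_eqI[where x = "\<tau> v"]) (simp_all add: y(3))
    ultimately have "\<exists>C\<in>star chambers x. u \<in> C \<and> v \<in> C" using D by (intro bexI[OF _ D] conjI)
    then show "v \<in> nbrs u" using uv v unfolding nbrs_def by auto
  qed
qed

text \<open>The traces on the link of the apartments through \<open>x\<close> satisfy the axioms of
  \<open>polygon_system\<close>, and thickness bounds the degrees on both sides from below by
  \<open>q\<close>.\<close>

lemma gap_thick:
  assumes th: "thick_chambers q" "2 \<le> q" and x: "x \<in> X" "card x + 2 = CARD('t)" and fin: "finite (star chambers x)"
    and inv: "\<And>y y'. y \<in> X \<Longrightarrow> y' \<in> X \<Longrightarrow> \<tau> ` y = \<tau> ` y' \<Longrightarrow> card (star chambers y) = card (star chambers y')"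
  shows "gap chambers 1 x (2 / sqrt q)"
proof -
  have nr: "nonredundant T" by (rule nonredundant_thick[OF th])
  have "card (- \<tau> ` x) = 2"
    using card_Diff_subset[of "\<tau> ` x" UNIV] face_finite[OF x(1)] card_image[OF face_type_inj[OF x(1)]] x(2)
    by (simp add: Compl_eq_Diff_UNIV)
  then obtain s t where st: "- \<tau> ` x = {s, t}" "s \<noteq> t" unfolding card_2_iff by blast
  obtain k l where "rank_two_link chambers x \<tau> s t k l" using rank_two_link_face[OF x fin inv st] by blast
  then interpret rank_two_link chambers x \<tau> s t k l .
  define E where "E = (\<lambda>C. C - x) ` star chambers x"
  define P where "P A = (\<lambda>C. C - x) ` (A \<inter> star chambers x)" for A
  define \<P> where "\<P> = P ` {A \<in> \<E>. x \<in> A}"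
  \<comment> \<open>Edges of the link stand for chambers around \<open>x\<close> without
    loss.\<close>
  have glue: "C = C' \<longleftrightarrow> C - x = C' - x" if "C \<in> star chambers x" "C' \<in> star chambers x" for C C'
    using that by (auto simp: star_def)
  have P_edge: "C \<in> A" if "C \<in> star chambers x" "C - x \<in> P A" for C A
    using that glue unfolding P_def by blast
  have PU: "insert v x \<in> A" "v \<notin> x" if A: "A \<in> \<E>" and v: "v \<in> \<Union>(P A)" for A v
  proof -
    obtain C where C: "C \<in> A" "C \<in> star chambers x" "v \<in> C - x" using v by (auto simp: P_def)
    then show "insert v x \<in> A" using apartment_face[OF A C(1), of "insert v x"] by (auto simp: star_def)
    show "v \<notin> x" using C(3) by simp
  qed
  have iso: "graph_iso f (P A) (P A')"
    if A: "A \<in> \<E>" "A' \<in> \<E>" and f: "complex_iso f A A'" "\<And>v. v \<in> x \<Longrightarrow> f v = v" and xA: "x \<in> A" for A A' f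
  proof -
    have inj: "inj_on f (\<Union>A)" and img: "(\<lambda>y. f ` y) ` A = A'" using f(1) by (auto simp: complex_iso_def bij_betw_def)
    have fx: "f ` x = x" using f(2) by simp
    have diff: "f ` (C - x) = f ` C - x" if C: "C \<in> A" for C
    proof -
      have "f ` (C - x) = f ` C - f ` x" by (rule inj_on_image_set_diff[OF inj]) (use C xA in auto)
      then show ?thesis using fx by simp
    qed
    have card_f: "card (f ` C) = card C" if C: "C \<in> A" for C
      by (rule card_image[OF inj_on_subset[OF inj]]) (use C in auto)
    have fC: "f ` C \<in> A' \<and> f ` C \<in> star chambers x" if "C \<in> A" "C \<in> star chambers x" for C
    proof -
      have "f ` C \<in> A'" using img that(1) by blast
      moreover have "x \<subseteq> f ` C" using that(2) fx by (auto simp: star_def)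
      ultimately show ?thesis using that card_f apartment_subset[OF A(2)] by (auto simp: star_def chambers_def)
    qed
    have fC': "\<exists>C\<in>A \<inter> star chambers x. D = f ` C" if D: "D \<in> A'" "D \<in> star chambers x" for D
    proof -
      obtain C where C: "C \<in> A" "D = f ` C" using img D(1) by blast
      have "f ` x \<subseteq> f ` C" using D(2) C(2) fx by (simp add: star_def)
      then have "x \<subseteq> C" using inj_on_image_subset_iff[OF inj, of x C] xA C(1) by blast
      then have "C \<in> star chambers x"
        using C card_f[OF C(1)] D(2) apartment_subset[OF A(1)] by (auto simp: star_def chambers_def)
      then show ?thesis using C by blast
    qed
    have edges: "(\<lambda>e. f ` e) ` P A = P A'"
    proof (intro equalityI subsetI)
      fix e assume "e \<in> (\<lambda>e. f ` e) ` P A"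
      then obtain C where C: "C \<in> A" "C \<in> star chambers x" "e = f ` (C - x)" by (auto simp: P_def)
      then show "e \<in> P A'" using fC[OF C(1,2)] diff[OF C(1)] unfolding P_def by blast
    next
      fix e assume "e \<in> P A'"
      then obtain D where D: "D \<in> A'" "D \<in> star chambers x" "e = D - x" by (auto simp: P_def)
      then obtain C where C: "C \<in> A" "C \<in> star chambers x" "D = f ` C" using fC' by blast
      then have "e = f ` (C - x)" using diff D(3) by simp
      then show "e \<in> (\<lambda>e. f ` e) ` P A" using C unfolding P_def by blast
    qed
    have "\<Union>(P A) \<subseteq> \<Union>A" by (auto simp: P_def)
    then have "inj_on f (\<Union>(P A))" by (rule inj_on_subset[OF inj])
    moreover have "f ` \<Union>(P A) = \<Union>(P A')" using edges by (metis image_Union)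
    ultimately show ?thesis using edges by (simp add: graph_iso_def bij_betw_def)
  qed
  interpret pg: polygon_system E \<P> "\<lambda>v. \<tau> v = s"
  proof
    show "finite E" using fin by (simp add: E_def)
    show "card e = 2" if "e \<in> E" for e using that chamber by (auto simp: E_def)
    show "(\<tau> u = s) \<noteq> (\<tau> v = s)" if uv: "{u, v} \<in> E" for u v
    proof -
      obtain C where C: "C \<in> star chambers x" "{u, v} = C - x" using uv by (auto simp: E_def)
      then obtain u' v' where "{u, v} = {u', v'}" "\<tau> u' = s" "\<tau> v' = t" using types(2)[OF C(1)] by metis
      then show ?thesis using st(2) by (auto simp: doubleton_eq_iff)
    qed
    show "Q \<subseteq> E" if "Q \<in> \<P>" for Q using that by (auto simp: \<P>_def P_def E_def)
    show "\<exists>Q\<in>\<P>. e \<in> Q \<and> e' \<in> Q" if e: "e \<in> E" "e' \<in> E" for e e'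
    proof -
      obtain C C' where C: "C \<in> star chambers x" "e = C - x" "C' \<in> star chambers x" "e' = C' - x"
        using e by (auto simp: E_def)
      obtain A where A: "A \<in> \<E>" "C \<in> A" "C' \<in> A"
        using common_apartment[of C C'] C(1,3) by (auto simp: star_def chambers_def)
      have "x \<in> A" using apartment_face[OF A(1,2), of x] C(1) by (simp add: star_def)
      then show ?thesis using A C unfolding \<P>_def P_def by blast
    qed
    show "\<exists>f. graph_iso f Q Q' \<and> (\<forall>v\<in>e. f v = v) \<and> f y = y"
      if Q: "Q \<in> \<P>" "Q' \<in> \<P>" and e: "e \<in> Q" "e \<in> Q'" and y: "y \<in> \<Union>Q" "y \<in> \<Union>Q'" for Q Q' e y
    proof -
      obtain A A' where A: "A \<in> \<E>" "x \<in> A" "Q = P A" "A' \<in> \<E>" "x \<in> A'" "Q' = P A'" using Q by (auto simp: \<P>_def)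
      obtain C where C: "C \<in> star chambers x" "C \<in> A" "e = C - x" using e(1) A(3) by (auto simp: P_def)
      have "C \<in> A'" by (rule P_edge[OF C(1)]) (use e(2) A(6) C(3) in simp)
      then obtain f where f: "complex_iso f A A'" "\<forall>v\<in>C \<union> insert y x. f v = v"
        using apartment_iso[OF A(1,4), of C "insert y x"] C(2) PU(1)[OF A(1), of y] PU(1)[OF A(4), of y] y A(3,6) by blast
      have "graph_iso f Q Q'" unfolding A(3,6) by (rule iso[OF A(1,4) f(1) _ A(2)]) (use f(2) in blast)
      then show ?thesis using f(2) C(3) by blast
    qed
    show "\<exists>f. graph_iso f Q Q' \<and> f y = y"
      if Q: "Q \<in> \<P>" "Q' \<in> \<P>" and y: "y \<in> \<Union>Q" "y \<in> \<Union>Q'" for Q Q' y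
    proof -
      obtain A A' where A: "A \<in> \<E>" "x \<in> A" "Q = P A" "A' \<in> \<E>" "x \<in> A'" "Q' = P A'" using Q by (auto simp: \<P>_def)
      obtain f where f: "complex_iso f A A'" "\<forall>v\<in>insert y x \<union> insert y x. f v = v"
        using apartment_iso[OF A(1,4), of "insert y x" "insert y x"] PU(1)[OF A(1), of y] PU(1)[OF A(4), of y] y A(3,6) by blast
      have "graph_iso f Q Q'" unfolding A(3,6) by (rule iso[OF A(1,4) f(1) _ A(2)]) (use f(2) in blast)
      then show ?thesis using f(2) by blast
    qed
    show "card {e \<in> Q. v \<in> e} = 2" if Q: "Q \<in> \<P>" and v: "v \<in> \<Union>Q" for Q v
    proof -
      obtain A where A: "A \<in> \<E>" "x \<in> A" "Q = P A" using Q by (auto simp: \<P>_def)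
      obtain C where C: "C \<in> star chambers x" "C \<in> A" "v \<in> C - x" using v A(3) by (auto simp: P_def)
      obtain a where ca: "coordinates A a" using apartment_coordinates[OF A(1)] by blast
      note a = coordinatesD[OF ca]
      have Cv: "C \<in> star chambers (insert v x)" using C by (auto simp: star_def)
      obtain u where u: "C = a u ` UNIV"
        "\<And>D. D \<in> A \<Longrightarrow> D \<in> star chambers (insert v x) \<Longrightarrow> \<exists>z. set z \<subseteq> - \<tau> ` insert v x \<and> D = a (u @ z) ` UNIV"
        "\<And>z. set z \<subseteq> - \<tau> ` insert v x \<Longrightarrow> a (u @ z) ` UNIV \<in> A \<and> a (u @ z) ` UNIV \<in> star chambers (insert v x)"
        using face_coordinates[OF nr A(1) ca Cv C(2)] by metis
      have "v \<in> U" using C unfolding link_vertices_def by blast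
      then obtain c where c: "- \<tau> ` insert v x = {c}"
        using type_cases[of v] st by (metis Compl_insert Diff_insert_absorb image_insert insert_absorb insert_commute insert_Diff_if singletonD singleton_insert_inj_eq' insertE)
      let ?D = "a (u @ [c]) ` UNIV"
      have D: "?D \<in> A" "?D \<in> star chambers (insert v x)" using u(3)[of "[c]"] c by auto
      \<comment> \<open>Only one type \<open>c\<close> is missing from \<open>insert v x\<close>, so
        the words in question represent 1 or \<open>c\<close>. \<open>nonredundant\<close> keeps the
        two resulting chambers apart.\<close>
      have all: "D = C \<or> D = ?D" if DA: "D \<in> A" "D \<in> star chambers (insert v x)" for D
      proof -
        obtain z where z: "set z \<subseteq> {c}" "D = a (u @ z) ` UNIV" using u(2)[OF DA] c by auto
        from singleton_word[OF z(1)] show ?thesis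
        proof
          assume "coxeter_eq T z []"
          then have "a (u @ z) r = a u r" for r
            using word_vertex[OF a(2), of "[]" r "u @ z" u] ceq_left[of T z "[]" u] by simp
          then show ?thesis using z(2) u(1) by simp
        next
          assume "coxeter_eq T z [c]"
          then have "a (u @ z) r = a (u @ [c]) r" for r
            using word_vertex[OF a(2), of "[]" r "u @ z" "u @ [c]"] ceq_left[of T z "[c]" u] by simp
          then show ?thesis using z(2) by simp
        qed
      qed
      have ne: "C \<noteq> ?D"
      proof
        assume "C = ?D"
        then have "a u c \<in> ?D" using u(1) by blast
        then obtain r where r: "a u c = a (u @ [c]) r" by blast
        then have "r = c" using a(3) by metis
        then show False using r chamber_adjacent_ne[OF nr, of u c] unfolding a(2) by simp
      qed
      have sub: "star chambers (insert v x) \<subseteq> star chambers x" by (auto simp: star_def)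
      have "{e \<in> Q. v \<in> e} = {C - x, ?D - x}"
      proof (intro equalityI subsetI)
        fix e assume "e \<in> {e \<in> Q. v \<in> e}"
        then obtain D' where D': "D' \<in> A" "D' \<in> star chambers x" "e = D' - x" "v \<in> D'"
          using A(3) by (auto simp: P_def)
        then have "D' \<in> star chambers (insert v x)" by (auto simp: star_def)
        then show "e \<in> {C - x, ?D - x}" using all[OF D'(1)] D'(3) by blast
      next
        fix e assume "e \<in> {C - x, ?D - x}"
        moreover have "v \<in> ?D" using D(2) by (auto simp: star_def)
        ultimately show "e \<in> {e \<in> Q. v \<in> e}" using C D sub A(3) unfolding P_def by blast
      qed
      moreover have "C - x \<noteq> ?D - x" using glue[of C ?D] ne C(1) D(2) sub by blast
      ultimately show ?thesis by simp
    qed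
    show "R = Q" if Q: "Q \<in> \<P>" and R: "R \<subseteq> Q" "R \<noteq> {}"
      and closed: "\<And>e e'. e \<in> R \<Longrightarrow> e' \<in> Q \<Longrightarrow> e \<inter> e' \<noteq> {} \<Longrightarrow> e' \<in> R" for Q R
    proof -
      obtain A where A: "A \<in> \<E>" "x \<in> A" "Q = P A" using Q by (auto simp: \<P>_def)
      obtain e where e: "e \<in> R" using R(2) by blast
      then have "e \<in> P A" using R(1) A(3) by blast
      then obtain C where C: "C \<in> star chambers x" "C \<in> A" "e = C - x" by (auto simp: P_def)
      obtain a where ca: "coordinates A a" using apartment_coordinates[OF A(1)] by blast
      note a = coordinatesD[OF ca]
      obtain u where u: "C = a u ` UNIV"
        "\<And>D. D \<in> A \<Longrightarrow> D \<in> star chambers x \<Longrightarrow> \<exists>z. set z \<subseteq> - \<tau> ` x \<and> D = a (u @ z) ` UNIV"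
        "\<And>z. set z \<subseteq> - \<tau> ` x \<Longrightarrow> a (u @ z) ` UNIV \<in> A \<and> a (u @ z) ` UNIV \<in> star chambers x"
        using face_coordinates[OF nr A(1) ca C(1,2)] by metis
      \<comment> \<open>Follow the gallery spelled by \<open>z\<close>: a letter \<open>c\<close>
        keeps the vertex of the other type, so the next edge meets the previous one.\<close>
      have all: "set z \<subseteq> {s, t} \<Longrightarrow> a (u @ z) ` UNIV - x \<in> R" for z
      proof (induction z rule: rev_induct)
        case Nil
        then show ?case using e C(3) u(1) by simp
      next
        case (snoc c z)
        obtain r where r: "r \<in> {s, t}" "r \<noteq> c" using st(2) by blast
        have same: "a (u @ z @ [c]) r = a (u @ z) r" using coordinates_snoc[OF a(2) r(2), of "u @ z"] by simp
        have D: "a (u @ z @ [c]) ` UNIV \<in> A" "a (u @ z @ [c]) ` UNIV \<in> star chambers x"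
          using u(3)[of "z @ [c]"] snoc.prems st(1) by auto
        have "a (u @ z) r \<notin> x"
        proof
          assume "a (u @ z) r \<in> x"
          then have "\<tau> (a (u @ z) r) \<in> \<tau> ` x" by (rule imageI)
          then show False using a(3) r(1) st(1) by auto
        qed
        then have "a (u @ z) r \<in> (a (u @ z) ` UNIV - x) \<inter> (a (u @ z @ [c]) ` UNIV - x)"
          using same by (metis DiffI IntI rangeI)
        then have meet: "(a (u @ z) ` UNIV - x) \<inter> (a (u @ z @ [c]) ` UNIV - x) \<noteq> {}" by blast
        have "a (u @ z @ [c]) ` UNIV - x \<in> Q" unfolding A(3) P_def using D by blast
        then show ?case using closed[OF _ _ meet] snoc by simp
      qed
      have "Q \<subseteq> R"
      proof
        fix e' assume "e' \<in> Q"
        then obtain D where D: "D \<in> A" "D \<in> star chambers x" "e' = D - x" using A(3) by (auto simp: P_def)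
        then obtain z where "set z \<subseteq> {s, t}" "D = a (u @ z) ` UNIV" using u(2)[OF D(1,2)] st(1) by auto
        then show "e' \<in> R" using all D(3) by simp
      qed
      then show ?thesis using R(1) by blast
    qed
  qed
  have EU: "\<Union>E = link_vertices chambers x" unfolding E_def link_vertices_def by auto
  have nbrs_E: "nbrs y = {z. {y, z} \<in> E}" if y: "y \<in> U" for y
  proof (intro equalityI subsetI)
    fix z assume "z \<in> nbrs y"
    then obtain C where C: "C \<in> star chambers x" "y \<in> C" "z \<in> C" and z: "z \<in> U" "z \<noteq> y"
      by (auto simp: nbrs_def)
    have "{y, z} \<subseteq> C - x" using C y z(1) by (auto simp: link_vertices_def)
    moreover have "card (C - x) = 2" "finite (C - x)" using chamber[OF C(1)] by simp_all
    moreover have "card {y, z} = 2" using z(2) by simp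
    ultimately have "{y, z} = C - x" by (intro card_subset_eq) simp_all
    then show "z \<in> {z. {y, z} \<in> E}" using C(1) by (auto simp: E_def)
  next
    fix z assume "z \<in> {z. {y, z} \<in> E}"
    then have yz: "{y, z} \<in> E" by simp
    then obtain C where C: "C \<in> star chambers x" "{y, z} = C - x" by (auto simp: E_def)
    then have "y \<in> C" "z \<in> C" by auto
    moreover have "z \<in> U" using yz EU by auto
    moreover have "z \<noteq> y" using pg.edge_distinct[OF yz] by simp
    ultimately show "z \<in> nbrs y" using C(1) by (auto simp: nbrs_def)
  qed
  have deg: "q \<le> card (star chambers (insert v x))" if v: "v \<in> U" for v
  proof -
    obtain C where C: "C \<in> star chambers x" "v \<in> C" using v by (auto simp: link_vertices_def)
    have "insert v x \<in> X" using C face_subset[of C "insert v x"] by (auto simp: star_def chambers_def)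
    moreover have "card (insert v x) + 1 = CARD('t)"
      using v x face_finite[OF x(1)] by (simp add: link_vertices_def)
    moreover have "finite (star chambers (insert v x))" by (rule finite_subset[OF _ fin]) (auto simp: star_def)
    ultimately show ?thesis using th(1) unfolding thick_chambers_def by blast
  qed
  obtain C where C: "C \<in> star chambers x" using star_ne by auto
  then obtain u v where uv: "C - x = {u, v}" "\<tau> u = s" "\<tau> v = t" using types(2) by blast
  then have "u \<in> C - x" "v \<in> C - x" by simp_all
  then have "u \<in> U" "v \<in> U" using C unfolding link_vertices_def by auto
  then have kl: "q \<le> k" "q \<le> l" using deg degree_s degree_t uv(2,3) by metis+
  show ?thesis
  proof (rule polygon_gap[of "real q" pg.dist pg.ecc])
    show "0 < real q" "real q \<le> real k" "real q \<le> real l" using th(2) kl by simp_all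
    fix v assume v: "v \<in> U"
    then have v': "v \<in> \<Union>E" using EU by simp
    show "1 \<le> pg.ecc v" by (rule pg.ecc_pos[OF v'])
    fix y assume y: "y \<in> U"
    then have y': "y \<in> \<Union>E" using EU by simp
    show "pg.dist v y = 0 \<longleftrightarrow> y = v" by (rule pg.dist_zero[OF v' y'])
    show "pg.dist v y \<le> pg.ecc v" by (rule pg.dist_le_ecc[OF y'])
    show "even (pg.dist v y) \<longleftrightarrow> \<tau> y = \<tau> v"
      using pg.even_dist[OF v' y'] type_cases[OF v] type_cases[OF y] st(2) by auto
    show "pg.dist v z = pg.dist v y + 1 \<or> pg.dist v y = pg.dist v z + 1" if "z \<in> nbrs y" for z
      by (rule pg.dist_step[OF v']) (use that nbrs_E[OF y] in simp)
    show "card {z \<in> nbrs y. pg.dist v z < pg.dist v y} = 1" if "0 < pg.dist v y" "pg.dist v y < pg.ecc v"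
      using pg.card_closer[OF v' y' that] by (simp add: nbrs_E[OF y])
  qed
qed

end

section \<open>Homogeneous complexes\<close>

text \<open>The common ground of a finite building and a finite quotient of a building.
  \<open>homogeneous\<close> speaks of nonempty faces, since these are the faces whose stars a
  covering compares.\<close>

locale homogeneous_chambers =
  fixes \<C> :: "'v set set" and \<tau> :: "'v \<Rightarrow> 't" and r q :: nat and \<mu> :: real
  assumes finite_chambers: "finite \<C>" and chambers_ne: "\<C> \<noteq> {}"
    and chamber: "C \<in> \<C> \<Longrightarrow> finite C \<and> card C = r + 1" and r: "1 \<le> r" and q: "1 \<le> q"
    and types: "C \<in> \<C> \<Longrightarrow> inj_on \<tau> C \<and> \<tau> ` C = UNIV"
    and homogeneous: "x \<noteq> {} \<Longrightarrow> star \<C> x \<noteq> {} \<Longrightarrow> star \<C> y \<noteq> {} \<Longrightarrow> \<tau> ` x = \<tau> ` y \<Longrightarrow>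
      card (star \<C> x) = card (star \<C> y)"
    and panel: "star \<C> x \<noteq> {} \<Longrightarrow> card x = r \<Longrightarrow> q \<le> card (star \<C> x)"
    and base: "star \<C> x \<noteq> {} \<Longrightarrow> card x + 1 = r \<Longrightarrow> gap \<C> 1 x \<mu>"
    and conn: "star \<C> x \<noteq> {} \<Longrightarrow> card x + 2 \<le> r \<Longrightarrow> link_connected \<C> x"
    and \<mu>: "0 \<le> \<mu>"
begin

abbreviation "V \<equiv> \<Union>\<C>"

definition "E = {e. card e = 2 \<and> star \<C> e \<noteq> {}}"

text \<open>With \<open>we\<close>, the canonical weights of vertices and edges after evaluating the
  binomial coefficients, see \<open>canonical_weights\<close>.\<close>

definition "wv v = real (card (star \<C> {v})) / (real (r + 1) * real (card \<C>))"

definition "we e = 2 * real (card (star \<C> e)) / (real r * real (r + 1) * real (card \<C>))"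

lemma finite_star: "finite (star \<C> x)"
  using finite_chambers by (simp add: star_def)

lemma star_empty: "star \<C> {} = \<C>"
  by (simp add: star_def)

lemma finite_V: "finite V"
  using finite_chambers chamber by blast

lemma edge_subset: "e \<in> E \<Longrightarrow> e \<subseteq> V"
  by (auto simp: E_def star_def)

lemma finite_E: "finite E"
  by (rule finite_subset[of _ "Pow V"]) (use edge_subset finite_V in auto)

sublocale whole: link \<C> "{}" r
proof
  show "finite C \<and> card (C - {}) = r + 1" if "C \<in> star \<C> {}" for C using chamber that by (simp add: star_empty)
qed (use finite_chambers chambers_ne in \<open>simp_all add: star_empty\<close>)

lemma U_whole: "link_vertices \<C> {} = V"
  by (simp add: link_vertices_def star_empty)

lemma sum_edges:
  "(\<Sum>e | e \<in> E \<and> P e. real (card (star \<C> e))) = (\<Sum>C\<in>\<C>. real (card {e. e \<subseteq> C \<and> card e = 2 \<and> P e}))"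
proof -
  have "(\<Sum>e | e \<in> E \<and> P e. real (card (star \<C> e))) = (\<Sum>e | e \<in> E \<and> P e. \<Sum>C | C \<in> \<C> \<and> e \<subseteq> C. 1)"
    by (simp add: star_def)
  also have "\<dots> = (\<Sum>C\<in>\<C>. \<Sum>e | e \<in> {e \<in> E. P e} \<and> e \<subseteq> C. 1)"
    using sum.swap_restrict[of "{e \<in> E. P e}" \<C> "\<lambda>e C. 1 :: real" "\<lambda>e C. e \<subseteq> C"] finite_E finite_chambers by simp
  also have "\<dots> = (\<Sum>C\<in>\<C>. real (card {e. e \<subseteq> C \<and> card e = 2 \<and> P e}))"
  proof (rule sum.cong[OF HOL.refl])
    fix C assume "C \<in> \<C>"
    then have "{e. e \<in> {e \<in> E. P e} \<and> e \<subseteq> C} = {e. e \<subseteq> C \<and> card e = 2 \<and> P e}"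
      by (auto simp: E_def star_def)
    then show "(\<Sum>e | e \<in> {e \<in> E. P e} \<and> e \<subseteq> C. 1) = real (card {e. e \<subseteq> C \<and> card e = 2 \<and> P e})" by simp
  qed
  finally show ?thesis .
qed

lemma two_subsets: "finite A \<Longrightarrow> real (card {e. e \<subseteq> A \<and> card e = 2}) = (real (card A) * (real (card A) - 1)) / 2"
  by (cases "card A") (simp_all add: n_subsets choose_two field_simps real_of_nat_div)

lemma N_pos: "0 < real (card \<C>)"
  using finite_chambers chambers_ne by (simp add: card_gt_0_iff)

lemma sum_wv_card: "sum wv S = (\<Sum>v\<in>S. real (card (star \<C> {v}))) / (real (r + 1) * real (card \<C>))"
  by (simp add: wv_def sum_divide_distrib)

lemma sum_wv_V: "sum wv V = 1"
proof -
  have "(\<Sum>v\<in>V. real (card (star \<C> {v}))) = real (r + 1) * real (card \<C>)"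
    using whole.mass_alt[of "\<lambda>_. 1"] whole.mass_const[of 1] by (simp add: U_whole star_empty algebra_simps)
  moreover have "real (r + 1) * real (card \<C>) \<noteq> 0" using N_pos by simp
  ultimately show ?thesis unfolding sum_wv_card by simp
qed

lemma sum_we_card: "sum we F = 2 * (\<Sum>e\<in>F. real (card (star \<C> e))) / (real r * real (r + 1) * real (card \<C>))"
  by (simp add: we_def sum_divide_distrib sum_distrib_left)

lemma sum_we_E: "sum we E = 1"
proof -
  have "(\<Sum>e\<in>E. real (card (star \<C> e))) = (\<Sum>C\<in>\<C>. real (card {e. e \<subseteq> C \<and> card e = 2}))"
    using sum_edges[of "\<lambda>_. True"] by simp
  also have "\<dots> = (\<Sum>C\<in>\<C>. real (r + 1) * real r / 2)"
  proof (rule sum.cong[OF HOL.refl])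
    show "real (card {e. e \<subseteq> C \<and> card e = 2}) = real (r + 1) * real r / 2" if "C \<in> \<C>" for C
      using two_subsets[of C] chamber[OF that] by simp
  qed
  finally have "2 * (\<Sum>e\<in>E. real (card (star \<C> e))) = real r * real (r + 1) * real (card \<C>)"
    by (simp add: mult.commute mult.left_commute)
  moreover have "real r * real (r + 1) * real (card \<C>) \<noteq> 0" using N_pos r by simp
  ultimately show ?thesis unfolding sum_we_card by simp
qed

lemma degree:
  assumes v: "v \<in> V"
  shows "(\<Sum>e | e \<in> E \<and> v \<in> e. we e) = 2 * wv v"
proof -
  have "(\<Sum>e | e \<in> E \<and> v \<in> e. real (card (star \<C> e))) =
      (\<Sum>C\<in>\<C>. if v \<in> C then real r else 0)"
    unfolding sum_edges
  proof (rule sum.cong[OF HOL.refl])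
    fix C assume C: "C \<in> \<C>"
    show "real (card {e. e \<subseteq> C \<and> card e = 2 \<and> v \<in> e}) = (if v \<in> C then real r else 0)"
    proof (cases "v \<in> C")
      case True
      have "{e. e \<subseteq> C \<and> card e = 2 \<and> v \<in> e} = (\<lambda>u. {v, u}) ` (C - {v})"
      proof (intro equalityI subsetI)
        fix e assume e: "e \<in> {e. e \<subseteq> C \<and> card e = 2 \<and> v \<in> e}"
        then obtain a b where ab: "e = {a, b}" "a \<noteq> b" unfolding card_2_iff by auto
        show "e \<in> (\<lambda>u. {v, u}) ` (C - {v})"
        proof (cases "a = v")
          case True then show ?thesis using e ab by auto
        next
          case False then have "e = {v, a}" using e ab by auto
          then show ?thesis using False e by auto
        qed
      next
        fix e assume "e \<in> (\<lambda>u. {v, u}) ` (C - {v})"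
        then show "e \<in> {e. e \<subseteq> C \<and> card e = 2 \<and> v \<in> e}" using True by (auto simp: card_2_iff)
      qed
      moreover have "inj_on (\<lambda>u. {v, u}) (C - {v})" by (auto simp: inj_on_def doubleton_eq_iff)
      ultimately show ?thesis using True chamber[OF C] by (simp add: card_image)
    next
      case False
      then have "{e. e \<subseteq> C \<and> card e = 2 \<and> v \<in> e} = {}" by blast
      then show ?thesis using False by (simp only: card.empty if_False of_nat_0)
    qed
  qed
  also have "\<dots> = (\<Sum>C | C \<in> \<C> \<and> v \<in> C. real r)"
    using finite_chambers by (simp add: sum.If_cases Int_def)
  also have "\<dots> = real r * real (card (star \<C> {v}))" by (simp add: star_def)
  finally show ?thesis using r by (simp add: sum_we_card wv_def)
qed

text \<open>The panel opposite \<open>u\<close> in a chamber through \<open>e\<close> lies in at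
  least \<open>q\<close> chambers. Their vertices of the type of \<open>u\<close> are distinct, and
  the edges from these to \<open>v\<close> have as many chambers as \<open>e\<close> by homogeneity.
  Their stars are disjoint in the star of \<open>v\<close>, so
  \<open>q * card (star \<C> e) \<le> card (star \<C> {v})\<close>; the factor \<open>2 / r\<close>
  is the quotient of the normalisations.\<close>

lemma light:
  assumes e: "e \<in> E" "v \<in> e"
  shows "we e \<le> 2 / (real r * real q) * wv v"
proof -
  obtain a b where ab: "e = {a, b}" "a \<noteq> b" using e(1) unfolding E_def card_2_iff by blast
  obtain u where u: "e = {u, v}" "u \<noteq> v" using ab e(2) by blast
  obtain C where C: "C \<in> \<C>" "u \<in> C" "v \<in> C" using e(1) u by (auto simp: E_def star_def)
  define N where "N = {u'. \<tau> u' = \<tau> u \<and> star \<C> {u', v} \<noteq> {}}"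
  have NV: "N \<subseteq> V" by (auto simp: N_def star_def)
  have finN: "finite N" by (rule finite_subset[OF NV finite_V])
  have "card (star \<C> (C - {u})) \<le> card N"
  proof (rule card_inj_on_le[OF _ _ finN])
    \<comment> \<open>The vertex of \<open>D\<close> that has the type of \<open>u\<close>; together
      with the panel it determines \<open>D\<close>.\<close>
    define h where "h D = inv_into D \<tau> (\<tau> u)" for D
    have h: "h D \<in> D" "\<tau> (h D) = \<tau> u" if D: "D \<in> \<C>" for D
    proof -
      have "\<tau> u \<in> \<tau> ` D" using types[OF D] by simp
      then show "h D \<in> D" "\<tau> (h D) = \<tau> u" unfolding h_def by (rule inv_into_into, rule f_inv_into_f)
    qed
    show "h ` star \<C> (C - {u}) \<subseteq> N"
    proof
      fix u' assume "u' \<in> h ` star \<C> (C - {u})"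
      then obtain D where D: "D \<in> \<C>" "C - {u} \<subseteq> D" "u' = h D" by (auto simp: star_def)
      have "v \<in> D" using D(2) C(3) u(2) by blast
      then have "D \<in> star \<C> {u', v}" using D h by (simp add: star_def)
      then show "u' \<in> N" using h D by (auto simp: N_def)
    qed
    show "inj_on h (star \<C> (C - {u}))"
    proof (rule inj_onI)
      fix D D' assume D: "D \<in> star \<C> (C - {u})" "D' \<in> star \<C> (C - {u})" and eq: "h D = h D'"
      have full: "F = insert (h F) (C - {u})" if F: "F \<in> star \<C> (C - {u})" for F
      proof -
        have F': "F \<in> \<C>" "C - {u} \<subseteq> F" using F by (simp_all add: star_def)
        have "h F \<notin> C - {u}"
        proof
          assume "h F \<in> C - {u}"
          then show False using inj_onD[OF conjunct1[OF types[OF C(1)]], of "h F" u] h(2)[OF F'(1)] C(2) by simp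
        qed
        then have "card (insert (h F) (C - {u})) = card F"
          using chamber[OF C(1)] chamber[OF F'(1)] C(2) by simp
        moreover have "insert (h F) (C - {u}) \<subseteq> F" using h(1)[OF F'(1)] F'(2) by simp
        ultimately show ?thesis using chamber[OF F'(1)] by (metis card_subset_eq)
      qed
      then have "D = insert (h D) (C - {u})" "D' = insert (h D') (C - {u})" using D by blast+
      then show "D = D'" using eq by simp
    qed
  qed
  moreover have "q \<le> card (star \<C> (C - {u}))"
  proof (rule panel)
    show "star \<C> (C - {u}) \<noteq> {}" using C(1) by (auto simp: star_def)
    show "card (C - {u}) = r" using chamber[OF C(1)] C(2) by simp
  qed
  ultimately have qN: "q \<le> card N" by linarith
  have "card (star \<C> {u', v}) = card (star \<C> {u, v})" if "u' \<in> N" for u'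
    by (rule homogeneous) (use that e(1) u in \<open>auto simp: N_def E_def\<close>)
  then have "card N * card (star \<C> {u, v}) = (\<Sum>u'\<in>N. card (star \<C> {u', v}))" by simp
  also have "\<dots> = card (\<Union>u'\<in>N. star \<C> {u', v})"
  proof (rule card_UN_disjoint[symmetric])
    show "\<forall>i\<in>N. \<forall>j\<in>N. i \<noteq> j \<longrightarrow> star \<C> {i, v} \<inter> star \<C> {j, v} = {}"
    proof (intro ballI impI equals0I)
      fix i j D assume ij: "i \<in> N" "j \<in> N" "i \<noteq> j" and D: "D \<in> star \<C> {i, v} \<inter> star \<C> {j, v}"
      then have "D \<in> \<C>" "i \<in> D" "j \<in> D" by (auto simp: star_def)
      then show False using inj_onD[OF conjunct1[OF types[of D]], of i j] ij by (simp add: N_def)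
    qed
  qed (use finN finite_star in simp_all)
  also have "\<dots> \<le> card (star \<C> {v})" by (rule card_mono[OF finite_star]) (auto simp: star_def)
  finally have "card N * card (star \<C> e) \<le> card (star \<C> {v})" by (simp add: u(1))
  then have "q * card (star \<C> e) \<le> card (star \<C> {v})" using mult_le_mono1[OF qN, of "card (star \<C> e)"] by linarith
  then have "real q * real (card (star \<C> e)) \<le> real (card (star \<C> {v}))" by (metis of_nat_le_iff of_nat_mult)
  then have le: "real (card (star \<C> e)) \<le> real (card (star \<C> {v})) / real q"
    using q by (simp add: pos_le_divide_eq mult.commute)
  have "we e = 2 / (real r * real (r + 1) * real (card \<C>)) * real (card (star \<C> e))"
    by (simp add: we_def)
  also have "\<dots> \<le> 2 / (real r * real (r + 1) * real (card \<C>)) * (real (card (star \<C> {v})) / real q)"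
    by (rule mult_left_mono[OF le]) simp
  also have "\<dots> = 2 / (real r * real q) * wv v" by (simp add: wv_def)
  finally show ?thesis .
qed

text \<open>The gap inequality for the indicator function of \<open>S\<close>: a chamber with
  \<open>k\<close> vertices in \<open>S\<close> contributes \<open>k * (k - 1)\<close> to the form,
  twice its number of edges inside \<open>S\<close>.\<close>

lemma mixing:
  assumes gap: "gap \<C> r {} lam" and S: "S \<subseteq> V"
  shows "(\<Sum>e | e \<in> E \<and> e \<subseteq> S. we e) \<le> (sum wv S)\<^sup>2 + lam * sum wv S * (1 - sum wv S)"
proof -
  define f :: "'v \<Rightarrow> real" where "f v = (if v \<in> S then 1 else 0)" for v
  define a where "a = real (r + 1) * real (card \<C>)"
  have a: "0 < a" using N_pos by (simp add: a_def)
  have sumf: "(\<Sum>v\<in>C. f v) = real (card (C \<inter> S))" if "C \<in> \<C>" for C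
    using chamber[OF that] by (simp add: f_def sum.If_cases)
  have ff: "f v * f v = f v" "(f v)\<^sup>2 = f v" for v by (simp_all add: f_def)
  have "mass \<C> {} f = (\<Sum>v\<in>V. if v \<in> S then real (card (star \<C> {v})) else 0)"
    unfolding whole.mass_alt U_whole by (intro sum.cong) (simp_all add: f_def)
  also have "\<dots> = (\<Sum>v\<in>S. real (card (star \<C> {v})))"
    using finite_V S by (simp add: sum.If_cases Int_absorb1)
  finally have m: "mass \<C> {} f = a * sum wv S" using N_pos by (simp add: sum_wv_card a_def)
  have "2 * (\<Sum>e | e \<in> E \<and> e \<subseteq> S. real (card (star \<C> e))) = (\<Sum>C\<in>\<C>. real (card (C \<inter> S)) * (real (card (C \<inter> S)) - 1))"
    unfolding sum_edges sum_distrib_left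
  proof (rule sum.cong[OF HOL.refl])
    fix C assume C: "C \<in> \<C>"
    have "{e. e \<subseteq> C \<and> card e = 2 \<and> e \<subseteq> S} = {e. e \<subseteq> C \<inter> S \<and> card e = 2}" by blast
    then show "2 * real (card {e. e \<subseteq> C \<and> card e = 2 \<and> e \<subseteq> S}) = real (card (C \<inter> S)) * (real (card (C \<inter> S)) - 1)"
      using two_subsets[of "C \<inter> S"] chamber[OF C] by simp
  qed
  also have "\<dots> = link_form \<C> {} f f"
    unfolding link_form_def star_empty by (intro sum.cong HOL.refl) (simp add: sumf ff algebra_simps)
  also have "\<dots> \<le> lam * r * (a * sum wv S) + (1 - lam) * r * (a * sum wv S)\<^sup>2 / a"
  proof -
    have na: "real ((r + 1) * card (star \<C> {})) = a" by (simp add: a_def star_empty algebra_simps)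
    show ?thesis using gap[unfolded gap_def, rule_format, of f] unfolding na ff(2) m .
  qed
  also have "\<dots> = r * a * ((sum wv S)\<^sup>2 + lam * sum wv S * (1 - sum wv S))"
    using a by (simp add: power2_eq_square field_simps)
  finally have "2 * (\<Sum>e | e \<in> E \<and> e \<subseteq> S. real (card (star \<C> e))) / (r * a) \<le>
      (sum wv S)\<^sup>2 + lam * sum wv S * (1 - sum wv S)"
    using a r by (simp add: divide_le_eq mult.commute)
  then show ?thesis by (simp add: sum_we_card a_def mult.assoc)
qed

lemma global_gap:
  assumes "(real r - 1) * \<mu> < 1"
  shows "gap \<C> r {} (\<mu> / (1 - (real r - 1) * \<mu>))"
  using iterated_trickling_down[OF finite_chambers chamber base conn \<mu> assms r, of "{}"] chambers_ne
  by (simp add: star_empty)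

theorem weighted_graph:
  assumes "lam = \<mu> / (1 - (real r - 1) * \<mu>)" "(real r - 1) * \<mu> < 1" "lam \<le> 1"
  shows "weighted_graph V E wv we lam (2 / (real r * real q))"
proof
  have 1: "gap \<C> r {} lam" using global_gap[OF assms(2)] assms(1) by simp
  show "0 \<le> lam" using assms(1,2) \<mu> by simp
  show "(\<Sum>e | e \<in> E \<and> e \<subseteq> S. we e) \<le> (sum wv S)\<^sup>2 + lam * sum wv S * (1 - sum wv S)" if "S \<subseteq> V" for S
    by (rule mixing[OF 1 that])
  show "e \<subseteq> V \<and> card e = 2" if "e \<in> E" for e using edge_subset[OF that] that by (simp add: E_def)
  show "0 \<le> wv v" "0 \<le> we e" for v e by (simp_all add: wv_def we_def)
qed (use finite_V sum_wv_V sum_we_E degree light assms(3) in simp_all)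

end

section \<open>Transfer to a finite quotient\<close>

lemma gap_image:
  fixes p :: "'u \<Rightarrow> 'v"
  assumes inj: "inj_on p (\<Union>(star \<C> y))" and y: "y \<subseteq> \<Union>(star \<C> y)"
    and im: "star \<C>' x = (\<lambda>C. p ` C) ` star \<C> y" "x = p ` y" and gap: "gap \<C> D y lam"
  shows "gap \<C>' D x lam"
proof -
  have inj': "inj_on (\<lambda>C. p ` C) (star \<C> y)"
    by (rule inj_onI) (use inj_on_image_eq_iff[OF inj] in blast)
  have diff: "(\<Sum>v\<in>p ` C - x. h v) = (\<Sum>v\<in>C - y. h (p v))" if C: "C \<in> star \<C> y" for C and h :: "'v \<Rightarrow> real"
  proof -
    have "p ` (C - y) = p ` C - p ` y" by (rule inj_on_image_set_diff[OF inj]) (use C y in auto)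
    moreover have "inj_on p (C - y)" by (rule inj_on_subset[OF inj]) (use C in auto)
    ultimately show ?thesis unfolding im(2) by (metis (no_types, lifting) sum.reindex_cong)
  qed
  have sums: "(\<Sum>C\<in>star \<C>' x. h C) = (\<Sum>C\<in>star \<C> y. h (p ` C))" for h :: "'v set \<Rightarrow> real"
    unfolding im(1) using sum.reindex[OF inj', of h] by simp
  have mass: "mass \<C>' x h = mass \<C> y (h \<circ> p)" for h
    unfolding mass_def sums by (intro sum.cong HOL.refl) (simp add: diff)
  have form: "link_form \<C>' x h h = link_form \<C> y (h \<circ> p) (h \<circ> p)" for h
    unfolding link_form_def sums by (intro sum.cong HOL.refl) (simp add: diff)
  have card: "card (star \<C>' x) = card (star \<C> y)" unfolding im(1) by (rule card_image[OF inj'])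
  show ?thesis
    unfolding gap_def
  proof
    fix f
    show "link_form \<C>' x f f \<le> lam * D * mass \<C>' x (\<lambda>v. (f v)\<^sup>2) +
        (1 - lam) * D * (mass \<C>' x f)\<^sup>2 / ((D + 1) * card (star \<C>' x))"
      using gap[unfolded gap_def, rule_format, of "f \<circ> p"] unfolding form mass card comp_def .
  qed
qed

lemma link_connected_image:
  fixes p :: "'u \<Rightarrow> 'v"
  assumes im: "star \<C>' x = (\<lambda>C. p ` C) ` star \<C> y" "x = p ` y"
    and inj: "inj_on p (\<Union>(star \<C> y))" and y: "y \<subseteq> \<Union>(star \<C> y)" and conn: "link_connected \<C> y"
  shows "link_connected \<C>' x"
  unfolding link_connected_def
proof (intro allI impI)
  fix f :: "'v \<Rightarrow> real"
  assume f: "\<forall>C\<in>star \<C>' x. \<forall>u\<in>C - x. \<forall>v\<in>C - x. f u = f v"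
  have mem: "p u \<in> p ` C - x" if "C \<in> star \<C> y" "u \<in> C - y" for C u
  proof -
    have "p u \<notin> p ` y"
    proof
      assume "p u \<in> p ` y"
      then obtain w where w: "w \<in> y" "p u = p w" by blast
      then have "u = w" using inj_onD[OF inj w(2)] that y by blast
      then show False using w that by blast
    qed
    then show ?thesis using that im(2) by blast
  qed
  have "\<forall>C\<in>star \<C> y. \<forall>u\<in>C - y. \<forall>v\<in>C - y. (f \<circ> p) u = (f \<circ> p) v"
  proof (intro ballI)
    fix C u v assume C: "C \<in> star \<C> y" "u \<in> C - y" "v \<in> C - y"
    have "p ` C \<in> star \<C>' x" unfolding im(1) using C(1) by (rule imageI)
    then have "f (p u) = f (p v)" by (rule bspec[OF bspec[OF bspec[OF f] mem[OF C(1,2)]] mem[OF C(1,3)]])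
    then show "(f \<circ> p) u = (f \<circ> p) v" by simp
  qed
  then have const0: "\<forall>u\<in>link_vertices \<C> y. \<forall>v\<in>link_vertices \<C> y. (f \<circ> p) u = (f \<circ> p) v"
    by (rule mp[OF spec[OF conn[unfolded link_connected_def]]])
  then have const: "f (p u) = f (p v)" if "u \<in> link_vertices \<C> y" "v \<in> link_vertices \<C> y" for u v
    using bspec[OF bspec[OF const0 that(1)] that(2)] by simp
  have lift: "\<exists>w\<in>link_vertices \<C> y. u = p w" if u: "u \<in> link_vertices \<C>' x" for u
  proof -
    obtain C where "C \<in> star \<C> y" "u \<in> p ` C" "u \<notin> p ` y"
      using u unfolding link_vertices_def im(1) unfolding im(2) by blast
    then show ?thesis unfolding link_vertices_def by blast
  qed
  show "\<forall>u\<in>link_vertices \<C>' x. \<forall>v\<in>link_vertices \<C>' x. f u = f v"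
  proof (intro ballI)
    fix u v assume "u \<in> link_vertices \<C>' x" "v \<in> link_vertices \<C>' x"
    then obtain a b where "a \<in> link_vertices \<C> y" "u = p a" "b \<in> link_vertices \<C> y" "v = p b" using lift by blast
    then show "f u = f v" using const[of a b] by simp
  qed
qed

context typed_building
begin

lemma homogeneous_chambers_building:
  assumes fin: "finite X" and d: "has_dimension X r" and r: "1 \<le> r" and q: "1 \<le> q" and th: "thick q r X"
    and st: "strongly_transitive r X \<E> \<tau>" and \<mu>: "edges T = {} \<and> \<mu> = 0 \<or> 2 \<le> q \<and> \<mu> = 2 / sqrt q"
  shows "homogeneous_chambers (faces X (int r)) \<tau> r q \<mu> \<and> (\<forall>x\<in>X. star (faces X (int r)) x \<noteq> {})"
proof -
  have d: "CARD('t) = r + 1" by (rule dimension[OF d])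
  have ch: "faces X (int r) = chambers" by (auto simp: chambers_def faces_def d)
  have th: "thick_chambers q" by (rule thick_chambersI) (use assms in simp_all)
  have nr: "nonredundant T" using \<mu> nonredundant_edgeless nonredundant_thick[OF th] by blast
  have fin_ch: "finite chambers" using fin by (simp add: chambers_def)
  then have fin_star: "finite (star chambers x)" for x by (simp add: star_def)
  have "homogeneous_chambers chambers \<tau> r q \<mu>"
  proof
    show "finite chambers" by (rule fin_ch)
    show "chambers \<noteq> {}" using face_in_chamber[of "{}"] complex_X by (auto simp: abstract_complex_def star_def)
    show "finite C \<and> card C = r + 1" if "C \<in> chambers" for C using that face_finite d by (simp add: chambers_def)
    show "inj_on \<tau> C \<and> \<tau> ` C = UNIV" if "C \<in> chambers" for C
      using that face_type_inj chamber_types by (simp add: chambers_def)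
    show "card (star chambers x) = card (star chambers y)"
      if "star chambers x \<noteq> {}" "star chambers y \<noteq> {}" "\<tau> ` x = \<tau> ` y" for x y
      by (rule type_invariance[OF st d]) (use that star_face in simp_all)
    show "q \<le> card (star chambers x)" if "star chambers x \<noteq> {}" "card x = r" for x
      using th that d star_face fin_star unfolding thick_chambers_def by simp
    show "gap chambers 1 x \<mu>" if x: "star chambers x \<noteq> {}" "card x + 1 = r" for x
    proof -
      have x': "x \<in> X" "card x + 2 = CARD('t)" using x star_face d by simp_all
      have inv: "\<And>y y'. y \<in> X \<Longrightarrow> y' \<in> X \<Longrightarrow> \<tau> ` y = \<tau> ` y' \<Longrightarrow> card (star chambers y) = card (star chambers y')"
        by (rule type_invariance[OF st d])
      show ?thesis using \<mu> gap_edgeless[OF _ x' fin_star inv] gap_thick[OF th _ x' fin_star inv] by blast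
    qed
    show "link_connected chambers x" if "card x + 2 \<le> r" for x
      by (rule connected_link[OF nr]) (use that d in simp)
    show "0 \<le> \<mu>" using \<mu> by auto
  qed (use r q in simp_all)
  then show ?thesis unfolding ch using face_in_chamber by blast
qed

text \<open>Around a nonempty face the covering is an isomorphism of stars, so degrees, gaps and
  connectedness are those of the building. The empty face needs a separate argument.\<close>

lemma homogeneous_chambers_covering:
  fixes Z :: "'w set set"
  assumes cov: "simplicial_covering p X Z" and fin: "finite Z" and dZ: "has_dimension Z r" and dX: "has_dimension X d"
    and d: "2 \<le> d" and q: "1 \<le> q" and th: "thick q d X"
    and st: "strongly_transitive d X \<E> \<tau>" and \<sigma>: "\<And>u. u \<in> \<Union>X \<Longrightarrow> \<sigma> (p u) = \<tau> u"
    and \<mu>: "edges T = {} \<and> \<mu> = 0 \<or> 2 \<le> q \<and> \<mu> = 2 / sqrt q"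
  shows "homogeneous_chambers (faces Z (int r)) \<sigma> r q \<mu> \<and> (\<forall>x\<in>Z. star (faces Z (int r)) x \<noteq> {})"
proof -
  have cd: "CARD('t) = d + 1" by (rule dimension[OF dX])
  have th: "thick_chambers q" by (rule thick_chambersI) (use assms in simp_all)
  have nr: "nonredundant T" using \<mu> nonredundant_edgeless nonredundant_thick[OF th] by blast
  have Zc: "abstract_complex Z" and pZ: "\<And>y. y \<in> X \<Longrightarrow> p ` y \<in> Z" and psurj: "p ` \<Union>X = \<Union>Z"
    and bij: "\<And>u. u \<in> \<Union>X \<Longrightarrow> bij_betw (\<lambda>y. p ` y) {y \<in> X. u \<in> y} {x \<in> Z. p u \<in> x}"
    using cov unfolding simplicial_covering_def by auto
  define W where "W u = \<Union>{y \<in> X. u \<in> y}" for u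
  \<comment> \<open>The covering is injective on the faces through \<open>u\<close>; apply this to
    the edges from \<open>u\<close> to \<open>a\<close> and to \<open>b\<close>.\<close>
  have injW: "inj_on p (W u)" if u: "u \<in> \<Union>X" for u
  proof (rule inj_onI)
    fix a b assume a: "a \<in> W u" and b: "b \<in> W u" and ab: "p a = p b"
    have star_edge: "{u, c} \<in> {y \<in> X. u \<in> y}" if c: "c \<in> W u" for c
    proof -
      obtain y where "y \<in> X" "u \<in> y" "c \<in> y" using c by (auto simp: W_def)
      then show ?thesis using face_subset[of y "{u, c}"] by simp
    qed
    have "p ` {u, a} = p ` {u, b}" using ab by simp
    then have "{u, a} = {u, b}"
      using inj_onD[OF bij_betw_imp_inj_on[OF bij[OF u]]] star_edge[OF a] star_edge[OF b] by blast
    then show "a = b" by (auto simp: doubleton_eq_iff)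
  qed
  have card_p: "card (p ` y) = card y" if y: "y \<in> X" for y
  proof (cases "y = {}")
    case False
    then obtain u where u: "u \<in> y" by blast
    then have "inj_on p y" using inj_on_subset[OF injW[of u], of y] y by (auto simp: W_def)
    then show ?thesis by (rule card_image)
  qed simp
  have lift: "\<exists>y\<in>X. y \<noteq> {} \<and> x = p ` y" if x: "x \<in> Z" "x \<noteq> {}" for x
  proof -
    obtain v where v: "v \<in> x" using x(2) by blast
    then have "v \<in> p ` \<Union>X" unfolding psurj using x(1) by blast
    then obtain u where u: "u \<in> \<Union>X" "v = p u" by blast
    have "x \<in> (\<lambda>y. p ` y) ` {y \<in> X. u \<in> y}" using bij_betw_imp_surj_on[OF bij[OF u(1)]] x(1) v u(2) by simp
    then show ?thesis by blast
  qed
  have rd: "r = d"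
  proof (rule antisym)
    obtain x where x: "x \<in> Z" "card x = r + 1" using dZ by (auto simp: has_dimension_def faces_def)
    then have "x \<noteq> {}" by auto
    then obtain y where "y \<in> X" "x = p ` y" using lift[OF x(1)] by blast
    then show "r \<le> d" using card_p x(2) dX by (auto simp: has_dimension_def)
    obtain y where y: "y \<in> X" "card y = d + 1" using dX by (auto simp: has_dimension_def faces_def)
    then show "d \<le> r" using card_p[OF y(1)] pZ[OF y(1)] dZ by (auto simp: has_dimension_def)
  qed
  define \<C> where "\<C> = faces Z (int r)"
  have C_iff: "C \<in> \<C> \<longleftrightarrow> C \<in> Z \<and> card C = CARD('t)" for C by (auto simp: \<C>_def faces_def rd cd)
  have fin_\<C>: "finite \<C>" using fin by (simp add: \<C>_def faces_def)
  have star_p: "star \<C> (p ` y) = (\<lambda>C. p ` C) ` star chambers y" "inj_on p (\<Union>(star chambers y))" "y \<subseteq> \<Union>(star chambers y)"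
    if y: "y \<in> X" "y \<noteq> {}" for y
  proof -
    obtain u where u: "u \<in> y" using y(2) by blast
    then have uX: "u \<in> \<Union>X" using y(1) by blast
    have sub: "\<Union>(star chambers y) \<subseteq> W u" using u unfolding star_def W_def chambers_def by blast
    show "inj_on p (\<Union>(star chambers y))" by (rule inj_on_subset[OF injW[OF uX] sub])
    show "y \<subseteq> \<Union>(star chambers y)" using face_in_chamber[OF y(1)] by (auto simp: star_def)
    show "star \<C> (p ` y) = (\<lambda>C. p ` C) ` star chambers y"
    proof (intro equalityI subsetI)
      fix D assume "D \<in> star \<C> (p ` y)"
      then have D: "D \<in> Z" "card D = CARD('t)" "p ` y \<subseteq> D" by (simp_all add: star_def C_iff)
      then have "D \<in> (\<lambda>y. p ` y) ` {y \<in> X. u \<in> y}" using bij_betw_imp_surj_on[OF bij[OF uX]] u by blast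
      then obtain C where C: "C \<in> X" "u \<in> C" "D = p ` C" by blast
      have "y \<subseteq> C"
        using inj_on_image_subset_iff[OF injW[OF uX], of y C] D(3) C y(1) u by (auto simp: W_def)
      then show "D \<in> (\<lambda>C. p ` C) ` star chambers y" using C card_p[OF C(1)] D(2) by (auto simp: star_def chambers_def)
    next
      fix D assume "D \<in> (\<lambda>C. p ` C) ` star chambers y"
      then show "D \<in> star \<C> (p ` y)" using pZ card_p by (auto simp: star_def chambers_def C_iff)
    qed
  qed
  have card_star: "card (star \<C> (p ` y)) = card (star chambers y)" and fin_star: "finite (star chambers y)"
    if y: "y \<in> X" "y \<noteq> {}" for y
  proof -
    have inj: "inj_on (\<lambda>C. p ` C) (star chambers y)"
      by (rule inj_onI) (use inj_on_image_eq_iff[OF star_p(2)[OF y]] in blast)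
    then show "card (star \<C> (p ` y)) = card (star chambers y)" unfolding star_p(1)[OF y] by (rule card_image)
    have "finite (star \<C> (p ` y))" using fin_\<C> by (simp add: star_def)
    then show "finite (star chambers y)" unfolding star_p(1)[OF y] by (rule finite_imageD[OF _ inj])
  qed
  have types: "\<sigma> ` p ` y = \<tau> ` y" if "y \<in> X" for y
    unfolding image_image by (rule image_cong) (use \<sigma> that in auto)
  have starZ: "x \<in> Z" if x: "star \<C> x \<noteq> {}" for x
  proof -
    obtain C where "C \<in> Z" "x \<subseteq> C" using x by (auto simp: star_def C_iff)
    then show ?thesis using Zc by (simp add: abstract_complex_def)
  qed
  have inv: "\<And>y y'. y \<in> X \<Longrightarrow> y' \<in> X \<Longrightarrow> \<tau> ` y = \<tau> ` y' \<Longrightarrow> card (star chambers y) = card (star chambers y')"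
    by (rule type_invariance[OF st cd])
  have "homogeneous_chambers \<C> \<sigma> r q \<mu>"
  proof
    show "\<C> \<noteq> {}" using dZ by (simp add: has_dimension_def \<C>_def)
    show "finite C \<and> card C = r + 1" if "C \<in> \<C>" for C
      using that Zc rd cd by (auto simp: C_iff abstract_complex_def)
    show "inj_on \<sigma> C \<and> \<sigma> ` C = UNIV" if C: "C \<in> \<C>" for C
    proof -
      have "C \<in> Z" "C \<noteq> {}" "finite C" using C Zc by (auto simp: C_iff abstract_complex_def)
      then obtain y where y: "y \<in> X" "C = p ` y" using lift by blast
      have "\<tau> ` y = UNIV" using chamber_types[of y] y card_p[OF y(1)] C by (simp add: C_iff chambers_def)
      then have "\<sigma> ` C = UNIV" using types[OF y(1)] y(2) by simp
      then show ?thesis using C \<open>finite C\<close> by (simp add: C_iff eq_card_imp_inj_on)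
    qed
    show "card (star \<C> x) = card (star \<C> y)"
      if x: "x \<noteq> {}" and ne: "star \<C> x \<noteq> {}" "star \<C> y \<noteq> {}" and eq: "\<sigma> ` x = \<sigma> ` y" for x y
    proof -
      have "y \<noteq> {}" using x eq by auto
      then obtain y' where y': "y' \<in> X" "y' \<noteq> {}" "y = p ` y'" using lift starZ[OF ne(2)] by blast
      obtain x' where x': "x' \<in> X" "x' \<noteq> {}" "x = p ` x'" using lift[OF starZ[OF ne(1)] x] by blast
      show ?thesis using inv[OF x'(1) y'(1)] eq types x' y' card_star by simp
    qed
    show "q \<le> card (star \<C> x)" if x: "star \<C> x \<noteq> {}" "card x = r" for x
    proof -
      \<comment> \<open>Here and for \<open>gap\<close> below, \<open>2 \<le> d\<close> makes faces
        of codimension one and two nonempty, so that they lift to the building together with their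
        stars.\<close>
      have "x \<noteq> {}" using x(2) d rd by auto
      then obtain y where y: "y \<in> X" "y \<noteq> {}" "x = p ` y" using lift[OF starZ[OF x(1)]] by blast
      have "card y + 1 = CARD('t)" using card_p[OF y(1)] x(2) y(3) rd cd by simp
      then show ?thesis using th y fin_star card_star unfolding thick_chambers_def by simp
    qed
    show "gap \<C> 1 x \<mu>" if x: "star \<C> x \<noteq> {}" "card x + 1 = r" for x
    proof -
      have "x \<noteq> {}" using x(2) d rd by auto
      then obtain y where y: "y \<in> X" "y \<noteq> {}" "x = p ` y" using lift[OF starZ[OF x(1)]] by blast
      have c: "card y + 2 = CARD('t)" using card_p[OF y(1)] x(2) y(3) rd cd by simp
      have "gap chambers 1 y \<mu>"
        using \<mu> gap_edgeless[OF _ y(1) c fin_star[OF y(1,2)] inv] gap_thick[OF th _ y(1) c fin_star[OF y(1,2)] inv] by blast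
      then show ?thesis using gap_image[OF star_p(2,3,1)] y by blast
    qed
    show "link_connected \<C> x" if x: "star \<C> x \<noteq> {}" "card x + 2 \<le> r" for x
    proof (cases "x = {}")
      case False
      then obtain y where y: "y \<in> X" "y \<noteq> {}" "x = p ` y" using lift[OF starZ[OF x(1)]] by blast
      have "link_connected chambers y"
        by (rule connected_link[OF nr]) (use card_p[OF y(1)] x(2) y(3) rd cd in simp)
      then show ?thesis using link_connected_image[OF star_p(1) _ star_p(2,3)] y by blast
    next
      case True
      \<comment> \<open>A function that is constant on each chamber of \<open>Z\<close> is composed
        with \<open>p\<close>; the building is connected, and every vertex of \<open>Z\<close> is
        the image of one of its vertices.\<close>
      have conn: "link_connected chambers {}" by (rule connected_link[OF nr]) (use d cd in simp)
      show ?thesis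
        unfolding link_connected_def True
      proof (intro allI impI)
        fix f :: "'w \<Rightarrow> real"
        assume f: "\<forall>C\<in>star \<C> {}. \<forall>u\<in>C - {}. \<forall>v\<in>C - {}. f u = f v"
        have "\<forall>C\<in>star chambers {}. \<forall>u\<in>C - {}. \<forall>v\<in>C - {}. (f \<circ> p) u = (f \<circ> p) v"
        proof (intro ballI)
          fix C u v assume C: "C \<in> star chambers {}" "u \<in> C - {}" "v \<in> C - {}"
          have "p ` C \<in> star \<C> {}" using C(1) pZ card_p by (simp add: star_def chambers_def C_iff)
          then have "f (p u) = f (p v)" by (rule bspec[OF bspec[OF bspec[OF f]]]) (use C(2,3) in simp_all)
          then show "(f \<circ> p) u = (f \<circ> p) v" by simp
        qed
        then have const0: "\<forall>u\<in>link_vertices chambers {}. \<forall>v\<in>link_vertices chambers {}. (f \<circ> p) u = (f \<circ> p) v"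
          by (rule mp[OF spec[OF conn[unfolded link_connected_def]]])
        then have const: "f (p u) = f (p v)" if "u \<in> link_vertices chambers {}" "v \<in> link_vertices chambers {}" for u v
          using bspec[OF bspec[OF const0 that(1)] that(2)] by simp
        have "\<exists>w\<in>link_vertices chambers {}. u = p w" if u: "u \<in> link_vertices \<C> {}" for u
        proof -
          obtain C where C: "C \<in> Z" "u \<in> C" using u by (auto simp: link_vertices_def star_def C_iff)
          then obtain y where y: "y \<in> X" "C = p ` y" using lift[of C] by blast
          then obtain w where w: "w \<in> y" "u = p w" using C(2) by blast
          obtain D where "D \<in> chambers" "y \<subseteq> D" using face_in_chamber[OF y(1)] by (auto simp: star_def)
          then have "w \<in> link_vertices chambers {}" using w(1) by (auto simp: link_vertices_def star_def)
          then show ?thesis using w(2) by blast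
        qed
        then have lift: "\<exists>w\<in>link_vertices chambers {}. u = p w" if "u \<in> link_vertices \<C> {}" for u using that by blast
        show "\<forall>u\<in>link_vertices \<C> {}. \<forall>v\<in>link_vertices \<C> {}. f u = f v"
        proof (intro ballI)
          fix u v assume "u \<in> link_vertices \<C> {}" "v \<in> link_vertices \<C> {}"
          then obtain a b where "a \<in> link_vertices chambers {}" "u = p a" "b \<in> link_vertices chambers {}" "v = p b"
            using lift by blast
          then show "f u = f v" using const[of a b] by simp
        qed
      qed
    qed
    show "0 \<le> \<mu>" using \<mu> by auto
  qed (use d rd q fin_\<C> in simp_all)
  moreover have "star \<C> x \<noteq> {}" if x: "x \<in> Z" for x
  proof (cases "x = {}")
    case True
    then show ?thesis using dZ by (simp add: has_dimension_def \<C>_def star_def)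
  next
    case False
    then obtain y where "y \<in> X" "y \<noteq> {}" "x = p ` y" using lift[OF x] by blast
    then show ?thesis using star_p(1) face_in_chamber by simp
  qed
  ultimately show ?thesis unfolding \<C>_def by blast
qed

end

section \<open>Linearly disjoint subgroups and cycles\<close>

locale plain_comm_group = comm_group G for G :: "'a monoid" (structure)
begin

text \<open>Injectivity in the form of a trivial kernel, for functions that need not be
  extensional.\<close>

lemma linearly_disjoint_one:
  assumes I: "linearly_disjoint G I H" and H: "\<And>i. i \<in> I \<Longrightarrow> subgroup (H i) G"
    and f: "\<And>i. i \<in> I \<Longrightarrow> f i \<in> H i" "finprod G f I = \<one>" and i: "i \<in> I"
  shows "f i = \<one>"
proof -
  have carr: "f j \<in> carrier G" if "j \<in> I" for j using f(1) H subgroup.mem_carrier that by metis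
  have "finprod G (restrict f I) I = finprod G f I" by (rule finprod_cong') (use carr in auto)
  moreover have "finprod G (\<lambda>i\<in>I. \<one>) I = \<one>" by (rule finprod_one_eqI) simp
  ultimately have "finprod G (restrict f I) I = finprod G (\<lambda>i\<in>I. \<one>) I" using f(2) by simp
  moreover have "restrict f I \<in> (\<Pi>\<^sub>E i\<in>I. H i)" using f(1) by (simp add: PiE_iff)
  moreover have "(\<lambda>i\<in>I. \<one>) \<in> (\<Pi>\<^sub>E i\<in>I. H i)" using subgroup.one_closed[OF H] by (simp add: PiE_iff)
  ultimately have "restrict f I = (\<lambda>i\<in>I. \<one>)"
    using I unfolding linearly_disjoint_def by (meson inj_onD)
  then show ?thesis using i by (metis restrict_apply')
qed

text \<open>An element of both subgroups gives the relation of \<open>a\<close> at \<open>i\<close>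
  and its inverse at \<open>j\<close>.\<close>

lemma linearly_disjoint_pair:
  assumes ij: "linearly_disjoint G {i, j} H" "i \<noteq> j" and H: "subgroup (H i) G" "subgroup (H j) G"
    and a: "a \<in> H i" "a \<in> H j"
  shows "a = \<one>"
proof -
  define f where "f k = (if k = i then a else inv a)" for k
  have aG: "a \<in> carrier G" by (rule subgroup.mem_carrier[OF H(1) a(1)])
  have "f i = \<one>"
  proof (rule linearly_disjoint_one[OF ij(1)])
    show "subgroup (H k) G" if "k \<in> {i, j}" for k using that H by auto
    show "f k \<in> H k" if "k \<in> {i, j}" for k
      using that a(1) subgroup.m_inv_closed[OF H(2) a(2)] ij(2) by (auto simp: f_def)
    have "finprod G f {i, j} = f i \<otimes> f j"
      using ij(2) aG by (subst finprod_insert) (auto simp: f_def)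
    then show "finprod G f {i, j} = \<one>" using ij(2) aG by (simp add: f_def)
  qed simp
  then show ?thesis by (simp add: f_def)
qed

lemma subgroup_sum_insert:
  assumes I: "finite I" "i \<notin> I" and H: "\<And>j. j \<in> insert i I \<Longrightarrow> subgroup (H j) G"
  shows "a \<in> subgroup_sum G (insert i I) H \<longleftrightarrow> (\<exists>b\<in>H i. \<exists>c\<in>subgroup_sum G I H. a = b \<otimes> c)"
proof
  have sub: "f j \<in> carrier G" if "f \<in> (\<Pi>\<^sub>E j\<in>J. H j)" "J \<subseteq> insert i I" "j \<in> J" for f j J
  proof (rule subgroup.mem_carrier)
    show "subgroup (H j) G" by (rule H) (use that in blast)
    show "f j \<in> H j" using that by (auto simp: PiE_iff)
  qed
  assume "a \<in> subgroup_sum G (insert i I) H"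
  then obtain f where f: "f \<in> (\<Pi>\<^sub>E j\<in>insert i I. H j)" "a = finprod G f (insert i I)"
    by (auto simp: subgroup_sum_def)
  have "a = f i \<otimes> finprod G f I" unfolding f(2) by (rule finprod_insert) (use I sub[OF f(1)] in auto)
  also have "finprod G f I = finprod G (restrict f I) I" by (rule finprod_cong') (use sub[OF f(1)] in auto)
  finally have "a = f i \<otimes> finprod G (restrict f I) I" .
  moreover have "finprod G (restrict f I) I \<in> subgroup_sum G I H"
    unfolding subgroup_sum_def
    by (rule imageI, rule iffD2[OF restrict_PiE_iff]) (use f(1) in \<open>auto simp: PiE_iff\<close>)
  ultimately show "\<exists>b\<in>H i. \<exists>c\<in>subgroup_sum G I H. a = b \<otimes> c" using f(1) by (auto simp: PiE_iff)
next
  assume "\<exists>b\<in>H i. \<exists>c\<in>subgroup_sum G I H. a = b \<otimes> c"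
  then obtain b f where b: "b \<in> H i" and f: "f \<in> (\<Pi>\<^sub>E j\<in>I. H j)" "a = b \<otimes> finprod G f I"
    by (auto simp: subgroup_sum_def)
  define h where "h = f(i := b)"
  have "h i = b" by (simp add: h_def)
  have h: "h \<in> (\<Pi>\<^sub>E j\<in>insert i I. H j)" using b f(1) by (auto simp: PiE_iff h_def extensional_def)
  have hc: "h j \<in> carrier G" if "j \<in> insert i I" for j
    by (rule subgroup.mem_carrier[OF H[OF that]]) (use h that in \<open>auto simp: PiE_iff\<close>)
  have fc: "f j \<in> carrier G" if "j \<in> I" for j
    by (rule subgroup.mem_carrier[OF H[of j]]) (use f(1) that in \<open>auto simp: PiE_iff\<close>)
  have "finprod G h (insert i I) = h i \<otimes> finprod G h I" by (rule finprod_insert) (use I hc in auto)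
  also have "finprod G h I = finprod G f I"
    by (rule finprod_cong') (use I(2) fc in \<open>auto simp: h_def\<close>)
  finally have "a = finprod G h (insert i I)" using f(2) \<open>h i = b\<close> by simp
  then show "a \<in> subgroup_sum G (insert i I) H" unfolding subgroup_sum_def using h by (rule image_eqI)
qed

lemma subgroup_sum_empty: "subgroup_sum G {} H = {\<one>}"
  by (simp add: subgroup_sum_def)

lemma subgroup_sum_point:
  assumes "H {} = {\<one>}" "subgroup (H {v}) G"
  shows "subgroup_sum G (Pow {v}) H = H {v}"
proof -
  have Pow: "Pow {v} = {{v}, {}}" by auto
  have 1: "subgroup {\<one>} G" by (rule triv_subgroup)
  have "a \<in> subgroup_sum G {{}} H \<longleftrightarrow> a = \<one>" for a
    using subgroup_sum_insert[of "{}" "{}" H a] assms(1) 1 by (simp add: subgroup_sum_empty)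
  then have 0: "subgroup_sum G {{}} H = {\<one>}" by blast
  have sub: "subgroup (H j) G" if "j \<in> insert {v} {{}}" for j using that assms 1 by auto
  have "a \<in> subgroup_sum G (Pow {v}) H \<longleftrightarrow> (\<exists>b\<in>H {v}. a = b \<otimes> \<one>)" for a
    unfolding Pow using subgroup_sum_insert[of "{{}}" "{v}" H a, OF _ _ sub] by (simp add: 0)
  then show ?thesis using subgroup.mem_carrier[OF assms(2)] by auto
qed

lemma subgroup_sum_edge:
  assumes one: "H {} = {\<one>}" and H: "subgroup (H {u}) G" "subgroup (H {v}) G" "subgroup (H {u, v}) G" and uv: "u \<noteq> v"
  shows "a \<in> subgroup_sum G (Pow {u, v}) H \<longleftrightarrow> (\<exists>b\<in>H {u}. \<exists>c\<in>H {v}. \<exists>d\<in>H {u, v}. a = b \<otimes> c \<otimes> d)"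
proof -
  have Pow: "Pow {u, v} = insert {u, v} (insert {u} (Pow {v}))" by auto
  have sub: "subgroup (H x) G" if "x \<in> insert {u, v} (insert {u} (Pow {v}))" for x
  proof -
    have "Pow {v} = {{v}, {}}" by auto
    then have "x = {u, v} \<or> x = {u} \<or> x = {v} \<or> x = {}" using that by auto
    then show ?thesis using H one triv_subgroup by auto
  qed
  have "a \<in> subgroup_sum G (Pow {u, v}) H \<longleftrightarrow> (\<exists>d\<in>H {u, v}. \<exists>e\<in>subgroup_sum G (insert {u} (Pow {v})) H. a = d \<otimes> e)"
    unfolding Pow by (rule subgroup_sum_insert) (use uv sub in auto)
  also have "\<dots> \<longleftrightarrow> (\<exists>d\<in>H {u, v}. \<exists>b\<in>H {u}. \<exists>c\<in>H {v}. a = d \<otimes> (b \<otimes> c))"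
  proof -
    have "e \<in> subgroup_sum G (insert {u} (Pow {v})) H \<longleftrightarrow> (\<exists>b\<in>H {u}. \<exists>c\<in>subgroup_sum G (Pow {v}) H. e = b \<otimes> c)" for e
      by (rule subgroup_sum_insert) (use uv sub in auto)
    then have "subgroup_sum G (insert {u} (Pow {v})) H = (\<Union>b\<in>H {u}. \<Union>c\<in>H {v}. {b \<otimes> c})"
      unfolding subgroup_sum_point[OF one H(2)] by auto
    then show ?thesis by simp
  qed
  also have "\<dots> \<longleftrightarrow> (\<exists>b\<in>H {u}. \<exists>c\<in>H {v}. \<exists>d\<in>H {u, v}. a = b \<otimes> c \<otimes> d)"
  proof -
    have comm: "d \<otimes> (b \<otimes> c) = b \<otimes> c \<otimes> d" if "b \<in> H {u}" "c \<in> H {v}" "d \<in> H {u, v}" for b c d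
      using that subgroup.mem_carrier[OF H(1)] subgroup.mem_carrier[OF H(2)] subgroup.mem_carrier[OF H(3)]
      by (simp add: m_comm)
    show ?thesis
    proof
      assume "\<exists>d\<in>H {u, v}. \<exists>b\<in>H {u}. \<exists>c\<in>H {v}. a = d \<otimes> (b \<otimes> c)"
      then obtain d b c where h: "d \<in> H {u, v}" "b \<in> H {u}" "c \<in> H {v}" "a = d \<otimes> (b \<otimes> c)" by blast
      then show "\<exists>b\<in>H {u}. \<exists>c\<in>H {v}. \<exists>d\<in>H {u, v}. a = b \<otimes> c \<otimes> d" unfolding comm[OF h(2,3,1)] by blast
    next
      assume "\<exists>b\<in>H {u}. \<exists>c\<in>H {v}. \<exists>d\<in>H {u, v}. a = b \<otimes> c \<otimes> d"
      then obtain b c d where h: "b \<in> H {u}" "c \<in> H {v}" "d \<in> H {u, v}" "a = b \<otimes> c \<otimes> d" by blast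
      then show "\<exists>d\<in>H {u, v}. \<exists>b\<in>H {u}. \<exists>c\<in>H {v}. a = d \<otimes> (b \<otimes> c)"
        unfolding comm[OF h(1-3), symmetric] by blast
    qed
  qed
  finally show ?thesis .
qed

text \<open>Reindexing by the cyclic successor makes the differences around a cycle telescope to
  1.\<close>

lemma finprod_shift:
  fixes l :: nat
  assumes l: "0 < l" and f: "\<And>i. i < l \<Longrightarrow> f i \<in> carrier G"
  shows "finprod G (\<lambda>i. f ((i + 1) mod l)) {..<l} = finprod G f {..<l}"
proof -
  have inj: "inj_on (\<lambda>i. (i + 1) mod l) {..<l}"
  proof (rule inj_onI)
    fix i j assume "i \<in> {..<l}" "j \<in> {..<l}" "(i + 1) mod l = (j + 1) mod l"
    then show "i = j" by (simp add: mod_Suc split: if_splits)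
  qed
  have im: "(\<lambda>i. (i + 1) mod l) ` {..<l} = {..<l}"
    by (rule endo_inj_surj[OF _ _ inj]) (use l in auto)
  show ?thesis using finprod_reindex[of f "\<lambda>i. (i + 1) mod l" "{..<l}", OF _ inj] f unfolding im by auto
qed

lemma diff_trans:
  "x \<in> carrier G \<Longrightarrow> y \<in> carrier G \<Longrightarrow> z \<in> carrier G \<Longrightarrow> (x \<otimes> inv y) \<otimes> (y \<otimes> inv z) = x \<otimes> inv z"
  by (simp add: m_assoc[symmetric]) (simp add: m_assoc)

lemma conj_cancel: "x \<in> carrier G \<Longrightarrow> y \<in> carrier G \<Longrightarrow> x \<otimes> y \<otimes> inv x = y"
  using m_comm[of x y] by (simp add: m_assoc)

lemma diff_diff: "x \<in> carrier G \<Longrightarrow> y \<in> carrier G \<Longrightarrow> x \<otimes> inv (x \<otimes> inv y) = y"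
  using conj_cancel[of x y] by (simp add: inv_mult_group m_assoc)

text \<open>Written additively: each difference along the cycle is \<open>b i + c i + d i\<close>
  with summands from the two ends and the edge, and all differences add up to 0. Collecting the two
  summands at each vertex gives a relation among the subgroups of the faces of the cycle, so by
  disjointness every \<open>d i\<close> vanishes and \<open>c i\<close> is minus
  \<open>b (i + 1)\<close>. Hence \<open>g - b\<close> is constant around the cycle.\<close>

lemma cycle_potential:
  assumes vs: "distinct vs" "3 \<le> length vs" and g: "\<And>i. i < length vs \<Longrightarrow> g (vs ! i) \<in> carrier G"
    and one: "H {} = {\<one>}"
    and Z: "Z = {{}} \<union> {{vs ! i} |i. i < length vs} \<union> {{vs ! i, vs ! ((i + 1) mod length vs)} |i. i < length vs}"
    and H: "\<And>z. z \<in> Z \<Longrightarrow> subgroup (H z) G" and disj: "linearly_disjoint G Z H"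
    and diff: "\<And>i. i < length vs \<Longrightarrow> g (vs ! i) \<otimes> inv g (vs ! ((i + 1) mod length vs)) \<in>
      subgroup_sum G (Pow {vs ! i, vs ! ((i + 1) mod length vs)}) H"
  shows "\<exists>c\<in>carrier G. \<forall>v\<in>set vs. g v \<otimes> inv c \<in> H {v}"
proof -
  define l where "l = length vs"
  define s where "s i = (i + 1) mod l" for i
  define e where "e i = {vs ! i, vs ! s i}" for i
  define p where "p j = (if j = 0 then l - 1 else j - 1)" for j
  have l: "3 \<le> l" using vs by (simp add: l_def)
  have s: "s i < l" for i using l by (simp add: s_def)
  have si: "s i = (if i + 1 = l then 0 else i + 1)" if "i < l" for i using that by (simp add: s_def mod_Suc)
  have ps: "p (s i) = i" if "i < l" for i using si[OF that] by (auto simp: p_def)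
  have p: "p j < l" "s (p j) = j" if "j < l" for j
  proof -
    show "p j < l" using that l by (auto simp: p_def)
    show "s (p j) = j" using si[OF \<open>p j < l\<close>] that l by (auto simp: p_def)
  qed
  have ne: "vs ! i \<noteq> vs ! s i" if "i < l" for i
    using si[OF that] that s[of i] vs(1) l by (auto simp: nth_eq_iff_index_eq l_def split: if_splits)
  have subH: "subgroup (H {vs ! i}) G" "subgroup (H (e i)) G" if "i < l" for i
    by (rule H; use that in \<open>auto simp: Z e_def s_def l_def\<close>)+
  have "\<forall>i. \<exists>b c d. i < l \<longrightarrow> b \<in> H {vs ! i} \<and> c \<in> H {vs ! s i} \<and> d \<in> H (e i) \<and>
      g (vs ! i) \<otimes> inv g (vs ! s i) = b \<otimes> c \<otimes> d"
  proof
    fix i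
    have "\<exists>b\<in>H {vs ! i}. \<exists>c\<in>H {vs ! s i}. \<exists>d\<in>H {vs ! i, vs ! s i}. g (vs ! i) \<otimes> inv g (vs ! s i) = b \<otimes> c \<otimes> d" if i: "i < l"
    proof (rule iffD1[OF subgroup_sum_edge[where H = H, OF one]])
      show "subgroup (H {vs ! i}) G" "subgroup (H {vs ! s i}) G" "subgroup (H {vs ! i, vs ! s i}) G"
        using subH[OF i] subH(1)[OF s] by (simp_all add: e_def)
      show "g (vs ! i) \<otimes> inv g (vs ! s i) \<in> subgroup_sum G (Pow {vs ! i, vs ! s i}) H"
        using diff[of i] i by (simp add: s_def l_def)
    qed (rule ne[OF i])
    then show "\<exists>b c d. i < l \<longrightarrow> b \<in> H {vs ! i} \<and> c \<in> H {vs ! s i} \<and> d \<in> H (e i) \<and>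
      g (vs ! i) \<otimes> inv g (vs ! s i) = b \<otimes> c \<otimes> d" unfolding e_def by blast
  qed
  then obtain b c d where bcd: "\<And>i. i < l \<Longrightarrow> b i \<in> H {vs ! i}" "\<And>i. i < l \<Longrightarrow> c i \<in> H {vs ! s i}"
    "\<And>i. i < l \<Longrightarrow> d i \<in> H (e i)" "\<And>i. i < l \<Longrightarrow> g (vs ! i) \<otimes> inv g (vs ! s i) = b i \<otimes> c i \<otimes> d i"
    by metis
  have carr: "b i \<in> carrier G" "c i \<in> carrier G" "d i \<in> carrier G" "g (vs ! i) \<in> carrier G" if "i < l" for i
    using bcd(1-3)[OF that] subH[OF that] subH(1)[OF s] subgroup.mem_carrier g that by (metis l_def)+
  define a where "a i = b i \<otimes> c (p i)" for i
  have aH: "a i \<in> H {vs ! i}" if "i < l" for i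
    unfolding a_def using subgroup.m_closed[OF subH(1)[OF that] bcd(1)[OF that]] bcd(2)[OF p(1)[OF that]] p(2)[OF that] by simp
  have cp: "c (p i) \<in> carrier G" if "i < l" for i by (rule carr(2)[OF p(1)[OF that]])
  have ac: "a i \<in> carrier G" if "i < l" for i using carr(1)[OF that] cp[OF that] by (simp add: a_def)
  have cs: "finprod G c {..<l} = finprod G (\<lambda>i. c (p i)) {..<l}"
  proof -
    have "finprod G (\<lambda>i. (\<lambda>i. c (p i)) ((i + 1) mod l)) {..<l} = finprod G (\<lambda>i. c (p i)) {..<l}"
      by (rule finprod_shift) (use l cp in auto)
    moreover have "finprod G (\<lambda>i. (\<lambda>i. c (p i)) ((i + 1) mod l)) {..<l} = finprod G c {..<l}"
      by (rule finprod_cong') (use carr ps in \<open>auto simp: s_def\<close>)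
    ultimately show ?thesis by simp
  qed
  have gs: "finprod G (\<lambda>i. inv g (vs ! s i)) {..<l} = finprod G (\<lambda>i. inv g (vs ! i)) {..<l}"
    unfolding s_def by (rule finprod_shift[where f = "\<lambda>i. inv g (vs ! i)"]) (use l carr(4) in auto)
  have prod: "finprod G a {..<l} \<otimes> finprod G d {..<l} = \<one>"
  proof -
    have Pi: "b \<in> {..<l} \<rightarrow> carrier G" "c \<in> {..<l} \<rightarrow> carrier G" "d \<in> {..<l} \<rightarrow> carrier G"
      "(\<lambda>i. c (p i)) \<in> {..<l} \<rightarrow> carrier G" "(\<lambda>i. b i \<otimes> c i) \<in> {..<l} \<rightarrow> carrier G"
      "(\<lambda>i. g (vs ! i)) \<in> {..<l} \<rightarrow> carrier G" "(\<lambda>i. inv g (vs ! i)) \<in> {..<l} \<rightarrow> carrier G"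
      "(\<lambda>i. inv g (vs ! s i)) \<in> {..<l} \<rightarrow> carrier G"
      using carr cp s by auto
    have "finprod G a {..<l} \<otimes> finprod G d {..<l} = finprod G b {..<l} \<otimes> finprod G c {..<l} \<otimes> finprod G d {..<l}"
      unfolding a_def finprod_multf[OF Pi(1,4)] cs ..
    also have "\<dots> = finprod G (\<lambda>i. b i \<otimes> c i \<otimes> d i) {..<l}"
      unfolding finprod_multf[OF Pi(5,3)] finprod_multf[OF Pi(1,2)] ..
    also have "\<dots> = finprod G (\<lambda>i. g (vs ! i) \<otimes> inv g (vs ! s i)) {..<l}"
      by (rule finprod_cong') (use carr s bcd(4) in auto)
    also have "\<dots> = finprod G (\<lambda>i. g (vs ! i)) {..<l} \<otimes> finprod G (\<lambda>i. inv g (vs ! i)) {..<l}"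
      unfolding finprod_multf[OF Pi(6,8)] gs ..
    also have "\<dots> = finprod G (\<lambda>i. g (vs ! i) \<otimes> inv g (vs ! i)) {..<l}"
      unfolding finprod_multf[OF Pi(6,7)] ..
    also have "\<dots> = \<one>" by (rule finprod_one_eqI) (use carr(4) in auto)
    finally show ?thesis .
  qed
  have injV: "inj_on (\<lambda>i. {vs ! i}) {..<l}" using vs(1) by (auto simp: inj_on_def nth_eq_iff_index_eq l_def)
  have injE: "inj_on e {..<l}" using graph_cycle_inj_edges[OF vs] unfolding e_def s_def l_def .
  have card_e: "card (e i) = 2" if "i < l" for i using ne[OF that] by (simp add: e_def)
  \<comment> \<open>The collected elements as one family over the faces of the cycle. Singletons and
    edges are told apart by cardinality, and the empty face contributes 1.\<close>
  define \<phi> where "\<phi> z = (if z = {} then \<one> else if card z = 1 then a (inv_into {..<l} (\<lambda>i. {vs ! i}) z)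
    else d (inv_into {..<l} e z))" for z
  have \<phi>V: "\<phi> {vs ! i} = a i" and \<phi>E: "\<phi> (e i) = d i" if "i < l" for i
  proof -
    have "inv_into {..<l} (\<lambda>i. {vs ! i}) {vs ! i} = i" by (rule inv_into_f_eq[OF injV]) (use that in auto)
    then show "\<phi> {vs ! i} = a i" by (simp add: \<phi>_def)
    have "e i \<noteq> {}" by (simp add: e_def)
    then show "\<phi> (e i) = d i" using card_e[OF that] inv_into_f_f[OF injE, of i] that by (simp add: \<phi>_def)
  qed
  have Z': "Z = insert {} ((\<lambda>i. {vs ! i}) ` {..<l} \<union> e ` {..<l})"
    unfolding Z e_def s_def l_def by auto
  have \<phi>H: "\<phi> z \<in> H z" if "z \<in> Z" for z
    using that \<phi>V \<phi>E aH bcd(3) one unfolding Z' by (auto simp: \<phi>_def[of "{}"])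
  have \<phi>G: "\<phi> z \<in> carrier G" if "z \<in> Z" for z by (rule subgroup.mem_carrier[OF H[OF that] \<phi>H[OF that]])
  have "finprod G \<phi> Z = \<phi> {} \<otimes> finprod G \<phi> ((\<lambda>i. {vs ! i}) ` {..<l} \<union> e ` {..<l})"
    unfolding Z' by (rule finprod_insert) (use \<phi>G in \<open>auto simp: Z' e_def\<close>)
  also have "\<dots> = finprod G \<phi> ((\<lambda>i. {vs ! i}) ` {..<l} \<union> e ` {..<l})"
  proof -
    have "finprod G \<phi> ((\<lambda>i. {vs ! i}) ` {..<l} \<union> e ` {..<l}) \<in> carrier G"
      by (rule finprod_closed) (use \<phi>G in \<open>auto simp: Z'\<close>)
    then show ?thesis by (simp add: \<phi>_def[of "{}"])
  qed
  also have "\<dots> = finprod G \<phi> ((\<lambda>i. {vs ! i}) ` {..<l}) \<otimes> finprod G \<phi> (e ` {..<l})"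
  proof (rule finprod_Un_disjoint)
    show "(\<lambda>i. {vs ! i}) ` {..<l} \<inter> e ` {..<l} = {}"
    proof (rule equals0I)
      fix z assume "z \<in> (\<lambda>i. {vs ! i}) ` {..<l} \<inter> e ` {..<l}"
      then obtain i j where "z = {vs ! i}" "j < l" "z = e j" by auto
      then show False using card_e[of j] by simp
    qed
  qed (use \<phi>G in \<open>auto simp: Z'\<close>)
  also have "finprod G \<phi> ((\<lambda>i. {vs ! i}) ` {..<l}) = finprod G (\<lambda>i. \<phi> {vs ! i}) {..<l}"
    by (rule finprod_reindex[OF _ injV]) (use \<phi>G in \<open>auto simp: Z'\<close>)
  also have "\<dots> = finprod G a {..<l}" by (rule finprod_cong') (use \<phi>V ac in auto)
  also have "finprod G \<phi> (e ` {..<l}) = finprod G (\<lambda>i. \<phi> (e i)) {..<l}"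
    by (rule finprod_reindex[OF _ injE]) (use \<phi>G in \<open>auto simp: Z'\<close>)
  also have "\<dots> = finprod G d {..<l}" by (rule finprod_cong') (use \<phi>E carr in auto)
  finally have \<phi>Z: "finprod G \<phi> Z = \<one>" using prod by simp
  have \<phi>1: "\<phi> z = \<one>" if "z \<in> Z" for z by (rule linearly_disjoint_one[where f = \<phi>, OF disj H \<phi>H \<phi>Z that])
  have a1: "a i = \<one>" and d1: "d i = \<one>" if "i < l" for i
    using \<phi>1[of "{vs ! i}"] \<phi>1[of "e i"] \<phi>V[OF that] \<phi>E[OF that] that by (auto simp: Z')
  \<comment> \<open>The constant sought: \<open>step\<close> shows that this value is the same at
    all vertices of the cycle.\<close>
  define k where "k i = g (vs ! i) \<otimes> inv b i" for i
  have kc: "k i \<in> carrier G" if "i < l" for i using carr[OF that] by (simp add: k_def)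
  have step: "k (Suc i) = k i" if i: "Suc i < l" for i
  proof -
    have i': "i < l" using i by simp
    have sS: "s i = Suc i" "p (Suc i) = i" using si[OF i'] i by (simp_all add: p_def)
    have "b (Suc i) \<otimes> c i = \<one>" using a1[OF i] sS by (simp add: a_def)
    then have "c i \<otimes> b (Suc i) = \<one>" using carr(1)[OF i] carr(2)[OF i'] by (simp add: m_comm)
    then have ci: "c i = inv b (Suc i)" using carr(1)[OF i] carr(2)[OF i'] by (intro inv_equality[symmetric])
    have "g (vs ! i) \<otimes> inv g (vs ! Suc i) = b i \<otimes> inv b (Suc i)"
      using bcd(4)[OF i'] d1[OF i'] carr[OF i] carr[OF i'] by (simp add: sS ci)
    then have "g (vs ! i) = b i \<otimes> inv b (Suc i) \<otimes> g (vs ! Suc i)"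
      using carr[OF i] carr[OF i'] inv_solve_right'[of "b i \<otimes> inv b (Suc i)" "g (vs ! i)" "g (vs ! Suc i)"] by simp
    then have "k i = b i \<otimes> inv b (Suc i) \<otimes> g (vs ! Suc i) \<otimes> inv b i" by (simp add: k_def)
    also have "\<dots> = inv b (Suc i) \<otimes> g (vs ! Suc i)"
      using conj_cancel[of "b i" "inv b (Suc i) \<otimes> g (vs ! Suc i)"] carr[OF i] carr[OF i'] by (simp add: m_assoc)
    finally show ?thesis using carr[OF i] by (simp add: k_def m_comm)
  qed
  have const: "k i = k 0" if "i < l" for i using that by (induction i) (use step in auto)
  show ?thesis
  proof (intro bexI ballI)
    show "k 0 \<in> carrier G" by (rule kc) (use l in simp)
    fix v assume "v \<in> set vs"
    then obtain i where i: "i < l" "v = vs ! i" by (auto simp: in_set_conv_nth l_def)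
    have "g v \<otimes> inv k 0 = g v \<otimes> inv (g v \<otimes> inv b i)" using const[OF i(1)] by (simp add: k_def i(2))
    also have "\<dots> = b i"
      using carr[OF i(1)] i(2) by (simp add: diff_diff)
    finally show "g v \<otimes> inv k 0 \<in> H {v}" using bcd(1)[OF i(1)] i(2) by simp
  qed
qed

end

section \<open>Faces of low dimension and cycles of a complex\<close>

lemma faces_edge: "e \<in> faces X 1 \<longleftrightarrow> e \<in> X \<and> card e = 2"
  by (auto simp: faces_def)

lemma faces_vertex:
  assumes "abstract_complex X"
  shows "faces X 0 = (\<lambda>v. {v}) ` \<Union>X"
proof (intro equalityI subsetI)
  fix x assume "x \<in> faces X 0"
  then have "x \<in> X" "card x = 1" by (auto simp: faces_def)
  then show "x \<in> (\<lambda>v. {v}) ` \<Union>X" by (auto simp: card_1_singleton_iff)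
next
  fix x assume "x \<in> (\<lambda>v. {v}) ` \<Union>X"
  then obtain v y where v: "x = {v}" "v \<in> y" "y \<in> X" by blast
  then have "{v} \<in> X" using assms by (auto simp: abstract_complex_def)
  then show "x \<in> faces X 0" using v(1) by (simp add: faces_def)
qed

lemma is_cycle_graph_cycle:
  assumes X: "abstract_complex X" and vs: "graph_cycle (faces X 1) vs"
  shows "is_cycle X ({{}} \<union> {{vs ! i} |i. i < length vs} \<union>
    {{vs ! i, vs ! ((i + 1) mod length vs)} |i. i < length vs}) (length vs)" (is "is_cycle X ?Z ?l")
proof -
  have vs': "distinct vs" "3 \<le> ?l" and e: "\<And>i. i < ?l \<Longrightarrow> {vs ! i, vs ! ((i + 1) mod ?l)} \<in> X"
    using vs by (auto simp: graph_cycle_def faces_edge)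
  have l: "0 < ?l" using vs'(2) by linarith
  then have lt: "(i + 1) mod ?l < ?l" for i by simp
  have ZX: "?Z \<subseteq> X"
  proof
    fix z assume "z \<in> ?Z"
    then consider "z = {}" | i where "i < ?l" "z \<subseteq> {vs ! i, vs ! ((i + 1) mod ?l)}" by blast
    then show "z \<in> X"
    proof cases
      case 1 then show ?thesis using X by (simp add: abstract_complex_def)
    next
      case (2 i) then show ?thesis using X e[OF 2(1)] unfolding abstract_complex_def by blast
    qed
  qed
  have down: "y \<in> ?Z" if z: "z \<in> ?Z" and y: "y \<subseteq> z" for y z
  proof -
    from z consider "z = {}" | i where "i < ?l" "z = {vs ! i}" | i where "i < ?l" "z = {vs ! i, vs ! ((i + 1) mod ?l)}"
      by blast
    then show ?thesis
    proof cases
      case 1 then show ?thesis using y by simp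
    next
      case (2 i) then show ?thesis using y by blast
    next
      case (3 i)
      then have "y = {} \<or> y = {vs ! i} \<or> y = {vs ! ((i + 1) mod ?l)} \<or> y = z" using y by blast
      then show ?thesis using 3 lt[of i] by blast
    qed
  qed
  have card2: "card z \<le> 2" if "z \<in> ?Z" for z
    using that by (auto intro: order.trans[OF card_insert_le_m1])
  have fin: "finite z" if "z \<in> ?Z" for z using that by auto
  have sub: "is_subgraph X ?Z"
    unfolding is_subgraph_def abstract_complex_def using ZX down card2 fin by blast
  have "complex_iso (\<lambda>i. vs ! i) (cycle_graph ?l) ?Z"
    unfolding complex_iso_def
  proof
    have "\<Union>(cycle_graph ?l) = {..<?l}" using lt by (auto simp: cycle_graph_def)
    moreover have "\<Union>?Z = (\<lambda>i. vs ! i) ` {..<?l}" using lt by auto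
    moreover have "inj_on (\<lambda>i. vs ! i) {..<?l}" using vs'(1) by (auto simp: inj_on_def nth_eq_iff_index_eq)
    ultimately show "bij_betw (\<lambda>i. vs ! i) (\<Union>(cycle_graph ?l)) (\<Union>?Z)" by (simp add: bij_betw_def)
    show "(\<lambda>x. (!) vs ` x) ` cycle_graph ?l = ?Z"
    proof -
      have 1: "cycle_graph ?l = insert {} ((\<lambda>i. {i}) ` {..<?l} \<union> (\<lambda>i. {i, (i + 1) mod ?l}) ` {..<?l})"
        by (auto simp: cycle_graph_def)
      have 2: "?Z = insert {} ((\<lambda>i. {vs ! i}) ` {..<?l} \<union> (\<lambda>i. {vs ! i, vs ! ((i + 1) mod ?l)}) ` {..<?l})"
        by auto
      show ?thesis unfolding 2 unfolding 1 by (simp add: image_Un image_image)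
    qed
  qed
  then show ?thesis using sub vs'(2) unfolding is_cycle_def by blast
qed

context plain_comm_group
begin

lemma coset_one: "subgroup N G \<Longrightarrow> a \<in> carrier G \<Longrightarrow> N #> a = N \<longleftrightarrow> a \<in> N"
  using coset_join1 coset_join2 by blast

lemma coset_diff:
  assumes N: "subgroup N G" and ab: "a \<in> carrier G" "b \<in> carrier G"
  shows "(N #> a) \<otimes>\<^bsub>G Mod N\<^esub> inv\<^bsub>G Mod N\<^esub> (N #> b) = N #> (a \<otimes> inv b)"
proof -
  interpret normal N G using N by (simp add: normal_iff_subgroup)
  have "N #> b \<in> carrier (G Mod N)" using ab(2) by (auto simp: carrier_FactGroup)
  then show ?thesis using ab by (simp add: inv_FactGroup rcos_inv rcos_sum)
qed

end

locale disjoint_subgroups = plain_comm_group G for G :: "'a monoid" (structure) +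
  fixes X :: "'v set set" and H :: "'v set \<Rightarrow> 'a set" and L :: "'v rel"
  assumes complex: "abstract_complex X" and finite_X: "finite X" and order: "linear_order_on (\<Union>X) L"
    and H: "x \<in> X \<Longrightarrow> subgroup (H x) G" and H_empty: "H {} = {\<one>}"
    and cycles: "is_cycle X Z l \<Longrightarrow> 3 * l \<le> 2 * (card (\<Union>X) + 1) \<Longrightarrow> linearly_disjoint G Z H"
    and pairs: "u \<in> \<Union>X \<Longrightarrow> v \<in> \<Union>X \<Longrightarrow> u \<noteq> v \<Longrightarrow> linearly_disjoint G {{u}, {v}} H"
begin

definition "F = quotient_sheaf (constant_sheaf G) (\<lambda>x. subgroup_sum G (Pow x) H)"

abbreviation "S x \<equiv> subgroup_sum G (Pow x) H"

lemma face_subset: "x \<in> X \<Longrightarrow> y \<subseteq> x \<Longrightarrow> y \<in> X"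
  using complex by (auto simp: abstract_complex_def)

lemma vertex_face: "v \<in> \<Union>X \<Longrightarrow> {v} \<in> X"
  using face_subset by blast

lemma S_subgroup: "x \<in> X \<Longrightarrow> subgroup (S x) G"
proof (rule subgroup_sum_subgroup)
  assume x: "x \<in> X"
  then show "finite (Pow x)" using complex by (simp add: abstract_complex_def)
  show "subgroup (H y) G" if "y \<in> Pow x" for y using face_subset[OF x] that H by simp
qed (rule comm_group_axioms)

lemma S_vertex: "v \<in> \<Union>X \<Longrightarrow> S {v} = H {v}"
  by (rule subgroup_sum_point[where H = H, OF H_empty H]) (rule vertex_face)

lemma stalk_F: "stalk F x = G Mod S x"
  by (simp add: F_def quotient_sheaf_def constant_sheaf_def)

lemma res_F:
  assumes "x \<in> X" "y \<in> X" "x \<subseteq> y" "a \<in> carrier G"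
  shows "res F y x (S x #> a) = S y #> a"
proof -
  have "S y <#> ((\<lambda>a. a) ` (S x #> a)) = S y #> a"
  proof (rule quotient_sheaf_res)
    show "(\<lambda>a. a) ` S x \<subseteq> S y"
    proof -
      have "S x \<subseteq> S y"
      proof (rule subgroup_sum_mono[OF comm_group_axioms])
        show "finite (Pow y)" using complex assms(2) by (simp add: abstract_complex_def)
        show "Pow x \<subseteq> Pow y" using assms(3) by blast
        show "subgroup (H z) G" if "z \<in> Pow y" for z using face_subset[OF assms(2)] that H by simp
      qed
      then show ?thesis by simp
    qed
  qed (use assms S_subgroup is_group in \<open>auto simp: hom_def\<close>)
  then show ?thesis by (simp add: F_def quotient_sheaf_def constant_sheaf_def)
qed

lemma extreme_vertices:
  assumes e: "e \<in> faces X 1"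
  shows "e = {larger_vertex L e, smaller_vertex L e} \<and> larger_vertex L e \<noteq> smaller_vertex L e"
proof -
  obtain a b where ab: "e = {a, b}" "a \<noteq> b" using e unfolding faces_edge card_2_iff by blast
  have abX: "a \<in> \<Union>X" "b \<in> \<Union>X" using e ab by (auto simp: faces_edge)
  have L: "(x, x) \<in> L" if "x \<in> \<Union>X" for x
    using order that by (auto simp: linear_order_on_def partial_order_on_def preorder_on_def refl_on_def)
  have anti: "x = y" if "(x, y) \<in> L" "(y, x) \<in> L" for x y
    using order that by (auto simp: linear_order_on_def partial_order_on_def antisym_def)
  have total: "(a, b) \<in> L \<or> (b, a) \<in> L"
    using order abX ab(2) by (auto simp: linear_order_on_def total_on_def)
  have aux: "larger_vertex L {x, y} = y \<and> smaller_vertex L {x, y} = x" if xy: "(x, y) \<in> L" "x \<in> \<Union>X" "y \<in> \<Union>X" for x y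
  proof
    show "larger_vertex L {x, y} = y" unfolding larger_vertex_def
      by (rule the_equality) (use xy L anti in auto)
    show "smaller_vertex L {x, y} = x" unfolding smaller_vertex_def
      by (rule the_equality) (use xy L anti in auto)
  qed
  from total show ?thesis
  proof
    assume "(a, b) \<in> L"
    then show ?thesis using aux[of a b] abX ab by auto
  next
    assume "(b, a) \<in> L"
    then show ?thesis using aux[of b a] abX ab by (auto simp: insert_commute)
  qed
qed

lemma cochain_lift:
  assumes "f \<in> cochains X F 0"
  shows "\<exists>g. \<forall>v\<in>\<Union>X. g v \<in> carrier G \<and> f {v} = S {v} #> g v"
proof -
  have "\<exists>a. a \<in> carrier G \<and> f {v} = S {v} #> a" if "v \<in> \<Union>X" for v
  proof -
    have "{v} \<in> faces X 0" using that by (simp add: faces_vertex[OF complex])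
    then have "f {v} \<in> carrier (G Mod S {v})" using assms unfolding cochains_def stalk_F by blast
    then show ?thesis by (auto simp: carrier_FactGroup)
  qed
  then show ?thesis by metis
qed

context
  fixes f g
  assumes g: "\<And>v. v \<in> \<Union>X \<Longrightarrow> g v \<in> carrier G" and f: "\<And>v. v \<in> \<Union>X \<Longrightarrow> f {v} = S {v} #> g v"
begin

text \<open>Both orientations of an edge are considered, so that the order \<open>L\<close> no
  longer occurs; \<open>coboundary_one\<close> shows that these are the edges where the coboundary
  vanishes.\<close>

definition "flat = {e \<in> faces X 1. \<forall>u v. e = {u, v} \<longrightarrow> g u \<otimes> inv g v \<in> S e}"

definition "cluster c = {v \<in> \<Union>X. g v \<otimes> inv c \<in> H {v}}"

lemma coboundary_one:
  assumes e: "e \<in> faces X 1"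
  shows "coboundary_0 L X F f e = \<one>\<^bsub>stalk F e\<^esub> \<longleftrightarrow> e \<in> flat"
proof -
  let ?a = "larger_vertex L e" and ?b = "smaller_vertex L e"
  have ab: "e = {?a, ?b}" "?a \<noteq> ?b" using extreme_vertices[OF e] by auto
  have eX: "e \<in> X" using e by (simp add: faces_edge)
  have in_e: "?a \<in> e" "?b \<in> e" using ab(1) by blast+
  then have abX: "?a \<in> \<Union>X" "?b \<in> \<Union>X" using eX by blast+
  have "res F e {?a} (f {?a}) = S e #> g ?a" "res F e {?b} (f {?b}) = S e #> g ?b"
    unfolding f[OF abX(1)] f[OF abX(2)]
    by (rule res_F; use abX in_e eX vertex_face g in auto)+
  then have "coboundary_0 L X F f e = S e #> (g ?a \<otimes> inv g ?b)"
    using e coset_diff[OF S_subgroup[OF eX] g[OF abX(1)] g[OF abX(2)]] by (simp add: coboundary_0_def Let_def stalk_F)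
  then have 1: "coboundary_0 L X F f e = \<one>\<^bsub>stalk F e\<^esub> \<longleftrightarrow> g ?a \<otimes> inv g ?b \<in> S e"
    using coset_one[OF S_subgroup[OF eX]] g abX by (simp add: stalk_F)
  have sym: "g v \<otimes> inv g u \<in> S e" if "g u \<otimes> inv g v \<in> S e" "u \<in> \<Union>X" "v \<in> \<Union>X" for u v
    using subgroup.m_inv_closed[OF S_subgroup[OF eX] that(1)] g that(2,3) by (simp add: inv_mult_group m_comm)
  have "e \<in> flat \<longleftrightarrow> g ?a \<otimes> inv g ?b \<in> S e"
  proof
    assume "e \<in> flat"
    then have "\<forall>u v. e = {u, v} \<longrightarrow> g u \<otimes> inv g v \<in> S e" by (simp add: flat_def)
    then show "g ?a \<otimes> inv g ?b \<in> S e" using ab(1) by blast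
  next
    assume "g ?a \<otimes> inv g ?b \<in> S e"
    then have *: "g ?a \<otimes> inv g ?b \<in> S e" "g ?b \<otimes> inv g ?a \<in> S e" using sym abX by blast+
    have "g u \<otimes> inv g v \<in> S e" if uv: "e = {u, v}" for u v
    proof -
      have "u = ?a \<and> v = ?b \<or> u = ?b \<and> v = ?a" using ab(1) uv by (metis doubleton_eq_iff)
      then show ?thesis using * by auto
    qed
    then show "e \<in> flat" using e by (simp add: flat_def)
  qed
  then show ?thesis using 1 by blast
qed

lemma cochain_norm_coboundary: "cochain_norm X w F 1 (coboundary_0 L X F f) = sum w (faces X 1 - flat)"
proof -
  have "{x \<in> faces X 1. coboundary_0 L X F f x \<noteq> \<one>\<^bsub>stalk F x\<^esub>} = faces X 1 - flat"
    using coboundary_one by blast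
  then show ?thesis by (simp add: cochain_norm_def)
qed

lemma dist_le_cluster:
  assumes c: "c \<in> carrier G"
  shows "dist_boundaries_0 X w F f \<le> (\<Sum>v\<in>\<Union>X - cluster c. w {v})"
proof -
  define h where "h = (\<lambda>x\<in>faces X (-1). S x #> c)"
  have h: "h \<in> cochains X F (-1)"
    unfolding cochains_def h_def stalk_F by (intro restrict_PiE_iff[THEN iffD2] ballI) (auto simp: carrier_FactGroup c)
  have e: "{} \<in> X" using complex by (simp add: abstract_complex_def)
  then have h0: "h {} = S {} #> c" by (simp add: h_def faces_def)
  define b where "b = coboundary_m1 X F h"
  have b: "b {v} = S {v} #> c" if "v \<in> \<Union>X" for v
  proof -
    have "{v} \<in> faces X 0" using that by (simp add: faces_vertex[OF complex])
    then show ?thesis using res_F[OF e vertex_face[OF that] _ c] by (simp add: b_def coboundary_m1_def h0)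
  qed
  let ?n = "\<lambda>b. cochain_norm X w F 0 (\<lambda>x\<in>faces X 0. f x \<otimes>\<^bsub>stalk F x\<^esub> inv\<^bsub>stalk F x\<^esub> b x)"
  \<comment> \<open>There may be infinitely many coboundaries, but their distances to
    \<open>f\<close> are sums over subsets of a finite set. Only therefore is the \<open>Min\<close>
    in the definition meaningful.\<close>
  have "range ?n \<subseteq> sum w ` Pow (faces X 0)" unfolding cochain_norm_def by auto
  moreover have "finite (faces X 0)" using finite_X by (simp add: faces_def)
  ultimately have "finite (range ?n)" by (meson finite_Pow_iff finite_imageI finite_subset)
  then have fin: "finite (?n ` boundaries_0 X F)" by (rule finite_subset[rotated]) blast
  have "b \<in> boundaries_0 X F" unfolding boundaries_0_def b_def using h by (rule imageI)
  then have "dist_boundaries_0 X w F f \<le> ?n b"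
    unfolding dist_boundaries_0_def by (intro Min_le[OF fin] imageI)
  also have "{x \<in> faces X 0. (\<lambda>x\<in>faces X 0. f x \<otimes>\<^bsub>stalk F x\<^esub> inv\<^bsub>stalk F x\<^esub> b x) x \<noteq> \<one>\<^bsub>stalk F x\<^esub>} =
      (\<lambda>v. {v}) ` (\<Union>X - cluster c)"
  proof -
    have "f {v} \<otimes>\<^bsub>stalk F {v}\<^esub> inv\<^bsub>stalk F {v}\<^esub> b {v} = \<one>\<^bsub>stalk F {v}\<^esub> \<longleftrightarrow> v \<in> cluster c" if v: "v \<in> \<Union>X" for v
    proof -
      have "f {v} \<otimes>\<^bsub>stalk F {v}\<^esub> inv\<^bsub>stalk F {v}\<^esub> b {v} = S {v} #> (g v \<otimes> inv c)"
        unfolding stalk_F f[OF v] b[OF v] by (rule coset_diff[OF S_subgroup[OF vertex_face[OF v]] g[OF v] c])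
      then show ?thesis
        using coset_one[OF S_subgroup[OF vertex_face[OF v]], of "g v \<otimes> inv c"] g[OF v] c v S_vertex[OF v]
        by (simp add: stalk_F cluster_def)
    qed
    then show ?thesis unfolding faces_vertex[OF complex] by auto
  qed
  then have "?n b = (\<Sum>v\<in>\<Union>X - cluster c. w {v})"
    unfolding cochain_norm_def by (simp add: sum.reindex)
  finally show ?thesis .
qed

lemma cluster_flat:
  assumes c: "c \<in> carrier G" and e: "e \<in> faces X 1" "e \<subseteq> cluster c"
  shows "e \<in> flat"
proof -
  have "g u \<otimes> inv g v \<in> S e" if uv: "e = {u, v}" for u v
  proof -
    have eX: "e \<in> X" using e by (simp add: faces_edge)
    have ne: "u \<noteq> v" using e(1) uv by (auto simp: faces_edge)
    have mem: "u \<in> \<Union>X" "v \<in> \<Union>X" "g u \<otimes> inv c \<in> H {u}" "g v \<otimes> inv c \<in> H {v}"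
      using e(2) uv by (auto simp: cluster_def)
    have subs: "subgroup (H {u}) G" "subgroup (H {v}) G" "subgroup (H {u, v}) G"
      using H vertex_face mem eX uv by auto
    have "inv (g v \<otimes> inv c) \<in> H {v}" by (rule subgroup.m_inv_closed[OF subs(2) mem(4)])
    then have "c \<otimes> inv g v \<in> H {v}" using g mem(2) c by (simp add: inv_mult_group)
    moreover have "g u \<otimes> inv g v = (g u \<otimes> inv c) \<otimes> (c \<otimes> inv g v) \<otimes> \<one>"
      using diff_trans[of "g u" c "g v"] g mem(1,2) c by simp
    ultimately show ?thesis
      using subgroup_sum_edge[where H = H and a = "g u \<otimes> inv g v", OF H_empty subs ne] mem(3) subgroup.one_closed[OF subs(3)] uv by blast
  qed
  then show ?thesis using e(1) by (simp add: flat_def)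
qed

text \<open>At a common vertex \<open>w\<close> the constants \<open>c\<close> and \<open>d\<close>
  differ by an element of \<open>H {w}\<close>. At two vertices this element lies in both subgroups
  and is trivial.\<close>

lemma cluster_meet:
  assumes c: "c \<in> carrier G" "d \<in> carrier G" and u: "u \<in> cluster c \<inter> cluster d" and v: "v \<in> cluster c \<inter> cluster d" and uv: "u \<noteq> v"
  shows "c = d"
proof -
  have diff: "d \<otimes> inv c \<in> H {w}" if w: "w \<in> cluster c \<inter> cluster d" for w
  proof -
    have w': "w \<in> \<Union>X" "g w \<otimes> inv c \<in> H {w}" "g w \<otimes> inv d \<in> H {w}" using w by (auto simp: cluster_def)
    have sub: "subgroup (H {w}) G" using H vertex_face w'(1) by blast
    have "inv (g w \<otimes> inv d) \<otimes> (g w \<otimes> inv c) \<in> H {w}"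
      by (rule subgroup.m_closed[OF sub subgroup.m_inv_closed[OF sub w'(3)] w'(2)])
    moreover have "inv (g w \<otimes> inv d) \<otimes> (g w \<otimes> inv c) = d \<otimes> inv c"
      using diff_trans[of d "g w" c] g[OF w'(1)] c by (simp add: inv_mult_group)
    ultimately show ?thesis by simp
  qed
  have uvX: "u \<in> \<Union>X" "v \<in> \<Union>X" using u v by (auto simp: cluster_def)
  have "d \<otimes> inv c = \<one>"
    by (rule linearly_disjoint_pair[OF pairs[OF uvX uv] _ H H diff[OF u] diff[OF v]]) (use uvX uv vertex_face in auto)
  then show ?thesis using c by (metis inv_equality inv_inv inv_closed)
qed

lemma short_cycle_cluster:
  assumes vs: "graph_cycle flat vs" "3 * length vs \<le> 2 * (card (\<Union>X) + 1)"
  shows "\<exists>c\<in>carrier G. set vs \<subseteq> cluster c"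
proof -
  let ?Z = "{{}} \<union> {{vs ! i} |i. i < length vs} \<union> {{vs ! i, vs ! ((i + 1) mod length vs)} |i. i < length vs}"
  have "graph_cycle (faces X 1) vs" by (rule graph_cycle_mono[OF vs(1)]) (auto simp: flat_def)
  then have cyc: "is_cycle X ?Z (length vs)" by (rule is_cycle_graph_cycle[OF complex])
  then have ZX: "?Z \<subseteq> X" unfolding is_cycle_def is_subgraph_def by blast
  have vX: "vs ! i \<in> \<Union>X" if "i < length vs" for i using ZX that by blast
  have "\<exists>c\<in>carrier G. \<forall>v\<in>set vs. g v \<otimes> inv c \<in> H {v}"
  proof (rule cycle_potential[where Z = ?Z and H = H])
    show "distinct vs" "3 \<le> length vs" using vs(1) by (simp_all add: graph_cycle_def)
    show "linearly_disjoint G ?Z H" by (rule cycles[OF cyc vs(2)])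
    show "subgroup (H z) G" if "z \<in> ?Z" for z using ZX that H by blast
    show "g (vs ! i) \<in> carrier G" if "i < length vs" for i by (rule g[OF vX[OF that]])
    show "g (vs ! i) \<otimes> inv g (vs ! ((i + 1) mod length vs)) \<in> S {vs ! i, vs ! ((i + 1) mod length vs)}"
      if "i < length vs" for i
    proof -
      have "{vs ! i, vs ! ((i + 1) mod length vs)} \<in> flat" using vs(1) that by (simp add: graph_cycle_def)
      then show ?thesis unfolding flat_def by blast
    qed
  qed (simp_all add: H_empty)
  then obtain c where c: "c \<in> carrier G" "\<forall>v\<in>set vs. g v \<otimes> inv c \<in> H {v}" by blast
  have "v \<in> \<Union>X" if "v \<in> set vs" for v
    using that vX unfolding in_set_conv_nth by blast
  then have "set vs \<subseteq> cluster c" using c(2) by (auto simp: cluster_def)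
  then show ?thesis using c(1) by blast
qed

text \<open>The heaviest cluster supplies the constant to be subtracted from \<open>f\<close>, and
  \<open>cluster_expansion\<close> compares the weight outside this cluster with the edges that are
  not flat.\<close>

lemma coboundary_bound:
  fixes lam \<delta> :: real
  assumes wg: "weighted_graph (\<Union>X) (faces X 1) (\<lambda>v. w {v}) w lam \<delta>" and pos: "0 \<le> 1 - 2 * lam - 3 * \<delta>"
  shows "(1 - 2 * lam - 3 * \<delta>) * dist_boundaries_0 X w F f \<le> cochain_norm X w F 1 (coboundary_0 L X F f)"
proof -
  interpret weighted_graph "\<Union>X" "faces X 1" "\<lambda>v. w {v}" w lam \<delta> by (rule wg)
  let ?\<A> = "cluster ` carrier G"
  have finA: "finite ?\<A>" by (rule finite_subset[of _ "Pow (\<Union>X)"]) (use finite_V in \<open>auto simp: cluster_def\<close>)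
  have "\<exists>M\<in>?\<A>. \<forall>A\<in>?\<A>. (\<Sum>v\<in>A. w {v}) \<le> (\<Sum>v\<in>M. w {v})"
  proof -
    let ?W = "(\<lambda>A. \<Sum>v\<in>A. w {v}) ` ?\<A>"
    have W: "finite ?W" "?W \<noteq> {}" using finA by auto
    have "Max ?W \<in> ?W" by (rule Max_in[OF W])
    then obtain M where M: "Max ?W = (\<Sum>v\<in>M. w {v})" "M \<in> ?\<A>" by (rule imageE)
    have "(\<Sum>v\<in>A. w {v}) \<le> (\<Sum>v\<in>M. w {v})" if "A \<in> ?\<A>" for A
      unfolding M(1)[symmetric] using that by (intro Max_ge[OF W(1)] imageI)
    then show ?thesis using M(2) by blast
  qed
  then obtain M where M: "M \<in> ?\<A>" "\<And>A. A \<in> ?\<A> \<Longrightarrow> (\<Sum>v\<in>A. w {v}) \<le> (\<Sum>v\<in>M. w {v})" by blast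
  then obtain c where c: "c \<in> carrier G" "M = cluster c" by blast
  have "(1 - 2 * lam - 3 * \<delta>) * (1 - (\<Sum>v\<in>M. w {v})) \<le> sum w (faces X 1 - flat)"
  proof (rule cluster_expansion[where F = flat, OF _ finA])
    show "flat \<subseteq> faces X 1" by (auto simp: flat_def)
    show "A \<subseteq> \<Union>X" if "A \<in> ?\<A>" for A using that by (auto simp: cluster_def)
    show "inner A \<subseteq> flat" if "A \<in> ?\<A>" for A using that cluster_flat by (auto simp: inner_def)
    show "u = v" if AB: "A \<in> ?\<A>" "B \<in> ?\<A>" "A \<noteq> B" and uv: "u \<in> A \<inter> B" "v \<in> A \<inter> B" for A B u v
    proof (rule ccontr)
      assume ne: "u \<noteq> v"
      obtain a b where "a \<in> carrier G" "A = cluster a" "b \<in> carrier G" "B = cluster b" using AB by blast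
      then show False using cluster_meet[of a b u v] uv ne AB(3) by blast
    qed
    show "\<exists>A\<in>?\<A>. set vs \<subseteq> A" if "graph_cycle flat vs" "3 * length vs \<le> 2 * (card (\<Union>X) + 1)" for vs
      using short_cycle_cluster[OF that] by blast
  qed (use M in auto)
  moreover have "(\<Sum>v\<in>\<Union>X - M. w {v}) = 1 - (\<Sum>v\<in>M. w {v})"
  proof -
    have "M \<subseteq> \<Union>X" using c(2) by (auto simp: cluster_def)
    have "(\<Sum>v\<in>\<Union>X - M. w {v}) = (\<Sum>v\<in>\<Union>X. w {v}) - (\<Sum>v\<in>M. w {v})"
      by (rule sum_diff[OF finite_V \<open>M \<subseteq> \<Union>X\<close>])
    then show ?thesis by (simp only: sum_wv)
  qed
  ultimately have 1: "(1 - 2 * lam - 3 * \<delta>) * (\<Sum>v\<in>\<Union>X - M. w {v}) \<le> sum w (faces X 1 - flat)" by simp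
  have 2: "dist_boundaries_0 X w F f \<le> (\<Sum>v\<in>\<Union>X - M. w {v})"
    unfolding c(2) by (rule dist_le_cluster[OF c(1)])
  show ?thesis
    unfolding cochain_norm_coboundary by (rule order_trans[OF mult_left_mono[OF 2 pos] 1])
qed

end

theorem cbe0_bound:
  fixes lam \<delta> :: real
  assumes wg: "weighted_graph (\<Union>X) (faces X 1) (\<lambda>v. w {v}) w lam \<delta>" and pos: "0 \<le> 1 - 2 * lam - 3 * \<delta>"
  shows "ereal (1 - 2 * lam - 3 * \<delta>) \<le> cbe0 L X w F"
  unfolding cbe0_def
proof (rule Sup_upper, intro CollectI exI conjI ballI HOL.refl)
  fix f assume "f \<in> cochains X F 0"
  then obtain g where g: "\<forall>v\<in>\<Union>X. g v \<in> carrier G \<and> f {v} = S {v} #> g v" using cochain_lift by blast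
  show "(1 - 2 * lam - 3 * \<delta>) * dist_boundaries_0 X w F f \<le> cochain_norm X w F 1 (coboundary_0 L X F f)"
    by (rule coboundary_bound[where g = g, OF _ _ wg pos]) (use g in blast)+
qed (use pos in simp_all)

end

section \<open>Numerical estimates\<close>

text \<open>Put \<open>Q = q + r - 1\<close>, which is at most \<open>r * q\<close>. Positivity of
  the claimed bound means \<open>7 < Q\<close> with room to spare, and from there on
  \<open>1 - 6 / Q\<close> is the larger value.\<close>

lemma bound_edgeless:
  fixes r q :: nat
  assumes r: "1 \<le> r" and q: "1 \<le> q"
    and pos: "0 < 2 * real r / (5 * real r + 2) - (14 * real r + 4) / ((5 * real r + 2) * (real q + real r - 1))"
  shows "2 * real r / (5 * real r + 2) - (14 * real r + 4) / ((5 * real r + 2) * (real q + real r - 1)) \<le>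
    1 - 6 / (real r * real q)"
proof -
  define Q where "Q = real q + real r - 1"
  have Q: "0 < Q" using r q by (simp add: Q_def)
  have "0 \<le> (real r - 1) * (real q - 1)" using r q by simp
  then have "Q \<le> real r * real q" by (simp add: Q_def algebra_simps)
  then have le: "6 / (real r * real q) \<le> 6 / Q" using Q by (intro divide_left_mono) (use r q in auto)
  have eq: "2 * real r / (5 * real r + 2) - (14 * real r + 4) / ((5 * real r + 2) * Q) =
      (2 * real r * Q - (14 * real r + 4)) / ((5 * real r + 2) * Q)"
    using Q by (simp add: diff_divide_distrib)
  have den: "0 < (5 * real r + 2) * Q" using Q by simp
  have "0 < 2 * real r * Q - (14 * real r + 4)"
    using pos unfolding Q_def[symmetric] eq using den by (simp add: zero_less_divide_iff order_less_asym)
  then have "(2 * real r) * 7 < (2 * real r) * Q" by linarith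
  then have "7 < Q" using mult_less_cancel_left_pos[of "2 * real r" 7 Q] r by simp
  then have "(3 * real r + 2) * 7 \<le> (3 * real r + 2) * Q" by (intro mult_left_mono) auto
  then have "2 * real r * Q - (14 * real r + 4) \<le> (Q - 6) * (5 * real r + 2)" by (simp add: algebra_simps)
  then have "(2 * real r * Q - (14 * real r + 4)) / ((5 * real r + 2) * Q) \<le> (Q - 6) * (5 * real r + 2) / ((5 * real r + 2) * Q)"
    using den by (intro divide_right_mono) auto
  also have "\<dots> = (Q - 6) / Q" by (simp add: mult.commute)
  also have "\<dots> = 1 - 6 / Q" using Q by (simp add: diff_divide_distrib)
  finally show ?thesis using le unfolding Q_def[symmetric] eq by linarith
qed

text \<open>Here \<open>x\<close> is \<open>sqrt q\<close> and \<open>s\<close> is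
  \<open>sqrt (m - 2)\<close>. For \<open>b\<close> to be positive its second fraction must be
  smaller than the first, which already forces \<open>2 * r\<^sup>2 + r + 1 < x\<close>. For
  \<open>r \<ge> 2\<close> the crude bound \<open>b \<le> 2 / 5\<close> then suffices;
  \<open>r = 1\<close> needs an exact comparison.\<close>

lemma bound_edges:
  fixes r :: nat and x s :: real
  assumes r: "1 \<le> r" and s: "1 \<le> s" and x: "real r * s \<le> x"
  defines "b \<equiv> 2 * real r / (5 * real r + 2)
      - (4 * real r ^ 3 + 4 * real r) * s / ((5 * real r + 2) * (x - (real r - 1) * s))
      - (14 * real r + 4) / ((5 * real r + 2) * (x\<^sup>2 + real r - 1))"
  assumes pos: "0 < b"
  shows "4 \<le> x - 2 * (real r - 1)" and "b \<le> 1 - 2 * (2 / (x - 2 * (real r - 1))) - 6 / (real r * x\<^sup>2)"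
proof -
  define D where "D = x - (real r - 1) * s"
  have "s \<le> D" using x by (simp add: D_def algebra_simps)
  then have D: "0 < D" using s by linarith
  have "1 * 1 \<le> real r * s" using r s by (intro mult_mono) auto
  then have x1: "1 \<le> x" using x by linarith
  then have "1 \<le> x\<^sup>2" by simp
  then have Q: "0 < x\<^sup>2 + real r - 1" using r by simp
  have third: "0 < (14 * real r + 4) / ((5 * real r + 2) * (x\<^sup>2 + real r - 1))"
    using Q by (intro divide_pos_pos mult_pos_pos) auto
  have "(4 * real r ^ 3 + 4 * real r) * s / ((5 * real r + 2) * D) < 2 * real r / (5 * real r + 2)"
    using pos third unfolding b_def D_def by linarith
  also have "2 * real r / (5 * real r + 2) = 2 * real r * D / ((5 * real r + 2) * D)" using D by simp
  finally have "(4 * real r ^ 3 + 4 * real r) * s < 2 * real r * D"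
    using D unfolding divide_less_cancel by (simp add: zero_less_mult_iff mult_less_0_iff)
  moreover have "(4 * real r ^ 3 + 4 * real r) * s = 2 * real r * ((2 * (real r)\<^sup>2 + 2) * s)"
    by (simp add: power2_eq_square power3_eq_cube algebra_simps)
  ultimately have "(2 * (real r)\<^sup>2 + 2) * s < D" using r by (simp only: mult_less_cancel_left_pos)
  then have "(2 * (real r)\<^sup>2 + real r + 1) * s < x" by (simp add: D_def algebra_simps)
  moreover have "(2 * (real r)\<^sup>2 + real r + 1) * 1 \<le> (2 * (real r)\<^sup>2 + real r + 1) * s"
    using s by (intro mult_left_mono) auto
  ultimately have x2: "2 * (real r)\<^sup>2 + real r + 1 < x" by simp
  have sq: "0 \<le> (real r - 1) * (2 * real r + 1)" using r by simp
  then show 4: "4 \<le> x - 2 * (real r - 1)" using x2 by (simp add: algebra_simps power2_eq_square)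
  show "b \<le> 1 - 2 * (2 / (x - 2 * (real r - 1))) - 6 / (real r * x\<^sup>2)"
  proof (cases "r = 1")
    case False
    then have r2: "2 \<le> real r" using r by simp
    then have sq: "0 \<le> (real r - 2) * (2 * real r + 3)" by simp
    have "9 \<le> x - 2 * (real r - 1)" using x2 sq by (simp add: algebra_simps power2_eq_square)
    then have 1: "2 / (x - 2 * (real r - 1)) \<le> 2 / 9" by (intro divide_left_mono) auto
    have "11 \<le> x" using \<open>9 \<le> x - 2 * (real r - 1)\<close> r2 by simp
    then have "11\<^sup>2 \<le> x\<^sup>2" by (intro power_mono) auto
    then have "2 * 121 \<le> real r * x\<^sup>2" using r2 by (intro mult_mono) auto
    then have 2: "6 / (real r * x\<^sup>2) \<le> 6 / (2 * 121)" by (intro divide_left_mono) auto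
    have "0 \<le> (4 * real r ^ 3 + 4 * real r) * s / ((5 * real r + 2) * D)" using D s by simp
    then have "b \<le> 2 * real r / (5 * real r + 2)" using third unfolding b_def D_def[symmetric] by linarith
    also have "\<dots> \<le> 2 / 5" by (simp add: field_simps)
    finally show ?thesis using 1 2 by linarith
  next
    case True
    have b: "b = 2 / 7 - 8 * s / (7 * x) - 18 / (7 * x\<^sup>2)" by (simp add: b_def True)
    have "8 * 1 / (7 * x) \<le> 8 * s / (7 * x)" using s x1 by (intro divide_right_mono) auto
    then have le: "b \<le> 2 / 7 - 8 / (7 * x) - 18 / (7 * x\<^sup>2)" unfolding b by simp
    then have "0 < 2 / 7 - 8 / (7 * x) - 18 / (7 * x\<^sup>2)" using pos by linarith
    moreover have "2 / 7 - 8 / (7 * x) - 18 / (7 * x\<^sup>2) = (2 * x\<^sup>2 - 8 * x - 18) / (7 * x\<^sup>2)"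
      using x1 by (simp add: field_simps power2_eq_square)
    ultimately have "0 < (2 * x\<^sup>2 - 8 * x - 18) / (7 * x\<^sup>2)" by simp
    then have "0 < 2 * x\<^sup>2 - 8 * x - 18" using x1 by (simp add: zero_less_divide_iff)
    \<comment> \<open>The numerator is 5/2 times the positive
      \<open>2 * x\<^sup>2 - 8 * x - 18\<close>, plus 21.\<close>
    then have "0 \<le> (5 * x\<^sup>2 - 20 * x - 24) / (7 * x\<^sup>2)" by (intro divide_nonneg_nonneg) auto
    also have "(5 * x\<^sup>2 - 20 * x - 24) / (7 * x\<^sup>2) = (1 - 2 * (2 / x) - 6 / x\<^sup>2) - (2 / 7 - 8 / (7 * x) - 18 / (7 * x\<^sup>2))"
      using x1 by (simp add: field_simps power2_eq_square)
    finally show ?thesis using le by (simp add: True)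
  qed
qed

section \<open>Canonical weights and the label bound\<close>

lemma (in homogeneous_chambers) canonical_weights:
  assumes "\<C> = faces X (int r)"
  shows "canonical_weight r X {v} = wv v" and "card e = 2 \<Longrightarrow> canonical_weight r X e = we e"
proof -
  have star: "{y \<in> faces X (int r). x \<subseteq> y} = star \<C> x" for x by (simp add: star_def assms)
  show "canonical_weight r X {v} = wv v"
    unfolding canonical_weight_def star wv_def unfolding assms[symmetric] by simp
  have two: "real ((r + 1) choose 2) = real r * real (r + 1) / 2"
    by (simp add: choose_two real_of_nat_div algebra_simps)
  show "canonical_weight r X e = we e" if "card e = 2"
    unfolding canonical_weight_def star we_def that two unfolding assms[symmetric] by simp
qed

lemma (in homogeneous_chambers) weighted_graph_canonical:
  assumes \<C>: "\<C> = faces X (int r)" and pure: "\<And>x. x \<in> X \<Longrightarrow> star \<C> x \<noteq> {}" and X: "abstract_complex X"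
    and lam: "lam = \<mu> / (1 - (real r - 1) * \<mu>)" "(real r - 1) * \<mu> < 1" "lam \<le> 1"
  shows "weighted_graph (\<Union>X) (faces X 1) (\<lambda>v. canonical_weight r X {v}) (canonical_weight r X) lam (2 / (real r * real q))"
proof -
  interpret wg: weighted_graph V E wv we lam "2 / (real r * real q)" by (rule weighted_graph[OF lam])
  have V: "\<Union>X = V"
  proof
    show "\<Union>X \<subseteq> V" using pure by (fastforce simp: star_def)
    show "V \<subseteq> \<Union>X" by (auto simp: \<C> faces_def)
  qed
  have E: "faces X 1 = E"
  proof (intro equalityI subsetI)
    fix e assume "e \<in> faces X 1"
    then show "e \<in> E" using pure by (simp add: faces_edge E_def)
  next
    fix e assume e: "e \<in> E"
    then obtain C where C: "C \<in> \<C>" "e \<subseteq> C" by (auto simp: E_def star_def)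
    then have "C \<in> X" by (simp add: \<C> faces_def)
    then have "e \<in> X" using X C(2) by (auto simp: abstract_complex_def)
    then show "e \<in> faces X 1" using e by (simp add: faces_edge E_def)
  qed
  note w = canonical_weights[OF \<C>]
  have we: "sum (canonical_weight r X) A = sum we A" if "A \<subseteq> E" for A
    by (rule sum.cong[OF HOL.refl]) (use that w(2) in \<open>auto simp: E_def\<close>)
  have wE: "canonical_weight r X e = we e" if "e \<in> E" for e using that w(2) by (auto simp: E_def)
  show ?thesis
    unfolding V E w(1)
  proof
    show "0 \<le> canonical_weight r X e" for e by (simp add: canonical_weight_def)
    show "sum (canonical_weight r X) E = 1" using we[of E] wg.sum_we by simp
    show "(\<Sum>e | e \<in> E \<and> v \<in> e. canonical_weight r X e) = 2 * wv v" if "v \<in> V" for v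
      using we[of "{e \<in> E. v \<in> e}"] wg.degree[OF that] by auto
    show "canonical_weight r X e \<le> 2 / (real r * real q) * wv v" if "e \<in> E" "v \<in> e" for e v
      using wE[OF that(1)] wg.light[OF that] by simp
    show "(\<Sum>e | e \<in> E \<and> e \<subseteq> S. canonical_weight r X e) \<le> (sum wv S)\<^sup>2 + lam * sum wv S * (1 - sum wv S)"
      if "S \<subseteq> V" for S
      using we[of "{e \<in> E. e \<subseteq> S}"] wg.mixing[OF that] by auto
  qed (use wg.edge wg.finite_V wg.wv_nonneg wg.sum_wv wg.lam wg.\<delta>_nonneg in auto)
qed

lemma max_label_two:
  assumes T: "coxeter_diagram T"
  shows "edges T = {} \<and> max_label T = 2 \<or> edges T \<noteq> {} \<and> 3 \<le> max_label T"
proof (cases "edges T = {}")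
  case True
  then show ?thesis by (simp add: max_label_def)
next
  case False
  then obtain e where e: "e \<in> edges T" by blast
  have "label T e \<le> max_label T" unfolding max_label_def by (rule Max_ge) (use e in auto)
  moreover have "3 \<le> label T e" using T e by (simp add: coxeter_diagram_def)
  ultimately show ?thesis using False by (meson order_trans)
qed

text \<open>Settles the case in which the claimed bound is not positive.\<close>

lemma cbe0_nonneg: "0 \<le> cbe0 L X (canonical_weight r X) F"
  unfolding cbe0_def zero_ereal_def
  by (intro Sup_upper CollectI exI[of _ 0] conjI ballI)
    (simp_all add: cochain_norm_def sum_nonneg canonical_weight_def)

text \<open>With an infinite label the assumed lower bound for \<open>q\<close> would be infinite,
  as \<open>r\<close> is positive.\<close>

lemma max_label_finite:
  assumes T: "coxeter_diagram T" and q: "enat (r\<^sup>2) * (max_label T - 2) \<le> enat q" and r: "1 \<le> r"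
  shows "\<exists>k. max_label T = enat k \<and> r\<^sup>2 * (k - 2) \<le> q \<and> (edges T = {} \<and> k = 2 \<or> edges T \<noteq> {} \<and> 3 \<le> k)"
proof -
  have two: "edges T = {} \<and> max_label T = 2 \<or> edges T \<noteq> {} \<and> 3 \<le> max_label T" by (rule max_label_two[OF T])
  have "max_label T \<noteq> \<infinity>"
  proof
    assume m: "max_label T = \<infinity>"
    have "enat (r\<^sup>2) * \<infinity> = \<infinity>" using r by (simp add: enat_0_iff imult_is_infinity)
    moreover have "(\<infinity> :: enat) - 2 = \<infinity>" by (simp add: numeral_eq_enat)
    ultimately show False using q m by simp
  qed
  then obtain k where k: "max_label T = enat k" by blast
  have "r\<^sup>2 * (k - 2) \<le> q" using q unfolding k by (simp add: numeral_eq_enat)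
  moreover have "edges T = {} \<and> k = 2 \<or> edges T \<noteq> {} \<and> 3 \<le> k" using two unfolding k by (simp add: numeral_eq_enat)
  ultimately show ?thesis using k by (intro exI[of _ k] conjI)
qed

theorem corollary7p6:
  fixes X :: "'v set set" and Y :: "'u set set" and p :: "'u \<Rightarrow> 'v"
    and T :: "'t::finite diagram" and r q :: nat and L :: "'v rel"
    and R :: "'a monoid" and H :: "'v set \<Rightarrow> 'a set"
  defines "w \<equiv> canonical_weight r X"
    and "m \<equiv> max_label T"
    and "n \<equiv> card (faces X 0)"
    and "G \<equiv> (\<lambda>x. subgroup_sum R (Pow x) H)"
  assumes "1 \<le> r" and "1 \<le> q"
    and "abstract_complex X" and "finite X" and "has_dimension X r"
    and "(\<exists>E \<tau>. building T X E \<and> building_labelling T E \<tau> \<and> spherical T \<and>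
            thick q r X \<and> strongly_transitive r X E \<tau>) \<or>
         (universal_covering p Y X \<and>
          (\<exists>E \<tau> d. building T Y E \<and> building_labelling T E \<tau> \<and> affine_diagram T \<and>
             has_dimension Y d \<and> 2 \<le> d \<and> thick q d Y \<and> strongly_transitive d Y E \<tau> \<and>
             (\<exists>\<sigma>. \<forall>u\<in>\<Union>Y. \<sigma> (p u) = \<tau> u)))"
    and "enat q \<ge> enat (r\<^sup>2) * (m - 2)"
    and "linear_order_on (\<Union>X) L"
    and "comm_group R"
    and "\<forall>x\<in>X - {{}}. subgroup (H x) R" and "H {} = {\<one>\<^bsub>R\<^esub>}"
    and "\<forall>Z l. (is_cycle X Z l \<and> int l \<le> \<lceil>2 / 3 * real n\<rceil>) \<or> (is_path X Z l \<and> l \<le> 2)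
               \<longrightarrow> linearly_disjoint R Z H"
    and "\<forall>x\<in>faces X 0. \<forall>y\<in>faces X 0. x \<noteq> y \<longrightarrow> linearly_disjoint R {x, y} H"
  shows "cbe0 L X w (quotient_sheaf (constant_sheaf R) G) \<ge>
    ereal (2 * real r / (5 * real r + 2)
      - (4 * real r ^ 3 + 4 * real r) * sqrt (real (the_enat m) - 2)
          / ((5 * real r + 2) * (sqrt (real q) - (real r - 1) * sqrt (real (the_enat m) - 2)))
      - (14 * real r + 4) / ((5 * real r + 2) * (real q + real r - 1)))"
proof -
  note r = assms(5) and q = assms(6) and X = assms(7) and finX = assms(8) and dim = assms(9) and cases = assms(10)
    and qm = assms(11)[unfolded m_def] and order = assms(12) and R = assms(13) and H = assms(14,15)
    and disj = assms(16,17)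
  have T: "coxeter_diagram T" using cases unfolding building_def by blast
  \<comment> \<open>\<mu> stays open here: which of the two values applies is decided later, by
    whether the diagram has edges.\<close>
  obtain \<sigma> :: "'v \<Rightarrow> 't" where hom: "\<And>\<mu>. edges T = {} \<and> \<mu> = 0 \<or> 2 \<le> q \<and> \<mu> = 2 / sqrt (real q) \<Longrightarrow>
      homogeneous_chambers (faces X (int r)) \<sigma> r q \<mu> \<and> (\<forall>x\<in>X. star (faces X (int r)) x \<noteq> {})"
  proof -
    from cases show thesis
    proof (elim disjE exE conjE)
      fix E \<tau>
      assume b: "building T X E" "building_labelling T E \<tau>" "thick q r X" "strongly_transitive r X E \<tau>"
      interpret typed_building T X E \<tau> by unfold_locales (rule b)+
      show thesis by (rule that[of \<tau>], rule homogeneous_chambers_building[OF finX dim r q b(3,4)])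
    next
      fix E \<tau> d \<sigma>
      assume c: "universal_covering p Y X" and b: "building T Y E" "building_labelling T E \<tau>" "has_dimension Y d" "2 \<le> d"
        "thick q d Y" "strongly_transitive d Y E \<tau>" and \<sigma>: "\<forall>u\<in>\<Union>Y. \<sigma> (p u) = \<tau> u"
      interpret typed_building T Y E \<tau> by unfold_locales (rule b)+
      have "simplicial_covering p Y X" using c by (simp add: universal_covering_def)
      note hom = homogeneous_chambers_covering[where \<sigma> = \<sigma>, OF this finX dim b(3,4) q b(5,6) bspec[OF \<sigma>]]
      show thesis by (rule that[of \<sigma>], rule hom)
    qed
  qed
  have n: "n = card (\<Union>X)" unfolding n_def faces_vertex[OF X] by (simp add: card_image)
  interpret R: comm_group R by (rule R)
  interpret disjoint_subgroups R X H L
  proof (intro disjoint_subgroups.intro disjoint_subgroups_axioms.intro plain_comm_group.intro)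
    show "subgroup (H x) R" if "x \<in> X" for x using H that R.triv_subgroup by (cases "x = {}") auto
    show "linearly_disjoint R Z H" if Z: "is_cycle X Z l" "3 * l \<le> 2 * (card (\<Union>X) + 1)" for Z l
    proof -
      \<comment> \<open>A length of at most \<open>(2 * n + 2) / 3\<close> is less than
        \<open>2 * n / 3 + 1\<close>, hence at most the integer to which \<open>2 * n / 3\<close> is
        rounded up. Thus the two bounds on cycle lengths fit together.\<close>
      have "3 * real l \<le> 2 * (real n + 1)" using Z(2) unfolding n[symmetric] by (simp flip: of_nat_le_iff[where 'a = real])
      then have "real l - 1 < 2 / 3 * real n" by (simp add: field_simps)
      then have "int l \<le> \<lceil>2 / 3 * real n\<rceil>" by linarith
      then show ?thesis using disj(1) Z(1) by blast
    qed
    show "linearly_disjoint R {{u}, {v}} H" if "u \<in> \<Union>X" "v \<in> \<Union>X" "u \<noteq> v" for u v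
    proof -
      have "{u} \<in> faces X 0" "{v} \<in> faces X 0" using that by (auto simp: faces_vertex[OF X])
      then show ?thesis using disj(2) that(3) by simp
    qed
  qed (rule R X finX order H(2))+
  have F: "F = quotient_sheaf (constant_sheaf R) G" by (simp add: F_def G_def)
  have bound: "ereal (1 - 2 * lam - 3 * (2 / (real r * real q))) \<le> cbe0 L X w F"
    if \<mu>: "edges T = {} \<and> \<mu> = 0 \<or> 2 \<le> q \<and> \<mu> = 2 / sqrt (real q)"
      and lam: "lam = \<mu> / (1 - (real r - 1) * \<mu>)" "(real r - 1) * \<mu> < 1" "lam \<le> 1"
      and pos: "0 \<le> 1 - 2 * lam - 3 * (2 / (real r * real q))" for \<mu> lam
  proof -
    note h = hom[OF \<mu>]
    interpret homogeneous_chambers "faces X (int r)" \<sigma> r q \<mu> using h by (rule conjunct1)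
    show ?thesis
      unfolding w_def
      by (rule cbe0_bound[OF weighted_graph_canonical[OF HOL.refl bspec[OF conjunct2[OF h]] X lam] pos])
  qed
  obtain k where k: "m = enat k" "r\<^sup>2 * (k - 2) \<le> q" "edges T = {} \<and> k = 2 \<or> edges T \<noteq> {} \<and> 3 \<le> k"
    using max_label_finite[OF T qm r] unfolding m_def by (elim exE conjE)
  define x where "x = sqrt (real q)"
  define s where "s = sqrt (real k - 2)"
  define b where "b = 2 * real r / (5 * real r + 2)
      - (4 * real r ^ 3 + 4 * real r) * s / ((5 * real r + 2) * (x - (real r - 1) * s))
      - (14 * real r + 4) / ((5 * real r + 2) * (real q + real r - 1))"
  have xq: "x\<^sup>2 = real q" by (simp add: x_def)
  have "ereal b \<le> cbe0 L X w F"
  proof (cases "0 < b")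
    case False
    then have "ereal b \<le> 0" by (simp add: zero_ereal_def)
    then show ?thesis using cbe0_nonneg[of L X r F] unfolding w_def by (rule order_trans)
  next
    case pos: True
    from k(3) show ?thesis
    proof
      assume e: "edges T = {} \<and> k = 2"
      \<comment> \<open>Without edges \<open>m\<close> is 2, the middle term of the bound vanishes,
        and the gap is 0.\<close>
      then have s0: "s = 0" by (simp add: s_def)
      have "b \<le> 1 - 6 / (real r * real q)"
        using bound_edgeless[OF r q] pos unfolding b_def s0 by simp
      then have le: "b \<le> 1 - 2 * 0 - 3 * (2 / (real r * real q))" by simp
      show ?thesis
        by (rule order_trans[OF _ bound[of 0 0]]) (use le pos e in simp_all)
    next
      assume e: "edges T \<noteq> {} \<and> 3 \<le> k"
      then have s1: "1 \<le> s" by (simp add: s_def)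
      have "real (r\<^sup>2 * (k - 2)) \<le> real q" using k(2) by (rule of_nat_mono)
      then have "(real r * s)\<^sup>2 \<le> x\<^sup>2" using e by (simp add: xq s_def power_mult_distrib of_nat_diff)
      then have rs: "real r * s \<le> x" by (rule power2_le_imp_le) (simp add: x_def)
      have pos': "0 < 2 * real r / (5 * real r + 2)
        - (4 * real r ^ 3 + 4 * real r) * s / ((5 * real r + 2) * (x - (real r - 1) * s))
        - (14 * real r + 4) / ((5 * real r + 2) * (x\<^sup>2 + real r - 1))"
        using pos unfolding b_def xq .
      note be = bound_edges[OF r s1 rs pos', unfolded xq]
      \<comment> \<open>The result of iterated trickling down when it starts from the polygon bound
        \<open>2 / x\<close>.\<close>
      let ?lam = "2 / (x - 2 * (real r - 1))"
      have x4: "4 \<le> x" using be(1) r by simp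
      then have "4\<^sup>2 \<le> x\<^sup>2" by (intro power_mono) auto
      then have q2: "2 \<le> q" unfolding xq by simp
      have eq: "?lam = 2 / x / (1 - (real r - 1) * (2 / x))" using x4 be(1) by (simp add: field_simps)
      have le: "b \<le> 1 - 2 * ?lam - 3 * (2 / (real r * real q))" using be(2) unfolding b_def by simp
      show ?thesis
      proof (rule order_trans[OF _ bound[of "2 / x" ?lam]])
        show "?lam \<le> 1" using be(1) by simp
        show "(real r - 1) * (2 / x) < 1" using be(1) x4 by (simp add: field_simps)
      qed (use le pos eq q2 in \<open>simp_all add: x_def\<close>)
    qed
  qed
  then show ?thesis unfolding b_def x_def s_def F k(1) the_enat.simps by simp
qed

end
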